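(* Consider the diffusion model, the privatized data and the estimator $\widehat\theta_n^N$ described in the context (with the deterministic uniform grid). Assume: (1) for every $\theta\in\Theta$ the function $b(\theta,\cdot)$ is bounded, and $b(\theta,\cdot)$ and $\sigma$ are globally Lipschitz: there exists $c>0$ such that $|b(\theta,x)-b(\theta,y)|+|\sigma(x)-\sigma(y)|\le c|x-y|$ for all $x,y\in\mathbb R$; (2) there exists $\sigma_{\min}>0$ such that $\sigma_{\min}^2\le\sigma^2(x)$ for all $x\in\mathbb R$; (3) for every integer $k\ge 1$, $\sup_{x\in\mathbb R,\theta\in\Theta}|\partial_\theta^k b(\theta,x)|<\infty$; (4) for every $\theta\in\Theta$ with $\theta\ne\theta^\star$, $\int_0^T\mathbb E\Big[\frac{(b(\theta,X_s)-b(\theta^\star,X_s))^2}{\sigma^2(X_s)}\Big]ds>0$. Assume moreover that $$\frac{L_n\log(n)}{\sqrt N}\sqrt{\frac{\log(L_n)}{\bar\alpha_2}}\longrightarrow 0\qquad\text{as } n,N,L_n\to\infty .$$ Then $\widehat\theta_n^N\to\theta^\star$ in probability.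
   Context: **Model.** Fix $T>0$, $\Theta=[0,1]$, $b:\Theta\times\mathbb R\to\mathbb R$, $\sigma:\mathbb R\to\mathbb R$ (known functions). For $\theta\in\Theta$ and $i\in\{1,\dots,N\}$ the process $X^{\theta,i}$ solves $X_t^{\theta,i}=X_0^{\theta,i}+\int_0^t b(\theta,X_s^{\theta,i})ds+\int_0^t\sigma(X_s^{\theta,i})dW_s^i$, $t\in[0,T]$, where $W^1,\dots,W^N$ are independent standard Brownian motions, independent of the initial values $(X_0^{\theta,i})_i$, which are i.i.d. and belong to $\cap_{p\ge1}L^p$. The true parameter is $\theta^\star\in(0,1)$; write $X^i:=X^{\theta^\star,i}$, and let $X$ denote a process with the common law of the $X^i$. Let $\Delta_n=T/n$, $t_j=j\Delta_n$. **Asymptotics.** $n\to\infty$ and $N\to\infty$ with $T$ fixed, and $N=O(n^{\rho})$ for some $\rho>0$. The grid size $L_n\to\infty$ satisfies $L_n=O(n^{\rho})$ for some $\rho>0$. The privacy levels $\alpha_1,\dots,\alpha_n>0$ may depend on $n,N$, and $\bar\alpha_2$ is defined by $1/\bar\alpha_2=n^{-1}\sum_{j=1}^n 1/\alpha_j^2$. **Privatized data.** Fix an integer $a\ge1$. Let $f(\theta;x,y)=\frac{2b(\theta,x)(y-x)-\Delta_n b^2(\theta,x)}{\sigma^2(x)}$ and $f^{(k)}=\partial_\theta^k f$. Let $\varphi\in C^\infty(\mathbb R)$ with $\varphi(\xi)=1$ for $|\xi|\le1$ and $\varphi(\xi)=0$ for $|\xi|\ge2$ (a smooth version of an indicator).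 Let $\tau_n=\sqrt{\Delta_n}\log(n)$. The grid is $\Xi=\{\theta_\ell=\ell/L_n:\ \ell=0,\dots,L_n-1\}$. Let $(\mathcal E_j^{i,\ell,(k)})$, $1\le i\le N$, $1\le j\le n$, $0\le k\le a$, $0\le\ell\le L_n-1$, be independent random variables, independent of the processes $X^1,\dots,X^N$, where $\mathcal E_j^{i,\ell,(k)}$ has the centered Laplace law with scale parameter $2\tau_nL_n(a+1)/\alpha_j$. The public data are $Z_j^i=(Z_j^{i,(k)}(\theta_\ell))_{\ell,k}$ with $Z_j^{i,(k)}(\theta_\ell)=f^{(k)}(\theta_\ell;X^i_{t_{j-1}},X^i_{t_j})\,\varphi\big(f^{(k)}(\theta_\ell;X^i_{t_{j-1}},X^i_{t_j})/\tau_n\big)+\mathcal E_j^{i,\ell,(k)}$. **Interpolation.** For an array $g=(g_\ell^k)_{0\le\ell\le L_n-1,0\le k\le a}$, $H(g)$ is the unique function in $C^a([\theta_0,\theta_{L_n-1}])$ which is a polynomial of degree at most $2a+1$ on each $[\theta_\ell,\theta_{\ell+1}]$ and satisfies $H(g)^{(k)}(\theta_\ell)=g_\ell^k$ for all $\ell,k$ (Hermite spline interpolation of order $a$). **Contrast and estimator.** $S_n^{N,\mathrm{pub}}(\theta)=\sum_{i=1}^N\sum_{j=1}^nH(Z_j^i)(\theta)$ for $\theta\in[\theta_0,\theta_{L_n-1}]$, and $\widehat\theta_n^N=\operatorname{argmax}_{\theta\in[\theta_0,\theta_{L_n-1}]}S_n^{N,\mathrm{pub}}(\theta)$. *)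

theory Defs
  imports
    "HOL-Probability.Probability"
    "HOL-Library.Landau_Symbols"
    "HOL-Computational_Algebra.Polynomial"
begin

text \<open>Measurability is part of the definition, because \<^const>\<open>measure\<close> is 0 on non-measurable sets.\<close>

definition tendsto_in_prob :: "'a measure \<Rightarrow> (nat \<Rightarrow> 'a \<Rightarrow> real) \<Rightarrow> ('a \<Rightarrow> real) \<Rightarrow> bool" where
  "tendsto_in_prob M Y Y' \<longleftrightarrow>
     (\<forall>r. Y r \<in> borel_measurable M) \<and> Y' \<in> borel_measurable M \<and>
     (\<forall>\<epsilon>>0. (\<lambda>r. measure M {\<omega> \<in> space M. \<epsilon> < \<bar>Y r \<omega> - Y' \<omega>\<bar>}) \<longlonglongrightarrow> 0)"

text \<open>\<open>indep_var\<close> only covers random variables with a common value type.\<close>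

definition indep_rv ::
  "'a measure \<Rightarrow> 'b measure \<Rightarrow> ('a \<Rightarrow> 'b) \<Rightarrow> 'c measure \<Rightarrow> ('a \<Rightarrow> 'c) \<Rightarrow> bool" where
  "indep_rv M S Y R Z \<longleftrightarrow>
     prob_space.indep_set M (sets (vimage_algebra (space M) Y S)) (sets (vimage_algebra (space M) Z R))"

text \<open>Processes are functions of time and outcome; only the times in \<open>{0..T}\<close> matter.\<close>

definition progressive :: "(real \<Rightarrow> 'a measure) \<Rightarrow> real \<Rightarrow> (real \<Rightarrow> 'a \<Rightarrow> real) \<Rightarrow> bool" where
  "progressive F T H \<longleftrightarrow>
     (\<forall>t\<in>{0..T}. (\<lambda>(s, \<omega>). H s \<omega>) \<in> borel_measurable (restrict_space borel {0..t} \<Otimes>\<^sub>M F t))"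

definition brownian_motion ::
  "'a measure \<Rightarrow> (real \<Rightarrow> 'a measure) \<Rightarrow> real \<Rightarrow> (real \<Rightarrow> 'a \<Rightarrow> real) \<Rightarrow> bool" where
  "brownian_motion M F T W \<longleftrightarrow>
     (\<forall>t\<in>{0..T}. W t \<in> borel_measurable (F t)) \<and>
     (AE \<omega> in M. W 0 \<omega> = 0) \<and>
     (AE \<omega> in M. continuous_on {0..T} (\<lambda>t. W t \<omega>)) \<and>
     (\<forall>s t. 0 \<le> s \<longrightarrow> s < t \<longrightarrow> t \<le> T \<longrightarrow>
        distributed M lborel (\<lambda>\<omega>. W t \<omega> - W s \<omega>) (normal_density 0 (sqrt (t - s))) \<and>
        prob_space.indep_set M (sets (F s))
          (sets (vimage_algebra (space M) (\<lambda>\<omega>. W t \<omega> - W s \<omega>) borel)))"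

definition simple_integrand ::
  "(real \<Rightarrow> 'a measure) \<Rightarrow> real \<Rightarrow> nat \<Rightarrow> (nat \<Rightarrow> real) \<Rightarrow> (nat \<Rightarrow> 'a \<Rightarrow> real) \<Rightarrow> bool" where
  "simple_integrand F T m p \<xi> \<longleftrightarrow>
     (\<forall>k\<le>m. 0 \<le> p k \<and> p k \<le> T) \<and> (\<forall>k<m. p k \<le> p (Suc k)) \<and>
     (\<forall>k<m. \<xi> k \<in> borel_measurable (F (p k)) \<and> (\<exists>C. \<forall>\<omega>\<in>space (F (p k)). \<bar>\<xi> k \<omega>\<bar> \<le> C))"

definition simple_process ::
  "nat \<Rightarrow> (nat \<Rightarrow> real) \<Rightarrow> (nat \<Rightarrow> 'a \<Rightarrow> real) \<Rightarrow> real \<Rightarrow> 'a \<Rightarrow> real" where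
  "simple_process m p \<xi> s \<omega> = (\<Sum>k<m. \<xi> k \<omega> * indicator {p k<..p (Suc k)} s)"

definition simple_stoch_integral ::
  "(real \<Rightarrow> 'a \<Rightarrow> real) \<Rightarrow> nat \<Rightarrow> (nat \<Rightarrow> real) \<Rightarrow> (nat \<Rightarrow> 'a \<Rightarrow> real) \<Rightarrow> real \<Rightarrow> 'a \<Rightarrow> real" where
  "simple_stoch_integral W m p \<xi> t \<omega> =
     (\<Sum>k<m. \<xi> k \<omega> * (W (min t (p (Suc k))) \<omega> - W (min t (p k)) \<omega>))"

text \<open>\<open>I\<close> is (a continuous version of) the process \<open>t \<mapsto> \<integral>\<^sub>0\<^sup>t H dW\<close> on \<open>{0..T}\<close>, for an
  integrand \<open>H\<close> with \<open>\<integral>\<^sub>0\<^sup>T H\<^sup>2 ds < \<infinity>\<close> almost surely. Together with path continuity, convergence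
  in probability at each fixed time determines \<open>I\<close> up to indistinguishability.\<close>

definition ito_integral ::
  "'a measure \<Rightarrow> (real \<Rightarrow> 'a measure) \<Rightarrow> real \<Rightarrow> (real \<Rightarrow> 'a \<Rightarrow> real) \<Rightarrow> (real \<Rightarrow> 'a \<Rightarrow> real)
     \<Rightarrow> (real \<Rightarrow> 'a \<Rightarrow> real) \<Rightarrow> bool" where
  "ito_integral M F T W H I \<longleftrightarrow>
     progressive F T H \<and>
     (AE \<omega> in M. set_integrable lborel {0..T} (\<lambda>s. (H s \<omega>)\<^sup>2)) \<and>
     (AE \<omega> in M. continuous_on {0..T} (\<lambda>t. I t \<omega>)) \<and>
     (\<exists>m p \<xi>. (\<forall>r::nat. simple_integrand F T (m r) (p r) (\<xi> r)) \<and>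
        tendsto_in_prob M
          (\<lambda>r \<omega>. LBINT s:{0..T}. (simple_process (m r) (p r) (\<xi> r) s \<omega> - H s \<omega>)\<^sup>2) (\<lambda>_. 0) \<and>
        (\<forall>t\<in>{0..T}. tendsto_in_prob M
          (\<lambda>r. simple_stoch_integral W (m r) (p r) (\<xi> r) t) (I t)))"

definition sde_solution ::
  "'a measure \<Rightarrow> (real \<Rightarrow> 'a measure) \<Rightarrow> real \<Rightarrow> (real \<Rightarrow> real) \<Rightarrow> (real \<Rightarrow> real)
     \<Rightarrow> (real \<Rightarrow> 'a \<Rightarrow> real) \<Rightarrow> (real \<Rightarrow> 'a \<Rightarrow> real) \<Rightarrow> bool" where
  "sde_solution M F T \<beta> \<sigma> W X \<longleftrightarrow>
     progressive F T X \<and>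
     (AE \<omega> in M. continuous_on {0..T} (\<lambda>t. X t \<omega>)) \<and>
     (\<exists>I. ito_integral M F T W (\<lambda>s \<omega>. \<sigma> (X s \<omega>)) I \<and>
        (AE \<omega> in M. \<forall>t\<in>{0..T}.
           X t \<omega> = X 0 \<omega> + (LBINT s:{0..t}. \<beta> (X s \<omega>)) + I t \<omega>))"

definition sample_path :: "real \<Rightarrow> (real \<Rightarrow> 'a \<Rightarrow> real) \<Rightarrow> 'a \<Rightarrow> real \<Rightarrow> real" where
  "sample_path T Y \<omega> = (\<lambda>t\<in>{0..T}. Y t \<omega>)"

abbreviation path_space :: "real \<Rightarrow> (real \<Rightarrow> real) measure" where
  "path_space T \<equiv> (\<Pi>\<^sub>M t\<in>{0..T}. borel)"

text \<open>The particles are numbered by \<open>{1..}\<close>; a sample of size \<open>N\<close> consists of the first \<open>N\<close> of them.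
  \<open>F\<close> is any filtration to which the driving noises and the solutions are adapted.\<close>

definition diffusion_model ::
  "'a measure \<Rightarrow> (real \<Rightarrow> 'a measure) \<Rightarrow> real \<Rightarrow> (real \<Rightarrow> real \<Rightarrow> real) \<Rightarrow> (real \<Rightarrow> real)
     \<Rightarrow> (nat \<Rightarrow> real \<Rightarrow> 'a \<Rightarrow> real) \<Rightarrow> (real \<Rightarrow> nat \<Rightarrow> real \<Rightarrow> 'a \<Rightarrow> real) \<Rightarrow> bool" where
  "diffusion_model M F T b \<sigma> W X \<longleftrightarrow>
     prob_space M \<and> filtration (space M) F \<and> (\<forall>t. subalgebra M (F t)) \<and>
     (\<forall>i\<ge>1. brownian_motion M F T (W i)) \<and>
     prob_space.indep_vars M (\<lambda>_. path_space T) (\<lambda>i. sample_path T (W i)) {1..} \<and>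
     (\<forall>\<theta>\<in>{0..1}.
        (\<forall>i\<ge>1. sde_solution M F T (b \<theta>) \<sigma> (W i) (X \<theta> i)) \<and>
        prob_space.indep_vars M (\<lambda>_. borel) (\<lambda>i. X \<theta> i 0) {1..} \<and>
        (\<forall>i\<ge>1. distr M borel (X \<theta> i 0) = distr M borel (X \<theta> 1 0)) \<and>
        (\<forall>i\<ge>1. \<forall>q::real\<ge>1. integrable M (\<lambda>\<omega>. \<bar>X \<theta> i 0 \<omega>\<bar> powr q)) \<and>
        indep_rv M
          (\<Pi>\<^sub>M i\<in>{1..}. path_space T) (\<lambda>\<omega>. \<lambda>i\<in>{1..}. sample_path T (W i) \<omega>)
          (\<Pi>\<^sub>M i\<in>{1..}. borel) (\<lambda>\<omega>. \<lambda>i\<in>{1..}. X \<theta> i 0 \<omega>))"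

text \<open>The \<open>k\<close>-th derivative in the parameter \<open>\<theta> \<in> [0,1]\<close>, one-sided at the end points.\<close>

primrec dparam :: "nat \<Rightarrow> (real \<Rightarrow> real) \<Rightarrow> real \<Rightarrow> real" where
  "dparam 0 g = g"
| "dparam (Suc k) g = (\<lambda>\<theta>. vector_derivative (dparam k g) (at \<theta> within {0..1}))"

definition laplace_density :: "real \<Rightarrow> real \<Rightarrow> real" where
  "laplace_density s x = exp (- \<bar>x\<bar> / s) / (2 * s)"

definition grid :: "nat \<Rightarrow> nat \<Rightarrow> real" where
  "grid L l = real l / real L"

definition trunc_level :: "real \<Rightarrow> nat \<Rightarrow> real" where
  "trunc_level T n = sqrt (T / n) * ln n"

definition f_increment ::
  "(real \<Rightarrow> real \<Rightarrow> real) \<Rightarrow> (real \<Rightarrow> real) \<Rightarrow> real \<Rightarrow> real \<Rightarrow> real \<Rightarrow> real \<Rightarrow> real" where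
  "f_increment b \<sigma> \<Delta> \<theta> x y = (2 * b \<theta> x * (y - x) - \<Delta> * (b \<theta> x)\<^sup>2) / (\<sigma> x)\<^sup>2"

text \<open>The process \<open>X\<close> and the noise \<open>e\<close> (indexed by \<open>l\<close>, \<open>k\<close>) belong to one
  particle and, for \<open>e\<close>, to the time step \<open>j\<close>.\<close>

definition priv_data ::
  "real \<Rightarrow> (real \<Rightarrow> real \<Rightarrow> real) \<Rightarrow> (real \<Rightarrow> real) \<Rightarrow> (real \<Rightarrow> real) \<Rightarrow> nat \<Rightarrow> nat
     \<Rightarrow> (real \<Rightarrow> 'a \<Rightarrow> real) \<Rightarrow> (nat \<Rightarrow> nat \<Rightarrow> 'a \<Rightarrow> real) \<Rightarrow> nat \<Rightarrow> 'a \<Rightarrow> nat \<Rightarrow> nat \<Rightarrow> real" where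
  "priv_data T b \<sigma> \<phi> n L X e j \<omega> l k =
     (let \<Delta> = T / n;
          v = dparam k (\<lambda>\<theta>. f_increment b \<sigma> \<Delta> \<theta> (X (real (j - 1) * \<Delta>) \<omega>) (X (real j * \<Delta>) \<omega>))
                (grid L l)
      in v * \<phi> (v / trunc_level T n) + e l k \<omega>)"

text \<open>\<open>D k\<close> is the \<open>k\<close>-th derivative of \<open>h\<close> on the closed interval; \<open>h\<close> is determined on
  that interval only if \<open>L \<ge> 2\<close>.\<close>

definition is_hermite_spline :: "nat \<Rightarrow> nat \<Rightarrow> (nat \<Rightarrow> nat \<Rightarrow> real) \<Rightarrow> (real \<Rightarrow> real) \<Rightarrow> bool" where
  "is_hermite_spline a L g h \<longleftrightarrow>
     (\<exists>D. D 0 = h \<and>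
        (\<forall>k<a. \<forall>x\<in>{grid L 0..grid L (L - 1)}.
           (D k has_real_derivative D (Suc k) x) (at x within {grid L 0..grid L (L - 1)})) \<and>
        (\<forall>k\<le>a. continuous_on {grid L 0..grid L (L - 1)} (D k)) \<and>
        (\<forall>l<L. \<forall>k\<le>a. D k (grid L l) = g l k)) \<and>
     (\<forall>l. Suc l < L \<longrightarrow>
        (\<exists>q. degree q \<le> 2 * a + 1 \<and> (\<forall>x\<in>{grid L l..grid L (Suc l)}. h x = poly q x)))"

text \<open>The value 0 outside the interval is a convention making the function unique on all of \<open>\<real>\<close>.\<close>

definition hermite_interp :: "nat \<Rightarrow> nat \<Rightarrow> (nat \<Rightarrow> nat \<Rightarrow> real) \<Rightarrow> real \<Rightarrow> real" where
  "hermite_interp a L g =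
     (THE h. is_hermite_spline a L g h \<and> (\<forall>x. x \<notin> {grid L 0..grid L (L - 1)} \<longrightarrow> h x = 0))"

definition pub_contrast ::
  "nat \<Rightarrow> real \<Rightarrow> (real \<Rightarrow> real \<Rightarrow> real) \<Rightarrow> (real \<Rightarrow> real) \<Rightarrow> (real \<Rightarrow> real) \<Rightarrow> nat \<Rightarrow> nat \<Rightarrow> nat
     \<Rightarrow> (nat \<Rightarrow> real \<Rightarrow> 'a \<Rightarrow> real) \<Rightarrow> (nat \<Rightarrow> nat \<Rightarrow> nat \<Rightarrow> nat \<Rightarrow> 'a \<Rightarrow> real) \<Rightarrow> real \<Rightarrow> 'a \<Rightarrow> real" where
  "pub_contrast a T b \<sigma> \<phi> n N L X E \<theta> \<omega> =
     (\<Sum>i=1..N. \<Sum>j=1..n. hermite_interp a L (priv_data T b \<sigma> \<phi> n L (X i) (E i j) j \<omega>) \<theta>)"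

definition alpha_bar2 :: "nat \<Rightarrow> (nat \<Rightarrow> real) \<Rightarrow> real" where
  "alpha_bar2 n \<alpha> = 1 / ((\<Sum>j=1..n. 1 / (\<alpha> j)\<^sup>2) / n)"

text \<open>The privacy noise \<open>E i j l k\<close> for one sample; \<open>X\<close> are the processes it is independent of.\<close>

definition noise_index :: "nat \<Rightarrow> nat \<Rightarrow> nat \<Rightarrow> nat \<Rightarrow> (nat \<times> nat \<times> nat \<times> nat) set" where
  "noise_index a n N L = {1..N} \<times> {1..n} \<times> {..<L} \<times> {..a}"

definition privacy_noise ::
  "'a measure \<Rightarrow> nat \<Rightarrow> real \<Rightarrow> nat \<Rightarrow> nat \<Rightarrow> nat \<Rightarrow> (nat \<Rightarrow> real) \<Rightarrow> (nat \<Rightarrow> real \<Rightarrow> 'a \<Rightarrow> real)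
     \<Rightarrow> (nat \<Rightarrow> nat \<Rightarrow> nat \<Rightarrow> nat \<Rightarrow> 'a \<Rightarrow> real) \<Rightarrow> bool" where
  "privacy_noise M a T n N L \<alpha> X E \<longleftrightarrow>
     (\<forall>(i, j, l, k) \<in> noise_index a n N L.
        distributed M lborel (E i j l k)
          (laplace_density (2 * trunc_level T n * real L * (real a + 1) / \<alpha> j))) \<and>
     prob_space.indep_vars M (\<lambda>_. borel) (\<lambda>(i, j, l, k). E i j l k) (noise_index a n N L) \<and>
     indep_rv M
       (\<Pi>\<^sub>M z\<in>noise_index a n N L. borel)
       (\<lambda>\<omega>. \<lambda>z\<in>noise_index a n N L. (case z of (i, j, l, k) \<Rightarrow> E i j l k \<omega>))
       (\<Pi>\<^sub>M i\<in>{1..N}. path_space T)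
       (\<lambda>\<omega>. \<lambda>i\<in>{1..N}. sample_path T (X i) \<omega>)"

end

theory Submission
 imports Defs "HOL-Real_Asymp.Real_Asymp"
begin

text \<open>Localizing by a truncated energy \<open>min c (\<integral>\<sigma>(X)\<^sup>2 ds)\<close> instead of stopping times, an approximation
  by simple integrands bounds the second moments of stochastic integrals; a Gronwall argument then
  controls \<open>X\<close> in \<open>L\<^sup>2\<close>. Each \<open>X\<^sup>i\<close> is the \<open>L\<^sup>2\<close> limit of its Euler scheme, a function of the initial
  value and of finitely many Brownian increments, so that functionals of different particles are
  uncorrelated with equal means. Hence the average contrast without noise and truncation converges
  pointwise, and by a bound on its derivative uniformly, to
  \<open>S(\<theta>) = \<integral>\<^sub>0\<^sup>T E[(2 b(\<theta>, X) b(\<theta>\<^sup>*, X) - b(\<theta>, X)\<^sup>2) / \<sigma>(X)\<^sup>2] ds\<close>, where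
  \<open>S(\<theta>\<^sup>*) - S(\<theta>)\<close> is the integral in the identifiability condition. Truncation is negligible by the
  Gaussian tails of the increments.

  In the interpolant the \<open>k\<close>-th derivatives carry a factor \<open>L\<^sup>-\<^sup>k\<close>, which makes their noise negligible by
  Chebyshev's inequality. The noise of the values need not be uniformly small: its maximum over the
  grid is of unknown size. But the averaged noise has a log-concave tail, so its maximum over all nodes
  and its maximum over the nodes near \<open>\<theta>\<^sup>*\<close> both concentrate around the same quantile, and this
  common shift does not move the maximizer.\<close>

text \<open>The model makes the Brownian paths independent, and the initial values, but
  \<open>F\<close> is an arbitrary common filtration and no solution is given as a functional of its
  own noise. Independence has to be carried over from the inputs, and the Euler scheme does this;
  since only means and covariances are carried to the limit, the law of large numbers is the one for
  uncorrelated variables. A stochastic integral is known only as a limit in probability of simple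
  integrals, so each moment bound starts from step integrands and passes through an almost surely
  convergent subsequence and Fatou's lemma. The diffusion coefficient may be unbounded; it enters
  the contrast only after division by its square. The rate condition bounds the variance of the
  averaged noise at a node times \<open>ln L\<close>. Gaussian noise would then be uniformly small
  over the grid. Laplace sums have merely exponential tails, and if \<open>N\<close> is small
  compared with \<open>ln L\<close> the maximum over the grid may diverge; this is why maxima are
  compared with each other and not bounded.\<close>

abbreviation (input) nnI :: "'a measure \<Rightarrow> ('a \<Rightarrow> ennreal) \<Rightarrow> ennreal" where "nnI \<equiv> nn_integral"

abbreviation (input) nnE :: "'a measure \<Rightarrow> ('a \<Rightarrow> real) \<Rightarrow> ennreal" where "nnE M f \<equiv> \<integral>\<^sup>+x. ennreal (f x) \<partial>M"

abbreviation (input) BM :: "'a measure \<Rightarrow> ('a \<Rightarrow> 'b::topological_space) set" where "BM \<equiv> borel_measurable"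

section \<open>Convergence in probability and bounds for second moments\<close>

lemma tendsto_in_prob_zeroD:
 assumes "tendsto_in_prob M Z (%_. 0)"
 shows "Z r \<in> BM M"
  and "0 < ep ==> (%r. measure M {w \<in> space M. ep < \<bar>Z r w\<bar>}) \<longlonglongrightarrow> 0"
 using assms by (auto simp: tendsto_in_prob_def)

text \<open>Truncation at 1 turns convergence in probability into convergence in mean, which has an
  almost surely convergent subsequence. Where the truncated values tend to 0, the truncation is
  eventually inactive.\<close>

lemma tendsto_in_prob_AE_subseq:
 assumes "prob_space M" and Z: "tendsto_in_prob M Z (%_. 0)"
 shows "\<exists>s. strict_mono s \<and> (AE w in M. (%r. Z (s r) w) \<longlonglongrightarrow> 0)"
proof -
 interpret prob_space M by fact
 have meas [measurable]: "Z r \<in> BM M" for r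
  using Z by (auto simp: tendsto_in_prob_def)
 define u where "u r w = min 1 \<bar>Z r w\<bar>" for r w
 have u_meas [measurable]: "u r \<in> BM M" for r unfolding u_def by measurable
 have int: "integrable M (u r)" for r
  by (rule integrable_const_bound[of _ 1]) (auto simp: u_def)
 have bnd: "(\<integral>x. norm (u r x) \<partial>M) <= ep + measure M {w \<in> space M. ep < \<bar>Z r w\<bar>}" if "0 < ep" for r ep
 proof -
  let ?A = "{w \<in> space M. ep < \<bar>Z r w\<bar>}"
  have "(\<integral>x. norm (u r x) \<partial>M) <= (\<integral>x. ep + indicator ?A x \<partial>M)"
  proof (rule integral_mono)
   show "integrable M (%x. norm (u r x))" using int by auto
   show "integrable M (%x. ep + indicator ?A x)" by (auto intro!: integrable_real_indicator simp: emeasure_eq_measure)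
   show "norm (u r x) <= ep + indicator ?A x" if "x \<in> space M" for x
    using that \<open>0 < ep\<close> by (auto simp: u_def indicator_def)
  qed
  also have "\<dots> = ep + measure M ?A"
   by (subst Bochner_Integration.integral_add)
    (auto intro!: integrable_real_indicator simp: emeasure_eq_measure prob_space)
  finally show ?thesis .
 qed
 have "(%r. \<integral>x. norm (u r x) \<partial>M) \<longlonglongrightarrow> 0"
 proof (rule tendstoI)
  fix e :: real assume "0 < e"
  have "(%r. measure M {w \<in> space M. e/2 < \<bar>Z r w\<bar>}) \<longlonglongrightarrow> 0"
   using tendsto_in_prob_zeroD(2)[OF Z, of "e/2"] \<open>0 < e\<close> by linarith
  from tendstoD[OF this, of "e/2"] \<open>0 < e\<close>
  have "\<forall>\<^sub>F r in sequentially. measure M {w \<in> space M. e/2 < \<bar>Z r w\<bar>} < e/2"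
   by (auto simp: dist_real_def)
  then show "\<forall>\<^sub>F r in sequentially. dist (\<integral>x. norm (u r x) \<partial>M) 0 < e"
  proof eventually_elim
   case (elim r)
   have "0 <= (\<integral>x. norm (u r x) \<partial>M)" by simp
   with elim bnd[of "e/2" r] \<open>0 < e\<close> show ?case by (simp add: dist_real_def)
  qed
 qed
 from tendsto_L1_AE_subseq[OF int this] obtain s where
  s: "strict_mono s" "AE x in M. (%n. u (s n) x) \<longlonglongrightarrow> 0" by auto
 have "AE w in M. (%r. Z (s r) w) \<longlonglongrightarrow> 0"
  using s(2)
 proof eventually_elim
  case (elim w)
  have ev: "\<forall>\<^sub>F r in sequentially. u (s r) w < 1"
   using order_tendstoD(2)[OF elim, of 1] by simp
  have "(%r. \<bar>Z (s r) w\<bar>) \<longlonglongrightarrow> 0"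
   by (rule Lim_transform_eventually[OF elim]) (use ev in \<open>eventually_elim; auto simp: u_def min_def split: if_splits\<close>)
  then show ?case by (rule tendsto_rabs_zero_cancel)
 qed
 with s(1) show ?thesis by blast
qed

lemma tendsto_in_prob_diff_zero:
 assumes "tendsto_in_prob M Y Y'"
 shows "tendsto_in_prob M (%r w. Y r w - Y' w) (%_. 0)"
 using assms unfolding tendsto_in_prob_def by (auto intro: borel_measurable_diff)

lemma tendsto_in_prob_zero_add:
 assumes "prob_space M" "tendsto_in_prob M Y (%_. 0)" "tendsto_in_prob M Z (%_. 0)"
 shows "tendsto_in_prob M (%r w. Y r w + Z r w) (%_. 0)"
proof -
 interpret prob_space M by fact
 have [measurable]: "Y r \<in> BM M" "Z r \<in> BM M" for r
  using assms by (auto simp: tendsto_in_prob_def)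
 { fix ep :: real assume "0 < ep"
  have "(%r. measure M {w \<in> space M. ep/2 < \<bar>Y r w\<bar>} + measure M {w \<in> space M. ep/2 < \<bar>Z r w\<bar>}) \<longlonglongrightarrow> 0 + 0"
   using \<open>0 < ep\<close> by (intro tendsto_add tendsto_in_prob_zeroD(2) assms) auto
  then have lim: "(%r. measure M {w \<in> space M. ep/2 < \<bar>Y r w\<bar>} + measure M {w \<in> space M. ep/2 < \<bar>Z r w\<bar>}) \<longlonglongrightarrow> 0"
   by simp
  have "(%r. measure M {w \<in> space M. ep < \<bar>Y r w + Z r w\<bar>}) \<longlonglongrightarrow> 0"
  proof (rule tendsto_sandwich[OF _ _ tendsto_const lim])
   show "\<forall>\<^sub>F r in sequentially. measure M {w \<in> space M. ep < \<bar>Y r w + Z r w\<bar>}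
    <= measure M {w \<in> space M. ep/2 < \<bar>Y r w\<bar>} + measure M {w \<in> space M. ep/2 < \<bar>Z r w\<bar>}"
   proof (intro always_eventually allI)
    fix r
    have "measure M {w \<in> space M. ep < \<bar>Y r w + Z r w\<bar>}
     <= measure M ({w \<in> space M. ep/2 < \<bar>Y r w\<bar>} \<union> {w \<in> space M. ep/2 < \<bar>Z r w\<bar>})"
     by (rule finite_measure_mono) auto
    also have "\<dots> <= measure M {w \<in> space M. ep/2 < \<bar>Y r w\<bar>} + measure M {w \<in> space M. ep/2 < \<bar>Z r w\<bar>}"
     by (rule measure_Un_le) auto
    finally show "measure M {w \<in> space M. ep < \<bar>Y r w + Z r w\<bar>}
     <= measure M {w \<in> space M. ep/2 < \<bar>Y r w\<bar>} + measure M {w \<in> space M. ep/2 < \<bar>Z r w\<bar>}" .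
   qed
  qed auto }
 then show ?thesis by (auto simp: tendsto_in_prob_def)
qed

lemma tendsto_in_prob_zero_sum_abs:
 assumes "prob_space M" "finite A" "!!k. k \<in> A ==> tendsto_in_prob M (Z k) (%_. 0)"
 shows "tendsto_in_prob M (%r w. \<Sum>k\<in>A. \<bar>Z k r w\<bar>) (%_. 0)"
 using assms(2,3)
proof (induction A)
 case empty
 then show ?case by (auto simp: tendsto_in_prob_def)
next
 case (insert k A)
 have "tendsto_in_prob M (%r w. \<bar>Z k r w\<bar>) (%_. 0)"
  using insert.prems[of k] by (auto simp: tendsto_in_prob_def intro: borel_measurable_abs)
 then have "tendsto_in_prob M (%r w. \<bar>Z k r w\<bar> + (\<Sum>k\<in>A. \<bar>Z k r w\<bar>)) (%_. 0)"
  using insert by (intro tendsto_in_prob_zero_add assms(1)) auto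
 then show ?case using insert by simp
qed

text \<open>One subsequence serves all indices, because the sum of the absolute values is a single
  sequence that tends to 0 in probability and dominates each of them.\<close>

lemma tendsto_in_prob_AE_subseq_finite:
 assumes "prob_space M" "finite A" "!!k. k \<in> A ==> tendsto_in_prob M (Z k) (%_. 0)"
 shows "\<exists>s. strict_mono s \<and> (AE w in M. \<forall>k\<in>A. (%r. Z k (s r) w) \<longlonglongrightarrow> 0)"
proof -
 obtain s where s: "strict_mono s" "AE w in M. (%r. \<Sum>k\<in>A. \<bar>Z k (s r) w\<bar>) \<longlonglongrightarrow> 0"
  using tendsto_in_prob_AE_subseq[OF assms(1) tendsto_in_prob_zero_sum_abs[OF assms(1,2), of Z]] assms(3) by auto
 have "AE w in M. \<forall>k\<in>A. (%r. Z k (s r) w) \<longlonglongrightarrow> 0"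
  using s(2)
 proof eventually_elim
  case (elim w)
  show ?case
  proof
   fix k assume "k \<in> A"
   show "(%r. Z k (s r) w) \<longlonglongrightarrow> 0"
    by (rule Lim_null_comparison[OF _ elim])
     (use \<open>k \<in> A\<close> assms(2) in \<open>auto intro!: always_eventually member_le_sum\<close>)
  qed
 qed
 with s(1) show ?thesis by blast
qed

text \<open>Chebyshev's inequality in the form used throughout: the second moment is an upper bound
  for an \<open>ennreal\<close> integral, so that integrability never has to be known
  beforehand.\<close>

lemma (in prob_space) prob_gt_le_nn_integral_square:
 assumes [measurable]: "Z \<in> BM M" and "0 < ep" "0 <= c"
  and le: "nnE M (%w. (Z w)^2) <= ennreal c"
 shows "prob {w \<in> space M. ep < \<bar>Z w\<bar>} <= c / ep^2"
proof -
 have "emeasure M {w \<in> space M. ep < \<bar>Z w\<bar>} <= emeasure M ({w \<in> space M. 1 <= ennreal (1/ep^2) * ennreal ((Z w)^2)})"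
 proof (rule emeasure_mono)
  show "{w \<in> space M. ep < \<bar>Z w\<bar>} \<subseteq> {w \<in> space M. 1 <= ennreal (1/ep^2) * ennreal ((Z w)^2)}"
  proof
   fix w assume *: "w \<in> {w \<in> space M. ep < \<bar>Z w\<bar>}"
   then have "ep^2 <= (Z w)^2" using \<open>0 < ep\<close> by (intro abs_le_square_iff[THEN iffD1]) auto
   then have "1 <= 1/ep^2 * (Z w)^2" using \<open>0 < ep\<close> by (simp add: field_simps)
   then have "1 <= ennreal (1/ep^2 * (Z w)^2)" by simp
   with * show "w \<in> {w \<in> space M. 1 <= ennreal (1/ep^2) * ennreal ((Z w)^2)}"
    by (subst ennreal_mult[symmetric]) auto
  qed
 qed measurable
 also have "\<dots> <= ennreal (1/ep^2) * (nnI M (%w. ennreal ((Z w)^2) * indicator (space M) w))"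
  by (rule nn_integral_Markov_inequality) auto
 also have "nnI M (%w. ennreal ((Z w)^2) * indicator (space M) w) = nnE M (%w. (Z w)^2)"
  by (rule nn_integral_cong) auto
 also have "ennreal (1/ep^2) * \<dots> <= ennreal (1/ep^2) * ennreal c"
  by (intro mult_left_mono le) auto
 also have "\<dots> = ennreal (c / ep^2)" using assms by (simp add: ennreal_mult[symmetric])
 finally show ?thesis using assms by (simp add: emeasure_eq_measure)
qed

lemma (in prob_space) integrable_from_nn_integral_square:
 assumes [measurable]: "Z \<in> BM M" and "0 <= c"
  and le: "nnE M (%w. (Z w)^2) <= ennreal c"
 shows "integrable M (%w. (Z w)^2)" "expectation (%w. (Z w)^2) <= c"
  "integrable M Z" "expectation (%w. \<bar>Z w\<bar>) <= sqrt c"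
proof -
 show sq: "integrable M (%w. (Z w)^2)"
  by (rule integrableI_nonneg) (use le in \<open>auto intro: le_less_trans\<close>)
 have "ennreal (expectation (%w. (Z w)^2)) <= ennreal c"
  using le by (subst nn_integral_eq_integral[symmetric]) (auto intro: sq)
 then show c: "expectation (%w. (Z w)^2) <= c" using \<open>0 <= c\<close> by simp
 show Z: "integrable M Z" by (rule square_integrable_imp_integrable[OF _ sq]) measurable
 have "(expectation (%w. \<bar>Z w\<bar>))^2 <= expectation (%w. \<bar>Z w\<bar>^2)"
 proof -
  have "0 <= variance (%w. \<bar>Z w\<bar>)" by simp
  also have "variance (%w. \<bar>Z w\<bar>) = expectation (%w. \<bar>Z w\<bar>^2) - (expectation (%w. \<bar>Z w\<bar>))^2"
   by (rule variance_eq) (use Z sq in auto)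
  finally show ?thesis by simp
 qed
 also have "\<dots> <= c" using c by simp
 finally show "expectation (%w. \<bar>Z w\<bar>) <= sqrt c"
  by (simp add: real_le_rsqrt)
qed

text \<open>Nearly all moment estimates below reduce to an almost sure inequality of this shape; the
  constants stay real numbers while the integrals are extended ones.\<close>

lemma (in prob_space) nn_bound2:
 fixes f g h :: "'a => real"
 assumes le: "AE w in M. f w <= a + b * g w + d * h w" and nn: "0 <= a" "0 <= b" "0 <= d"
  and g [measurable]: "g \<in> BM M" and g0: "!!w. 0 <= g w" and C: "nnE M (%w. g w) <= ennreal C" "0 <= C"
  and h [measurable]: "h \<in> BM M" and h0: "!!w. 0 <= h w" and D: "nnE M (%w. h w) <= ennreal D" "0 <= D"
 shows "nnE M (%w. f w) <= ennreal (a + b * C + d * D)"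
proof -
 have "nnE M (%w. f w) <= nnE M (%w. a + b * g w + d * h w)"
  by (rule nn_integral_mono_AE, use le in eventually_elim) (rule ennreal_leI)
 also have "\<dots> = nnI M (%w. ennreal a + ennreal b * ennreal (g w) + ennreal d * ennreal (h w))"
  by (simp only: nn g0 h0 ennreal_plus ennreal_mult add_nonneg_nonneg mult_nonneg_nonneg)
 also have "\<dots> = ennreal a + ennreal b * (nnE M (%w. g w)) + ennreal d * (nnE M (%w. h w))"
  by (simp add: nn_integral_add nn_integral_cmult emeasure_space_1)
 also have "\<dots> <= ennreal a + ennreal b * ennreal C + ennreal d * ennreal D" by (intro add_mono mult_left_mono C D) auto
 also have "\<dots> = ennreal (a + b * C + d * D)" by (simp only: nn C D ennreal_plus ennreal_mult add_nonneg_nonneg mult_nonneg_nonneg)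
 finally show ?thesis .
qed

lemma (in prob_space) nn_bound1:
 fixes f g :: "'a => real"
 assumes "AE w in M. f w <= a + b * g w" "0 <= a" "0 <= b" "g \<in> BM M" "!!w. 0 <= g w"
  "nnE M (%w. g w) <= ennreal C" "0 <= C"
 shows "nnE M (%w. f w) <= ennreal (a + b * C)"
 using nn_bound2[of f a b g 0 "%_. 0" C 0] assms by simp

lemma (in prob_space) nn_average_bound:
 fixes f :: "nat => 'a => real"
 assumes m: "!!i. i \<in> {1..N} ==> f i \<in> BM M" and b: "!!i. i \<in> {1..N} ==> (nnE M (%w. \<bar>f i w\<bar>)) <= ennreal C"
  and C: "0 <= C" and N: "1 <= N"
 shows "nnE M (%w. \<bar>(\<Sum>i=1..N. f i w) / real N\<bar>) <= ennreal C"
proof -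
 have m': "(%w. ennreal \<bar>f i w\<bar>) \<in> BM M" if "i \<in> {1..N}" for i using m[OF that] by simp
 have "nnE M (%w. \<bar>(\<Sum>i=1..N. f i w) / real N\<bar>) <= nnI M (%w. ennreal (1 / real N) * (\<Sum>i=1..N. ennreal \<bar>f i w\<bar>))"
 proof (rule nn_integral_mono, goal_cases)
  case (1 w)
  have "\<bar>(\<Sum>i=1..N. f i w) / real N\<bar> <= 1 / real N * (\<Sum>i=1..N. \<bar>f i w\<bar>)"
   unfolding abs_divide by (simp add: divide_right_mono sum_abs)
  then have "ennreal \<bar>(\<Sum>i=1..N. f i w) / real N\<bar> <= ennreal (1 / real N * (\<Sum>i=1..N. \<bar>f i w\<bar>))" by (rule ennreal_leI)
  also have "\<dots> = ennreal (1 / real N) * (\<Sum>i=1..N. ennreal \<bar>f i w\<bar>)"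
   by (subst ennreal_mult) (auto simp: sum_ennreal sum_nonneg)
  finally show ?case .
 qed
 also have "\<dots> = ennreal (1 / real N) * (\<Sum>i=1..N. (nnE M (%w. \<bar>f i w\<bar>)))"
  by (subst nn_integral_cmult, rule borel_measurable_sum[OF m'], assumption, subst nn_integral_sum[OF m']) simp_all
 also have "\<dots> <= ennreal (1 / real N) * (\<Sum>i=1..N. ennreal C)" by (intro mult_left_mono sum_mono b) auto
 also have "\<dots> = ennreal C" using N C by (subst sum_ennreal, simp, subst ennreal_mult[symmetric]) auto
 finally show ?thesis .
qed

text \<open>Passes from the independence of sigma-algebras, in which \<open>brownian_motion\<close>
  is phrased, to that of random variables, for which expectations of products factor.\<close>

lemma (in prob_space) indep_set_imp_indep_var:
 assumes "indep_set (sets G) (sets (vimage_algebra (space M) Y R))" "subalgebra M G"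
  and Z: "Z \<in> measurable G S" and Y: "Y \<in> measurable M R"
 shows "indep_var S Z R Y"
 unfolding indep_var_eq
proof (intro conjI)
 have sp: "space G = space M" using assms(2) by (simp add: subalgebra_def)
 show "random_variable S Z" using Z assms(2) by (rule measurable_from_subalg[rotated])
 show "random_variable R Y" by fact
 have 1: "{Z -` A \<inter> space M |A. A \<in> sets S} \<subseteq> sets G"
  using measurable_sets[OF Z] sp by auto
 have "sigma_sets (space M) {Z -` A \<inter> space M |A. A \<in> sets S} \<subseteq> sets G"
  using sets.sigma_sets_subset[OF 1] sp by simp
 moreover have "sigma_sets (space M) {Y -` A \<inter> space M |A. A \<in> sets R} = sets (vimage_algebra (space M) Y R)"
  by (simp add: sets_vimage_algebra)
 ultimately show "indep_set (sigma_sets (space M) {Z -` A \<inter> space M |A. A \<in> sets S})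
  (sigma_sets (space M) {Y -` A \<inter> space M |A. A \<in> sets R})"
  using assms(1) unfolding indep_sets2_eq by blast
qed

section \<open>Stochastic integrals and the stochastic differential equation\<close>

lemma square_le_of_abs_le: "\<bar>x\<bar> <= B ==> x^2 <= B^2" for x B :: real
 by (metis abs_ge_zero power2_abs power_mono)

section \<open>Step integrands against a Brownian motion\<close>

locale filtered_bm = prob_space M for M :: "'a measure" +
 fixes F :: "real => 'a measure" and T :: real and W :: "real => 'a => real"
 assumes filt: "filtration (space M) F" and subalg: "!!t. subalgebra M (F t)"
  and bm: "brownian_motion M F T W" and T_pos: "0 < T"
begin

lemma F_mono: "s <= t ==> Z \<in> BM (F s) ==> Z \<in> BM (F t)"
 using filtration.sets_F_mono[OF filt, of s t] filtration.space_F[OF filt]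
 by (auto simp: measurable_def)

lemma F_imp_M: "Z \<in> BM (F s) ==> Z \<in> BM M"
 using subalg by (rule measurable_from_subalg)

lemma W_F: "0 <= t ==> t <= T ==> W t \<in> BM (F t)"
 using bm by (auto simp: brownian_motion_def)

lemma W_M: "0 <= t ==> t <= T ==> W t \<in> BM M"
 using W_F F_imp_M by blast

lemma W_incr_indep:
 assumes "0 <= s" "s < t" "t <= T" "Z \<in> BM (F s)"
 shows "indep_var borel Z borel (%w. W t w - W s w)"
proof (rule indep_set_imp_indep_var[OF _ subalg])
 show "indep_set (sets (F s)) (sets (vimage_algebra (space M) (%w. W t w - W s w) borel))"
  using bm assms by (auto simp: brownian_motion_def)
 show "Z \<in> BM (F s)" by fact
 show "(%w. W t w - W s w) \<in> BM M"
  using assms by (intro borel_measurable_diff W_M) auto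
qed

lemma W_incr_dist:
 assumes "0 <= s" "s < t" "t <= T"
 shows "distributed M lborel (%w. W t w - W s w) (normal_density 0 (sqrt (t - s)))"
 using bm assms by (auto simp: brownian_motion_def)

lemma W_incr_moments:
 assumes "0 <= s" "s < t" "t <= T"
 shows "integrable M (%w. W t w - W s w)" "expectation (%w. W t w - W s w) = 0"
  "integrable M (%w. (W t w - W s w)^2)" "expectation (%w. (W t w - W s w)^2) = t - s"
proof -
 note d = W_incr_dist[OF assms]
 have pos: "0 < sqrt (t - s)" using assms by simp
 show 1: "integrable M (%w. W t w - W s w)"
  using distributed_integrable_var[OF d] integrable_normal_moment_nz_1[OF pos] by simp
 show E: "expectation (%w. W t w - W s w) = 0"
  using normal_distributed_expectation[OF pos d] .
 show "integrable M (%w. (W t w - W s w)^2)"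
  using distributed_integrable[OF d, of "%x. x^2"] integrable_normal_moment[OF pos, of 0 2] by simp
 show "expectation (%w. (W t w - W s w)^2) = t - s"
  using normal_distributed_variance[OF pos d] E assms by simp
qed

text \<open>Ito's isometry by induction on the number of steps: the last increment is independent of
  everything known at its left end, so the cross term has mean 0 and the expectation of the last
  square factors. Boundedness of \<open>ka\<close> gives the integrability of all products.\<close>

lemma step_isometry:
 assumes q: "!!l. l < m ==> q l < q (Suc l)" "0 <= q 0" "q m <= T"
  and ka: "!!l. l < m ==> ka l \<in> BM (F (q l))"
  and bnd: "!!l w. l < m ==> w \<in> space M ==> \<bar>ka l w\<bar> <= B l"
 defines "Z \<equiv> %m w. \<Sum>l<m. ka l w * (W (q (Suc l)) w - W (q l) w)"
 shows "Z m \<in> BM M" "Z m \<in> BM (F (q m))" "integrable M (%w. (Z m w)^2)" 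
  "expectation (%w. (Z m w)^2) = (\<Sum>l<m. expectation (%w. (ka l w)^2) * (q (Suc l) - q l))"
  "expectation (Z m) = 0"
proof -
 have qmono: "i <= j ==> j <= m ==> q i <= q j" for i j
 proof (induction j rule: dec_induct)
  case base
  then show ?case by simp
 next
  case (step k)
  with q(1)[of k] show ?case by auto
 qed
 have "Z j \<in> BM (F (q j)) \<and> integrable M (%w. (Z j w)^2) \<and>
  expectation (%w. (Z j w)^2) = (\<Sum>l<j. expectation (%w. (ka l w)^2) * (q (Suc l) - q l)) \<and>
  expectation (Z j) = 0" if "j <= m" for j
  using that
 proof (induction j)
  case 0
  then show ?case by (simp add: Z_def)
 next
  case (Suc j)
  let ?D = "%w. W (q (Suc j)) w - W (q j) w"
  have j: "j < m" using Suc by simp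
  have r: "0 <= q j" "q j < q (Suc j)" "q (Suc j) <= T"
   using q(1)[OF j] q(2,3) qmono[of 0 j] qmono[of "Suc j" m] j by auto
  note IH = Suc.IH[OF less_imp_le[OF j]]
  have ZF: "Z j \<in> BM (F (q j))" using IH by blast
  have ZM [measurable]: "Z j \<in> BM M" using ZF F_imp_M by blast
  have kaM [measurable]: "ka j \<in> BM M" using ka[OF j] F_imp_M by blast
  have DM [measurable]: "?D \<in> BM M" using r by (intro borel_measurable_diff W_M) auto
  have intZ: "integrable M (Z j)"
   using IH by (intro square_integrable_imp_integrable[OF ZM]) auto
  have intka2: "integrable M (%w. (ka j w)^2)"
  proof (rule integrable_const_bound[of _ "(B j)^2"])
   show "AE x in M. norm ((ka j x)^2) <= (B j)^2"
    using bnd[OF j] by (intro AE_I2) (simp add: square_le_of_abs_le)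
  qed simp
  have intka: "integrable M (ka j)"
   by (rule square_integrable_imp_integrable[OF _ intka2]) simp
  have intZka: "integrable M (%w. Z j w * ka j w)"
  proof (rule Bochner_Integration.integrable_bound[OF integrable_mult_left[OF intZ, of "B j"]])
   show "AE x in M. norm (Z j x * ka j x) <= norm (Z j x * B j)"
    using bnd[OF j] by (intro AE_I2) (simp add: abs_mult mult_left_mono order_trans[OF _ abs_ge_self])
  qed simp
  have i1: "indep_var borel (%w. Z j w * ka j w) borel ?D"
   by (rule W_incr_indep[OF r]) (intro borel_measurable_times ZF ka[OF j])
  have i2: "indep_var borel (ka j) borel ?D"
   by (rule W_incr_indep[OF r]) (intro ka[OF j])
  have "indep_var borel (%w. (ka j w)^2) borel ?D"
   by (rule W_incr_indep[OF r]) (intro borel_measurable_power ka[OF j])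
  from indep_var_compose[OF this, of "%x. x" borel "%x. x^2" borel]
  have i3: "indep_var borel (%w. (ka j w)^2) borel (%w. (?D w)^2)"
   by (simp add: comp_def)
  note m = W_incr_moments[OF r]
  have E1: "integrable M (%w. (Z j w * ka j w) * ?D w)" "expectation (%w. (Z j w * ka j w) * ?D w) = 0"
   using indep_var_integrable[OF i1 intZka m(1)] indep_var_lebesgue_integral[OF i1 intZka m(1)] m(2) by simp_all
  have E2: "integrable M (%w. ka j w * ?D w)" "expectation (%w. ka j w * ?D w) = 0"
   using indep_var_integrable[OF i2 intka m(1)] indep_var_lebesgue_integral[OF i2 intka m(1)] m(2) by simp_all
  have E3: "integrable M (%w. (ka j w)^2 * (?D w)^2)" 
   "expectation (%w. (ka j w)^2 * (?D w)^2) = expectation (%w. (ka j w)^2) * (q (Suc j) - q j)"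
   using indep_var_integrable[OF i3 intka2 m(3)] indep_var_lebesgue_integral[OF i3 intka2 m(3)] m(4) by simp_all
  have eq: "Z (Suc j) = (%w. Z j w + ka j w * ?D w)" by (simp add: Z_def fun_eq_iff)
  have sq: "(%w. (Z (Suc j) w)^2) = (%w. ((Z j w)^2 + 2 * ((Z j w * ka j w) * ?D w)) + (ka j w)^2 * (?D w)^2)"
   unfolding eq by (simp add: fun_eq_iff power2_eq_square algebra_simps)
  have m1: "Z (Suc j) \<in> BM (F (q (Suc j)))"
   unfolding eq using r
   by (intro borel_measurable_add borel_measurable_times borel_measurable_diff W_F
     F_mono[OF less_imp_le[OF r(2)]] ZF ka[OF j]) auto
  have m2: "integrable M (%w. (Z (Suc j) w)^2)"
   unfolding sq using IH E1 E3 by (intro Bochner_Integration.integrable_add integrable_mult_right) auto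
  have "expectation (%w. (Z (Suc j) w)^2) = expectation (%w. (Z j w)^2) + expectation (%w. (ka j w)^2) * (q (Suc j) - q j)"
   unfolding sq using IH E1 E3
   by (subst Bochner_Integration.integral_add) (auto intro!: Bochner_Integration.integrable_add integrable_mult_right simp del: integrable_mult_left_iff integrable_mult_right_iff)
  moreover have "expectation (Z (Suc j)) = 0"
   unfolding eq using intZ E2 IH by (subst Bochner_Integration.integral_add) auto
  ultimately show ?case using IH m1 m2 by simp
 qed
 from this[OF order_refl] show "Z m \<in> BM (F (q m))" "integrable M (%w. (Z m w)^2)" 
  "expectation (%w. (Z m w)^2) = (\<Sum>l<m. expectation (%w. (ka l w)^2) * (q (Suc l) - q l))"
  "expectation (Z m) = 0" by blast+
 then show "Z m \<in> BM M" using F_imp_M by blast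
qed

text \<open>Switching the integrand off as soon as its accumulated energy would exceed \<open>c\<close> keeps it
 adapted, because the energy up to and including step \<open>l\<close> is already known at time \<open>q l\<close>.\<close>

lemma step_truncated_bound:
 assumes q: "!!l. l < m ==> q l < q (Suc l)" "0 <= q 0" "q m <= T"
  and ka: "!!l. l < m ==> ka l \<in> BM (F (q l))" and "0 <= c"
 defines "Q \<equiv> %w. \<Sum>l<m. (ka l w)^2 * (q (Suc l) - q l)"
 shows "\<exists>Z. Z \<in> BM M \<and> (nnE M (%w. (Z w)^2)) <= (nnE M (%w. min c (Q w))) \<and>
  (\<forall>w. Q w <= c \<longrightarrow> Z w = (\<Sum>l<m. ka l w * (W (q (Suc l)) w - W (q l) w)))"
proof -
 define S where "S l w = (\<Sum>i<l. (ka i w)^2 * (q (Suc i) - q i))" for l w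
 define ka' where "ka' l w = (if S (Suc l) w <= c then ka l w else 0)" for l w
 have qmono: "i <= j ==> j <= m ==> q i <= q j" for i j
 proof (induction j rule: dec_induct)
  case base
  then show ?case by simp
 next
  case (step k)
  with q(1)[of k] show ?case by auto
 qed
 have kaF: "ka i \<in> BM (F (q l))" if "i <= l" "l < m" for i l
  using F_mono[OF qmono[of i l] ka[of i]] that by auto
 have SF: "S (Suc l) \<in> BM (F (q l))" if "l < m" for l
 proof -
  have "(%w. \<Sum>i<Suc l. (ka i w)^2 * (q (Suc i) - q i)) \<in> BM (F (q l))"
   using that by (intro borel_measurable_sum borel_measurable_times borel_measurable_power kaF borel_measurable_const) auto
  then show ?thesis by (simp add: S_def[abs_def])
 qed
 have ka'F: "ka' l \<in> BM (F (q l))" if "l < m" for l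
 proof -
  note [measurable] = SF[OF that] ka[OF that]
  show ?thesis unfolding ka'_def[abs_def] by measurable
 qed
 have nonneg: "0 <= (ka l w)^2 * (q (Suc l) - q l)" if "l < m" for l w
  using q(1)[OF that] by simp
 have Smono: "S i w <= S j w" if "i <= j" "j <= m" for i j w
  unfolding S_def using that nonneg by (intro sum_mono2) auto
 \<comment> \<open>A step that is kept contributes at most \<open>c\<close> to the energy. This
   yields the deterministic bound that \<open>step_isometry\<close> asks for, although
   \<open>ka\<close> itself may be unbounded.\<close>
 have bnd: "\<bar>ka' l w\<bar> <= sqrt (c / (q (Suc l) - q l))" if "l < m" for l w
 proof (cases "S (Suc l) w <= c")
  case True
  have "(ka l w)^2 * (q (Suc l) - q l) <= S (Suc l) w"
   unfolding S_def using nonneg that by (intro member_le_sum) auto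
  with True have "(ka l w)^2 * (q (Suc l) - q l) <= c" by simp
  then have "(ka l w)^2 <= c / (q (Suc l) - q l)" using q(1)[OF that] by (simp add: field_simps)
  then have "sqrt ((ka l w)^2) <= sqrt (c / (q (Suc l) - q l))" by (rule real_sqrt_le_mono)
  then show ?thesis using True by (simp add: ka'_def)
 next
  case False
  then show ?thesis using q(1)[OF that] \<open>0 <= c\<close> by (simp add: ka'_def)
 qed
 define Z where "Z w = (\<Sum>l<m. ka' l w * (W (q (Suc l)) w - W (q l) w))" for w
 have Z_eq: "Z = (%w. \<Sum>l<m. ka' l w * (W (q (Suc l)) w - W (q l) w))" by (simp add: Z_def fun_eq_iff)
 note iso = step_isometry[where q=q and m=m and ka=ka' and B="%l. sqrt (c / (q (Suc l) - q l))"]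
 have iso2: "Z \<in> BM M" "integrable M (%w. (Z w)^2)"
  "expectation (%w. (Z w)^2) = (\<Sum>l<m. expectation (%w. (ka' l w)^2) * (q (Suc l) - q l))"
  unfolding Z_eq by (rule iso; use q ka'F bnd in blast)+
 have ka'M [measurable]: "l < m ==> ka' l \<in> BM M" for l using F_imp_M[OF ka'F] .
 have intka': "integrable M (%w. (ka' l w)^2)" if "l < m" for l
 proof (rule integrable_const_bound[of _ "(sqrt (c / (q (Suc l) - q l)))^2"])
  show "AE x in M. norm ((ka' l x)^2) <= (sqrt (c / (q (Suc l) - q l)))^2"
   using bnd[OF that] by (intro AE_I2) (simp add: square_le_of_abs_le del: real_sqrt_pow2_iff)
 qed (use that in measurable)
 have le: "(\<Sum>l<j. (ka' l w)^2 * (q (Suc l) - q l)) <= min c (S j w)" if "j <= m" for j w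
  using that
 proof (induction j)
  case 0
  then show ?case using \<open>0 <= c\<close> by (simp add: S_def)
 next
  case (Suc j)
  then have IH: "(\<Sum>l<j. (ka' l w)^2 * (q (Suc l) - q l)) <= min c (S j w)" by simp
  have "S j w <= S (Suc j) w" using Smono Suc.prems by auto
  moreover have "S (Suc j) w = S j w + (ka j w)^2 * (q (Suc j) - q j)" by (simp add: S_def)
  ultimately show ?case using IH by (auto simp: ka'_def)
 qed
 have QS: "Q w = S m w" for w by (simp add: Q_def S_def)
 have [measurable]: "l < m ==> ka l \<in> BM M" for l using F_imp_M[OF ka] .
 have [measurable]: "Q \<in> BM M"
  unfolding Q_def by (intro borel_measurable_sum borel_measurable_times borel_measurable_power borel_measurable_const) auto
 have Q0: "0 <= Q w" for w unfolding Q_def by (intro sum_nonneg nonneg) auto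
 have intQ: "integrable M (%w. min c (Q w))"
  using Q0 \<open>0 <= c\<close> by (intro integrable_const_bound[of _ c]) auto
 have "expectation (%w. (Z w)^2) = expectation (%w. \<Sum>l<m. (ka' l w)^2 * (q (Suc l) - q l))"
  unfolding iso2(3) using intka' by (subst Bochner_Integration.integral_sum) auto
 also have "\<dots> <= expectation (%w. min c (Q w))"
  using le[OF order_refl] QS intka' by (intro integral_mono intQ) auto
 finally have "ennreal (expectation (%w. (Z w)^2)) <= ennreal (expectation (%w. min c (Q w)))"
  by (rule ennreal_leI)
 then have "nnE M (%w. (Z w)^2) <= nnE M (%w. min c (Q w))"
  using iso2 intQ Q0 \<open>0 <= c\<close> by (subst (1 2) nn_integral_eq_integral) auto
 moreover have "Z w = (\<Sum>l<m. ka l w * (W (q (Suc l)) w - W (q l) w))" if "Q w <= c" for w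
  unfolding Z_def
 proof (intro sum.cong refl)
  fix l assume "l \<in> {..<m}"
  then have "S (Suc l) w <= c" using Smono[of "Suc l" m w] QS[of w] that by auto
  then show "ka' l w * (W (q (Suc l)) w - W (q l) w) = ka l w * (W (q (Suc l)) w - W (q l) w)"
   by (simp add: ka'_def)
 qed
 ultimately show ?thesis using iso2(1) by blast
qed

end

section \<open>Overlapping blocks on a common grid\<close>

lemma exists_grid:
 fixes P :: "real set"
 assumes "finite P" "P \<subseteq> {0..T}" "0 \<in> P" "T \<in> P"
 shows "\<exists>m q. (\<forall>l<m. q l < q (Suc l)) \<and> q 0 = 0 \<and> q m = T \<and> P = q ` {..m::nat}"
proof -
 let ?xs = "sorted_list_of_set P"
 define m where "m = length ?xs - 1"
 have set: "set ?xs = P" using assms by simp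
 have len: "length ?xs = Suc m"
  using assms unfolding m_def by (metis Suc_pred' card_gt_0_iff empty_iff length_sorted_list_of_set)
 have lt: "?xs ! i < ?xs ! j" if "i < j" "j <= m" for i j
  using strict_sorted_list_of_set[of P] that len by (intro sorted_wrt_nth_less[of "(<)"]) auto
 have im: "P = (%i. ?xs ! i) ` {..m}"
  using set len by (auto simp: set_conv_nth less_Suc_eq_le image_iff)
 have le: "?xs ! i <= ?xs ! j" if "i <= j" "j <= m" for i j
  using lt[of i j] that by (cases "i = j") auto
 have "0 \<in> (%i. ?xs ! i) ` {..m}" "T \<in> (%i. ?xs ! i) ` {..m}" using im assms(3,4) by auto
 then obtain i j where i: "i <= m" "0 = ?xs ! i" and j: "j <= m" "T = ?xs ! j" by blast
 have "?xs ! 0 \<in> P" "?xs ! m \<in> P" using im by auto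
 then have "?xs ! 0 = 0" using le[of 0 i] i assms(2) by force
 moreover have "?xs ! m = T" using le[of j m] j \<open>?xs ! m \<in> P\<close> assms(2) by force
 ultimately show ?thesis
  using lt im by (intro exI[of _ m] exI[of _ "%i. ?xs ! i"]) auto
qed

lemma sum_square_orthogonal:
 fixes f :: "nat => real"
 assumes "!!i j. i < j ==> j < m ==> f i * f j = 0"
 shows "(\<Sum>l<m. f l)^2 = (\<Sum>l<m. (f l)^2)"
 using assms
proof (induction m)
 case (Suc m)
 have "f m * (\<Sum>l<m. f l) = (\<Sum>l<m. f l * f m)" by (simp add: sum_distrib_left mult.commute)
 also have "\<dots> = 0" using Suc.prems by (intro sum.neutral) auto
 finally have 0: "f m * (\<Sum>l<m. f l) = 0" .
 have "(\<Sum>l<Suc m. f l)^2 = (\<Sum>l<m. f l)^2 + 2 * (f m * (\<Sum>l<m. f l)) + (f m)^2"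
  by (simp add: power2_eq_square algebra_simps)
 then show ?case using 0 Suc by simp
qed simp

lemma step_mono:
 fixes q :: "nat => real"
 assumes "!!l. l < m ==> q l <= q (Suc l)" "i <= j" "j <= m"
 shows "q i <= q j"
 using assms(2,3)
proof (induction j rule: dec_induct)
 case (step k)
 with assms(1)[of k] show ?case by auto
qed simp

lemma sum_disjoint_indicators_square:
 fixes q :: "nat => real"
 assumes q: "!!l. l < m ==> q l <= q (Suc l)"
 shows "(\<Sum>l<m. g l * indicator {q l<..q (Suc l)} s)^2 = (\<Sum>l<m. (g l)^2 * indicator {q l<..q (Suc l)} s :: real)"
proof -
 have "(\<Sum>l<m. g l * indicator {q l<..q (Suc l)} s)^2 = (\<Sum>l<m. (g l * indicator {q l<..q (Suc l)} s)^2)"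
 proof (rule sum_square_orthogonal)
  fix i j assume "i < j" "j < m"
  then have "q (Suc i) <= q j" using step_mono[of m q "Suc i" j] q by auto
  then show "g i * indicator {q i<..q (Suc i)} s * (g j * indicator {q j<..q (Suc j)} s) = 0"
   by (auto simp: indicator_def)
 qed
 moreover have "(indicator A s :: real)^2 = indicator A s" for A by (simp add: indicator_def)
 ultimately show ?thesis by (simp only: power_mult_distrib)
qed

lemma step_process_energy:
 fixes q :: "nat => real"
 assumes q: "!!l. l < m ==> q l < q (Suc l)" "q 0 = 0" "q m = T"
 shows "set_integrable lborel {0..T} (%s. (\<Sum>l<m. g l * indicator {q l<..q (Suc l)} s)^2)" (is ?A)
  and "(LBINT s:{0..T}. (\<Sum>l<m. g l * indicator {q l<..q (Suc l)} s)^2) = (\<Sum>l<m. (g l)^2 * (q (Suc l) - q l))" (is ?B)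
proof -
 have mono: "q i <= q j" if "i <= j" "j <= m" for i j
  by (rule step_mono[of m q]) (use q that in \<open>auto intro: less_imp_le\<close>)
 have eq: "indicator {0..T} s *\<^sub>R (\<Sum>l<m. g l * indicator {q l<..q (Suc l)} s)^2
  = (\<Sum>l<m. (g l)^2 * indicator {q l<..q (Suc l)} s)" for s
 proof -
  have "indicator {0..T} s * indicator {q l<..q (Suc l)} s = (indicator {q l<..q (Suc l)} s :: real)" if "l < m" for l
   using mono[of 0 l] mono[of "Suc l" m] q that by (auto simp: indicator_def)
  note ind = this
  have "(\<Sum>l<m. g l * indicator {q l<..q (Suc l)} s)^2 = (\<Sum>l<m. (g l)^2 * indicator {q l<..q (Suc l)} s)"
   using q by (intro sum_disjoint_indicators_square less_imp_le) auto
  then show ?thesis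
   by (simp only: real_scaleR_def sum_distrib_left, intro sum.cong refl) (simp only: lessThan_iff ind mult.left_commute[of "indicator {0..T} s"])
 qed
 have "has_bochner_integral lborel (%s. \<Sum>l<m. (g l)^2 * indicator {q l<..q (Suc l)} s) (\<Sum>l<m. (g l)^2 * (q (Suc l) - q l))"
 proof (intro has_bochner_integral_sum has_bochner_integral_mult_right)
  fix l assume "l \<in> {..<m}"
  then show "has_bochner_integral lborel (indicator {q l<..q (Suc l)}) (q (Suc l) - q l)"
   using has_bochner_integral_real_indicator[of "{q l<..q (Suc l)}" lborel] q(1)[of l] by simp
 qed
 then show ?A ?B
  unfolding set_integrable_def set_lebesgue_integral_def eq
  by (auto simp: has_bochner_integral_iff)
qed

context filtered_bm begin

text \<open>On the common refinement of all end points the blocks form a step integrand, whose value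
  on a cell is the sum of the \<open>xi\<close> of the blocks covering it. It stays adapted since a
  covering block began no later than the cell. Blocks may overlap, as happens when two partitions
  are intersected.\<close>

lemma block_truncated_bound:
 fixes xi :: "'k => 'a => real" and u v :: "'k => real"
 assumes A: "finite A" and uv: "!!k. k \<in> A ==> 0 <= u k" "!!k. k \<in> A ==> u k <= v k" "!!k. k \<in> A ==> v k <= T"
  and xi: "!!k. k \<in> A ==> xi k \<in> BM (F (u k))" and "0 <= c"
 defines "K \<equiv> %w s. \<Sum>k\<in>A. xi k w * indicator {u k<..v k} s"
 defines "Q \<equiv> %w. LBINT s:{0..T}. (K w s)^2"
 shows "Q \<in> BM M" "!!w. set_integrable lborel {0..T} (%s. (K w s)^2)"
  "\<exists>Z. Z \<in> BM M \<and> (nnE M (%w. (Z w)^2)) <= (nnE M (%w. min c (Q w))) \<and>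
   (\<forall>w. Q w <= c \<longrightarrow> Z w = (\<Sum>k\<in>A. xi k w * (W (v k) w - W (u k) w)))"
proof -
 let ?P = "insert 0 (insert T (u ` A \<union> v ` A))"
 have "\<exists>m q. (\<forall>l<m. q l < q (Suc l)) \<and> q 0 = 0 \<and> q m = T \<and> ?P = q ` {..m::nat}"
  using A uv T_pos by (intro exists_grid) (auto intro: order_trans[OF uv(2) uv(3)] order_trans[OF uv(1) uv(2)])
 then obtain m q where q: "!!l. l < m ==> q l < q (Suc l)" "q 0 = 0" "q m = T" and P: "?P = q ` {..m::nat}"
  by blast
 have mono: "q i <= q j" if "i <= j" "j <= m" for i j
  by (rule step_mono[of m q]) (use q that in \<open>auto intro: less_imp_le\<close>)
 have strict: "q i < q j \<longleftrightarrow> i < j" if "i <= m" "j <= m" for i j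
 proof
  assume "q i < q j" then show "i < j" using mono[of j i] that by (meson leD leI)
 next
  assume "i < j" then show "q i < q j" using q(1)[of i] mono[of "Suc i" j] that by simp
 qed
 have le_iff: "q i <= q j \<longleftrightarrow> i <= j" if "i <= m" "j <= m" for i j
  using strict[OF that(2,1)] by (simp add: not_less[symmetric])
 have "\<forall>k\<in>A. \<exists>i\<le>m. u k = q i" "\<forall>k\<in>A. \<exists>i\<le>m. v k = q i" using P by blast+
 then obtain iu iv where iu: "!!k. k \<in> A ==> iu k <= m \<and> u k = q (iu k)" and iv: "!!k. k \<in> A ==> iv k <= m \<and> v k = q (iv k)"
  by metis
 have iuv: "iu k <= iv k" if "k \<in> A" for k using uv(2)[OF that] iu[OF that] iv[OF that] le_iff by auto
 define ka where "ka l w = (\<Sum>k\<in>{k\<in>A. iu k <= l \<and> l < iv k}. xi k w)" for l w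
 have kaF: "ka l \<in> BM (F (q l))" if "l < m" for l
  unfolding ka_def
 proof (intro borel_measurable_sum)
  fix k assume "k \<in> {k\<in>A. iu k <= l \<and> l < iv k}"
  then show "xi k \<in> BM (F (q l))"
   using F_mono[OF _ xi[of k], of "q l"] iu[of k] mono[of "iu k" l] that by auto
 qed
 have ind: "indicator {u k<..v k} s = (\<Sum>l<m. if iu k <= l \<and> l < iv k then indicator {q l<..q (Suc l)} s else 0 :: real)"
  if k: "k \<in> A" for k s
 proof -
  have tele: "(\<Sum>l\<in>{i..<j}. indicator {q l<..q (Suc l)} s :: real) = indicator {q i<..q j} s" if "i <= j" "j <= m" for i j
   using that
  proof (induction j rule: dec_induct)
   case (step n)
   have "q i <= q n" "q n <= q (Suc n)" using mono step by auto
   then have "indicator {q i<..q (Suc n)} s = indicator {q i<..q n} s + (indicator {q n<..q (Suc n)} s :: real)"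
    by (auto simp: indicator_def)
   with step show ?case by simp
  qed simp
  have "(\<Sum>l<m. if iu k <= l \<and> l < iv k then indicator {q l<..q (Suc l)} s else 0 :: real)
   = (\<Sum>l\<in>{iu k..<iv k}. indicator {q l<..q (Suc l)} s)"
   using iu[OF k] iv[OF k] by (intro sum.mono_neutral_cong_right) auto
  then show ?thesis using tele[OF iuv[OF k]] iu[OF k] iv[OF k] by simp
 qed
 have Wt: "W (v k) w - W (u k) w = (\<Sum>l<m. if iu k <= l \<and> l < iv k then W (q (Suc l)) w - W (q l) w else 0)"
  if k: "k \<in> A" for k w
 proof -
  have "(\<Sum>l<m. if iu k <= l \<and> l < iv k then W (q (Suc l)) w - W (q l) w else 0)
   = (\<Sum>l\<in>{iu k..<iv k}. W (q (Suc l)) w - W (q l) w)"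
   using iu[OF k] iv[OF k] by (intro sum.mono_neutral_cong_right) auto
  also have "\<dots> = W (q (iv k)) w - W (q (iu k)) w"
   using sum_Suc_diff'[OF iuv[OF k], of "%l. W (q l) w"] .
  finally show ?thesis using iu[OF k] iv[OF k] by simp
 qed
 have swap: "(\<Sum>k\<in>A. xi k w * (\<Sum>l<m. if iu k <= l \<and> l < iv k then f l else 0)) = (\<Sum>l<m. ka l w * f l)" for w and f :: "nat => real"
 proof -
  have "(\<Sum>k\<in>A. xi k w * (\<Sum>l<m. if iu k <= l \<and> l < iv k then f l else 0))
   = (\<Sum>l<m. \<Sum>k\<in>A. if iu k <= l \<and> l < iv k then xi k w * f l else 0)"
   unfolding sum_distrib_left by (subst sum.swap) (auto intro!: sum.cong)
  also have "\<dots> = (\<Sum>l<m. ka l w * f l)"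
   unfolding ka_def sum_distrib_right by (simp add: sum.inter_filter[OF A])
  finally show ?thesis .
 qed
 have K_eq: "K w s = (\<Sum>l<m. ka l w * indicator {q l<..q (Suc l)} s)" for w s
  unfolding K_def using ind swap[of w "%l. indicator {q l<..q (Suc l)} s"] by simp
 have Q_eq: "Q = (%w. \<Sum>l<m. (ka l w)^2 * (q (Suc l) - q l))"
  unfolding Q_def K_eq using step_process_energy(2)[OF q] by simp
 show "set_integrable lborel {0..T} (%s. (K w s)^2)" for w
  unfolding K_eq using step_process_energy(1)[OF q] by simp
 show "Q \<in> BM M"
  unfolding Q_eq using F_imp_M[OF kaF]
  by (intro borel_measurable_sum borel_measurable_times borel_measurable_power borel_measurable_const) auto
 have Z_eq: "(\<Sum>k\<in>A. xi k w * (W (v k) w - W (u k) w)) = (\<Sum>l<m. ka l w * (W (q (Suc l)) w - W (q l) w))" for w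
  using Wt swap[of w "%l. W (q (Suc l)) w - W (q l) w"] by simp
 show "\<exists>Z. Z \<in> BM M \<and> (nnE M (%w. (Z w)^2)) <= (nnE M (%w. min c (Q w))) \<and>
   (\<forall>w. Q w <= c \<longrightarrow> Z w = (\<Sum>k\<in>A. xi k w * (W (v k) w - W (u k) w)))"
  unfolding Z_eq Q_eq by (rule step_truncated_bound) (use q kaF \<open>0 <= c\<close> in auto)
qed

end

text \<open>Young's inequality bounds the difference of two squares by a small multiple of the limit
  energy plus a large multiple of the squared distance; the latter tends to 0 once the former is
  fixed.\<close>

lemma square_integral_tendsto:
 fixes f :: "'b => real" and g :: "nat => 'b => real"
 assumes [measurable]: "f \<in> BM N" "!!r. g r \<in> BM N"
  and f: "integrable N (%x. (f x)^2)" and d: "!!r. integrable N (%x. (g r x - f x)^2)"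
  and lim: "(%r. \<integral>x. (g r x - f x)^2 \<partial>N) \<longlonglongrightarrow> 0"
 shows "(%r. \<integral>x. (g r x)^2 \<partial>N) \<longlonglongrightarrow> (\<integral>x. (f x)^2 \<partial>N)"
proof (rule tendstoI)
 fix e :: real assume "0 < e"
 let ?E = "\<integral>x. (f x)^2 \<partial>N"
 have E0: "0 <= ?E" by simp
 \<comment> \<open>Chosen so that \<open>de * ?E < e / 2\<close>; the added 1 covers the case of
   zero energy.\<close>
 define de where "de = e / (2 * (?E + 1))"
 have de: "0 < de" unfolding de_def using \<open>0 < e\<close> E0 by (intro divide_pos_pos mult_pos_pos add_nonneg_pos) auto
 have deE: "de * ?E < e / 2"
 proof -
  have "de * ?E < de * (?E + 1)" using de by simp
  also have "de * (?E + 1) = e / 2" unfolding de_def times_divide_eq_left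
   using E0 by (intro mult_divide_mult_cancel_right) linarith
  finally show ?thesis .
 qed
 have pt: "\<bar>y^2 - z^2\<bar> <= de * z^2 + (1 + 1 / de) * (y - z)^2" for y z :: real
 proof -
  define h where "h = y - z"
  have y: "y = z + h" by (simp add: h_def)
  have "0 <= (de * z - h)^2 / de" "0 <= (de * z + h)^2 / de" using de by auto
  then have "2 * z * h <= de * z^2 + h^2 / de" "- (2 * z * h) <= de * z\<^sup>2 + h\<^sup>2 / de"
   using de by (auto simp: power2_eq_square field_simps)
  moreover have "y^2 - z^2 = 2 * z * h + h^2" unfolding y by (simp add: power2_eq_square algebra_simps)
  moreover have "(1 + 1 / de) * (y - z)^2 = h^2 + h^2 / de" by (simp add: h_def algebra_simps)
  moreover have "0 <= h^2" by simp
  ultimately show ?thesis unfolding abs_le_iff by linarith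
 qed
 have g2: "integrable N (%x. (g r x)^2)" for r
 proof (rule Bochner_Integration.integrable_bound)
  show "integrable N (%x. 2 * (f x)^2 + 2 * (g r x - f x)^2)" using f d by auto
  show "AE x in N. norm ((g r x)^2) <= norm (2 * (f x)^2 + 2 * (g r x - f x)^2)"
  proof (intro AE_I2)
   fix x
   have "(g r x)^2 <= 2 * (f x)^2 + 2 * (g r x - f x)^2"
    using zero_le_power2[of "g r x - 2 * f x"] by (simp add: power2_eq_square algebra_simps)
   then show "norm ((g r x)^2) <= norm (2 * (f x)^2 + 2 * (g r x - f x)^2)" by simp
  qed
 qed simp
 have bound: "\<bar>(\<integral>x. (g r x)^2 \<partial>N) - ?E\<bar> <= de * ?E + (1 + 1 / de) * (\<integral>x. (g r x - f x)^2 \<partial>N)" for r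
 proof -
  have "\<bar>(\<integral>x. (g r x)^2 \<partial>N) - ?E\<bar> = \<bar>\<integral>x. (g r x)^2 - (f x)^2 \<partial>N\<bar>"
   using g2 f by (subst Bochner_Integration.integral_diff) auto
  also have "\<dots> <= (\<integral>x. \<bar>(g r x)^2 - (f x)^2\<bar> \<partial>N)" by (rule integral_abs_bound)
  also have "\<dots> <= (\<integral>x. de * (f x)^2 + (1 + 1 / de) * (g r x - f x)^2 \<partial>N)"
   using pt g2 f d by (intro integral_mono integrable_abs Bochner_Integration.integrable_diff
     Bochner_Integration.integrable_add integrable_mult_right) auto
  also have "\<dots> = de * ?E + (1 + 1 / de) * (\<integral>x. (g r x - f x)^2 \<partial>N)"
   using f d by (subst Bochner_Integration.integral_add) auto
  finally show ?thesis .
 qed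
 have "(%r. (1 + 1 / de) * (\<integral>x. (g r x - f x)^2 \<partial>N)) \<longlonglongrightarrow> (1 + 1 / de) * 0"
  by (intro tendsto_mult_left lim)
 from order_tendstoD(2)[OF this, of "e / 2"] \<open>0 < e\<close>
 have "\<forall>\<^sub>F r in sequentially. (1 + 1 / de) * (\<integral>x. (g r x - f x)^2 \<partial>N) < e / 2" by simp
 then show "\<forall>\<^sub>F r in sequentially. dist (\<integral>x. (g r x)^2 \<partial>N) ?E < e"
 proof eventually_elim
  case (elim r)
  then show ?case using bound[of r] deE unfolding dist_real_def by linarith
 qed
qed

section \<open>Moment bounds for general stochastic integrals\<close>

context filtered_bm begin

lemma progressive_adapted:
 assumes "progressive F T H" "0 <= t" "t <= T"
 shows "H t \<in> BM (F t)"
proof -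
 have "(%w. (t, w)) \<in> F t \<rightarrow>\<^sub>M restrict_space borel {0..t} \<Otimes>\<^sub>M F t"
  using assms by (intro measurable_Pair measurable_const measurable_ident) (auto simp: space_restrict_space)
 moreover have "(%(s, w). H s w) \<in> BM (restrict_space borel {0..t} \<Otimes>\<^sub>M F t)"
  using assms by (auto simp: progressive_def)
 ultimately have "(%(s, w). H s w) \<circ> (%w. (t, w)) \<in> BM (F t)"
  by (rule measurable_comp)
 then show ?thesis by (simp add: comp_def)
qed

text \<open>Clamping the time to \<open>{0..T}\<close> extends the process to the whole line without
  changing it where it matters, and makes it jointly measurable in the form that Fubini's theorem
  with \<open>lborel\<close> requires.\<close>

lemma progressive_joint:
 assumes "progressive F T H"
 shows "(%(w, s). H (max 0 (min T s)) w) \<in> BM (M \<Otimes>\<^sub>M lborel)"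
proof -
 have "(%x. (max 0 (min T (snd x)), fst x)) \<in> M \<Otimes>\<^sub>M lborel \<rightarrow>\<^sub>M restrict_space borel {0..T} \<Otimes>\<^sub>M F T"
 proof (intro measurable_Pair measurable_restrict_space2)
  show "fst \<in> M \<Otimes>\<^sub>M lborel \<rightarrow>\<^sub>M F T"
   using measurable_fst[of M lborel] subalg[of T] by (auto simp: subalgebra_def measurable_def)
  show "(%x. max 0 (min T (snd x))) \<in> space (M \<Otimes>\<^sub>M lborel) \<rightarrow> {0..T}" using T_pos by auto
 qed measurable
 moreover have "(%(s, w). H s w) \<in> BM (restrict_space borel {0..T} \<Otimes>\<^sub>M F T)"
  using assms T_pos by (auto simp: progressive_def)
 ultimately have "(%(s, w). H s w) \<circ> (%x. (max 0 (min T (snd x)), fst x)) \<in> BM (M \<Otimes>\<^sub>M lborel)"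
  by (rule measurable_comp)
 then show ?thesis by (simp add: comp_def case_prod_beta)
qed

lemma progressive_path:
 assumes "progressive F T H" "w \<in> space M"
 shows "(%s. H (max 0 (min T s)) w) \<in> BM borel"
 using measurable_Pair2[OF progressive_joint[OF assms(1)] assms(2)] by simp

lemma ito_integral_M: "ito_integral M F T W H I ==> 0 <= t ==> t <= T ==> I t \<in> BM M"
 unfolding ito_integral_def tendsto_in_prob_def by auto

end

text \<open>Both sides compare a block of a simple process with its restriction to a second interval.\<close>

lemma interval_overlap:
 fixes x x' y y' t :: real and W :: "real => real"
 assumes "x <= x'" "y <= y'"
 shows "indicator {max x y<..max (max x y) (min x' y')} t = (indicator {x<..x'} t * indicator {y<..y'} t :: real)"
  and "W (max (max x y) (min x' y')) - W (max x y) = (W (min x' y') - W (min x' y)) - (W (min x y') - W (min x y))"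
 using assms by (auto simp: indicator_def max_def min_def)

context filtered_bm begin

lemma ito_localized_bound:
 assumes I: "ito_integral M F T W H I"
  and p: "!!k. k <= m ==> 0 <= p k \<and> p k <= T" "!!k. k < m ==> p k <= p (Suc k)"
  and w: "!!k. k < m ==> w k \<in> BM (F (p k))"
  and wC: "!!k y. k < m ==> y \<in> space M ==> \<bar>w k y\<bar> <= C"
  and g: "!!k. k < m ==> g k \<in> BM (F (p k))" and c: "0 <= c"
 defines "K \<equiv> %y t. \<Sum>k<m. w k y * (H t y - g k y) * indicator {p k<..p (Suc k)} t"
 defines "J \<equiv> %y. \<Sum>k<m. w k y * (I (p (Suc k)) y - I (p k) y - g k y * (W (p (Suc k)) y - W (p k) y))"
 defines "Q \<equiv> %y. LBINT t:{0..T}. (K y t)^2"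
 shows "J \<in> BM M" "Q \<in> BM M"
  "nnI M (%y. ennreal ((J y)^2) * indicator {y. Q y < c} y) <= nnE M (%y. min c (Q y))"
  "AE y in M. set_integrable lborel {0..T} (%t. (K y t)^2)"
proof -
 have wM [measurable]: "k < m ==> w k \<in> BM M" for k using F_imp_M[OF w] .
 have gM [measurable]: "k < m ==> g k \<in> BM M" for k using F_imp_M[OF g] .
 have prog: "progressive F T H" and H2: "AE y in M. set_integrable lborel {0..T} (%s. (H s y)^2)"
  using I by (auto simp: ito_integral_def)
 obtain mr pr xir where simple: "!!r::nat. simple_integrand F T (mr r) (pr r) (xir r)"
  and lim1: "tendsto_in_prob M (%r y. LBINT s:{0..T}. (simple_process (mr r) (pr r) (xir r) s y - H s y)^2) (%_. 0)"
  and lim2: "!!t. t \<in> {0..T} ==> tendsto_in_prob M (%r. simple_stoch_integral W (mr r) (pr r) (xir r) t) (I t)"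
  using I unfolding ito_integral_def by blast
 note joint [measurable] = progressive_joint[OF prog]
 show JM [measurable]: "J \<in> BM M"
  unfolding J_def using p by (intro borel_measurable_sum borel_measurable_times borel_measurable_diff wM gM W_M ito_integral_M[OF I]) auto
 have Q_clamp: "Q y = (\<integral>t. indicator {0..T} t * (\<Sum>k<m. w k y * (H (max 0 (min T t)) y - g k y) * indicator {p k<..p (Suc k)} t)^2 \<partial>lborel)" for y
  unfolding Q_def K_def set_lebesgue_integral_def by (intro Bochner_Integration.integral_cong) (auto simp: indicator_def)
 have "(%y. \<integral>t. indicator {0..T} t * (\<Sum>k<m. w k y * (H (max 0 (min T t)) y - g k y) * indicator {p k<..p (Suc k)} t)^2 \<partial>lborel) \<in> BM M"
 proof (rule lborel.borel_measurable_lebesgue_integral)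
  have "(%x. w k (fst x) * (H (max 0 (min T (snd x))) (fst x) - g k (fst x)) * indicator {p k<..p (Suc k)} (snd x)) \<in> BM (M \<Otimes>\<^sub>M lborel)" if "k < m" for k
   using wM[OF that] gM[OF that] joint by (simp add: case_prod_beta) measurable
  then show "(%(y, t). indicator {0..T} t * (\<Sum>k<m. w k y * (H (max 0 (min T t)) y - g k y) * indicator {p k<..p (Suc k)} t)^2) \<in> BM (M \<Otimes>\<^sub>M lborel)"
   unfolding case_prod_beta by (intro borel_measurable_times borel_measurable_power borel_measurable_sum) auto
 qed
 then show QM [measurable]: "Q \<in> BM M" by (simp add: Q_clamp[abs_def])

 define Hr where "Hr r t y = simple_process (mr r) (pr r) (xir r) t y" for r t y
 define Ir where "Ir r t y = simple_stoch_integral W (mr r) (pr r) (xir r) t y" for r t y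
 define Kr where "Kr r y t = (\<Sum>k<m. w k y * (Hr r t y - g k y) * indicator {p k<..p (Suc k)} t)" for r y t
 define Jr where "Jr r y = (\<Sum>k<m. w k y * (Ir r (p (Suc k)) y - Ir r (p k) y - g k y * (W (p (Suc k)) y - W (p k) y)))" for r y
 define Qr where "Qr r y = (LBINT t:{0..T}. (Kr r y t)^2)" for r y
 have pr: "k <= mr r ==> 0 <= pr r k \<and> pr r k <= T" "k < mr r ==> pr r k <= pr r (Suc k)"
  "k < mr r ==> xir r k \<in> BM (F (pr r k))" for r k
  using simple[of r] by (auto simp: simple_integrand_def)
 have approx: "Qr r \<in> BM M \<and> (\<forall>y. set_integrable lborel {0..T} (%s. (Kr r y s)^2)) \<and>
  (\<exists>Z. Z \<in> BM M \<and> (nnE M (%y. (Z y)^2)) <= (nnE M (%y. min c (Qr r y))) \<and>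
   (\<forall>y. Qr r y <= c \<longrightarrow> Z y = Jr r y))" for r
 proof -
  let ?A = "{..<m} \<times> {..mr r}"
  define u where "u = (%(k, j). if j < mr r then max (p k) (pr r j) else p k)"
  \<comment> \<open>The outer \<open>max\<close> collapses an empty intersection to a block of
    length 0.\<close>
  define v where "v = (%(k, j). if j < mr r then max (max (p k) (pr r j)) (min (p (Suc k)) (pr r (Suc j))) else p (Suc k))"
  define xi where "xi = (%(k, j) y. if j < mr r then w k y * xir r j y else - (w k y * g k y))"
  have K_eq: "(\<Sum>z\<in>?A. xi z y * indicator {u z<..v z} t) = Kr r y t" for y t
  proof -
   have "(\<Sum>z\<in>?A. xi z y * indicator {u z<..v z} t)
    = (\<Sum>k<m. (\<Sum>j<mr r. w k y * xir r j y * (indicator {p k<..p (Suc k)} t * indicator {pr r j<..pr r (Suc j)} t))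
      - w k y * g k y * indicator {p k<..p (Suc k)} t)"
    unfolding sum.cartesian_product' lessThan_Suc_atMost[symmetric] sum.lessThan_Suc
   proof (intro sum.cong refl)
    fix k assume "k \<in> {..<m}"
    then have "p k <= p (Suc k)" using p by simp
    then have 1: "xi (k, j) y * indicator {u (k, j)<..v (k, j)} t
     = w k y * xir r j y * (indicator {p k<..p (Suc k)} t * indicator {pr r j<..pr r (Suc j)} t)" if "j < mr r" for j
     using that pr(2) unfolding u_def v_def xi_def by (simp only: prod.case if_True interval_overlap(1))
    have 2: "xi (k, mr r) y * indicator {u (k, mr r)<..v (k, mr r)} t = - (w k y * g k y * indicator {p k<..p (Suc k)} t)"
     by (simp add: u_def v_def xi_def)
    show "(\<Sum>j<mr r. xi (k, j) y * indicator {u (k, j)<..v (k, j)} t) + xi (k, mr r) y * indicator {u (k, mr r)<..v (k, mr r)} t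
     = (\<Sum>j<mr r. w k y * xir r j y * (indicator {p k<..p (Suc k)} t * indicator {pr r j<..pr r (Suc j)} t))
      - w k y * g k y * indicator {p k<..p (Suc k)} t"
     unfolding 2 minus_real_def by (intro arg_cong2[where f="(+)"] sum.cong refl 1) simp
   qed
   also have "\<dots> = Kr r y t"
    unfolding Kr_def Hr_def simple_process_def
    by (simp only: right_diff_distrib left_diff_distrib sum_distrib_left sum_distrib_right mult_ac)
   finally show ?thesis .
  qed
  have J_eq: "(\<Sum>z\<in>?A. xi z y * (W (v z) y - W (u z) y)) = Jr r y" for y
  proof -
   have "(\<Sum>z\<in>?A. xi z y * (W (v z) y - W (u z) y))
    = (\<Sum>k<m. (\<Sum>j<mr r. w k y * xir r j y * ((W (min (p (Suc k)) (pr r (Suc j))) y - W (min (p (Suc k)) (pr r j)) y)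
       - (W (min (p k) (pr r (Suc j))) y - W (min (p k) (pr r j)) y)))
      - w k y * g k y * (W (p (Suc k)) y - W (p k) y))"
    unfolding sum.cartesian_product' lessThan_Suc_atMost[symmetric] sum.lessThan_Suc
   proof (intro sum.cong refl)
    fix k assume "k \<in> {..<m}"
    then have "p k <= p (Suc k)" using p by simp
    then have 1: "xi (k, j) y * (W (v (k, j)) y - W (u (k, j)) y)
     = w k y * xir r j y * ((W (min (p (Suc k)) (pr r (Suc j))) y - W (min (p (Suc k)) (pr r j)) y)
       - (W (min (p k) (pr r (Suc j))) y - W (min (p k) (pr r j)) y))" if "j < mr r" for j
     using that pr(2) unfolding u_def v_def xi_def
     by (simp only: prod.case if_True interval_overlap(2)[where W = "%t. W t y"])
    have 2: "xi (k, mr r) y * (W (v (k, mr r)) y - W (u (k, mr r)) y) = - (w k y * g k y * (W (p (Suc k)) y - W (p k) y))"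
     by (simp add: u_def v_def xi_def)
    show "(\<Sum>j<mr r. xi (k, j) y * (W (v (k, j)) y - W (u (k, j)) y)) + xi (k, mr r) y * (W (v (k, mr r)) y - W (u (k, mr r)) y)
     = (\<Sum>j<mr r. w k y * xir r j y * ((W (min (p (Suc k)) (pr r (Suc j))) y - W (min (p (Suc k)) (pr r j)) y)
       - (W (min (p k) (pr r (Suc j))) y - W (min (p k) (pr r j)) y)))
      - w k y * g k y * (W (p (Suc k)) y - W (p k) y)"
     unfolding 2 minus_real_def[of "sum _ _"] by (intro arg_cong2[where f="(+)"] sum.cong refl 1) simp
   qed
   also have "\<dots> = Jr r y"
    unfolding Jr_def Ir_def simple_stoch_integral_def
    by (intro sum.cong refl) (simp add: right_diff_distrib sum_subtractf sum_distrib_left mult.assoc)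
   finally show ?thesis .
  qed
  have A: "finite ?A" by simp
  have u0: "0 <= u z" if "z \<in> ?A" for z
   using that p pr by (auto simp: u_def le_max_iff_disj split: prod.splits if_splits)
  have uv: "u z <= v z" if "z \<in> ?A" for z
   using that p by (auto simp: u_def v_def split: prod.splits if_splits)
  have vT: "v z <= T" if "z \<in> ?A" for z
   using that p pr by (auto simp: v_def min_le_iff_disj split: prod.splits if_splits)
  have xiF: "xi z \<in> BM (F (u z))" if "z \<in> ?A" for z
  proof -
   obtain k j where z: "z = (k, j)" "k < m" "j <= mr r" using \<open>z \<in> ?A\<close> by auto
   show ?thesis
   proof (cases "j < mr r")
    case True
    have "w k \<in> BM (F (u z))" by (rule F_mono[OF _ w]) (use z True in \<open>auto simp: u_def\<close>)
    moreover have "xir r j \<in> BM (F (u z))" by (rule F_mono[OF _ pr(3)]) (use z True in \<open>auto simp: u_def\<close>)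
    ultimately show ?thesis using z True by (simp add: xi_def)
   next
    case False
    then show ?thesis using z w[of k] g[of k] by (simp add: xi_def u_def)
   qed
  qed
  note b = block_truncated_bound[where A="?A" and u=u and v=v and xi=xi, OF A u0 uv vT xiF c]
  show ?thesis
   using b unfolding K_eq J_eq Qr_def[symmetric, abs_def] by blast
 qed
 then obtain Z where Z: "!!r. Z r \<in> BM M"
  "!!r. (nnE M (%y. (Z r y)^2)) <= nnE M (%y. min c (Qr r y))"
  "!!r y. Qr r y <= c ==> Z r y = Jr r y" by metis
 have Qr_M [measurable]: "Qr r \<in> BM M" for r using approx by blast
 note [measurable] = Z(1)

 \<comment> \<open>The indices up to \<open>m\<close> carry the errors of the integrals at the
   partition points, and \<open>Suc m\<close> the distance of the integrands, so that a single
   subsequence serves both.\<close>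
 define S where "S i r y = (if i <= m then Ir r (p i) y - I (p i) y else LBINT s:{0..T}. (Hr r s y - H s y)^2)" for i r y
 have "\<exists>s. strict_mono s \<and> (AE y in M. \<forall>k\<in>{..Suc m}. (%r. S k (s r) y) \<longlonglongrightarrow> 0)"
 proof (rule tendsto_in_prob_AE_subseq_finite[OF prob_space_axioms])
  fix i assume "i \<in> {..Suc m}"
  show "tendsto_in_prob M (S i) (%_. 0)"
  proof (cases "i <= m")
   case True
   then show ?thesis unfolding S_def[abs_def] Ir_def using tendsto_in_prob_diff_zero[OF lim2[of "p i"]] p(1)[of i] by simp
  next
   case False
   then show ?thesis unfolding S_def[abs_def] Hr_def using lim1 by simp
  qed
 qed simp
 then obtain s where s: "strict_mono s" "AE y in M. \<forall>k\<in>{..Suc m}. (%r. S k (s r) y) \<longlonglongrightarrow> 0" by blast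
 have good: "AE y in M. (%r. Qr (s r) y) \<longlonglongrightarrow> Q y \<and> (%r. Jr (s r) y) \<longlonglongrightarrow> J y \<and> set_integrable lborel {0..T} (%t. (K y t)^2)"
  using s(2) H2 AE_space
 proof eventually_elim
  case (elim y)
  have Slim: "(%r. S k (s r) y) \<longlonglongrightarrow> 0" if "k <= Suc m" for k using elim(1) that by auto
  have Ilim: "(%r. Ir (s r) (p k) y) \<longlonglongrightarrow> I (p k) y" if "k <= m" for k
   using Slim[of k] that LIM_zero_cancel[of "%r. Ir (s r) (p k) y"] by (simp add: S_def)
  have "(%r. Jr (s r) y) \<longlonglongrightarrow> J y"
   unfolding Jr_def J_def by (intro tendsto_intros Ilim) auto
  have Dlim: "(%r. LBINT t:{0..T}. (Hr (s r) t y - H t y)^2) \<longlonglongrightarrow> 0"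
   using Slim[of "Suc m"] by (simp add: S_def)
  note path = progressive_path[OF prog elim(3)]
  have Hpath [measurable]: "(%t. indicator {0..T} t * H t y) \<in> BM borel"
  proof -
   have "(%t. indicator {0..T} t * H t y) = (%t. indicator {0..T} t * H (max 0 (min T t)) y)"
    by (auto simp: indicator_def fun_eq_iff)
   then show ?thesis using path by simp
  qed
  have Hr_meas [measurable]: "(%t. Hr r t y) \<in> BM borel" for r
   unfolding Hr_def simple_process_def by measurable
  have intD: "integrable lborel (%t. indicator {0..T} t * (Hr r t y - H t y)^2)" for r
  proof (rule Bochner_Integration.integrable_bound)
   let ?B = "\<Sum>j<mr r. \<bar>xir r j y\<bar>"
   have "integrable lborel (%t. 2 * (?B^2 * indicator {0..T} t) + 2 * (indicator {0..T} t * (H t y)^2))"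
    using elim(2) T_pos by (intro Bochner_Integration.integrable_add integrable_mult_right integrable_real_indicator)
     (auto simp: set_integrable_def)
   then show "integrable lborel (%t. 2 * (?B^2 * indicator {0..T} t) + 2 * (indicator {0..T} t * (H t y)^2))" .
   show "AE t in lborel. norm (indicator {0..T} t * (Hr r t y - H t y)^2)
    <= norm (2 * (?B^2 * indicator {0..T} t) + 2 * (indicator {0..T} t * (H t y)^2))"
   proof (intro AE_I2)
    fix t
    have "\<bar>Hr r t y\<bar> <= ?B"
     unfolding Hr_def simple_process_def
     by (rule order_trans[OF sum_abs]) (auto intro!: sum_mono simp: indicator_def)
    then have "(Hr r t y)^2 <= ?B^2" by (rule square_le_of_abs_le)
    moreover have "(Hr r t y - H t y)^2 <= 2 * (Hr r t y)^2 + 2 * (H t y)^2"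
     using zero_le_power2[of "Hr r t y + H t y"] by (simp add: power2_eq_square algebra_simps)
    ultimately have "(Hr r t y - H t y)^2 <= 2 * ?B^2 + 2 * (H t y)^2" by linarith
    then show "norm (indicator {0..T} t * (Hr r t y - H t y)^2)
    <= norm (2 * (?B^2 * indicator {0..T} t) + 2 * (indicator {0..T} t * (H t y)^2))"
     by (auto simp: indicator_def)
   qed
   have "(%t. indicator {0..T} t * (Hr r t y - indicator {0..T} t * H t y)^2) \<in> BM lborel" by measurable
   moreover have "(%t. indicator {0..T} t * (Hr r t y - indicator {0..T} t * H t y)^2) = (%t. indicator {0..T} t * (Hr r t y - H t y)^2)"
    by (auto simp: indicator_def fun_eq_iff)
   ultimately show "(%t. indicator {0..T} t * (Hr r t y - H t y)^2) \<in> BM lborel" by simp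
  qed
  define f where "f t = indicator {0..T} t * K y t" for t
  define fr where "fr r t = indicator {0..T} t * Kr r y t" for r t
  have f2: "(f t)^2 = indicator {0..T} t * (K y t)^2" "(fr r t)^2 = indicator {0..T} t * (Kr r y t)^2" for r t
   by (auto simp: f_def fr_def indicator_def)
  have fM [measurable]: "f \<in> BM borel"
  proof -
   have "f = (%t. indicator {0..T} t * (\<Sum>k<m. w k y * (indicator {0..T} t * H t y - g k y) * indicator {p k<..p (Suc k)} t))"
    by (auto simp: f_def K_def indicator_def fun_eq_iff)
   then show ?thesis
    by (elim ssubst) (intro borel_measurable_times borel_measurable_sum borel_measurable_diff Hpath; simp)
  qed
  have frM [measurable]: "fr r \<in> BM borel" for r
   unfolding fr_def[abs_def] Kr_def by measurable
  \<comment> \<open>The blocks are disjoint, so the sum equals its own square.\<close>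
  have ind_le_1: "(\<Sum>k<m. indicator {p k<..p (Suc k)} t) <= (1::real)" for t
  proof -
   have "(\<Sum>k<m. indicator {p k<..p (Suc k)} t)^2 = (\<Sum>k<m. indicator {p k<..p (Suc k)} t :: real)"
    using sum_disjoint_indicators_square[of m p "%_. 1" t] p(2) by simp
   then show ?thesis by (smt (verit) power2_eq_square mult_cancel_left1 mult_cancel_right1)
  qed
  have C0: "0 <= C^2" by simp
  have dle: "(fr r t - f t)^2 <= C^2 * (indicator {0..T} t * (Hr r t y - H t y)^2)" for r t
  proof (cases "t \<in> {0..T}")
   case True
   let ?d = "Hr r t y - H t y"
   have "fr r t - f t = (\<Sum>k<m. (w k y * ?d) * indicator {p k<..p (Suc k)} t)"
    using True by (simp add: fr_def f_def Kr_def K_def sum_subtractf[symmetric] algebra_simps)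
   then have "(fr r t - f t)^2 = (\<Sum>k<m. (w k y * ?d)^2 * indicator {p k<..p (Suc k)} t)"
    using sum_disjoint_indicators_square[of m p "%k. w k y * ?d" t] p(2) by simp
   also have "\<dots> <= (\<Sum>k<m. (C^2 * ?d^2) * indicator {p k<..p (Suc k)} t)"
    using wC elim(3) by (intro sum_mono mult_right_mono) (auto simp: power_mult_distrib square_le_of_abs_le intro!: mult_right_mono)
   also have "\<dots> = (C^2 * ?d^2) * (\<Sum>k<m. indicator {p k<..p (Suc k)} t)" by (simp only: sum_distrib_left)
   also have "\<dots> <= (C^2 * ?d^2) * 1" using ind_le_1 by (intro mult_left_mono) auto
   finally show ?thesis using True by simp
  qed (simp add: fr_def f_def)
  have intd: "integrable lborel (%t. (fr r t - f t)^2)" for r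
   by (rule Bochner_Integration.integrable_bound[OF integrable_mult_right[OF intD, of "C^2" r]])
    (use dle in \<open>auto intro!: AE_I2 order_trans[OF dle]\<close>)
  have intfr: "integrable lborel (%t. (fr r t)^2)" for r
   using approx[of r] by (simp add: f2 set_integrable_def)
  have intf: "integrable lborel (%t. (f t)^2)"
  proof (rule Bochner_Integration.integrable_bound)
   show "integrable lborel (%t. 2 * (fr 0 t)^2 + 2 * (fr 0 t - f t)^2)" using intfr intd by auto
   show "AE t in lborel. norm ((f t)^2) <= norm (2 * (fr 0 t)^2 + 2 * (fr 0 t - f t)^2)"
   proof (intro AE_I2)
    fix t
    have "(f t)^2 <= 2 * (fr 0 t)^2 + 2 * (fr 0 t - f t)^2"
     using zero_le_power2[of "f t - 2 * fr 0 t"] by (simp add: power2_eq_square algebra_simps)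
    then show "norm ((f t)^2) <= norm (2 * (fr 0 t)^2 + 2 * (fr 0 t - f t)^2)" by simp
   qed
  qed simp
  have dlim: "(%r. \<integral>t. (fr (s r) t - f t)^2 \<partial>lborel) \<longlonglongrightarrow> 0"
  proof (rule tendsto_sandwich[OF _ _ tendsto_const])
   show "\<forall>\<^sub>F r in sequentially. 0 <= (\<integral>t. (fr (s r) t - f t)^2 \<partial>lborel)" by simp
   show "\<forall>\<^sub>F r in sequentially. (\<integral>t. (fr (s r) t - f t)^2 \<partial>lborel) <= C^2 * (LBINT t:{0..T}. (Hr (s r) t y - H t y)^2)"
   proof (intro always_eventually allI)
    fix r
    have "(\<integral>t. (fr (s r) t - f t)^2 \<partial>lborel) <= (\<integral>t. C^2 * (indicator {0..T} t * (Hr (s r) t y - H t y)^2) \<partial>lborel)"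
     by (intro integral_mono intd integrable_mult_right intD dle)
    then show "(\<integral>t. (fr (s r) t - f t)^2 \<partial>lborel) <= C^2 * (LBINT t:{0..T}. (Hr (s r) t y - H t y)^2)"
     by (simp add: set_lebesgue_integral_def)
   qed
   show "(%r. C^2 * (LBINT t:{0..T}. (Hr (s r) t y - H t y)^2)) \<longlonglongrightarrow> 0"
    using tendsto_mult_left[OF Dlim, of "C^2"] by simp
  qed
  have "(%r. \<integral>t. (fr (s r) t)^2 \<partial>lborel) \<longlonglongrightarrow> (\<integral>t. (f t)^2 \<partial>lborel)"
   by (rule square_integral_tendsto) (use intf intd dlim in auto)
  then have "(%r. Qr (s r) y) \<longlonglongrightarrow> Q y"
   by (simp add: Qr_def Q_def f2 set_lebesgue_integral_def)
  moreover have "set_integrable lborel {0..T} (%t. (K y t)^2)"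
   using intf by (simp add: f2 set_integrable_def)
  ultimately show ?case using \<open>(%r. Jr (s r) y) \<longlonglongrightarrow> J y\<close> by blast
 qed
 then show "AE y in M. set_integrable lborel {0..T} (%t. (K y t)^2)" by auto
 have Q0: "0 <= Q y" "0 <= Qr r y" for r y
  unfolding Q_def Qr_def set_lebesgue_integral_def by (auto intro!: integral_nonneg_AE)
 have "nnI M (%y. ennreal ((J y)^2) * indicator {y. Q y < c} y) <= nnI M (%y. liminf (%r. ennreal ((Z (s r) y)^2)))"
 proof (rule nn_integral_mono_AE, use good in eventually_elim)
  case (elim y)
  show ?case
  proof (cases "Q y < c")
   case True
   \<comment> \<open>The strict inequality \<open>Q y < c\<close> passes to the approximating
     energies eventually, and there \<open>Z\<close> is the untruncated simple integral.\<close>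
   have ev: "\<forall>\<^sub>F r in sequentially. Jr (s r) y = Z (s r) y"
    using order_tendstoD(2)[OF conjunct1[OF elim] True] by eventually_elim (simp add: Z(3))
   have "(%r. Z (s r) y) \<longlonglongrightarrow> J y"
    using elim by (intro Lim_transform_eventually[OF _ ev]) auto
   then have "(%r. ennreal ((Z (s r) y)^2)) \<longlonglongrightarrow> ennreal ((J y)^2)"
    by (intro tendsto_ennrealI tendsto_power)
   then have "liminf (%r. ennreal ((Z (s r) y)^2)) = ennreal ((J y)^2)"
    by (intro lim_imp_Liminf) auto
   then show ?thesis using True by simp
  qed simp
 qed
 also have "\<dots> <= liminf (%r. (nnE M (%y. (Z (s r) y)^2)))"
  by (rule nn_integral_liminf) measurable
 also have "\<dots> <= liminf (%r. (nnE M (%y. min c (Qr (s r) y))))"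
  by (intro Liminf_mono always_eventually allI Z(2))
 also have "\<dots> = nnE M (%y. min c (Q y))"
 proof (intro lim_imp_Liminf)
  show "(%r. (nnE M (%y. min c (Qr (s r) y)))) \<longlonglongrightarrow> (nnE M (%y. min c (Q y)))"
  proof (rule nn_integral_dominated_convergence[where w="%_. ennreal c"])
   show "AE x in M. (%i. ennreal (min c (Qr (s i) x))) \<longlonglongrightarrow> ennreal (min c (Q x))"
    using good by eventually_elim (intro tendsto_ennrealI tendsto_min tendsto_const, blast)
  qed (auto simp: ennreal_leI emeasure_space_1 c ennreal_mult_less_top)
 qed simp
 finally show "nnI M (%y. ennreal ((J y)^2) * indicator {y. Q y < c} y) <= nnE M (%y. min c (Q y))" .
qed

end

text \<open>Gronwall's inequality for a bounded function that need not be continuous. If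
  \<open>e * exp (2 * d * t)\<close> dominates \<open>g\<close>, then inserting this bound improves
  \<open>e\<close> to \<open>a + e / 2\<close>, the exponent \<open>2 * d\<close> being responsible
  for the half. Hence the infimum \<open>m\<close> of all such constants satisfies
  \<open>m <= a + m / 2\<close>. The bound \<open>c\<close> ensures that there is such a constant at
  all.\<close>

lemma nn_gronwall:
 fixes g :: "real => ennreal"
 assumes [measurable]: "g \<in> BM borel"
  and bounded: "!!t. 0 <= t ==> t <= T ==> g t <= ennreal c"
  and g: "!!t. 0 <= t ==> t <= T ==> g t <= ennreal a + ennreal d * (nnI lborel (%s. g s * indicator {0..t} s))"
  and pos: "0 <= a" "0 < d" "0 <= c" and t: "0 <= t" "t <= T"
 shows "g t <= ennreal (2 * a * exp (2 * d * T))"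
proof -
 define S where "S = {e \<in> {0..c}. \<forall>t\<in>{0..T}. g t <= ennreal (e * exp (2 * d * t))}"
 have "c \<in> S"
 proof -
  have "ennreal c <= ennreal (c * exp (2 * d * t))" if "0 <= t" for t
   using that pos by (intro ennreal_leI) (simp add: mult_le_cancel_left1)
  then have "g t <= ennreal (c * exp (2 * d * t))" if "0 <= t" "t <= T" for t
   using bounded[OF that] that order_trans by blast
  then show ?thesis using pos by (auto simp: S_def)
 qed
 define m where "m = Inf S"
 have m0: "0 <= m" unfolding m_def using \<open>c \<in> S\<close> by (intro cInf_greatest) (auto simp: S_def)
 have step: "min c (a + e / 2) \<in> S" if "e \<in> S" for e
 proof -
  have e: "0 <= e" "!!t. 0 <= t ==> t <= T ==> g t <= ennreal (e * exp (2 * d * t))" using that by (auto simp: S_def)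
  have "g t <= ennreal ((a + e / 2) * exp (2 * d * t))" if t: "0 <= t" "t <= T" for t
  proof -
   have "nnI lborel (%s. g s * indicator {0..t} s) <= nnI lborel (%s. ennreal (e * exp (2 * d * s)) * indicator {0..t} s)"
    using e t by (intro nn_integral_mono) (auto simp: indicator_def)
   also have "\<dots> = ennreal (e * exp (2 * d * t) / (2 * d) - e * exp (2 * d * 0) / (2 * d))"
    using t e pos by (intro nn_integral_FTC_Icc[where F="%s. e * exp (2 * d * s) / (2 * d)"])
     (auto intro!: derivative_eq_intros simp: field_simps)
   also have "\<dots> <= ennreal (e * exp (2 * d * t) / (2 * d))"
    using e pos by (intro ennreal_leI) simp
   finally have "ennreal d * (nnI lborel (%s. g s * indicator {0..t} s)) <= ennreal d * ennreal (e * exp (2 * d * t) / (2 * d))"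
    by (intro mult_left_mono) auto
   also have "\<dots> = ennreal (e / 2 * exp (2 * d * t))" using pos e by (subst ennreal_mult[symmetric]) auto
   finally have "g t <= ennreal a + ennreal (e / 2 * exp (2 * d * t))"
    using g[OF t] by (meson add_left_mono order_trans)
   also have "\<dots> = ennreal (a + e / 2 * exp (2 * d * t))" using pos e by (subst ennreal_plus) auto
   also have "\<dots> <= ennreal ((a + e / 2) * exp (2 * d * t))"
   proof (intro ennreal_leI)
    have "a * 1 <= a * exp (2 * d * t)" using pos t by (intro mult_left_mono) auto
    then show "a + e / 2 * exp (2 * d * t) <= (a + e / 2) * exp (2 * d * t)" by (simp add: algebra_simps)
   qed
   finally show ?thesis .
  qed
  moreover have "g t <= ennreal (c * exp (2 * d * t))" if "0 <= t" "t <= T" for t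
   using \<open>c \<in> S\<close> that by (auto simp: S_def)
  ultimately show ?thesis using pos e by (auto simp: S_def min_def)
 qed
 have bdd: "bdd_below S" by (auto simp: S_def bdd_below_def)
 have "m <= a + e / 2" if "e \<in> S" for e
  using cInf_lower[OF step[OF that] bdd] by (simp add: m_def)
 then have "2 * (m - a) <= m" unfolding m_def[of] using \<open>c \<in> S\<close>
  by (intro cInf_greatest) (auto simp: m_def field_simps)
 then have m2: "m <= 2 * a" by simp
 have "g t <= ennreal (m * exp (2 * d * t))"
 proof (rule ennreal_le_epsilon)
  fix e :: real assume "0 < e"
  define e' where "e' = e / exp (2 * d * t)"
  have "0 < e'" using \<open>0 < e\<close> by (simp add: e'_def)
  then obtain x where x: "x \<in> S" "x < m + e'"
   using cInf_lessD[of S "m + e'"] \<open>c \<in> S\<close> by (auto simp: m_def)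
  have "g t <= ennreal (x * exp (2 * d * t))" using x t by (auto simp: S_def)
  also have "\<dots> <= ennreal ((m + e') * exp (2 * d * t))" using x by (intro ennreal_leI mult_right_mono) auto
  also have "(m + e') * exp (2 * d * t) = m * exp (2 * d * t) + e" by (simp add: e'_def algebra_simps)
  also have "ennreal (m * exp (2 * d * t) + e) = ennreal (m * exp (2 * d * t)) + ennreal e"
   using m0 \<open>0 < e\<close> by (subst ennreal_plus) auto
  finally show "g t <= ennreal (m * exp (2 * d * t)) + ennreal e" .
 qed
 also have "\<dots> <= ennreal (2 * a * exp (2 * d * T))"
  using m2 m0 t pos by (intro ennreal_leI mult_mono) auto
 finally show ?thesis .
qed

text \<open>In fact equality holds: the energy stops growing exactly when it reaches \<open>c\<close>.\<close>

lemma truncated_energy_le: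
 fixes h :: "real => real"
 assumes h: "set_integrable lborel {0..T} h" "!!s. 0 <= h s" and t: "0 <= t" "t <= T" and "0 <= c"
 shows "min (ennreal c) (nnI lborel (%u. ennreal (h u) * indicator {0..t} u))
  <= nnI lborel (%s. ennreal (h s) * indicator {s. (nnI lborel (%u. ennreal (h u) * indicator {0..s} u)) < ennreal c} s * indicator {0..t} s)"
proof -
 define V where "V s = (LBINT u:{0..s}. h u)" for s
 have hs: "set_integrable lborel {0..s} h" if "s <= T" for s
  by (rule set_integrable_subset[OF h(1)]) (use that in auto)
 have V_eq: "nnI lborel (%u. ennreal (h u) * indicator {0..s} u) = ennreal (V s)" if "s <= T" for s
 proof -
  have "nnI lborel (%u. ennreal (h u) * indicator {0..s} u) = nnE lborel (%u. indicator {0..s} u *\<^sub>R h u)"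
   by (intro nn_integral_cong) (auto simp: indicator_def)
  also have "\<dots> = ennreal (V s)"
   unfolding V_def set_lebesgue_integral_def using hs[OF that] h(2)
   by (intro nn_integral_eq_integral) (auto simp: set_integrable_def)
  finally show ?thesis .
 qed
 have V0: "0 <= V s" for s unfolding V_def set_lebesgue_integral_def using h(2) by (intro integral_nonneg_AE) auto
 have Vmono: "V s <= V s'" if "s <= s'" "s' <= T" for s s'
 proof -
  have "ennreal (V s) <= ennreal (V s')"
   using that by (subst (1 2) V_eq[symmetric]) (auto intro!: nn_integral_mono simp: indicator_def)
  then show ?thesis using V0 by simp
 qed
 show ?thesis
 proof (cases "V t < c")
  case True
  have "nnI lborel (%u. ennreal (h u) * indicator {0..t} u) = 
   (nnI lborel (%s. ennreal (h s) * indicator {s. (nnI lborel (%u. ennreal (h u) * indicator {0..s} u)) < ennreal c} s * indicator {0..t} s))"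
  proof (intro nn_integral_cong)
   fix s
   have "V s < c" if "0 <= s" "s <= t" using Vmono[of s t] that t True by auto
   then have "nnI lborel (%u. ennreal (h u) * indicator {0..s} u) < ennreal c" if "0 <= s" "s <= t"
    using that t V0 by (subst V_eq) (auto intro!: ennreal_lessI le_less_trans[OF V0])
   then show "ennreal (h s) * indicator {0..t} s = ennreal (h s) * indicator {s. (nnI lborel (%u. ennreal (h u) * indicator {0..s} u)) < ennreal c} s * indicator {0..t} s"
    by (auto simp: indicator_def)
  qed
  then show ?thesis by (simp add: min.coboundedI2)
 next
  case False
  have cont: "continuous_on {0..t} V"
  proof -
   have "V s = integral {0..s} h" if "s \<in> {0..t}" for s
    unfolding V_def using hs[of s] that t by (intro set_borel_integral_eq_integral) auto
   moreover have "continuous_on {0..t} (%s. integral {0..s} h)"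
    using set_borel_integral_eq_integral(1)[OF hs[OF t(2)]] by (rule indefinite_integral_continuous_1)
   ultimately show ?thesis by (metis (no_types, lifting) continuous_on_eq)
  qed
  have "V 0 = 0" unfolding V_def set_lebesgue_integral_def
  proof (rule integral_eq_zero_AE)
   show "AE u in lborel. indicator {0..0} u *\<^sub>R h u = 0"
    using AE_lborel_singleton[of "0::real"] by eventually_elim auto
  qed
  then obtain s1 where s1: "0 <= s1" "s1 <= t" "V s1 = c"
   using IVT'[of V 0 c t] cont t False \<open>0 <= c\<close> by auto
  \<comment> \<open>The energy is continuous in its upper limit, so the level \<open>c\<close> is
    attained; compactness of the level set provides the first time \<open>s0\<close> at which this
    happens.\<close>
  let ?C = "{s \<in> {0..t}. V s = c}"
  have "compact ?C"
  proof -
   have "closed ?C" using continuous_closed_preimage_constant[OF cont closed_atLeastAtMost, of c] by (simp add: Collect_conj_eq)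
   then have "compact ({0..t} \<inter> ?C)" by (intro compact_Int_closed) auto
   moreover have "{0..t} \<inter> ?C = ?C" by auto
   ultimately show ?thesis by simp
  qed
  moreover have "?C \<noteq> {}" using s1 by auto
  ultimately have "\<exists>s\<in>?C. \<forall>s'\<in>?C. s <= s'" by (rule compact_attains_inf)
  then obtain s0 where s0: "s0 \<in> ?C" "!!s. s \<in> ?C ==> s0 <= s" by fast
  have less: "V s < c" if "0 <= s" "s < s0" for s
  proof -
   have "V s <= c" "s \<notin> ?C" using s0(1) s0(2)[of s] that Vmono[of s s0] t by auto
   then show ?thesis using that s0(1) by auto
  qed
  have "min (ennreal c) (nnI lborel (%u. ennreal (h u) * indicator {0..t} u)) <= ennreal (V s0)"
   using s0 by (auto intro: min.coboundedI1)
  also have "ennreal (V s0) = nnI lborel (%u. ennreal (h u) * indicator {0..s0} u)"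
   using s0 t by (intro V_eq[symmetric]) auto
  \<comment> \<open>At \<open>s0\<close> itself the energy equals \<open>c\<close> and is no longer
    below it, so the end point has to be dropped.\<close>
  also have "\<dots> = nnI lborel (%u. ennreal (h u) * indicator {0..<s0} u)"
   by (rule nn_integral_cong_AE, use AE_lborel_singleton[of s0] in eventually_elim) (auto simp: indicator_def)
  also have "\<dots> <= nnI lborel (%s. ennreal (h s) * indicator {s. (nnI lborel (%u. ennreal (h u) * indicator {0..s} u)) < ennreal c} s * indicator {0..t} s)"
  proof (intro nn_integral_mono)
   fix s
   have "nnI lborel (%u. ennreal (h u) * indicator {0..s} u) < ennreal c" if "0 <= s" "s < s0"
    using that less[OF that] s0 t V0 by (subst V_eq) (auto intro!: ennreal_lessI le_less_trans[OF V0])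
   then show "ennreal (h s) * indicator {0..<s0} s <= ennreal (h s) * indicator {s. (nnI lborel (%u. ennreal (h u) * indicator {0..s} u)) < ennreal c} s * indicator {0..t} s"
    using s0(1) by (auto simp: indicator_def)
  qed
  finally show ?thesis .
 qed
qed

context filtered_bm begin

text \<open>The expected energy is finite by Fubini's theorem, so the localized bounds hold
  uniformly in the truncation level, and the level can be sent to infinity with Fatou's
  lemma.\<close>

lemma ito_bound:
 assumes I: "ito_integral M F T W H I"
  and p: "!!k. k <= m ==> 0 <= p k \<and> p k <= T" "!!k. k < m ==> p k <= p (Suc k)"
  and w: "!!k. k < m ==> w k \<in> BM (F (p k))"
  and wC: "!!k y. k < m ==> y \<in> space M ==> \<bar>w k y\<bar> <= C"
  and g: "!!k. k < m ==> g k \<in> BM (F (p k))"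
  and B: "!!k t. k < m ==> p k < t ==> t <= p (Suc k) ==> (nnE M (%y. (w k y * (H t y - g k y))^2)) <= ennreal (B k)"
  and B0: "!!k. k < m ==> 0 <= B k"
 defines "J \<equiv> %y. \<Sum>k<m. w k y * (I (p (Suc k)) y - I (p k) y - g k y * (W (p (Suc k)) y - W (p k) y))"
 shows "J \<in> BM M"
  and "nnE M (%y. (J y)^2) <= ennreal (\<Sum>k<m. B k * (p (Suc k) - p k))"
proof -
 have prog: "progressive F T H" using I by (auto simp: ito_integral_def)
 define K where "K y t = (\<Sum>k<m. w k y * (H t y - g k y) * indicator {p k<..p (Suc k)} t)" for y t
 define Q where "Q y = (LBINT t:{0..T}. (K y t)^2)" for y
 note loc = ito_localized_bound[where m=m and p=p and w=w and g=g and C=C, OF I p w wC g, folded J_def K_def Q_def]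
 show JM [measurable]: "J \<in> BM M" using loc(1)[of 0] by simp
 have QM [measurable]: "Q \<in> BM M" using loc(2)[of 0] by (simp add: Q_def[abs_def])
 have Kint: "AE y in M. set_integrable lborel {0..T} (%t. (K y t)^2)" using loc(4)[of 0] by simp
 have Ksq: "(K y t)^2 = (\<Sum>k<m. (w k y * (H t y - g k y))^2 * indicator {p k<..p (Suc k)} t)" for y t
  unfolding K_def by (rule sum_disjoint_indicators_square) (rule p(2))
 have wM [measurable]: "k < m ==> w k \<in> BM M" for k using F_imp_M[OF w] .
 have gM [measurable]: "k < m ==> g k \<in> BM M" for k using F_imp_M[OF g] .
 note joint = progressive_joint[OF prog]
 let ?cl = "%t. max 0 (min T t)"
 have Kcl: "(w k y * (H t y - g k y))^2 * indicator {p k<..p (Suc k)} t = (w k y * (H (?cl t) y - g k y))^2 * indicator {p k<..p (Suc k)} t"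
  if "k < m" for k y t
  using p(1)[of k] p(1)[of "Suc k"] that by (auto simp: indicator_def)
 have jm: "(%x. ennreal ((w k (fst x) * (H (?cl (snd x)) (fst x) - g k (fst x)))^2 * indicator {p k<..p (Suc k)} (snd x))) \<in> BM (M \<Otimes>\<^sub>M lborel)" if "k < m" for k
  using wM[OF that] gM[OF that] joint by (simp add: case_prod_beta) measurable
 have meas1: "(%t. ennreal ((w k y * (H (?cl t) y - g k y))^2 * indicator {p k<..p (Suc k)} t)) \<in> BM lborel" if "k < m" "y \<in> space M" for k y
  using measurable_Pair2[OF jm[OF that(1)] that(2)] by simp
 have EQ: "nnE M (%y. Q y) <= ennreal (\<Sum>k<m. B k * (p (Suc k) - p k))"
 proof -
  have "nnE M (%y. Q y) <= nnI M (%y. (\<Sum>k<m. (nnE lborel (%t. (w k y * (H (?cl t) y - g k y))^2 * indicator {p k<..p (Suc k)} t))))"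
  proof (rule nn_integral_mono_AE, use Kint AE_space in eventually_elim)
   case (elim y)
   have "ennreal (Q y) = nnE lborel (%t. indicator {0..T} t *\<^sub>R (K y t)^2)"
    unfolding Q_def set_lebesgue_integral_def using elim
    by (intro nn_integral_eq_integral[symmetric]) (auto simp: set_integrable_def)
   also have "\<dots> <= nnI lborel (%t. (\<Sum>k<m. ennreal ((w k y * (H (?cl t) y - g k y))^2 * indicator {p k<..p (Suc k)} t)))"
   proof (intro nn_integral_mono)
    fix t
    have "indicator {0..T} t *\<^sub>R (K y t)^2 <= (K y t)^2" by (auto simp: indicator_def)
    also have "\<dots> = (\<Sum>k<m. (w k y * (H (?cl t) y - g k y))^2 * indicator {p k<..p (Suc k)} t)"
     unfolding Ksq by (intro sum.cong refl Kcl) auto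
    finally show "ennreal (indicator {0..T} t *\<^sub>R (K y t)^2) <= (\<Sum>k<m. ennreal ((w k y * (H (?cl t) y - g k y))^2 * indicator {p k<..p (Suc k)} t))"
     by (subst sum_ennreal) (auto intro: ennreal_leI)
   qed
   also have "\<dots> = (\<Sum>k<m. (nnE lborel (%t. (w k y * (H (?cl t) y - g k y))^2 * indicator {p k<..p (Suc k)} t)))"
    using meas1 elim by (intro nn_integral_sum) auto
   finally show ?case .
  qed
  also have "\<dots> = (\<Sum>k<m. (nnI M (%y. (nnE lborel (%t. (w k y * (H (?cl t) y - g k y))^2 * indicator {p k<..p (Suc k)} t)))))"
  proof (rule nn_integral_sum)
   fix k assume "k \<in> {..<m}"
   then show "(%y. (nnE lborel (%t. (w k y * (H (?cl t) y - g k y))^2 * indicator {p k<..p (Suc k)} t))) \<in> BM M"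
    using lborel.borel_measurable_nn_integral_fst[OF jm[of k]] by simp
  qed
  also have "\<dots> <= (\<Sum>k<m. ennreal (B k * (p (Suc k) - p k)))"
  proof (intro sum_mono)
   fix k assume "k \<in> {..<m}"
   then have k: "k < m" by simp
   interpret P: pair_sigma_finite M lborel ..
   have "(nnI M (%y. (nnE lborel (%t. (w k y * (H (?cl t) y - g k y))^2 * indicator {p k<..p (Suc k)} t))))
    = nnI lborel (%t. (nnE M (%y. (w k y * (H (?cl t) y - g k y))^2 * indicator {p k<..p (Suc k)} t)))"
    using P.Fubini'[of "%y t. ennreal ((w k y * (H (?cl t) y - g k y))^2 * indicator {p k<..p (Suc k)} t)"] jm[OF k]
    by (simp add: case_prod_beta)
   also have "\<dots> <= nnI lborel (%t. ennreal (B k) * indicator {p k<..p (Suc k)} t)"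
   proof (intro nn_integral_mono)
    fix t
    show "nnE M (%y. (w k y * (H (?cl t) y - g k y))^2 * indicator {p k<..p (Suc k)} t) <= ennreal (B k) * indicator {p k<..p (Suc k)} t"
     using B[OF k, of t] p(1)[of k] p(1)[of "Suc k"] k by (cases "t \<in> {p k<..p (Suc k)}") auto
   qed
   also have "\<dots> = ennreal (B k * (p (Suc k) - p k))"
    using p(2)[OF k] B0[OF k] by (simp add: nn_integral_cmult_indicator ennreal_mult)
   finally show "nnI M (%y. (nnE lborel (%t. (w k y * (H (?cl t) y - g k y))^2 * indicator {p k<..p (Suc k)} t))) <= ennreal (B k * (p (Suc k) - p k))" .
  qed
  also have "\<dots> = ennreal (\<Sum>k<m. B k * (p (Suc k) - p k))"
   using p(2) B0 by (intro sum_ennreal) auto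
  finally show ?thesis .
 qed
 have "nnE M (%y. (J y)^2) = nnI M (%y. liminf (%n. ennreal ((J y)^2) * indicator {y. Q y < real n} y))"
 proof (intro nn_integral_cong)
  fix y
  obtain n0 where n0: "Q y < real n0" using reals_Archimedean2 by blast
  have "\<forall>\<^sub>F n in sequentially. ennreal ((J y)^2) = ennreal ((J y)^2) * indicator {y. Q y < real n} y"
   by (rule eventually_mono[OF eventually_ge_at_top[of n0]]) (use n0 in auto)
  then have "(%n. ennreal ((J y)^2) * indicator {y. Q y < real n} y) \<longlonglongrightarrow> ennreal ((J y)^2)"
   by (rule Lim_transform_eventually[OF tendsto_const])
  then show "ennreal ((J y)^2) = liminf (%n. ennreal ((J y)^2) * indicator {y. Q y < real n} y)"
   by (intro lim_imp_Liminf[symmetric]) auto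
 qed
 also have "\<dots> <= liminf (%n. (nnI M (%y. ennreal ((J y)^2) * indicator {y. Q y < real n} y)))"
  by (rule nn_integral_liminf) measurable
 also have "\<dots> <= liminf (%n::nat. ennreal (\<Sum>k<m. B k * (p (Suc k) - p k)))"
 proof (intro Liminf_mono always_eventually allI)
  fix n :: nat
  have "nnI M (%y. ennreal ((J y)^2) * indicator {y. Q y < real n} y) <= nnE M (%y. min (real n) (Q y))"
   using loc(3)[of "real n"] by (simp add: Q_def J_def)
  also have "\<dots> <= nnE M (%y. Q y)" by (intro nn_integral_mono ennreal_leI) auto
  also note EQ
  finally show "nnI M (%y. ennreal ((J y)^2) * indicator {y. Q y < real n} y) <= ennreal (\<Sum>k<m. B k * (p (Suc k) - p k))" .
 qed
 also have "\<dots> = ennreal (\<Sum>k<m. B k * (p (Suc k) - p k))" by (simp add: Liminf_const)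
 finally show "nnE M (%y. (J y)^2) <= ennreal (\<Sum>k<m. B k * (p (Suc k) - p k))" .
qed

end

section \<open>Moments and increments of one solution\<close>

locale sde_particle = filtered_bm M F T W
 for M :: "'a measure" and F :: "real => 'a measure" and T :: real and W :: "real => 'a => real" +
 fixes bt sg :: "real => real" and X I :: "real => 'a => real" and B c ka :: real
 assumes bt_bound: "!!x. \<bar>bt x\<bar> <= B" and bt_lip: "!!x y. \<bar>bt x - bt y\<bar> <= c * \<bar>x - y\<bar>"
  and sg_lip: "!!x y. \<bar>sg x - sg y\<bar> <= c * \<bar>x - y\<bar>"
  and progX: "progressive F T X"
  and ito: "ito_integral M F T W (%s w. sg (X s w)) I"
  and X_eq: "AE w in M. \<forall>t\<in>{0..T}. X t w = X 0 w + (LBINT s:{0..t}. bt (X s w)) + I t w"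
  and X0_bound: "nnE M (%w. (X 0 w)^2) <= ennreal ka"
  and pos: "0 <= B" "0 <= c" "0 <= ka"
begin

definition "growth = 2 * c^2 + 2 * (sg 0)^2"
text \<open>The outcome of \<open>nn_gronwall\<close> in \<open>I_second_moment\<close>: the leading
  2 and the doubled exponent come from there, and the 1 in \<open>3 * growth + 1\<close> keeps its
  rate positive.\<close>

definition "energy_bound = 2 * (growth * (1 + 3 * ka + 3 * (B^2 * T^2)) * T) * exp (2 * (3 * growth + 1) * T)"
definition "sigma_bound = growth * (1 + 3 * ka + 3 * (B^2 * T^2) + 3 * energy_bound)"
definition "incr_bound = 2 * (B^2 * T) + 2 * sigma_bound"

lemma growth_nonneg: "0 <= growth" by (simp add: growth_def)

lemma energy_bound_nonneg: "0 <= energy_bound"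
 unfolding energy_bound_def using growth_nonneg T_pos pos by (intro mult_nonneg_nonneg add_nonneg_nonneg) auto

lemma sigma_bound_nonneg: "0 <= sigma_bound"
 unfolding sigma_bound_def using growth_nonneg T_pos pos energy_bound_nonneg by (intro mult_nonneg_nonneg add_nonneg_nonneg) auto

lemma incr_bound_nonneg: "0 <= incr_bound"
 unfolding incr_bound_def using T_pos pos sigma_bound_nonneg by (intro mult_nonneg_nonneg add_nonneg_nonneg) auto

lemma X_F: "0 <= t ==> t <= T ==> X t \<in> BM (F t)"
 by (rule progressive_adapted[OF progX])

lemma X_M: "0 <= t ==> t <= T ==> X t \<in> BM M"
 using X_F F_imp_M by blast

lemma I_M: "0 <= t ==> t <= T ==> I t \<in> BM M"
 by (rule ito_integral_M[OF ito])

lemma bt_cont: "continuous_on UNIV bt" and sg_cont: "continuous_on UNIV sg"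
proof -
 have lip: "continuous_on UNIV f" if "!!x y. \<bar>f x - f y\<bar> <= c * \<bar>x - y\<bar>" for f :: "real => real"
  by (rule lipschitz_on_continuous_on[of c]) (use that pos in \<open>auto simp: lipschitz_on_def dist_real_def\<close>)
 show "continuous_on UNIV bt" "continuous_on UNIV sg" using lip bt_lip sg_lip by auto
qed

lemma bt_meas [measurable]: "bt \<in> BM borel" and sg_meas [measurable]: "sg \<in> BM borel"
 using bt_cont sg_cont by (auto intro: borel_measurable_continuous_onI)

lemma sg_growth: "(sg x)^2 <= growth * (1 + x^2)"
proof -
 have "\<bar>sg x\<bar> <= c * \<bar>x\<bar> + \<bar>sg 0\<bar>" using sg_lip[of x 0] by simp
 then have "(sg x)^2 <= (c * \<bar>x\<bar> + \<bar>sg 0\<bar>)^2" by (rule square_le_of_abs_le)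
 also have "\<dots> <= 2 * (c * \<bar>x\<bar>)^2 + 2 * \<bar>sg 0\<bar>^2"
  using zero_le_power2[of "c * \<bar>x\<bar> - \<bar>sg 0\<bar>"] by (simp add: power2_eq_square algebra_simps)
 also have "\<dots> = 2 * c^2 * x^2 + 2 * (sg 0)^2" by (simp add: power_mult_distrib)
 also have "\<dots> <= growth * (1 + x^2)" by (simp add: growth_def algebra_simps)
 finally show ?thesis .
qed

definition "drift t w = (LBINT s:{0..t}. bt (X s w))"

lemma btX_integrable:
 assumes "w \<in> space M" "0 <= s" "t <= T"
 shows "set_integrable lborel {s..t} (%u. bt (X u w))"
proof -
 have "integrable lborel (%u. indicator {s..t} u *\<^sub>R bt (X (max 0 (min T u)) w))"
 proof (rule Bochner_Integration.integrable_bound)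
  show "integrable lborel (%u. B * indicator {s..t} u)"
   by (cases "s <= t") (auto intro!: integrable_mult_right integrable_real_indicator)
  show "AE u in lborel. norm (indicator {s..t} u *\<^sub>R bt (X (max 0 (min T u)) w)) <= norm (B * indicator {s..t} u)"
   using bt_bound pos by (intro AE_I2) (auto simp: indicator_def)
  note [measurable] = progressive_path[OF progX assms(1)]
  show "(%u. indicator {s..t} u *\<^sub>R bt (X (max 0 (min T u)) w)) \<in> BM lborel" by measurable
 qed
 moreover have "(%u. indicator {s..t} u *\<^sub>R bt (X (max 0 (min T u)) w)) = (%u. indicator {s..t} u *\<^sub>R bt (X u w))"
  using assms by (auto simp: indicator_def fun_eq_iff)
 ultimately show ?thesis by (simp add: set_integrable_def)
qed

lemma drift_diff:
 assumes "w \<in> space M" "0 <= s" "s <= t" "t <= T"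
 shows "drift t w - drift s w = (LBINT u:{s..t}. bt (X u w))"
proof -
 have "drift t w = (LBINT u:{0..s} \<union> {s<..t}. bt (X u w))"
  unfolding drift_def using assms by (intro arg_cong[where f="%A. set_lebesgue_integral lborel A (%u. bt (X u w))"]) auto
 also have "\<dots> = drift s w + (LBINT u:{s<..t}. bt (X u w))"
  unfolding drift_def using btX_integrable[OF assms(1), of 0 t] assms
  by (intro set_integral_Un) (auto intro: set_integrable_subset)
 also have "(LBINT u:{s<..t}. bt (X u w)) = (LBINT u:{s..t}. bt (X u w))"
  unfolding set_lebesgue_integral_def
 proof (rule integral_cong_AE)
  show "AE u in lborel. indicator {s<..t} u *\<^sub>R bt (X u w) = indicator {s..t} u *\<^sub>R bt (X u w)"
   using AE_lborel_singleton[of s] by eventually_elim (auto simp: indicator_def)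
  have "set_integrable lborel {s<..t} (%u. bt (X u w))"
   using btX_integrable[OF assms(1,2,4)] by (rule set_integrable_subset) auto
  then show "(%u. indicator {s<..t} u *\<^sub>R bt (X u w)) \<in> BM lborel" by (simp add: set_integrable_def)
  show "(%u. indicator {s..t} u *\<^sub>R bt (X u w)) \<in> BM lborel"
   using btX_integrable[OF assms(1,2,4)] by (simp add: set_integrable_def)
 qed
 finally show ?thesis by simp
qed

lemma drift_diff_bound:
 assumes "w \<in> space M" "0 <= s" "s <= t" "t <= T"
 shows "\<bar>drift t w - drift s w\<bar> <= B * (t - s)"
proof -
 have int: "integrable lborel (%u. indicator {s..t} u *\<^sub>R bt (X u w))"
  using btX_integrable[OF assms(1,2,4)] by (simp add: set_integrable_def)
 have "\<bar>drift t w - drift s w\<bar> <= (\<integral>u. \<bar>indicator {s..t} u *\<^sub>R bt (X u w)\<bar> \<partial>lborel)"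
  unfolding drift_diff[OF assms] set_lebesgue_integral_def by (rule integral_abs_bound)
 also have "\<dots> <= (\<integral>u. B * indicator {s..t} u \<partial>lborel)"
  using int assms bt_bound pos
  by (intro integral_mono integrable_abs integrable_mult_right integrable_real_indicator) (auto simp: indicator_def)
 also have "\<dots> = B * (t - s)" using assms by simp
 finally show ?thesis .
qed

lemma X_eq_drift: "AE w in M. \<forall>t\<in>{0..T}. X t w = X 0 w + drift t w + I t w"
 using X_eq by (simp add: drift_def)

lemma drift_0: "drift 0 w = 0"
 unfolding drift_def set_lebesgue_integral_def
proof (rule integral_eq_zero_AE)
 show "AE u in lborel. indicator {0..0} u *\<^sub>R bt (X u w) = 0"
  using AE_lborel_singleton[of "0::real"] by eventually_elim auto
qed

lemma I_0: "AE w in M. I 0 w = 0"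
 using X_eq_drift
proof eventually_elim
 case (elim w)
 have "0 \<in> {0..T}" using T_pos by simp
 from bspec[OF elim this] show ?case using drift_0[of w] by linarith
qed

lemma two_squares: "(x + y)^2 <= 2 * x^2 + 2 * y^2" for x y :: real
 using zero_le_power2[of "x - y"] by (simp add: power2_eq_square algebra_simps)

lemma three_squares: "(x + y + z)^2 <= 3 * x^2 + 3 * y^2 + 3 * z^2" for x y z :: real
proof -
 have "0 <= (x - y)^2 + (y - z)^2 + (x - z)^2" by simp
 then show ?thesis by (simp add: power2_eq_square algebra_simps)
qed

lemma X_square_le: 
 assumes "0 <= t" "t <= T"
 shows "AE w in M. (X t w)^2 <= 3 * (X 0 w)^2 + 3 * (B^2 * T^2) + 3 * (I t w)^2"
 using X_eq_drift AE_space
proof eventually_elim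
 case (elim w)
 have "\<bar>drift t w\<bar> <= B * t" using drift_diff_bound[of w 0 t] elim(2) assms by (simp add: drift_0)
 also have "\<dots> <= B * T" using assms pos by (intro mult_left_mono) auto
 finally have "(drift t w)^2 <= (B * T)^2" by (rule square_le_of_abs_le)
 moreover have "X t w = X 0 w + drift t w + I t w" using bspec[OF elim(1), of t] assms by simp
 ultimately show ?case using three_squares[of "X 0 w" "drift t w" "I t w"] by (simp add: power_mult_distrib)
qed

lemma sigma_joint: "(%(w, s). ennreal ((sg (X (max 0 (min T s)) w))^2)) \<in> BM (M \<Otimes>\<^sub>M lborel)"
 using progressive_joint[OF progX] by (simp add: case_prod_beta) 

lemma sigma_square_le:
 assumes t: "0 <= t" "t <= T"
 shows "AE w in M. (sg (X t w))^2 <= growth * (1 + 3 * (B^2 * T^2)) + 3 * growth * (X 0 w)^2 + 3 * growth * (I t w)^2"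
 using X_square_le[OF t]
proof eventually_elim
 case (elim w)
 have "(sg (X t w))^2 <= growth * (1 + (X t w)^2)" by (rule sg_growth)
 also have "\<dots> <= growth * (1 + (3 * (X 0 w)^2 + 3 * (B^2 * T^2) + 3 * (I t w)^2))"
  using elim growth_nonneg by (intro mult_left_mono) auto
 finally show ?case by (simp add: algebra_simps)
qed

text \<open>Since \<open>min c' V\<^sub>t\<close> is the energy collected before \<open>V\<close> reaches \<open>c'\<close>, Gronwall's inequality
 can be applied to its expectation, which is finite a priori; no stopping times are needed.\<close>

lemma I_second_moment:
 assumes t: "0 <= t" "t <= T"
 shows "nnE M (%y. (I t y)^2) <= ennreal energy_bound"
proof -
 let ?cl = "%s. max 0 (min T s)"
 define V where "V y s = nnI lborel (%u. ennreal ((sg (X u y))^2) * indicator {0..s} u)" for y s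
 \<comment> \<open>The energy with clamped time: jointly measurable, and equal to \<open>V\<close>
   up to time \<open>T\<close>.\<close>
 define Vc where "Vc y s = nnI lborel (%u. ennreal ((sg (X (?cl u) y))^2) * indicator {0..s} u)" for y s
 have V_Vc: "V y s = Vc y s" if "s <= T" for y s
  unfolding V_def Vc_def using that by (intro nn_integral_cong) (auto simp: indicator_def)
 have Vc_joint [measurable]: "(%x. Vc (fst x) (snd x)) \<in> BM (M \<Otimes>\<^sub>M lborel)"
 proof -
  note [measurable] = sigma_joint
  have 1: "(%z. ennreal ((sg (X (?cl (snd z)) (fst (fst z))))^2)) \<in> BM ((M \<Otimes>\<^sub>M lborel) \<Otimes>\<^sub>M lborel)"
  proof -
   have "(%z. (fst (fst z), snd z)) \<in> (M \<Otimes>\<^sub>M lborel) \<Otimes>\<^sub>M lborel \<rightarrow>\<^sub>M M \<Otimes>\<^sub>M lborel" by measurable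
   from measurable_compose[OF this sigma_joint] show ?thesis by simp
  qed
  have "(%(x, u). ennreal ((sg (X (?cl u) (fst x)))^2) * (if 0 <= u \<and> u <= snd x then 1 else 0)) \<in> BM ((M \<Otimes>\<^sub>M lborel) \<Otimes>\<^sub>M lborel)"
   unfolding case_prod_beta using 1 by measurable
  then have "(%x. (nnI lborel (%u. ennreal ((sg (X (?cl u) (fst x)))^2) * (if 0 <= u \<and> u <= snd x then 1 else 0)))) \<in> BM (M \<Otimes>\<^sub>M lborel)"
   by (rule lborel.borel_measurable_nn_integral)
  moreover have "Vc (fst x) (snd x) = nnI lborel (%u. ennreal ((sg (X (?cl u) (fst x)))^2) * (if 0 <= u \<and> u <= snd x then 1 else 0))" for x
   unfolding Vc_def by (intro nn_integral_cong) (auto simp: indicator_def)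
  ultimately show ?thesis by simp
 qed
 have Vc_M [measurable]: "(%y. Vc y s) \<in> BM M" for s
 proof -
  have "(%y. (y, s)) \<in> M \<rightarrow>\<^sub>M M \<Otimes>\<^sub>M lborel" by measurable
  from measurable_compose[OF this Vc_joint] show ?thesis by simp
 qed
 have Hint: "AE y in M. set_integrable lborel {0..T} (%s. (sg (X s y))^2)" using ito by (simp add: ito_integral_def)
 have loc: "nnI M (%y. ennreal ((I s y)^2) * indicator {y. Vc y s < ennreal c'} y) <= nnI M (%y. min (ennreal c') (Vc y s))"
  if s: "0 <= s" "s <= T" and c': "0 <= c'" for s c'
 proof -
  \<comment> \<open>The interval from 0 to \<open>s\<close> as a single block, with weight 1 and
    frozen value 0.\<close>
  define p where "p k = (if k = 0 then 0 else s)" for k :: nat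
  define Q where "Q y = (LBINT t:{0..T}. (sg (X t y) * indicator {0<..s} t)^2)" for y
  have l: "nnI M (%y. ennreal ((I s y - I 0 y)^2) * indicator {y. Q y < c'} y) <= nnE M (%y. min c' (Q y))"
   using ito_localized_bound(3)[OF ito, where m=1 and p=p and w="%_ _. 1" and g="%_ _. 0" and C=1 and c=c'] s c'
   by (simp add: p_def Q_def)
  have VQ: "AE y in M. Vc y s = ennreal (Q y) \<and> I 0 y = 0"
   using Hint I_0
  proof eventually_elim
   case (elim y)
   have eq: "indicator {0..T} t *\<^sub>R (sg (X t y) * indicator {0<..s} t)^2 = indicator {0<..s} t *\<^sub>R (sg (X t y))^2" for t
    using s by (auto simp: indicator_def)
   have int: "integrable lborel (%t. indicator {0<..s} t *\<^sub>R (sg (X t y))^2)"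
   proof -
    have "{0<..s} \<subseteq> {0..T}" using s by auto
    then have "set_integrable lborel {0<..s} (%t. (sg (X t y))^2)" by (intro set_integrable_subset[OF elim(1)]) auto
    then show ?thesis by (simp add: set_integrable_def)
   qed
   have "ennreal (Q y) = nnE lborel (%t. indicator {0<..s} t *\<^sub>R (sg (X t y))^2)"
    unfolding Q_def set_lebesgue_integral_def eq using int by (intro nn_integral_eq_integral[symmetric]) auto
   also have "\<dots> = V y s"
    unfolding V_def
   proof (rule nn_integral_cong_AE)
    show "AE t in lborel. ennreal (indicator {0<..s} t *\<^sub>R (sg (X t y))^2) = ennreal ((sg (X t y))^2) * indicator {0..s} t"
     using AE_lborel_singleton[of "0::real"] by eventually_elim (auto simp: indicator_def)
   qed
   finally show ?case using V_Vc s elim by simp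
  qed
  have Q0: "0 <= Q y" for y unfolding Q_def set_lebesgue_integral_def by (auto intro!: integral_nonneg_AE)
  have "nnI M (%y. ennreal ((I s y)^2) * indicator {y. Vc y s < ennreal c'} y) = nnI M (%y. ennreal ((I s y - I 0 y)^2) * indicator {y. Q y < c'} y)"
   by (rule nn_integral_cong_AE, use VQ in eventually_elim) (auto simp: indicator_def ennreal_less_iff Q0)
  also note l
  also have "nnE M (%y. min c' (Q y)) = nnI M (%y. min (ennreal c') (Vc y s))"
   by (rule nn_integral_cong_AE, use VQ in eventually_elim) (simp add: c' Q0 min_def ennreal_le_iff)
  finally show ?thesis .
 qed
 have g_bound: "nnI M (%y. min (ennreal c') (Vc y t)) <= ennreal energy_bound" if c': "0 <= c'" for c'
 proof -
  define g where "g s = nnI M (%y. min (ennreal c') (Vc y s))" for s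
  define A where "A = growth * (1 + 3 * ka + 3 * (B^2 * T^2))"
  define d where "d = 3 * growth + 1"
  have A0: "0 <= A" unfolding A_def using growth_nonneg pos by simp
  have d0: "0 < d" unfolding d_def using growth_nonneg by simp
  have gM [measurable]: "g \<in> BM borel"
  proof -
   have "(%(s, y). min (ennreal c') (Vc y s)) \<in> BM (lborel \<Otimes>\<^sub>M M)"
   proof -
    have "(%x. (snd x, fst x)) \<in> lborel \<Otimes>\<^sub>M M \<rightarrow>\<^sub>M M \<Otimes>\<^sub>M lborel" by measurable
    note [measurable] = measurable_compose[OF this Vc_joint, unfolded fst_conv snd_conv]
    show ?thesis unfolding case_prod_beta by measurable
   qed
   then have "(%s. (nnI M (%y. min (ennreal c') (Vc y s)))) \<in> BM lborel"
    by (rule borel_measurable_nn_integral)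
   then show ?thesis by (simp add: g_def[abs_def])
  qed
  have pt: "nnI M (%y. ennreal ((sg (X s y))^2) * indicator {y. Vc y s < ennreal c'} y) <= ennreal A + ennreal d * g s"
   if s: "0 <= s" "s <= T" for s
  proof -
   have [measurable]: "X s \<in> BM M" "X 0 \<in> BM M" "I s \<in> BM M"
    using X_M I_M s T_pos by auto
   have "(nnI M (%y. ennreal ((sg (X s y))^2) * indicator {y. Vc y s < ennreal c'} y))
    <= nnI M (%y. (ennreal (growth * (1 + 3 * (B^2 * T^2))) + ennreal (3 * growth) * ennreal ((X 0 y)^2))
      + ennreal d * (ennreal ((I s y)^2) * indicator {y. Vc y s < ennreal c'} y))"
   proof (rule nn_integral_mono_AE, use sigma_square_le[OF s] in eventually_elim)
    case (elim y)
    have "(sg (X s y))^2 <= (growth * (1 + 3 * (B^2 * T^2)) + 3 * growth * (X 0 y)^2) + d * (I s y)^2"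
     using elim zero_le_power2[of "I s y"] unfolding d_def distrib_right mult_1_left by linarith
    then have "ennreal ((sg (X s y))^2) <= ennreal ((growth * (1 + 3 * (B^2 * T^2)) + 3 * growth * (X 0 y)^2) + d * (I s y)^2)"
     by (rule ennreal_leI)
    also have "\<dots> = (ennreal (growth * (1 + 3 * (B^2 * T^2))) + ennreal (3 * growth) * ennreal ((X 0 y)^2)) + ennreal d * ennreal ((I s y)^2)"
     using growth_nonneg d0 by (simp add: ennreal_plus ennreal_mult)
    finally show ?case by (auto simp: indicator_def)
   qed
   also have "\<dots> = (ennreal (growth * (1 + 3 * (B^2 * T^2))) + ennreal (3 * growth) * (nnE M (%y. (X 0 y)^2)))
      + ennreal d * (nnI M (%y. ennreal ((I s y)^2) * indicator {y. Vc y s < ennreal c'} y))"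
    by (simp add: nn_integral_add nn_integral_cmult emeasure_space_1)
   also have "\<dots> <= (ennreal (growth * (1 + 3 * (B^2 * T^2))) + ennreal (3 * growth) * ennreal ka) + ennreal d * g s"
    unfolding g_def using loc[OF s c'] X0_bound by (intro add_mono mult_left_mono) auto
   also have "ennreal (growth * (1 + 3 * (B^2 * T^2))) + ennreal (3 * growth) * ennreal ka = ennreal A"
    using growth_nonneg pos unfolding A_def
    by (simp add: ennreal_mult[symmetric] ennreal_plus[symmetric] algebra_simps del: ennreal_plus)
   finally show ?thesis .
  qed
  \<comment> \<open>By \<open>truncated_energy_le\<close> the truncated energy is at most the
    integral of the integrand switched off once the level is reached. After Fubini's theorem
    \<open>pt\<close> bounds the expectation of the latter by \<open>g\<close> itself, which closes
    the inequality.\<close>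
  have gle: "g s <= ennreal (A * T) + ennreal d * (nnI lborel (%u. g u * indicator {0..s} u))" if s: "0 <= s" "s <= T" for s
  proof -
   have "g s <= nnI M (%y. (nnI lborel (%u. ennreal ((sg (X (?cl u) y))^2) * indicator {u. Vc y u < ennreal c'} u * indicator {0..s} u)))"
    unfolding g_def
   proof (rule nn_integral_mono_AE, use Hint in eventually_elim)
    case (elim y)
    have "min (ennreal c') (V y s) <= nnI lborel (%u. ennreal ((sg (X u y))^2) * indicator {u. V y u < ennreal c'} u * indicator {0..s} u)"
     unfolding V_def by (rule truncated_energy_le[OF elim _ s c']) simp
    also have "\<dots> = nnI lborel (%u. ennreal ((sg (X (?cl u) y))^2) * indicator {u. Vc y u < ennreal c'} u * indicator {0..s} u)"
     using s by (intro nn_integral_cong) (auto simp: indicator_def V_Vc)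
    finally show ?case using V_Vc s by simp
   qed
   also have "\<dots> = nnI lborel (%u. (nnI M (%y. ennreal ((sg (X (?cl u) y))^2) * indicator {u. Vc y u < ennreal c'} u * indicator {0..s} u)))"
   proof -
    interpret P: pair_sigma_finite M lborel ..
    have m1: "(%x. ennreal ((sg (X (?cl (snd x)) (fst x)))^2)) \<in> BM (M \<Otimes>\<^sub>M lborel)"
     using sigma_joint unfolding case_prod_beta .
    have m2: "(%x. indicator {u. Vc (fst x) u < ennreal c'} (snd x) :: ennreal) \<in> BM (M \<Otimes>\<^sub>M lborel)"
    proof -
     have "(%x. if Vc (fst x) (snd x) < ennreal c' then 1 else 0 :: ennreal) \<in> BM (M \<Otimes>\<^sub>M lborel)" by measurable
     then show ?thesis by (simp add: indicator_def of_bool_def)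
    qed
    have "(%(y, u). ennreal ((sg (X (?cl u) y))^2) * indicator {u. Vc y u < ennreal c'} u * indicator {0..s} u) \<in> BM (M \<Otimes>\<^sub>M lborel)"
     unfolding case_prod_beta by (intro borel_measurable_times_ennreal m1 m2) measurable
    from P.Fubini'[OF this] show ?thesis by simp
   qed
   also have "\<dots> <= nnI lborel (%u. (ennreal A + ennreal d * g u) * indicator {0..s} u)"
   proof (intro nn_integral_mono)
    fix u
    show "nnI M (%y. ennreal ((sg (X (?cl u) y))^2) * indicator {u. Vc y u < ennreal c'} u * indicator {0..s} u) <= (ennreal A + ennreal d * g u) * indicator {0..s} u"
    proof (cases "u \<in> {0..s}")
     case True
     then have "(nnI M (%y. ennreal ((sg (X (?cl u) y))^2) * indicator {u. Vc y u < ennreal c'} u * indicator {0..s} u))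
      = nnI M (%y. ennreal ((sg (X u y))^2) * indicator {y. Vc y u < ennreal c'} y)"
      using s by (intro nn_integral_cong) (auto simp: indicator_def)
     then show ?thesis using pt[of u] True s by simp
    qed simp
   qed
   also have "\<dots> = nnI lborel (%u. ennreal A * indicator {0..s} u + ennreal d * (g u * indicator {0..s} u))"
    by (intro nn_integral_cong) (auto simp: indicator_def)
   also have "\<dots> = ennreal A * ennreal s + ennreal d * (nnI lborel (%u. g u * indicator {0..s} u))"
    using s by (simp add: nn_integral_add nn_integral_cmult)
   also have "\<dots> <= ennreal (A * T) + ennreal d * (nnI lborel (%u. g u * indicator {0..s} u))"
    using s A0 by (intro add_mono order_refl) (auto simp: ennreal_mult[symmetric] intro!: ennreal_leI mult_left_mono)
   finally show ?thesis .
  qed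
  have gc: "g s <= ennreal c'" for s
  proof -
   have "g s <= nnI M (%y. ennreal c')" unfolding g_def by (intro nn_integral_mono) auto
   then show ?thesis by (simp add: emeasure_space_1)
  qed
  have "g t <= ennreal (2 * (A * T) * exp (2 * d * T))"
   by (rule nn_gronwall[OF gM gc gle]) (use A0 d0 c' T_pos t in auto)
  then show ?thesis by (simp add: g_def energy_bound_def A_def d_def)
 qed
 have [measurable]: "I t \<in> BM M" using I_M t by auto
 have Vfin: "AE y in M. Vc y t < \<top>"
  using Hint
 proof eventually_elim
  case (elim y)
  have "V y t <= nnE lborel (%u. indicator {0..T} u *\<^sub>R (sg (X u y))^2)"
   unfolding V_def using t by (intro nn_integral_mono) (auto simp: indicator_def)
  also have "\<dots> < \<top>" using elim by (subst nn_integral_eq_integral) (auto simp: set_integrable_def)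
  finally show ?case using V_Vc t by simp
 qed
 have "nnE M (%y. (I t y)^2) = nnI M (%y. liminf (%n. ennreal ((I t y)^2) * indicator {y. Vc y t < ennreal (real n)} y))"
 proof (rule nn_integral_cong_AE, use Vfin in eventually_elim)
  case (elim y)
  obtain v where v: "Vc y t = ennreal v" "0 <= v" using elim by (cases "Vc y t") auto
  obtain n0 where n0: "v < real n0" using reals_Archimedean2 by blast
  have "\<forall>\<^sub>F n in sequentially. ennreal ((I t y)^2) = ennreal ((I t y)^2) * indicator {y. Vc y t < ennreal (real n)} y"
   by (rule eventually_mono[OF eventually_ge_at_top[of n0]]) (use n0 v in \<open>auto simp: indicator_def ennreal_less_iff\<close>)
  then have "(%n. ennreal ((I t y)^2) * indicator {y. Vc y t < ennreal (real n)} y) \<longlonglongrightarrow> ennreal ((I t y)^2)"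
   by (rule Lim_transform_eventually[OF tendsto_const])
  then show ?case by (intro lim_imp_Liminf[symmetric]) auto
 qed
 also have "\<dots> <= liminf (%n. (nnI M (%y. ennreal ((I t y)^2) * indicator {y. Vc y t < ennreal (real n)} y)))"
  by (rule nn_integral_liminf) measurable
 also have "\<dots> <= liminf (%n::nat. ennreal energy_bound)"
  by (intro Liminf_mono always_eventually allI order_trans[OF loc g_bound] t) auto
 also have "\<dots> = ennreal energy_bound" by (simp add: Liminf_const)
 finally show ?thesis .
qed

lemma sigma_second_moment:
 assumes t: "0 <= t" "t <= T"
 shows "nnE M (%w. (sg (X t w))^2) <= ennreal sigma_bound"
proof -
 have [measurable]: "X 0 \<in> BM M" "I t \<in> BM M" using X_M I_M t T_pos by auto
 have "nnE M (%w. (sg (X t w))^2) <= ennreal (growth * (1 + 3 * (B^2 * T^2)) + 3 * growth * ka + 3 * growth * energy_bound)"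
  by (rule nn_bound2[OF sigma_square_le[OF t] _ _ _ _ _ X0_bound _ _ _ I_second_moment[OF t]])
   (use growth_nonneg energy_bound_nonneg pos in auto)
 then show ?thesis by (simp add: sigma_bound_def algebra_simps)
qed

text \<open>The case of frozen values 0 in \<open>ito_bound\<close>. Since the bound depends only on
  the time elapsed, it gives the order of the increments of \<open>X\<close> as well as a bound for
  the stochastic part of the contrast that is uniform in the number of observations.\<close>

lemma weighted_ito_sum:
 assumes p: "!!k. k <= m ==> 0 <= p k \<and> p k <= T" "!!k. k < m ==> p k <= p (Suc k)"
  and w: "!!k. k < m ==> w k \<in> BM (F (p k))"
  and wC: "!!k y. k < m ==> y \<in> space M ==> \<bar>w k y\<bar> <= C"
 shows "nnE M (%y. (\<Sum>k<m. w k y * (I (p (Suc k)) y - I (p k) y))^2) <= ennreal (C^2 * sigma_bound * (p m - p 0))"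
proof -
 have Bk: "nnE M (%y. (w k y * (sg (X t y) - 0))^2) <= ennreal (C^2 * sigma_bound)"
  if k: "k < m" and t: "p k < t" "t <= p (Suc k)" for k t
 proof -
  have t': "0 <= t" "t <= T" using t p(1)[of k] p(1)[of "Suc k"] k by auto
  have [measurable]: "X t \<in> BM M" using X_M t' by auto
  have "nnE M (%y. (w k y * (sg (X t y) - 0))^2) <= ennreal (0 + C^2 * sigma_bound)"
   by (rule nn_bound1[OF AE_I2 _ _ _ _ sigma_second_moment[OF t']])
    (use wC[OF k] sigma_bound_nonneg in \<open>auto simp: power_mult_distrib intro!: mult_right_mono square_le_of_abs_le\<close>)
  then show ?thesis by simp
 qed
 have "nnE M (%y. (\<Sum>k<m. w k y * (I (p (Suc k)) y - I (p k) y - 0 * (W (p (Suc k)) y - W (p k) y)))^2) <= ennreal (\<Sum>k<m. C^2 * sigma_bound * (p (Suc k) - p k))"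
  by (rule ito_bound(2)[where H="%s y. sg (X s y)" and I=I and m=m and p=p and w=w and C=C and g="%_ _. 0" and B="%_. C^2 * sigma_bound"])
   (use ito p w wC Bk sigma_bound_nonneg in auto)
 also have "(\<Sum>k<m. C^2 * sigma_bound * (p (Suc k) - p k)) = C^2 * sigma_bound * (p m - p 0)"
  unfolding sum_distrib_left[symmetric] by (simp add: sum_lessThan_telescope)
 finally show ?thesis by simp
qed

text \<open>The drift contributes the order \<open>(t - s)^2\<close>, of which one factor is
  estimated by \<open>T\<close>; the stochastic integral contributes the order
  \<open>t - s\<close>.\<close>

lemma X_increment:
 assumes "0 <= s" "s <= t" "t <= T"
 shows "nnE M (%y. (X t y - X s y)^2) <= ennreal (incr_bound * (t - s))"
proof -
 have [measurable]: "I t \<in> BM M" "I s \<in> BM M" using I_M assms by auto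
 have le: "AE y in M. (X t y - X s y)^2 <= 2 * (B^2 * T) * (t - s) + 2 * (I t y - I s y)^2"
  using X_eq_drift AE_space
 proof eventually_elim
  case (elim y)
  have "X t y - X s y = (drift t y - drift s y) + (I t y - I s y)"
  proof -
   have "t \<in> {0..T}" "s \<in> {0..T}" using assms by auto
   from bspec[OF elim(1) this(1)] bspec[OF elim(1) this(2)] show ?thesis by linarith
  qed
  then have "(X t y - X s y)^2 <= 2 * (drift t y - drift s y)^2 + 2 * (I t y - I s y)^2"
   by (simp only: two_squares)
  also have "(drift t y - drift s y)^2 <= (B * (t - s))^2"
   by (rule square_le_of_abs_le[OF drift_diff_bound]) (use elim(2) assms in auto)
  also have "(B * (t - s))^2 <= B^2 * T * (t - s)"
  proof -
   have "B^2 * ((t - s) * (t - s)) <= B^2 * (T * (t - s))"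
    using assms by (intro mult_left_mono mult_right_mono) auto
   then show ?thesis by (simp add: power2_eq_square mult_ac)
  qed
  finally show ?case by simp
 qed
 have EI: "nnE M (%y. (I t y - I s y)^2) <= ennreal (sigma_bound * (t - s))"
  using weighted_ito_sum[where m=1 and p="%k. if k = 0 then s else t" and w="%_ _. 1" and C=1] assms by simp
 have "nnE M (%y. (X t y - X s y)^2) <= ennreal (2 * (B^2 * T) * (t - s) + 2 * (sigma_bound * (t - s)))"
  by (rule nn_bound1[OF le _ _ _ _ EI]) (use assms T_pos sigma_bound_nonneg in auto)
 then show ?thesis by (simp add: incr_bound_def algebra_simps)
qed

text \<open>Within a step of length \<open>h\<close> the integrand moves in mean square by the order
  \<open>h\<close>, so freezing it at the left end costs \<open>h^2\<close> per step. The errors of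
  different steps do not accumulate beyond the sum of their squares.\<close>

lemma weighted_remainder_sum:
 assumes p: "!!k. k <= m ==> 0 <= p k \<and> p k <= T" "!!k. k < m ==> p k <= p (Suc k)"
  and w: "!!k. k < m ==> w k \<in> BM (F (p k))"
  and wC: "!!k y. k < m ==> y \<in> space M ==> \<bar>w k y\<bar> <= C"
 shows "(%y. \<Sum>k<m. w k y * (I (p (Suc k)) y - I (p k) y - sg (X (p k) y) * (W (p (Suc k)) y - W (p k) y))) \<in> BM M" 
  "(nnE M (%y. (\<Sum>k<m. w k y * (I (p (Suc k)) y - I (p k) y - sg (X (p k) y) * (W (p (Suc k)) y - W (p k) y)))^2))
   <= ennreal (\<Sum>k<m. C^2 * c^2 * incr_bound * (p (Suc k) - p k) * (p (Suc k) - p k))"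
proof -
 have gF: "(%y. sg (X (p k) y)) \<in> BM (F (p k))" if "k < m" for k
  using X_F[of "p k"] p(1)[of k] that by simp
 have Bk: "nnE M (%y. (w k y * (sg (X t y) - sg (X (p k) y)))^2) <= ennreal (C^2 * c^2 * incr_bound * (p (Suc k) - p k))"
  if k: "k < m" and t: "p k < t" "t <= p (Suc k)" for k t
 proof -
  have t': "0 <= p k" "p k <= t" "t <= T" using t p(1)[of k] p(1)[of "Suc k"] k by auto
  have [measurable]: "X t \<in> BM M" "X (p k) \<in> BM M" using X_M t' by auto
  have le: "AE y in M. (w k y * (sg (X t y) - sg (X (p k) y)))^2 <= 0 + C^2 * c^2 * (X t y - X (p k) y)^2"
  proof (rule AE_I2)
   fix y assume "y \<in> space M"
   have "(w k y)^2 <= C^2" using wC[OF k \<open>y \<in> space M\<close>] by (rule square_le_of_abs_le)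
   moreover have "(sg (X t y) - sg (X (p k) y))^2 <= (c * \<bar>X t y - X (p k) y\<bar>)^2" by (rule square_le_of_abs_le[OF sg_lip])
   ultimately have "(w k y)^2 * (sg (X t y) - sg (X (p k) y))^2 <= C^2 * (c * \<bar>X t y - X (p k) y\<bar>)^2"
    by (intro mult_mono) auto
   then show "(w k y * (sg (X t y) - sg (X (p k) y)))^2 <= 0 + C^2 * c^2 * (X t y - X (p k) y)^2"
    by (simp add: power_mult_distrib mult.assoc)
  qed
  have "nnE M (%y. (w k y * (sg (X t y) - sg (X (p k) y)))^2) <= ennreal (0 + C^2 * c^2 * (incr_bound * (t - p k)))"
   by (rule nn_bound1[OF le _ _ _ _ X_increment[OF t']]) (use incr_bound_nonneg t' in auto)
  also have "\<dots> <= ennreal (C^2 * c^2 * incr_bound * (p (Suc k) - p k))"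
   using incr_bound_nonneg t by (intro ennreal_leI) (simp add: mult.assoc mult_left_mono)
  finally show ?thesis .
 qed
 have B0: "0 <= C^2 * c^2 * incr_bound * (p (Suc k) - p k)" if "k < m" for k
  using incr_bound_nonneg p(2)[OF that] by simp
 show "(nnE M (%y. (\<Sum>k<m. w k y * (I (p (Suc k)) y - I (p k) y - sg (X (p k) y) * (W (p (Suc k)) y - W (p k) y)))^2))
   <= ennreal (\<Sum>k<m. C^2 * c^2 * incr_bound * (p (Suc k) - p k) * (p (Suc k) - p k))"
  by (rule ito_bound(2)[where H="%s y. sg (X s y)" and I=I and m=m and p=p and w=w and C=C
    and g="%k y. sg (X (p k) y)" and B="%k. C^2 * c^2 * incr_bound * (p (Suc k) - p k)"])
   (fact ito p w wC gF Bk B0)+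
 show "(%y. \<Sum>k<m. w k y * (I (p (Suc k)) y - I (p k) y - sg (X (p k) y) * (W (p (Suc k)) y - W (p k) y))) \<in> BM M"
  by (rule ito_bound(1)[where H="%s y. sg (X s y)" and I=I and m=m and p=p and w=w and C=C
    and g="%k y. sg (X (p k) y)" and B="%k. C^2 * c^2 * incr_bound * (p (Suc k) - p k)"])
   (fact ito p w wC gF Bk B0)+
qed

end

section \<open>The Euler scheme and the law of large numbers\<close>

text \<open>Written as a deterministic function of the start \<open>x\<close> and the increments
  \<open>d\<close>, because the independence of the particles is read off from this form.\<close>

primrec euler :: "(real => real) => (real => real) => real => real => (nat => real) => nat => real" where
 "euler bt sg h x d 0 = x"
| "euler bt sg h x d (Suc k) = euler bt sg h x d k + bt (euler bt sg h x d k) * h + sg (euler bt sg h x d k) * d k"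

text \<open>The extremal case of the discrete Gronwall inequality: with equality here, the induction
  in \<open>euler_error\<close> closes exactly.\<close>

lemma discrete_gronwall_solution:
 "ga * (1 + \<alpha>) ^ k = ga + \<alpha> * (\<Sum>l<k. ga * (1 + \<alpha>) ^ l)" for \<alpha> ga :: real
 by (induction k) (simp_all add: algebra_simps)

context sde_particle begin

lemma drift_M [measurable]:
 assumes "t <= T" shows "drift t \<in> BM M"
proof -
 have "(%w. \<integral>u. indicator {0..t} u * bt (X (max 0 (min T u)) w) \<partial>lborel) \<in> BM M"
  using progressive_joint[OF progX] by (intro lborel.borel_measurable_lebesgue_integral) (simp add: case_prod_beta)
 moreover have "drift t w = (\<integral>u. indicator {0..t} u * bt (X (max 0 (min T u)) w) \<partial>lborel)" for w
  unfolding drift_def set_lebesgue_integral_def using assms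
  by (intro Bochner_Integration.integral_cong) (auto simp: indicator_def)
 ultimately show ?thesis by (simp cong: measurable_cong)
qed

text \<open>Cauchy-Schwarz in time, which gains the second factor \<open>t - s\<close>. It is
  obtained by integrating the square of \<open>f - m\<close>, with \<open>m\<close> the mean of
  \<open>f\<close> over the interval.\<close>

lemma drift_local_error:
 assumes st: "0 <= s" "s < t" "t <= T" and Z [measurable]: "Z \<in> BM M"
  and b: "!!u. s <= u ==> u <= t ==> (nnE M (%w. (bt (X u w) - bt (Z w))^2)) <= ennreal b" and "0 <= b"
 shows "nnE M (%w. (drift t w - drift s w - bt (Z w) * (t - s))^2) <= ennreal (b * (t - s)^2)"
proof -
 let ?cl = "%u. max 0 (min T u)"
 have joint: "(%x. ennreal (indicator {s..t} (snd x) * (bt (X (?cl (snd x)) (fst x)) - bt (Z (fst x)))^2)) \<in> BM (M \<Otimes>\<^sub>M lborel)"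
  using progressive_joint[OF progX] unfolding case_prod_beta by measurable
 have pt: "(drift t w - drift s w - bt (Z w) * (t - s))^2 <= (t - s) * (\<integral>u. indicator {s..t} u * (bt (X (?cl u) w) - bt (Z w))^2 \<partial>lborel)"
  and intf2: "integrable lborel (%u. indicator {s..t} u * (bt (X (?cl u) w) - bt (Z w))^2)"
  if w: "w \<in> space M" for w
 proof -
  define f where "f u = bt (X (?cl u) w) - bt (Z w)" for u
  note [measurable] = progressive_path[OF progX w]
  have f_le: "\<bar>f u\<bar> <= 2 * B" for u using bt_bound[of "X (?cl u) w"] bt_bound[of "Z w"] unfolding f_def by linarith
  have fM [measurable]: "f \<in> BM borel" unfolding f_def by measurable
  have ind: "integrable lborel (%u. C * indicator {s..t} u :: real)" for C using st by (intro integrable_mult_right integrable_real_indicator) auto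
  have if1: "integrable lborel (%u. indicator {s..t} u * f u)"
   by (rule Bochner_Integration.integrable_bound[OF ind[of "2 * B"]]) (use f_le pos in \<open>auto intro!: AE_I2 simp: indicator_def\<close>)
  show if2: "integrable lborel (%u. indicator {s..t} u * (bt (X (?cl u) w) - bt (Z w))^2)"
   unfolding f_def[symmetric]
   by (rule Bochner_Integration.integrable_bound[OF ind[of "(2 * B)^2"]]) (use square_le_of_abs_le[OF f_le] in \<open>auto intro!: AE_I2 simp: indicator_def\<close>)
  define S where "S = (\<integral>u. indicator {s..t} u * f u \<partial>lborel)"
  have S_eq: "drift t w - drift s w - bt (Z w) * (t - s) = S"
  proof -
   have i1: "integrable lborel (%u. indicator {s..t} u *\<^sub>R bt (X u w))"
    using btX_integrable[OF w st(1,3)] by (simp add: set_integrable_def)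
   have "S = (\<integral>u. indicator {s..t} u *\<^sub>R bt (X u w) - bt (Z w) * indicator {s..t} u \<partial>lborel)"
    unfolding S_def f_def using st by (intro Bochner_Integration.integral_cong) (auto simp: indicator_def)
   also have "\<dots> = (drift t w - drift s w) - bt (Z w) * (t - s)"
    using drift_diff[OF w st(1) less_imp_le[OF st(2)] st(3)] st
    by (subst Bochner_Integration.integral_diff[OF i1 ind]) (simp add: set_lebesgue_integral_def)
   finally show ?thesis by simp
  qed
  define m where "m = S / (t - s)"
  have "0 <= (\<integral>u. indicator {s..t} u * (f u - m)^2 \<partial>lborel)" by (intro integral_nonneg_AE) auto
  also have "\<dots> = (\<integral>u. indicator {s..t} u * (f u)^2 - 2 * m * (indicator {s..t} u * f u) + m^2 * indicator {s..t} u \<partial>lborel)"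
   by (intro Bochner_Integration.integral_cong) (auto simp: power2_eq_square algebra_simps)
  also have "\<dots> = (\<integral>u. indicator {s..t} u * (f u)^2 \<partial>lborel) - 2 * m * S + m^2 * (t - s)"
  proof -
   have i2: "integrable lborel (%u. indicator {s..t} u * (f u)^2)" using if2 by (simp add: f_def)
   have i3: "integrable lborel (%u. 2 * m * (indicator {s..t} u * f u))" by (intro integrable_mult_right if1)
   show ?thesis
    using st by (subst Bochner_Integration.integral_add[OF Bochner_Integration.integrable_diff[OF i2 i3] ind],
      subst Bochner_Integration.integral_diff[OF i2 i3]) (simp add: S_def)
  qed
  also have "2 * m * S = 2 * (S^2 / (t - s))" by (simp add: m_def power2_eq_square)
  also have "m^2 * (t - s) = S^2 / (t - s)" using st by (simp add: m_def power2_eq_square)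
  finally have "S^2 / (t - s) <= (\<integral>u. indicator {s..t} u * (f u)^2 \<partial>lborel)" by simp
  then have "S^2 <= (t - s) * (\<integral>u. indicator {s..t} u * (f u)^2 \<partial>lborel)" using st by (simp add: field_simps)
  then show "(drift t w - drift s w - bt (Z w) * (t - s))^2 <= (t - s) * (\<integral>u. indicator {s..t} u * (bt (X (?cl u) w) - bt (Z w))^2 \<partial>lborel)"
   unfolding S_eq f_def .
 qed
 have outer: "(nnE M (%w. (drift t w - drift s w - bt (Z w) * (t - s))^2))
  <= nnI M (%w. ennreal (t - s) * (nnE lborel (%u. indicator {s..t} u * (bt (X (?cl u) w) - bt (Z w))^2)))"
 proof (intro nn_integral_mono)
  fix w assume w: "w \<in> space M"
  have "(nnE lborel (%u. indicator {s..t} u * (bt (X (?cl u) w) - bt (Z w))^2))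
   = ennreal (\<integral>u. indicator {s..t} u * (bt (X (?cl u) w) - bt (Z w))^2 \<partial>lborel)"
   by (intro nn_integral_eq_integral intf2[OF w]) auto
  then show "ennreal ((drift t w - drift s w - bt (Z w) * (t - s))^2)
   <= ennreal (t - s) * (nnE lborel (%u. indicator {s..t} u * (bt (X (?cl u) w) - bt (Z w))^2))"
   using pt[OF w] st by (simp add: ennreal_mult'[symmetric] ennreal_leI)
 qed
 have cmult: "(nnI M (%w. ennreal (t - s) * (nnE lborel (%u. indicator {s..t} u * (bt (X (?cl u) w) - bt (Z w))^2))))
  = ennreal (t - s) * (nnI M (%w. (nnE lborel (%u. indicator {s..t} u * (bt (X (?cl u) w) - bt (Z w))^2))))"
  using lborel.borel_measurable_nn_integral_fst[OF joint] by (intro nn_integral_cmult) simp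
 have "(nnI M (%w. (nnE lborel (%u. indicator {s..t} u * (bt (X (?cl u) w) - bt (Z w))^2))))
  = nnI lborel (%u. (nnE M (%w. indicator {s..t} u * (bt (X (?cl u) w) - bt (Z w))^2)))"
 proof -
  interpret P: pair_sigma_finite M lborel ..
  have "(%(w, u). ennreal (indicator {s..t} u * (bt (X (?cl u) w) - bt (Z w))^2)) \<in> BM (M \<Otimes>\<^sub>M lborel)"
   using joint unfolding case_prod_beta .
  from P.Fubini'[OF this] show ?thesis by (rule sym)
 qed
 also have "\<dots> <= nnI lborel (%u. ennreal b * indicator {s..t} u)"
 proof (intro nn_integral_mono)
  fix u
  show "nnE M (%w. indicator {s..t} u * (bt (X (?cl u) w) - bt (Z w))^2) <= ennreal b * indicator {s..t} u"
   using b[of u] st by (cases "u \<in> {s..t}") auto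
 qed
 also have "\<dots> = ennreal (b * (t - s))" using st \<open>0 <= b\<close> by (simp add: nn_integral_cmult_indicator ennreal_mult)
 finally have "ennreal (t - s) * (nnI M (%w. (nnE lborel (%u. indicator {s..t} u * (bt (X (?cl u) w) - bt (Z w))^2))))
  <= ennreal (t - s) * ennreal (b * (t - s))" by (intro mult_left_mono) auto
 also have "\<dots> = ennreal (b * (t - s)^2)"
  using st \<open>0 <= b\<close> by (simp add: ennreal_mult[symmetric] power2_eq_square mult_ac)
 finally show ?thesis using outer unfolding cmult by (rule order_trans[rotated])
qed

definition "euler_rate = 4 * (T + 1) * c^2"
definition "euler_const = euler_rate * incr_bound * T * exp (euler_rate * T)"

text \<open>On each step the error splits into a drift part \<open>D\<close> and a stochastic part
  \<open>J\<close>. The parts \<open>J\<close> are controlled like orthogonal variables, at cost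
  \<open>h\<close> per step. For the parts \<open>D\<close> Cauchy-Schwarz costs the number of
  steps, which is paid for by the additional factor \<open>h\<close> from
  \<open>drift_local_error\<close>.\<close>

lemma euler_error:
 assumes m: "1 <= m" and k: "k <= m"
 defines "h \<equiv> T / real m"
 defines "E \<equiv> %k z. euler bt sg h (X 0 z) (%l. W (real (Suc l) * h) z - W (real l * h) z) k"
 shows "nnE M (%z. (X (real k * h) z - E k z)^2) <= ennreal (euler_const * h)"
  and "E k \<in> BM M"
proof -
 have h: "0 < h" using T_pos m by (simp add: h_def)
 have mh: "real m * h = T" using m by (simp add: h_def)
 have tm: "0 <= real k * h" "real k * h <= T" if "k <= m" for k
 proof -
  have "real k * h <= real m * h" using that h by (intro mult_right_mono) auto
  then show "real k * h <= T" using mh by simp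
 qed (use h in auto)
 have EF: "E k \<in> BM (F (real k * h))" if "k <= m" for k
  using that
 proof (induction k)
  case 0
  then show ?case using X_F[of 0] T_pos by (simp add: E_def)
 next
  case (Suc k)
  have "real k * h <= real (Suc k) * h" using h by simp
  then have [measurable]: "E k \<in> BM (F (real (Suc k) * h))" "W (real k * h) \<in> BM (F (real (Suc k) * h))"
   "W (real (Suc k) * h) \<in> BM (F (real (Suc k) * h))"
   using F_mono[OF _ Suc.IH] F_mono[OF _ W_F[of "real k * h"]] Suc.prems W_F tm[of k] tm[of "Suc k"] by auto
  have "E (Suc k) = (%z. E k z + bt (E k z) * h + sg (E k z) * (W (real (Suc k) * h) z - W (real k * h) z))"
   by (simp add: E_def fun_eq_iff)
  then show ?case by (simp only:) measurable
 qed
 have EM [measurable]: "k <= m ==> E k \<in> BM M" for k using F_imp_M[OF EF] .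
 then show "E k \<in> BM M" using k by blast
 have XM [measurable]: "k <= m ==> X (real k * h) \<in> BM M" for k using X_M tm by blast
 have IM [measurable]: "k <= m ==> I (real k * h) \<in> BM M" for k using I_M tm by blast
 have WM [measurable]: "k <= m ==> W (real k * h) \<in> BM M" for k using W_M tm by blast
 have dM [measurable]: "k <= m ==> drift (real k * h) \<in> BM M" for k using drift_M tm by blast
 \<comment> \<open>\<open>ga\<close> collects the local errors over the whole interval and
   \<open>\<alpha>\<close> is the growth rate per step, so that \<open>a\<close> solves the
   recursion of \<open>discrete_gronwall_solution\<close>.\<close>
 define ga where "ga = euler_rate * incr_bound * T * h"
 define \<alpha> where "\<alpha> = euler_rate * h"
 define a where "a k = ga * (1 + \<alpha>) ^ k" for k
 have \<alpha>0: "0 <= \<alpha>" "0 <= ga" "0 <= euler_rate" using T_pos h incr_bound_nonneg by (auto simp: \<alpha>_def ga_def euler_rate_def)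
 have a0: "0 <= a k" for k using \<alpha>0 by (simp add: a_def)
 define D where "D l z = drift (real (Suc l) * h) z - drift (real l * h) z - bt (E l z) * h" for l z
 define J where "J l z = I (real (Suc l) * h) z - I (real l * h) z - sg (E l z) * (W (real (Suc l) * h) z - W (real l * h) z)" for l z
 have DM [measurable]: "l < m ==> D l \<in> BM M" for l
  unfolding D_def[abs_def] using dM[of l] dM[of "Suc l"] EM[of l] by measurable
 have JM [measurable]: "l < m ==> J l \<in> BM M" for l
  unfolding J_def[abs_def] using IM[of l] IM[of "Suc l"] EM[of l] WM[of l] WM[of "Suc l"] by measurable
 have decomp: "AE z in M. \<forall>k\<in>{..m}. X (real k * h) z - E k z = (\<Sum>l<k. D l z) + (\<Sum>l<k. J l z)"
  using X_eq_drift I_0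
 proof eventually_elim
  case (elim z)
  have Xk: "X (real k * h) z = X 0 z + drift (real k * h) z + I (real k * h) z" if "k <= m" for k
  proof -
   have "real k * h \<in> {0..T}" using tm that by auto
   from bspec[OF elim(1) this] show ?thesis .
  qed
  have 1: "E k z = X 0 z + (\<Sum>l<k. bt (E l z) * h + sg (E l z) * (W (real (Suc l) * h) z - W (real l * h) z))" for k
   by (induction k) (simp_all add: E_def)
  have 2: "(\<Sum>l<k. drift (real (Suc l) * h) z - drift (real l * h) z) = drift (real k * h) z" for k
   using sum_lessThan_telescope[of "%l. drift (real l * h) z" k] by (simp add: drift_0)
  have 3: "(\<Sum>l<k. I (real (Suc l) * h) z - I (real l * h) z) = I (real k * h) z" for k
   using sum_lessThan_telescope[of "%l. I (real l * h) z" k] elim(2) by simp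
  show ?case
  proof
   fix k assume "k \<in> {..m}"
   have "(\<Sum>l<k. D l z) = drift (real k * h) z - (\<Sum>l<k. bt (E l z) * h)"
    unfolding D_def sum_subtractf[of _ "%l. bt (E l z) * h"] 2 ..
   moreover have "(\<Sum>l<k. J l z) = I (real k * h) z - (\<Sum>l<k. sg (E l z) * (W (real (Suc l) * h) z - W (real l * h) z))"
    unfolding J_def sum_subtractf[of _ "%l. sg (E l z) * (W (real (Suc l) * h) z - W (real l * h) z)"] 3 ..
   ultimately show "X (real k * h) z - E k z = (\<Sum>l<k. D l z) + (\<Sum>l<k. J l z)"
    using Xk[of k] 1[of k] \<open>k \<in> {..m}\<close> unfolding sum.distrib atMost_iff by linarith
  qed
 qed
 have "nnE M (%z. (X (real k * h) z - E k z)^2) <= ennreal (a k)" if "k <= m" for k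
  using that
 proof (induction k rule: less_induct)
  case (less k)
  define b where "b l = c^2 * (2 * (incr_bound * h) + 2 * a l)" for l
  have b0: "0 <= b l" for l using incr_bound_nonneg h a0 by (simp add: b_def)
  have diff: "nnE M (%z. (f (X u z) - f (E l z))^2) <= ennreal (b l)"
   if l: "l < k" and u: "real l * h <= u" "u <= real (Suc l) * h" and f: "!!x y. \<bar>f x - f y\<bar> <= c * \<bar>x - y\<bar>" for f l u
  proof -
   have u': "0 <= u" "u <= T" using u tm[of l] tm[of "Suc l"] l less.prems by auto
   have [measurable]: "X u \<in> BM M" "X (real l * h) \<in> BM M" "E l \<in> BM M"
    using X_M u' XM EM l less.prems by auto
   have le: "AE z in M. (f (X u z) - f (E l z))^2 <= 0 + 2 * c^2 * (X u z - X (real l * h) z)^2 + 2 * c^2 * (X (real l * h) z - E l z)^2"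
   proof (rule AE_I2)
    fix z
    have "(f (X u z) - f (E l z))^2 <= (c * \<bar>X u z - E l z\<bar>)^2" by (rule square_le_of_abs_le[OF f])
    also have "\<dots> = c^2 * ((X u z - X (real l * h) z) + (X (real l * h) z - E l z))^2" by (simp add: power_mult_distrib)
    also have "\<dots> <= c^2 * (2 * (X u z - X (real l * h) z)^2 + 2 * (X (real l * h) z - E l z)^2)"
     by (intro mult_left_mono two_squares) auto
    finally show "(f (X u z) - f (E l z))^2 <= 0 + 2 * c^2 * (X u z - X (real l * h) z)^2 + 2 * c^2 * (X (real l * h) z - E l z)^2"
     by (simp add: algebra_simps)
   qed
   have EX: "nnE M (%z. (X u z - X (real l * h) z)^2) <= ennreal (incr_bound * h)"
   proof -
    have "nnE M (%z. (X u z - X (real l * h) z)^2) <= ennreal (incr_bound * (u - real l * h))"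
     using u u' tm[of l] l less.prems by (intro X_increment) auto
    also have "\<dots> <= ennreal (incr_bound * h)"
     using u incr_bound_nonneg by (intro ennreal_leI mult_left_mono) (auto simp: algebra_simps)
    finally show ?thesis .
   qed
   have EE: "nnE M (%z. (X (real l * h) z - E l z)^2) <= ennreal (a l)" using less.IH[of l] l less.prems by simp
   have "nnE M (%z. (f (X u z) - f (E l z))^2) <= ennreal (0 + 2 * c^2 * (incr_bound * h) + 2 * c^2 * a l)"
    by (rule nn_bound2[OF le _ _ _ _ _ EX _ _ _ EE]) (use a0[of l] incr_bound_nonneg h in auto)
   then show ?thesis by (simp add: b_def algebra_simps)
  qed
  have kM: "l < k ==> l < m" for l using less.prems by simp
  have ED: "nnE M (%z. (D l z)^2) <= ennreal (b l * h^2)" if l: "l < k" for l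
  proof -
   have "nnE M (%z. (drift (real (Suc l) * h) z - drift (real l * h) z - bt (E l z) * (real (Suc l) * h - real l * h))^2) <= ennreal (b l * (real (Suc l) * h - real l * h)^2)"
    by (rule drift_local_error) (use tm[of l] tm[of "Suc l"] kM[OF l] h EM[of l] diff[OF l _ _ bt_lip] b0 in auto)
   moreover have "real (Suc l) * h - real l * h = h" by (simp add: algebra_simps)
   ultimately show ?thesis by (simp only: D_def)
  qed
  have EJ: "nnE M (%z. (\<Sum>l<k. J l z)^2) <= ennreal (\<Sum>l<k. b l * h)"
  proof -
   have "(nnE M (%z. (\<Sum>l<k. 1 * (I (real (Suc l) * h) z - I (real l * h) z - sg (E l z) * (W (real (Suc l) * h) z - W (real l * h) z)))^2))
    <= ennreal (\<Sum>l<k. b l * (real (Suc l) * h - real l * h))"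
   proof (rule ito_bound(2)[where H="%s z. sg (X s z)" and I=I and m=k and p="%l. real l * h" and w="%_ _. 1" and C=1 and g="%l z. sg (E l z)" and B=b])
    show "ito_integral M F T W (%s z. sg (X s z)) I" by (rule ito)
    show "(%z. sg (E l z)) \<in> BM (F (real l * h))" if "l < k" for l using EF[of l] kM[OF that] by simp
    show "nnE M (%z. (1 * (sg (X t z) - sg (E l z)))^2) <= ennreal (b l)" if "l < k" "real l * h < t" "t <= real (Suc l) * h" for l t
     using diff[OF that(1) _ _ sg_lip, of t] that by simp
    show "0 <= real l * h \<and> real l * h <= T" if "l <= k" for l using tm[of l] that less.prems by simp
   qed (use h b0 in auto)
   moreover have "real (Suc l) * h - real l * h = h" for l by (simp add: algebra_simps)
   ultimately show ?thesis by (simp only: J_def mult_1)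
  qed
  have ED': "nnE M (%z. (\<Sum>l<k. D l z)^2) <= ennreal (T * (\<Sum>l<k. b l * h))"
  proof -
   have "nnE M (%z. (\<Sum>l<k. D l z)^2) <= nnI M (%z. ennreal (real k) * (\<Sum>l<k. ennreal ((D l z)^2)))"
   proof (intro nn_integral_mono)
    fix z
    have "(\<Sum>l<k. D l z)^2 <= real k * (\<Sum>l<k. (D l z)^2)"
     using sum_squared_le_sum_of_squares[of "%l. D l z" "{..<k}"] by (simp add: mult.commute)
    then show "ennreal ((\<Sum>l<k. D l z)^2) <= ennreal (real k) * (\<Sum>l<k. ennreal ((D l z)^2))"
     by (subst sum_ennreal, simp, subst ennreal_mult[symmetric]) (auto intro: sum_nonneg ennreal_leI)
   qed
   also have "\<dots> = ennreal (real k) * (\<Sum>l<k. (nnE M (%z. (D l z)^2)))"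
    using kM DM by (subst nn_integral_cmult, measurable, subst nn_integral_sum) auto
   also have "\<dots> <= ennreal (real k) * (\<Sum>l<k. ennreal (b l * h^2))"
    by (intro mult_left_mono sum_mono ED) auto
   also have "\<dots> = ennreal (real k * (\<Sum>l<k. b l * h^2))"
    using b0 h by (subst sum_ennreal) (auto simp: ennreal_mult sum_nonneg)
   also have "\<dots> <= ennreal (T * (\<Sum>l<k. b l * h))"
   proof (intro ennreal_leI)
    have "real k * (\<Sum>l<k. b l * h^2) = (real k * h) * (\<Sum>l<k. b l * h)" by (simp add: sum_distrib_left power2_eq_square mult_ac)
    also have "\<dots> <= T * (\<Sum>l<k. b l * h)" using tm[of k] less.prems b0 h by (intro mult_right_mono sum_nonneg) auto
    finally show "real k * (\<Sum>l<k. b l * h^2) <= T * (\<Sum>l<k. b l * h)" .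
   qed
   finally show ?thesis .
  qed
  have SDM [measurable]: "(%z. \<Sum>l<k. D l z) \<in> BM M" "(%z. \<Sum>l<k. J l z) \<in> BM M"
   using kM DM JM by auto
  have le: "AE z in M. (X (real k * h) z - E k z)^2 <= 0 + 2 * (\<Sum>l<k. D l z)^2 + 2 * (\<Sum>l<k. J l z)^2"
   using decomp
  proof eventually_elim
   case (elim z)
   have "X (real k * h) z - E k z = (\<Sum>l<k. D l z) + (\<Sum>l<k. J l z)" using elim less.prems by blast
   then show ?case by (simp only: add_0_left two_squares)
  qed
  have b0': "0 <= (\<Sum>l<k. b l * h)" "0 <= T" using b0 h T_pos by (auto intro: sum_nonneg)
  have "nnE M (%z. (X (real k * h) z - E k z)^2) <= ennreal (0 + 2 * (T * (\<Sum>l<k. b l * h)) + 2 * (\<Sum>l<k. b l * h))"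
   by (rule nn_bound2[OF le _ _ _ _ _ ED' _ _ _ EJ]) (use b0' SDM in auto)
  also have "\<dots> <= ennreal (a k)"
  proof (intro ennreal_leI)
   have "2 * (T * (\<Sum>l<k. b l * h)) + 2 * (\<Sum>l<k. b l * h) = 2 * (T + 1) * (\<Sum>l<k. c^2 * (2 * (incr_bound * h)) * h + 2 * c^2 * h * a l)"
    by (simp add: b_def algebra_simps)
   also have "\<dots> = euler_rate * incr_bound * (real k * h) * h + \<alpha> * (\<Sum>l<k. a l)"
   proof -
    have "(\<Sum>l<k. c^2 * (2 * (incr_bound * h)) * h + 2 * c^2 * h * a l)
     = real k * (c^2 * (2 * (incr_bound * h)) * h) + 2 * c^2 * h * (\<Sum>l<k. a l)"
     by (simp add: sum.distrib sum_distrib_left[symmetric])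
    then show ?thesis by (simp add: euler_rate_def \<alpha>_def algebra_simps)
   qed
   also have "\<dots> <= euler_rate * incr_bound * T * h + \<alpha> * (\<Sum>l<k. a l)"
    using tm[of k] less.prems \<alpha>0 incr_bound_nonneg h by (intro add_mono order_refl mult_right_mono mult_left_mono) auto
   also have "\<dots> = a k" using discrete_gronwall_solution[of ga \<alpha> k] by (simp add: a_def ga_def)
   finally show "0 + 2 * (T * (\<Sum>l<k. b l * h)) + 2 * (\<Sum>l<k. b l * h) <= a k" by simp
  qed
  finally show ?case .
 qed
 from this[OF k] have "nnE M (%z. (X (real k * h) z - E k z)^2) <= ennreal (a k)" .
 also have "a k <= euler_const * h"
 proof -
  have "(1 + \<alpha>) ^ k <= exp \<alpha> ^ k" using \<alpha>0 by (intro power_mono) auto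
  also have "\<dots> = exp (euler_rate * (real k * h))" by (simp add: exp_of_nat_mult[symmetric] \<alpha>_def mult_ac)
  also have "\<dots> <= exp (euler_rate * T)" using tm[OF k] \<alpha>0 by (simp add: mult_left_mono)
  finally have "a k <= ga * exp (euler_rate * T)" unfolding a_def using \<alpha>0 by (intro mult_left_mono) auto
  then show ?thesis by (simp add: ga_def euler_const_def mult_ac)
 qed
 finally show "nnE M (%z. (X (real k * h) z - E k z)^2) <= ennreal (euler_const * h)"
  by (simp add: ennreal_leI)
qed

end

section \<open>Laws and independence of the inputs of the Euler scheme\<close>

lemma coordinate_event:
 assumes "i \<in> J" "S \<in> sets N"
 shows "(%f. f i) -` S \<inter> space (\<Pi>\<^sub>M j\<in>J. N) \<in> sets (\<Pi>\<^sub>M j\<in>J. N)"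
 using measurable_component_singleton[OF assms(1), of "%_. N"] assms(2) by (rule measurable_sets)

lemma (in prob_space) prob_indep_rv:
 assumes "indep_rv M S Y R Z" "A \<in> sets S" "B \<in> sets R"
 shows "prob (Y -` A \<inter> space M \<inter> (Z -` B \<inter> space M)) = prob (Y -` A \<inter> space M) * prob (Z -` B \<inter> space M)"
proof -
 have "Y -` A \<inter> space M \<in> sets (vimage_algebra (space M) Y S)" "Z -` B \<inter> space M \<in> sets (vimage_algebra (space M) Z R)"
  using assms(2,3) by (auto intro: in_vimage_algebra)
 then show ?thesis using assms(1) unfolding indep_rv_def indep_sets2_eq by blast
qed

context filtered_bm begin

lemma W_incr_prob:
 assumes "0 <= s" "s < t" "t <= T" "A \<in> sets borel"
 shows "prob {w \<in> space M. W t w - W s w \<in> A} = measure (density lborel (normal_density 0 (sqrt (t - s)))) A"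
proof -
 have [measurable]: "W t \<in> BM M" "W s \<in> BM M" using W_M assms by auto
 have "distr M lborel (%w. W t w - W s w) = density lborel (normal_density 0 (sqrt (t - s)))"
  by (rule distributed_distr_eq_density[OF W_incr_dist[OF assms(1-3)]])
 then have "measure (density lborel (normal_density 0 (sqrt (t - s)))) A = measure (distr M lborel (%w. W t w - W s w)) A" by simp
 also have "\<dots> = prob ((%w. W t w - W s w) -` A \<inter> space M)" using assms by (subst measure_distr) auto
 also have "(%w. W t w - W s w) -` A \<inter> space M = {w \<in> space M. W t w - W s w \<in> A}" by auto
 finally show ?thesis by simp
qed

text \<open>The events about the first \<open>j\<close> increments belong to the filtration at time
  \<open>j * h\<close>, of which the next increment is independent; so one factor splits off in each
  induction step.\<close>

lemma W_incrs_prob: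
 assumes h: "0 < h" "real m * h <= T" and A: "!!l. l < m ==> A l \<in> sets borel"
 shows "prob {w \<in> space M. \<forall>l<m. W (real (Suc l) * h) w - W (real l * h) w \<in> A l}
  = (\<Prod>l<m. measure (density lborel (normal_density 0 (sqrt h))) (A l))"
proof -
 let ?E = "%j. {w \<in> space M. \<forall>l<j. W (real (Suc l) * h) w - W (real l * h) w \<in> A l}"
 have tm: "0 <= real k * h" "real k * h <= T" if "k <= m" for k
 proof -
  have "real k * h <= real m * h" using that h by (intro mult_right_mono) auto
  then show "real k * h <= T" using h(2) by (rule order_trans)
 qed (use h in auto)
 have "prob (?E j) = (\<Prod>l<j. measure (density lborel (normal_density 0 (sqrt h))) (A l))" if "j <= m" for j
  using that
 proof (induction j)
  case 0
  then show ?case by (simp add: prob_space)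
 next
  case (Suc j)
  let ?D = "%w. W (real (Suc j) * h) w - W (real j * h) w"
  have sp: "space (F t) = space M" for t using subalg by (simp add: subalgebra_def)
  have "?E j \<in> sets (F (real j * h))"
  proof -
   have "{w \<in> space (F (real j * h)). \<forall>l\<in>{..<j}. W (real (Suc l) * h) w - W (real l * h) w \<in> A l} \<in> sets (F (real j * h))"
   proof (intro sets.sets_Collect_finite_All)
    fix l assume l: "l \<in> {..<j}"
    have le: "real (Suc l) * h <= real j * h" "real l * h <= real j * h" using l h by (auto intro!: mult_right_mono simp del: of_nat_Suc)
    have W1: "W (real (Suc l) * h) \<in> BM (F (real j * h))" and W2: "W (real l * h) \<in> BM (F (real j * h))"
     using F_mono[OF le(1) W_F] F_mono[OF le(2) W_F] tm[of "Suc l"] tm[of l] l Suc.prems by auto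
    have "(%w. W (real (Suc l) * h) w - W (real l * h) w) -` A l \<inter> space (F (real j * h)) \<in> sets (F (real j * h))"
     using l Suc.prems by (intro measurable_sets[OF borel_measurable_diff[OF W1 W2] A]) auto
    moreover have "(%w. W (real (Suc l) * h) w - W (real l * h) w) -` A l \<inter> space (F (real j * h))
     = {w \<in> space (F (real j * h)). W (real (Suc l) * h) w - W (real l * h) w \<in> A l}" by auto
    ultimately show "{w \<in> space (F (real j * h)). W (real (Suc l) * h) w - W (real l * h) w \<in> A l} \<in> sets (F (real j * h))" by simp
   qed simp
   moreover have "(\<forall>l<j. P l) = (\<forall>l\<in>{..<j}. P l)" for P by auto
   ultimately show ?thesis by (simp only: sp)
  qed
  moreover have "?D -` A j \<inter> space M \<in> sets (vimage_algebra (space M) ?D borel)"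
   using A Suc.prems by (intro in_vimage_algebra) auto
  moreover have "indep_set (sets (F (real j * h))) (sets (vimage_algebra (space M) ?D borel))"
  proof -
   have "0 <= real j * h" "real j * h < real (Suc j) * h" "real (Suc j) * h <= T"
    using tm[of j] tm[of "Suc j"] h Suc.prems by auto
   with bm show ?thesis unfolding brownian_motion_def by blast
  qed
  ultimately have "prob (?E j \<inter> (?D -` A j \<inter> space M)) = prob (?E j) * prob (?D -` A j \<inter> space M)"
   unfolding indep_sets2_eq by blast
  moreover have "?E j \<inter> (?D -` A j \<inter> space M) = ?E (Suc j)" by (auto simp: less_Suc_eq)
  moreover have "?D -` A j \<inter> space M = {w \<in> space M. ?D w \<in> A j}" by auto
  moreover have "prob {w \<in> space M. ?D w \<in> A j} = measure (density lborel (normal_density 0 (sqrt h))) (A j)"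
   using W_incr_prob[of "real j * h" "real (Suc j) * h" "A j"] tm[of j] tm[of "Suc j"] h A Suc.prems
   by (simp add: algebra_simps)
  ultimately show ?case using Suc by simp
 qed
 then show ?thesis by simp
qed

end

locale particle_system = prob_space M for M :: "'a measure" +
 fixes F :: "real => 'a measure" and T :: real and W X I :: "nat => real => 'a => real"
  and bt sg :: "real => real" and B c ka :: real
 assumes particle: "!!i. 1 <= i ==> sde_particle M F T (W i) bt sg (X i) (I i) B c ka"
  and indep_W: "indep_vars (%_. path_space T) (%i. sample_path T (W i)) {1..}"
  and indep_X0: "indep_vars (%_. borel) (%i. X i 0) {1..}"
  and law_X0: "!!i. 1 <= i ==> distr M borel (X i 0) = distr M borel (X 1 0)"
  and indep_W_X0: "indep_rv M
     (\<Pi>\<^sub>M i\<in>{1..}. path_space T) (%w. \<lambda>i\<in>{1..}. sample_path T (W i) w)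
     (\<Pi>\<^sub>M i\<in>{1..}. borel) (%w. \<lambda>i\<in>{1..}. X i 0 w)"
begin

lemma X0_M: "1 <= i ==> X i 0 \<in> BM M"
 using sde_particle.X_M[OF particle, of i 0] filtered_bm.T_pos[OF sde_particle.axioms(1)[OF particle], of i] by simp

text \<open>The initial value and the increments are indexed as one family, so that a single joint
  law describes all inputs of the scheme for one particle.\<close>

definition noise_vec :: "real => nat => nat => 'a => real" where
 "noise_vec h i k w = (case k of 0 => X i 0 w | Suc l => W i (real (Suc l) * h) w - W i (real l * h) w)"

definition noise_law :: "real => nat => real measure" where
 "noise_law h k = (case k of 0 => distr M borel (X 1 0) | Suc l => density lborel (normal_density 0 (sqrt h)))"

context
 fixes h :: real and m :: nat
 assumes h: "0 < h" and mh: "real m * h <= T"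
begin

lemma grid_le: assumes "k <= m" shows "0 <= real k * h" "real k * h <= T"
proof -
 have "real k * h <= real m * h" using assms h by (intro mult_right_mono) auto
 then show "real k * h <= T" using mh by (rule order_trans)
qed (use h in auto)

lemma noise_vec_M: "1 <= i ==> k <= m ==> noise_vec h i k \<in> BM M"
proof (cases k)
 case 0
 then show "1 <= i ==> k <= m ==> noise_vec h i k \<in> BM M" using X0_M by (simp add: noise_vec_def[abs_def])
next
 case (Suc l)
 show "1 <= i ==> k <= m ==> noise_vec h i k \<in> BM M"
  unfolding noise_vec_def[abs_def] Suc nat.case
  using grid_le[of l] grid_le[of "Suc l"]
  by (intro borel_measurable_diff filtered_bm.W_M[OF sde_particle.axioms(1)[OF particle]]) auto
qed

lemma path_event:
 assumes A: "!!k. k <= m ==> A k \<in> sets borel"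
 shows "{f \<in> space (path_space T). \<forall>l<m. f (real (Suc l) * h) - f (real l * h) \<in> A (Suc l)} \<in> sets (path_space T)"
proof -
 have "{f \<in> space (path_space T). \<forall>l\<in>{..<m}. f (real (Suc l) * h) - f (real l * h) \<in> A (Suc l)} \<in> sets (path_space T)"
 proof (intro sets.sets_Collect_finite_All)
  fix l assume l: "l \<in> {..<m}"
  have "real (Suc l) * h \<in> {0..T}" "real l * h \<in> {0..T}" using grid_le[of l] grid_le[of "Suc l"] l by auto
  then have "(%f. f (real (Suc l) * h) - f (real l * h)) \<in> BM (path_space T)"
   by (intro borel_measurable_diff measurable_component_singleton)
  from measurable_sets[OF this A[of "Suc l"]] l
  show "{f \<in> space (path_space T). f (real (Suc l) * h) - f (real l * h) \<in> A (Suc l)} \<in> sets (path_space T)"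
   by (simp add: vimage_def Int_def conj_commute)
 qed simp
 moreover have "(\<forall>l<m. P l) = (\<forall>l\<in>{..<m}. P l)" for P by auto
 ultimately show ?thesis by (simp only:)
qed

text \<open>The factors are split off at two levels: the Brownian paths from the initial values by
  \<open>indep_W_X0\<close>, and then one particle from the other within each group. The remaining
  laws do not depend on the particle.\<close>

lemma joint_prob:
 assumes ii: "1 <= i" "1 <= i'" "i \<noteq> i'" and A: "!!k. k <= m ==> A k \<in> sets borel" and A': "!!k. k <= m ==> A' k \<in> sets borel"
 shows "prob {w \<in> space M. (\<forall>k\<le>m. noise_vec h i k w \<in> A k) \<and> (\<forall>k\<le>m. noise_vec h i' k w \<in> A' k)}
  = (\<Prod>k\<le>m. measure (noise_law h k) (A k)) * (\<Prod>k\<le>m. measure (noise_law h k) (A' k))"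
proof -
 define S where "S A = {f \<in> space (path_space T). \<forall>l<m. f (real (Suc l) * h) - f (real l * h) \<in> A (Suc l)}" for A :: "nat => real set"
 have S_sets: "S C \<in> sets (path_space T)" if "!!k. k <= m ==> C k \<in> sets borel" for C
  unfolding S_def by (rule path_event[OF that])
 let ?Y = "%w. \<lambda>i\<in>{1..}. sample_path T (W i) w" and ?Z = "%w. \<lambda>i\<in>{1..}. X i 0 w"
 let ?EW = "{f \<in> space (\<Pi>\<^sub>M i\<in>{1..}. path_space T). f i \<in> S A \<and> f i' \<in> S A'}"
 let ?EX = "{f \<in> space (\<Pi>\<^sub>M i\<in>{1..}. borel). f i \<in> A 0 \<and> f i' \<in> A' 0} :: (nat => real) set"
 have EW: "?EW \<in> sets (\<Pi>\<^sub>M i\<in>{1..}. path_space T)"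
 proof -
  have "(%f. f i) -` S A \<inter> space (\<Pi>\<^sub>M i\<in>{1..}. path_space T) \<in> sets (\<Pi>\<^sub>M i\<in>{1..}. path_space T)"
   "(%f. f i') -` S A' \<inter> space (\<Pi>\<^sub>M i\<in>{1..}. path_space T) \<in> sets (\<Pi>\<^sub>M i\<in>{1..}. path_space T)"
   using ii S_sets[OF A] S_sets[OF A'] by (auto intro!: coordinate_event)
  from sets.Int[OF this] show ?thesis by (rule back_subst[where P="%S. S \<in> _"]) auto
 qed
 have EX: "?EX \<in> sets (\<Pi>\<^sub>M i\<in>{1..}. borel)"
 proof -
  have "(%f. f i) -` A 0 \<inter> space (\<Pi>\<^sub>M i\<in>{1..}. borel) \<in> sets (\<Pi>\<^sub>M i\<in>{1..}. borel)"
   "(%f. f i') -` A' 0 \<inter> space (\<Pi>\<^sub>M i\<in>{1..}. borel) \<in> sets (\<Pi>\<^sub>M i\<in>{1..}. borel)"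
   using ii A[of 0] A'[of 0] by (auto intro!: coordinate_event)
  from sets.Int[OF this] show ?thesis by (rule back_subst[where P="%S. S \<in> _"]) auto
 qed
 have sp: "sample_path T (W k) w \<in> space (path_space T)" for k w
  by (auto simp: sample_path_def space_PiM)
 have incr: "sample_path T (W k) w (real (Suc l) * h) - sample_path T (W k) w (real l * h) = noise_vec h k (Suc l) w" if "l < m" for k l w
  using grid_le[of l] grid_le[of "Suc l"] that by (auto simp: sample_path_def noise_vec_def simp del: of_nat_Suc)
 have S_iff: "sample_path T (W k) w \<in> S C \<longleftrightarrow> (\<forall>l<m. noise_vec h k (Suc l) w \<in> C (Suc l))" for k w C
 proof
  assume *: "sample_path T (W k) w \<in> S C"
  show "\<forall>l<m. noise_vec h k (Suc l) w \<in> C (Suc l)"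
  proof (intro allI impI)
   fix l assume l: "l < m"
   with * have "sample_path T (W k) w (real (Suc l) * h) - sample_path T (W k) w (real l * h) \<in> C (Suc l)"
    unfolding S_def by blast
   then show "noise_vec h k (Suc l) w \<in> C (Suc l)" unfolding incr[OF l] .
  qed
 next
  assume *: "\<forall>l<m. noise_vec h k (Suc l) w \<in> C (Suc l)"
  show "sample_path T (W k) w \<in> S C"
   unfolding S_def mem_Collect_eq
  proof (intro conjI allI impI sp)
   fix l assume l: "l < m"
   show "sample_path T (W k) w (real (Suc l) * h) - sample_path T (W k) w (real l * h) \<in> C (Suc l)"
    unfolding incr[OF l] using * l by blast
  qed
 qed
 have YE: "?Y -` ?EW \<inter> space M = {w \<in> space M. (\<forall>l<m. noise_vec h i (Suc l) w \<in> A (Suc l)) \<and> (\<forall>l<m. noise_vec h i' (Suc l) w \<in> A' (Suc l))}"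
 proof -
  have "?Y w \<in> space (\<Pi>\<^sub>M i\<in>{1..}. path_space T)" for w using sp unfolding space_PiM by (intro restrict_PiE_iff[THEN iffD2]) auto
  then show ?thesis using ii by (auto simp only: vimage_eq Int_iff mem_Collect_eq restrict_apply' S_iff atLeast_iff)
 qed
 have ZE: "?Z -` ?EX \<inter> space M = {w \<in> space M. noise_vec h i 0 w \<in> A 0 \<and> noise_vec h i' 0 w \<in> A' 0}"
  using ii by (auto simp: space_PiM PiE_iff noise_vec_def)
 have all: "(\<forall>k\<le>m. P k) \<longleftrightarrow> P 0 \<and> (\<forall>l<m. P (Suc l))" for P
 proof
  assume *: "P 0 \<and> (\<forall>l<m. P (Suc l))"
  show "\<forall>k\<le>m. P k"
  proof (intro allI impI)
   fix k show "k <= m ==> P k" using * by (cases k) auto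
  qed
 qed auto
 have "{w \<in> space M. (\<forall>k\<le>m. noise_vec h i k w \<in> A k) \<and> (\<forall>k\<le>m. noise_vec h i' k w \<in> A' k)}
  = (?Y -` ?EW \<inter> space M) \<inter> (?Z -` ?EX \<inter> space M)"
  unfolding YE ZE all by auto
 then have 1: "prob {w \<in> space M. (\<forall>k\<le>m. noise_vec h i k w \<in> A k) \<and> (\<forall>k\<le>m. noise_vec h i' k w \<in> A' k)}
  = prob (?Y -` ?EW \<inter> space M) * prob (?Z -` ?EX \<inter> space M)"
  using prob_indep_rv[OF indep_W_X0 EW EX] by simp
 have pX: "prob (X k 0 -` C \<inter> space M) = measure (noise_law h 0) C" if "1 <= k" "C \<in> sets borel" for k C
  using law_X0[OF that(1)] measure_distr[OF X0_M[OF that(1)] that(2)] by (simp add: noise_law_def)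
 have "?Z -` ?EX \<inter> space M = (\<Inter>k\<in>{i, i'}. X k 0 -` (if k = i then A 0 else A' 0) \<inter> space M)"
  unfolding ZE using ii by (auto simp: noise_vec_def)
 also have "prob \<dots> = (\<Prod>k\<in>{i, i'}. prob (X k 0 -` (if k = i then A 0 else A' 0) \<inter> space M))"
  using A A' ii by (intro indep_varsD[OF indep_X0]) auto
 also have "\<dots> = measure (noise_law h 0) (A 0) * measure (noise_law h 0) (A' 0)"
  using ii A A' by (simp add: pX)
 finally have 2: "prob (?Z -` ?EX \<inter> space M) = measure (noise_law h 0) (A 0) * measure (noise_law h 0) (A' 0)" .
 have pW: "prob (sample_path T (W k) -` S C \<inter> space M) = (\<Prod>l<m. measure (noise_law h (Suc l)) (C (Suc l)))"
  if "1 <= k" "!!j. j <= m ==> C j \<in> sets borel" for k C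
 proof -
  have "sample_path T (W k) -` S C \<inter> space M = {w \<in> space M. \<forall>l<m. W k (real (Suc l) * h) w - W k (real l * h) w \<in> C (Suc l)}"
   using S_iff[of k _ C] by (auto simp: noise_vec_def simp del: of_nat_Suc)
  moreover have "prob {w \<in> space M. \<forall>l<m. W k (real (Suc l) * h) w - W k (real l * h) w \<in> C (Suc l)}
   = (\<Prod>l<m. measure (density lborel (normal_density 0 (sqrt h))) (C (Suc l)))"
   using that by (intro filtered_bm.W_incrs_prob[OF sde_particle.axioms(1)[OF particle] h mh]) auto
  ultimately show ?thesis by (simp add: noise_law_def)
 qed
 have "?Y -` ?EW \<inter> space M = (\<Inter>k\<in>{i, i'}. sample_path T (W k) -` (if k = i then S A else S A') \<inter> space M)"
  unfolding YE using ii by (auto simp: S_iff)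
 also have "prob \<dots> = (\<Prod>k\<in>{i, i'}. prob (sample_path T (W k) -` (if k = i then S A else S A') \<inter> space M))"
  using S_sets[OF A] S_sets[OF A'] ii by (intro indep_varsD[OF indep_W]) auto
 also have "\<dots> = (\<Prod>l<m. measure (noise_law h (Suc l)) (A (Suc l))) * (\<Prod>l<m. measure (noise_law h (Suc l)) (A' (Suc l)))"
  using ii pW[OF ii(1) A] pW[OF ii(2) A'] by simp
 finally have 3: "prob (?Y -` ?EW \<inter> space M) = (\<Prod>l<m. measure (noise_law h (Suc l)) (A (Suc l))) * (\<Prod>l<m. measure (noise_law h (Suc l)) (A' (Suc l)))" .
 show ?thesis unfolding 1 2 3 lessThan_Suc_atMost[symmetric] prod.lessThan_Suc_shift by (simp add: mult_ac)
qed

lemma prob_space_noise_law: "prob_space (noise_law h k)"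
 using h X0_M[of 1] by (auto simp: noise_law_def split: nat.split intro!: prob_space_distr prob_space_normal_density)

lemma noise_vec_prob:
 assumes i: "1 <= i" and A: "!!k. k <= m ==> A k \<in> sets borel"
 shows "prob {w \<in> space M. \<forall>k\<le>m. noise_vec h i k w \<in> A k} = (\<Prod>k\<le>m. measure (noise_law h k) (A k))"
proof -
 have "measure (noise_law h k) UNIV = 1" for k
 proof -
  have "space (noise_law h k) = UNIV" by (simp add: noise_law_def split: nat.split)
  then show ?thesis using prob_space.prob_space[OF prob_space_noise_law[of k]] by simp
 qed
 \<comment> \<open>A second particle with trivial events contributes only factors 1.\<close>
 then show ?thesis using joint_prob[of i "Suc i" A "%_. UNIV"] i A by simp
qed

lemma noise_vec_law:
 assumes i: "1 <= i" and k: "k <= m" and C: "C \<in> sets borel"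
 shows "prob (noise_vec h i k -` C \<inter> space M) = measure (noise_law h k) C"
proof -
 have 1: "measure (noise_law h j) UNIV = 1" for j
 proof -
  have "space (noise_law h j) = UNIV" by (simp add: noise_law_def split: nat.split)
  then show ?thesis using prob_space.prob_space[OF prob_space_noise_law[of j]] by simp
 qed
 have "noise_vec h i k -` C \<inter> space M = {w \<in> space M. \<forall>j\<le>m. noise_vec h i j w \<in> (if j = k then C else UNIV)}"
  using k by auto
 also have "prob \<dots> = (\<Prod>j\<le>m. measure (noise_law h j) (if j = k then C else UNIV))"
  using C by (intro noise_vec_prob[OF i]) auto
 also have "\<dots> = (\<Prod>j\<in>{k}. measure (noise_law h j) (if j = k then C else UNIV))"
  using k 1 by (intro prod.mono_neutral_right) auto
 finally show ?thesis by simp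
qed

lemma indep_noise_vec_pair:
 assumes ii: "1 <= i" "1 <= i'" "i \<noteq> i'"
 shows "indep_vars (%_. borel) (%(j, k). noise_vec h j k) ({i, i'} \<times> {..m})"
proof (subst indep_vars_finite[where E="%_. sets borel"])
 show "\<forall>A\<in>{i, i'} \<times> {..m} \<rightarrow> sets borel. prob (\<Inter>z\<in>{i, i'} \<times> {..m}. (case z of (j, k) => noise_vec h j k) -` A z \<inter> space M)
  = (\<Prod>z\<in>{i, i'} \<times> {..m}. prob ((case z of (j, k) => noise_vec h j k) -` A z \<inter> space M))"
 proof
  fix A :: "nat \<times> nat => real set" assume A: "A \<in> {i, i'} \<times> {..m} \<rightarrow> sets borel"
  have Ai: "A (i, k) \<in> sets borel" and Ai': "A (i', k) \<in> sets borel" if "k <= m" for k using A that by auto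
  have eq: "(\<Inter>z\<in>{i, i'} \<times> {..m}. (case z of (j, k) => noise_vec h j k) -` A z \<inter> space M)
   = {w \<in> space M. (\<forall>k\<le>m. noise_vec h i k w \<in> A (i, k)) \<and> (\<forall>k\<le>m. noise_vec h i' k w \<in> A (i', k))}"
   by auto
  have "prob (\<Inter>z\<in>{i, i'} \<times> {..m}. (case z of (j, k) => noise_vec h j k) -` A z \<inter> space M)
   = (\<Prod>k\<le>m. measure (noise_law h k) (A (i, k))) * (\<Prod>k\<le>m. measure (noise_law h k) (A (i', k)))"
   unfolding eq by (rule joint_prob[OF ii, of "%k. A (i, k)" "%k. A (i', k)"]) (fact Ai Ai')+
  also have "\<dots> = (\<Prod>k\<le>m. prob (noise_vec h i k -` A (i, k) \<inter> space M)) * (\<Prod>k\<le>m. prob (noise_vec h i' k -` A (i', k) \<inter> space M))"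
  proof (intro arg_cong2[where f="(*)"] prod.cong refl)
   fix k assume "k \<in> {..m}"
   then have k: "k <= m" by simp
   show "measure (noise_law h k) (A (i, k)) = prob (noise_vec h i k -` A (i, k) \<inter> space M)"
    by (rule noise_vec_law[OF ii(1) k Ai[OF k], symmetric])
   show "measure (noise_law h k) (A (i', k)) = prob (noise_vec h i' k -` A (i', k) \<inter> space M)"
    by (rule noise_vec_law[OF ii(2) k Ai'[OF k], symmetric])
  qed
  also have "\<dots> = (\<Prod>z\<in>{i, i'} \<times> {..m}. prob ((case z of (j, k) => noise_vec h j k) -` A z \<inter> space M))"
   unfolding prod.cartesian_product' using ii by simp
  finally show "prob (\<Inter>z\<in>{i, i'} \<times> {..m}. (case z of (j, k) => noise_vec h j k) -` A z \<inter> space M)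
   = (\<Prod>z\<in>{i, i'} \<times> {..m}. prob ((case z of (j, k) => noise_vec h j k) -` A z \<inter> space M))" .
 qed
 show "(case z of (j, k) => noise_vec h j k) \<in> BM M" if "z \<in> {i, i'} \<times> {..m}" for z
  using that ii noise_vec_M by auto
qed (use sets.sigma_sets_eq[of "borel :: real measure"] in \<open>auto simp: Int_stable_def\<close>)

lemma indep_noise_vec_single:
 assumes i: "1 <= i"
 shows "indep_vars (%_. borel) (noise_vec h i) {..m}"
proof (subst indep_vars_finite[where E="%_. sets borel"])
 show "\<forall>A\<in>{..m} \<rightarrow> sets borel. prob (\<Inter>k\<in>{..m}. noise_vec h i k -` A k \<inter> space M) = (\<Prod>k\<in>{..m}. prob (noise_vec h i k -` A k \<inter> space M))"
 proof
  fix A :: "nat => real set" assume A: "A \<in> {..m} \<rightarrow> sets borel"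
  have eq: "(\<Inter>k\<in>{..m}. noise_vec h i k -` A k \<inter> space M) = {w \<in> space M. \<forall>k\<le>m. noise_vec h i k w \<in> A k}" by auto
  have "prob (\<Inter>k\<in>{..m}. noise_vec h i k -` A k \<inter> space M) = (\<Prod>k\<le>m. measure (noise_law h k) (A k))" unfolding eq by (rule noise_vec_prob[OF i]) (use A in auto)
  also have "\<dots> = (\<Prod>k\<in>{..m}. prob (noise_vec h i k -` A k \<inter> space M))"
  proof (intro prod.cong refl)
   fix k assume "k \<in> {..m}"
   then show "measure (noise_law h k) (A k) = prob (noise_vec h i k -` A k \<inter> space M)"
    using noise_vec_law[OF i, of k "A k"] Pi_mem[OF A, of k] by simp
  qed
  finally show "prob (\<Inter>k\<in>{..m}. noise_vec h i k -` A k \<inter> space M) = (\<Prod>k\<in>{..m}. prob (noise_vec h i k -` A k \<inter> space M))" .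
 qed
qed (use noise_vec_M i sets.sigma_sets_eq[of "borel :: real measure"] in \<open>auto simp: Int_stable_def\<close>)

lemma noise_functional_expectation:
 assumes "1 <= i" "1 <= i'" and Ph: "Ph \<in> BM (\<Pi>\<^sub>M k\<in>{..m}. borel)"
 shows "expectation (%w. Ph (\<lambda>k\<in>{..m}. noise_vec h i k w)) = expectation (%w. Ph (\<lambda>k\<in>{..m}. noise_vec h i' k w) :: real)"
proof -
 have law: "distr M borel (noise_vec h j k) = distr M borel (noise_vec h i k)" if "1 <= j" "k <= m" for j k
 proof (rule measure_eqI)
  fix C assume "C \<in> sets (distr M borel (noise_vec h j k))"
  then have C: "C \<in> sets borel" by simp
  show "emeasure (distr M borel (noise_vec h j k)) C = emeasure (distr M borel (noise_vec h i k)) C"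
   using noise_vec_M[OF that] noise_vec_M[OF assms(1) that(2)] C noise_vec_law[OF that C] noise_vec_law[OF assms(1) that(2) C]
   by (simp add: emeasure_distr emeasure_eq_measure)
 qed simp
 have "expectation (%w. Ph (\<lambda>k\<in>{..m}. noise_vec h j k w)) = integral\<^sup>L (\<Pi>\<^sub>M k\<in>{..m}. distr M borel (noise_vec h i k)) Ph" if j: "1 <= j" for j
 proof -
  have meas: "(%w. \<lambda>k\<in>{..m}. noise_vec h j k w) \<in> M \<rightarrow>\<^sub>M (\<Pi>\<^sub>M k\<in>{..m}. borel)"
   using noise_vec_M[OF j] by (intro measurable_restrict) auto
  have "distr M (\<Pi>\<^sub>M k\<in>{..m}. borel) (%w. \<lambda>k\<in>{..m}. noise_vec h j k w) = (\<Pi>\<^sub>M k\<in>{..m}. distr M borel (noise_vec h j k))"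
   using indep_vars_iff_distr_eq_PiM'[where I="{..m}" and M'="%_. borel" and X="noise_vec h j"] noise_vec_M[OF j] indep_noise_vec_single[OF j] by auto
  also have "\<dots> = (\<Pi>\<^sub>M k\<in>{..m}. distr M borel (noise_vec h i k))"
   using law[OF j] by (intro PiM_cong) auto
  finally have "integral\<^sup>L (\<Pi>\<^sub>M k\<in>{..m}. distr M borel (noise_vec h i k)) Ph = integral\<^sup>L (distr M (\<Pi>\<^sub>M k\<in>{..m}. borel) (%w. \<lambda>k\<in>{..m}. noise_vec h j k w)) Ph" by simp
  also have "\<dots> = expectation (%w. Ph (\<lambda>k\<in>{..m}. noise_vec h j k w))" by (rule integral_distr[OF meas Ph])
  finally show ?thesis by simp
 qed
 then show ?thesis using assms by simp
qed

lemma noise_functional_indep: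
 assumes ii: "1 <= i" "1 <= i'" "i \<noteq> i'" and Ph: "Ph \<in> BM (\<Pi>\<^sub>M k\<in>{..m}. borel)"
 shows "indep_var borel (%w. Ph (\<lambda>k\<in>{..m}. noise_vec h i k w)) borel (%w. Ph (\<lambda>k\<in>{..m}. noise_vec h i' k w) :: real)"
proof -
 have ind: "indep_var (\<Pi>\<^sub>M z\<in>{i} \<times> {..m}. borel) (%w. \<lambda>z\<in>{i} \<times> {..m}. (case z of (j, k) => noise_vec h j k) w)
  (\<Pi>\<^sub>M z\<in>{i'} \<times> {..m}. borel) (%w. \<lambda>z\<in>{i'} \<times> {..m}. (case z of (j, k) => noise_vec h j k) w)"
  using ii by (intro indep_var_restrict[OF indep_noise_vec_pair[OF ii]]) auto
 have m: "(%v. Ph (\<lambda>k\<in>{..m}. v (j, k))) \<in> BM (\<Pi>\<^sub>M z\<in>{j} \<times> {..m}. borel)" for j :: nat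
  by (rule measurable_compose[OF _ Ph]) (intro measurable_restrict measurable_component_singleton; simp)
 from indep_var_compose[OF ind m m] show ?thesis
  by (simp add: comp_def cong: restrict_cong)
qed

end

end

section \<open>Uncorrelated path functionals and their averages\<close>

definition clamp_to :: "real => real => real" where
 "clamp_to R z = max (- R) (min R z)"

lemma clamp_to_bound: "0 <= R ==> \<bar>clamp_to R z\<bar> <= R" "0 <= R ==> \<bar>clamp_to R z\<bar> <= \<bar>z\<bar>"
 by (auto simp: clamp_to_def)

lemma clamp_to_meas [measurable]: "clamp_to R \<in> BM borel"
 unfolding clamp_to_def[abs_def] by measurable

lemma clamp_to_tendsto: "(f \<longlongrightarrow> z) G ==> ((%x. clamp_to R (f x)) \<longlongrightarrow> clamp_to R z) G"
 unfolding clamp_to_def by (intro tendsto_intros)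

lemma clamp_to_at_top: "(%r. clamp_to (real r) z) \<longlonglongrightarrow> z"
proof -
 obtain n0 where n0: "\<bar>z\<bar> <= real n0" using real_arch_simple by blast
 have "\<forall>\<^sub>F r in sequentially. z = clamp_to (real r) z"
  by (rule eventually_mono[OF eventually_ge_at_top[of n0]]) (use n0 in \<open>auto simp: clamp_to_def\<close>)
 then show ?thesis by (rule Lim_transform_eventually[OF tendsto_const])
qed

lemma euler_cong: "(!!l. l < k ==> d l = d' l) ==> euler bt sg h x d k = euler bt sg h x d' k"
 by (induction k) auto

lemma euler_measurable:
 assumes [measurable]: "bt \<in> BM borel" "sg \<in> BM borel" and "k <= m"
 shows "(%v. euler bt sg h (v 0) (%l. v (Suc l)) k) \<in> BM (\<Pi>\<^sub>M k\<in>{..m}. borel)"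
 using assms(3)
proof (induction k)
 case 0
 then show ?case by (simp add: measurable_component_singleton)
next
 case (Suc k)
 have [measurable]: "(%v. v (Suc k)) \<in> BM (\<Pi>\<^sub>M k\<in>{..m}. borel)"
  using Suc.prems by (intro measurable_component_singleton) auto
 have [measurable]: "(%v. euler bt sg h (v 0) (%l. v (Suc l)) k) \<in> BM (\<Pi>\<^sub>M k\<in>{..m}. borel)"
  using Suc by auto
 show ?case by simp
qed

context particle_system begin

definition path_sum :: "(real => real => real) => nat => nat => 'a => real" where
 "path_sum g n i w = (\<Sum>j<n. g (X i (real j * (T / real n)) w) (X i (real (Suc j) * (T / real n)) w))"

context
 fixes g :: "real => real => real" and n :: nat
 assumes g: "continuous_on UNIV (%z. g (fst z) (snd z))" and n: "1 <= n"
begin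

lemma T_pos: "0 < T"
 using filtered_bm.T_pos[OF sde_particle.axioms(1)[OF particle[of 1]]] by simp

lemma time_le: assumes "j <= n" shows "0 <= real j * (T / real n)" "real j * (T / real n) <= T"
proof -
 show "0 <= real j * (T / real n)" using T_pos by simp
 have "real j * (T / real n) <= real n * (T / real n)" using assms T_pos by (intro mult_right_mono) auto
 then show "real j * (T / real n) <= T" using n by simp
qed

lemma g_meas [measurable]: "(%z. g (fst z) (snd z)) \<in> BM (borel \<Otimes>\<^sub>M borel)"
 using borel_measurable_continuous_onI[OF g] by (simp add: borel_prod)

lemma g_compose: assumes "u \<in> BM N" "v \<in> BM N" shows "(%x. g (u x) (v x)) \<in> BM N"
 using measurable_compose[OF measurable_Pair[OF assms] g_meas] by simp

lemma path_sum_M: assumes "1 <= i" shows "path_sum g n i \<in> BM M"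
 unfolding path_sum_def[abs_def]
 by (intro borel_measurable_sum g_compose sde_particle.X_M[OF particle[OF assms]] time_le) auto

text \<open>Every observation interval is divided into \<open>Suc r\<close> Euler steps, so the
  observation times stay on the Euler grid for all \<open>r\<close>.\<close>

definition euler_sum :: "nat => (nat => real) => real" where
 "euler_sum r v = (let h = T / real (n * Suc r); e = euler bt sg h (v 0) (%l. v (Suc l)) in
  (\<Sum>j<n. g (e (j * Suc r)) (e (Suc j * Suc r))))"

lemma coeff_meas: "bt \<in> BM borel" "sg \<in> BM borel"
 using sde_particle.bt_meas[OF particle[of 1]] sde_particle.sg_meas[OF particle[of 1]] by auto

lemma euler_sum_meas: "(%v. clamp_to R (euler_sum r v)) \<in> BM (\<Pi>\<^sub>M k\<in>{..n * Suc r}. borel)"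
proof -
 have "euler_sum r \<in> BM (\<Pi>\<^sub>M k\<in>{..n * Suc r}. borel)"
  unfolding euler_sum_def[abs_def] Let_def
 proof (intro borel_measurable_sum g_compose euler_measurable coeff_meas)
  fix j assume "j \<in> {..<n}"
  then show "j * Suc r <= n * Suc r" "Suc j * Suc r <= n * Suc r" by (auto simp del: mult_Suc_right mult_Suc intro!: mult_le_mono)
 qed
 then show ?thesis by (rule measurable_compose[OF _ clamp_to_meas])
qed

text \<open>The mean square error at each observation time tends to 0; a common subsequence for
  finitely many particles and times converges almost surely, and the continuity of \<open>g\<close>
  carries this over to the sums.\<close>

lemma euler_sum_converges:
 assumes "finite J" and J: "!!i. i \<in> J ==> 1 <= i"
 shows "\<exists>s. strict_mono s \<and> (AE w in M. \<forall>i\<in>J. (%r. euler_sum (s r) (\<lambda>k\<in>{..n * Suc (s r)}. noise_vec (T / real (n * Suc (s r))) i k w)) \<longlonglongrightarrow> path_sum g n i w)"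
proof -
 define e where "e i r j w = euler bt sg (T / real (n * Suc r)) (X i 0 w) (%l. W i (real (Suc l) * (T / real (n * Suc r))) w - W i (real l * (T / real (n * Suc r))) w) (j * Suc r)" for i r j w
 have "\<exists>s. strict_mono s \<and> (AE w in M. \<forall>z\<in>J \<times> {..n}. (%r. X (fst z) (real (snd z) * (T / real n)) w - e (fst z) (s r) (snd z) w) \<longlonglongrightarrow> 0)"
 proof (rule tendsto_in_prob_AE_subseq_finite[OF prob_space_axioms, where Z="%z r w. X (fst z) (real (snd z) * (T / real n)) w - e (fst z) r (snd z) w"])
  fix z assume "z \<in> J \<times> {..n}"
  then obtain i j where z: "z = (i, j)" "i \<in> J" "j <= n" by auto
  interpret P: sde_particle M F T "W i" bt sg "X i" "I i" B c ka by (rule particle[OF J[OF z(2)]])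
  have jr: "j * Suc r <= n * Suc r" "1 <= n * Suc r" for r using z(3) n by (auto simp del: mult_Suc_right intro!: mult_le_mono)
  have time: "real (j * Suc r) * (T / real (n * Suc r)) = real j * (T / real n)" for r
  proof -
   have "real (j * Suc r) * (T / real (n * Suc r)) = (real j * T * real (Suc r)) / (real n * real (Suc r))"
    by (simp only: of_nat_mult times_divide_eq_right mult_ac)
   also have "\<dots> = real j * T / real n" by (rule mult_divide_mult_cancel_right) simp
   finally show ?thesis by simp
  qed
  note err = P.euler_error[OF jr(2,1), unfolded time]
  have m1 [measurable]: "e i r j \<in> BM M" for r
   using err(2)[of r] unfolding e_def[abs_def] .
  have m2 [measurable]: "X i (real j * (T / real n)) \<in> BM M"
   using P.X_M time_le[OF z(3)] by blast
  have lim0: "(%r. (P.euler_const * (T / real (n * Suc r))) / ep^2) \<longlonglongrightarrow> 0" for ep :: real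
  proof -
   have "(%r. (P.euler_const * T / real n / ep^2) * (1 / real (Suc r))) \<longlonglongrightarrow> (P.euler_const * T / real n / ep^2) * 0"
    by (intro tendsto_mult_left LIMSEQ_Suc[OF lim_1_over_n])
   moreover have "(P.euler_const * (T / real (n * Suc r))) / ep^2 = (P.euler_const * T / real n / ep^2) * (1 / real (Suc r))" for r
    by (simp only: of_nat_mult divide_divide_eq_left times_divide_eq_right times_divide_eq_left mult_1_right mult_ac)
   ultimately show ?thesis by (simp only: mult_zero_right)
  qed
  have c0: "0 <= P.euler_const * (T / real (n * Suc r))" for r
   using P.incr_bound_nonneg T_pos unfolding P.euler_const_def P.euler_rate_def
   by (intro mult_nonneg_nonneg) auto
  show "tendsto_in_prob M (%r w. X (fst z) (real (snd z) * (T / real n)) w - e (fst z) r (snd z) w) (%_. 0)"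
   unfolding tendsto_in_prob_def z fst_conv snd_conv
  proof (intro conjI allI impI)
   fix ep :: real assume "0 < ep"
   show "(%r. prob {w \<in> space M. ep < \<bar>X i (real j * (T / real n)) w - e i r j w - 0\<bar>}) \<longlonglongrightarrow> 0"
   proof (rule tendsto_sandwich[OF _ _ tendsto_const lim0[of ep]])
    show "\<forall>\<^sub>F r in sequentially. prob {w \<in> space M. ep < \<bar>X i (real j * (T / real n)) w - e i r j w - 0\<bar>} <= P.euler_const * (T / real (n * Suc r)) / ep^2"
    proof (intro always_eventually allI)
     fix r
     have "prob {w \<in> space M. ep < \<bar>(%w. X i (real j * (T / real n)) w - e i r j w) w\<bar>} <= P.euler_const * (T / real (n * Suc r)) / ep^2"
     proof (rule prob_gt_le_nn_integral_square)
      show "(%w. X i (real j * (T / real n)) w - e i r j w) \<in> BM M" by measurable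
      show "nnE M (%w. (X i (real j * (T / real n)) w - e i r j w)^2) <= ennreal (P.euler_const * (T / real (n * Suc r)))"
       using err(1)[of r] unfolding e_def .
     qed (fact \<open>0 < ep\<close> c0)+
     then show "prob {w \<in> space M. ep < \<bar>X i (real j * (T / real n)) w - e i r j w - 0\<bar>} <= P.euler_const * (T / real (n * Suc r)) / ep^2" by simp
    qed
   qed (use borel_measurable_diff[OF m2 m1] in simp_all)
  qed (use borel_measurable_diff[OF m2 m1] in simp_all)
 qed (use \<open>finite J\<close> in auto)
 then obtain s where s: "strict_mono s" "AE w in M. \<forall>z\<in>J \<times> {..n}. (%r. X (fst z) (real (snd z) * (T / real n)) w - e (fst z) (s r) (snd z) w) \<longlonglongrightarrow> 0" by blast
 have "AE w in M. \<forall>i\<in>J. (%r. euler_sum (s r) (\<lambda>k\<in>{..n * Suc (s r)}. noise_vec (T / real (n * Suc (s r))) i k w)) \<longlonglongrightarrow> path_sum g n i w"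
  using s(2)
 proof eventually_elim
  case (elim w)
  show ?case
  proof
   fix i assume i: "i \<in> J"
   have e_lim: "(%r. e i (s r) j w) \<longlonglongrightarrow> X i (real j * (T / real n)) w" if "j <= n" for j
   proof -
    have "(i, j) \<in> J \<times> {..n}" using i that by simp
    from bspec[OF elim this] have "(%r. X i (real j * (T / real n)) w - e i (s r) j w) \<longlonglongrightarrow> 0" by simp
    from tendsto_diff[OF tendsto_const[of "X i (real j * (T / real n)) w"] this] show ?thesis by simp
   qed
   have e_eq: "euler bt sg (T / real (n * Suc r)) ((\<lambda>k\<in>{..n * Suc r}. noise_vec (T / real (n * Suc r)) i k w) 0) (%l. (\<lambda>k\<in>{..n * Suc r}. noise_vec (T / real (n * Suc r)) i k w) (Suc l)) (j * Suc r) = e i r j w"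
    if "j <= n" for r j
   proof -
    have le: "j * Suc r <= n * Suc r" using that by (intro mult_le_mono) auto
    have "euler bt sg (T / real (n * Suc r)) (X i 0 w) (%l. (\<lambda>k\<in>{..n * Suc r}. noise_vec (T / real (n * Suc r)) i k w) (Suc l)) (j * Suc r) = e i r j w"
     unfolding e_def
    proof (rule euler_cong)
     fix l assume "l < j * Suc r"
     then have "Suc l \<in> {..n * Suc r}" using le by simp
     then show "(\<lambda>k\<in>{..n * Suc r}. noise_vec (T / real (n * Suc r)) i k w) (Suc l) = W i (real (Suc l) * (T / real (n * Suc r))) w - W i (real l * (T / real (n * Suc r))) w"
      unfolding restrict_def noise_vec_def by simp
    qed
    moreover have "(\<lambda>k\<in>{..n * Suc r}. noise_vec (T / real (n * Suc r)) i k w) 0 = X i 0 w" by (simp add: noise_vec_def)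
    ultimately show ?thesis by simp
   qed
   have "euler_sum r (\<lambda>k\<in>{..n * Suc r}. noise_vec (T / real (n * Suc r)) i k w) = (\<Sum>j<n. g (e i r j w) (e i r (Suc j) w))" for r
    unfolding euler_sum_def Let_def
    by (intro sum.cong refl arg_cong2[where f=g] e_eq) auto
   moreover have "(%r. \<Sum>j<n. g (e i (s r) j w) (e i (s r) (Suc j) w)) \<longlonglongrightarrow> path_sum g n i w"
    unfolding path_sum_def
   proof (intro tendsto_sum)
    fix j assume "j \<in> {..<n}"
    then have "(%r. (e i (s r) j w, e i (s r) (Suc j) w)) \<longlonglongrightarrow> (X i (real j * (T / real n)) w, X i (real (Suc j) * (T / real n)) w)"
     by (intro tendsto_Pair e_lim) auto
    from continuous_on_tendsto_compose[OF g this] show "(%r. g (e i (s r) j w) (e i (s r) (Suc j) w)) \<longlonglongrightarrow> g (X i (real j * (T / real n)) w) (X i (real (Suc j) * (T / real n)) w)" by simp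
   qed
   ultimately show "(%r. euler_sum (s r) (\<lambda>k\<in>{..n * Suc (s r)}. noise_vec (T / real (n * Suc (s r))) i k w)) \<longlonglongrightarrow> path_sum g n i w" by simp
  qed
 qed
 with s(1) show ?thesis by blast
qed

text \<open>For the Euler approximations both claims follow from the independence and the common law
  of the inputs. Clamping makes the functionals bounded, so that dominated convergence transports
  the claims to the solutions, whose own independence is never established.\<close>

lemma clamp_path_sum_moments:
 assumes ii: "1 <= i" "1 <= i'" and R: "0 <= R"
 shows "expectation (%y. clamp_to R (path_sum g n i y)) = expectation (%y. clamp_to R (path_sum g n i' y))"
  and "i \<noteq> i' ==> expectation (%y. clamp_to R (path_sum g n i y) * clamp_to R (path_sum g n i' y))
   = expectation (%y. clamp_to R (path_sum g n i y)) * expectation (%y. clamp_to R (path_sum g n i' y))"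
proof -
 define v where "v r i y = (\<lambda>k\<in>{..n * Suc r}. noise_vec (T / real (n * Suc r)) i k y)" for r i y
 define U where "U r i y = clamp_to R (euler_sum r (v r i y))" for r i y
 have hm: "0 < T / real (n * Suc r)" "real (n * Suc r) * (T / real (n * Suc r)) <= T" for r
  using T_pos n by (auto simp del: of_nat_Suc of_nat_mult)
 have UM [measurable]: "U r j \<in> BM M" if "1 <= j" for r j
  unfolding U_def[abs_def] v_def using noise_vec_M[OF hm that]
  by (intro measurable_compose[OF _ euler_sum_meas] measurable_restrict) auto
 have PM [measurable]: "path_sum g n i \<in> BM M" "path_sum g n i' \<in> BM M" using path_sum_M ii by auto
 have Ub: "\<bar>U r j y\<bar> <= R" for r j y unfolding U_def by (rule clamp_to_bound(1)[OF R])
 have Uint: "integrable M (U r j)" if "1 <= j" for r j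
  using UM[OF that] by (intro integrable_const_bound[of _ R]) (auto simp: Ub)
 obtain s where s: "strict_mono s" "AE y in M. \<forall>j\<in>{i, i'}. (%r. euler_sum (s r) (v (s r) j y)) \<longlonglongrightarrow> path_sum g n j y"
  using euler_sum_converges[of "{i, i'}"] ii unfolding v_def by auto
 have lim1: "(%r. expectation (U (s r) j)) \<longlonglongrightarrow> expectation (%y. clamp_to R (path_sum g n j y))" if "j \<in> {i, i'}" for j
 proof (rule integral_dominated_convergence[where w="%_. R"])
  show "(%y. clamp_to R (path_sum g n j y)) \<in> BM M" "U (s r) j \<in> BM M" for r using that PM UM ii by auto
  show "AE y in M. (%r. U (s r) j y) \<longlonglongrightarrow> clamp_to R (path_sum g n j y)"
   using s(2) by eventually_elim (use that in \<open>auto simp: U_def intro!: clamp_to_tendsto\<close>)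
 qed (use Ub in auto)
 have eq1: "expectation (U r i) = expectation (U r i')" for r
  using noise_functional_expectation[OF hm ii euler_sum_meas] unfolding U_def[abs_def] v_def .
 show 1: "expectation (%y. clamp_to R (path_sum g n i y)) = expectation (%y. clamp_to R (path_sum g n i' y))"
  using LIMSEQ_unique[OF lim1[of i]] lim1[of i'] unfolding eq1 by simp
 assume ne: "i \<noteq> i'"
 have "expectation (%y. U r i y * U r i' y) = expectation (U r i) * expectation (U r i')" for r
 proof (rule indep_var_lebesgue_integral)
  show "indep_var borel (U r i) borel (U r i')"
   using noise_functional_indep[OF hm ii ne euler_sum_meas] unfolding U_def[abs_def] v_def .
 qed (use Uint ii in auto)
 moreover have "(%r. expectation (%y. U (s r) i y * U (s r) i' y)) \<longlonglongrightarrow> expectation (%y. clamp_to R (path_sum g n i y) * clamp_to R (path_sum g n i' y))"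
 proof (rule integral_dominated_convergence[where w="%_. R * R"])
  show "(%y. U (s r) i y * U (s r) i' y) \<in> BM M" for r using UM ii by (intro borel_measurable_times) auto
  show "AE y in M. (%r. U (s r) i y * U (s r) i' y) \<longlonglongrightarrow> clamp_to R (path_sum g n i y) * clamp_to R (path_sum g n i' y)"
   using s(2) by eventually_elim (auto simp: U_def intro!: clamp_to_tendsto tendsto_mult)
  show "AE y in M. norm (U (s r) i y * U (s r) i' y) <= R * R" for r
   using Ub R by (intro AE_I2) (auto simp: abs_mult intro!: mult_mono)
 qed auto
 ultimately have "(%r. expectation (U (s r) i) * expectation (U (s r) i')) \<longlonglongrightarrow> expectation (%y. clamp_to R (path_sum g n i y) * clamp_to R (path_sum g n i' y))" by simp
 moreover have "(%r. expectation (U (s r) i) * expectation (U (s r) i')) \<longlonglongrightarrow> expectation (%y. clamp_to R (path_sum g n i y)) * expectation (%y. clamp_to R (path_sum g n i' y))"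
  by (intro tendsto_mult lim1) auto
 ultimately show "expectation (%y. clamp_to R (path_sum g n i y) * clamp_to R (path_sum g n i' y))
   = expectation (%y. clamp_to R (path_sum g n i y)) * expectation (%y. clamp_to R (path_sum g n i' y))"
  by (rule LIMSEQ_unique)
qed

text \<open>The clamp is removed by raising its level; the unclamped functional and the unclamped
  product serve as dominating functions.\<close>

lemma path_sum_moments:
 assumes ii: "1 <= i" "1 <= i'" and sq: "!!i. 1 <= i ==> integrable M (%z. (path_sum g n i z)^2)"
 shows "expectation (path_sum g n i) = expectation (path_sum g n i')"
  and "i \<noteq> i' ==> expectation (%z. path_sum g n i z * path_sum g n i' z) = expectation (path_sum g n i) * expectation (path_sum g n i')"
  and "integrable M (%z. path_sum g n i z * path_sum g n i' z)" and "integrable M (path_sum g n i)"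
proof -
 have PM [measurable]: "1 <= j ==> path_sum g n j \<in> BM M" for j using path_sum_M by auto
 have int: "integrable M (path_sum g n j)" if "1 <= j" for j
  using square_integrable_imp_integrable[OF PM[OF that] sq[OF that]] .
 then show "integrable M (path_sum g n i)" using ii by simp
 show prod: "integrable M (%z. path_sum g n i z * path_sum g n i' z)"
 proof (rule Bochner_Integration.integrable_bound)
  show "integrable M (%z. (path_sum g n i z)^2 + (path_sum g n i' z)^2)" using sq ii by (intro Bochner_Integration.integrable_add) auto
  show "(%z. path_sum g n i z * path_sum g n i' z) \<in> BM M" using ii by (intro borel_measurable_times PM)
  show "AE z in M. norm (path_sum g n i z * path_sum g n i' z) <= norm ((path_sum g n i z)^2 + (path_sum g n i' z)^2)"
  proof (intro AE_I2)
   fix z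
   have "2 * \<bar>x * y\<bar> <= x^2 + y^2" for x y :: real
    using zero_le_power2[of "\<bar>x\<bar> - \<bar>y\<bar>"] by (simp add: power2_eq_square algebra_simps abs_mult)
   from this[of "path_sum g n i z" "path_sum g n i' z"]
   show "norm (path_sum g n i z * path_sum g n i' z) <= norm ((path_sum g n i z)^2 + (path_sum g n i' z)^2)" by simp
  qed
 qed
 have lim: "(%r. expectation (%z. clamp_to (real r) (path_sum g n j z))) \<longlonglongrightarrow> expectation (path_sum g n j)" if j: "1 <= j" for j
 proof (rule integral_dominated_convergence[where w="%z. \<bar>path_sum g n j z\<bar>"])
  show "(%z. clamp_to (real r) (path_sum g n j z)) \<in> BM M" for r using PM[OF j] by measurable
 qed (use int j PM[OF j] in \<open>auto simp: clamp_to_at_top clamp_to_bound(2)\<close>)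
 show "expectation (path_sum g n i) = expectation (path_sum g n i')"
  using LIMSEQ_unique[OF lim[OF ii(1)]] lim[OF ii(2)] clamp_path_sum_moments(1)[OF ii] by simp
 assume ne: "i \<noteq> i'"
 have "(%r. expectation (%z. clamp_to (real r) (path_sum g n i z) * clamp_to (real r) (path_sum g n i' z))) \<longlonglongrightarrow> expectation (%z. path_sum g n i z * path_sum g n i' z)"
 proof (rule integral_dominated_convergence[where w="%z. \<bar>path_sum g n i z * path_sum g n i' z\<bar>"])
  show "(%z. clamp_to (real r) (path_sum g n i z) * clamp_to (real r) (path_sum g n i' z)) \<in> BM M" for r using PM ii by measurable
  show "(%z. path_sum g n i z * path_sum g n i' z) \<in> BM M" using PM ii by measurable
  show "integrable M (%z. \<bar>path_sum g n i z * path_sum g n i' z\<bar>)" using prod by (rule integrable_abs)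
  show "AE z in M. (%r. clamp_to (real r) (path_sum g n i z) * clamp_to (real r) (path_sum g n i' z)) \<longlonglongrightarrow> path_sum g n i z * path_sum g n i' z"
   by (intro AE_I2 tendsto_mult clamp_to_at_top)
  show "AE z in M. norm (clamp_to (real r) (path_sum g n i z) * clamp_to (real r) (path_sum g n i' z)) <= \<bar>path_sum g n i z * path_sum g n i' z\<bar>" for r
   by (intro AE_I2) (auto simp: abs_mult intro!: mult_mono clamp_to_bound(2))
 qed
 moreover have "(%r. expectation (%z. clamp_to (real r) (path_sum g n i z)) * expectation (%z. clamp_to (real r) (path_sum g n i' z))) \<longlonglongrightarrow> expectation (path_sum g n i) * expectation (path_sum g n i')"
  by (intro tendsto_mult lim ii)
 ultimately show "expectation (%z. path_sum g n i z * path_sum g n i' z) = expectation (path_sum g n i) * expectation (path_sum g n i')"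
  using clamp_path_sum_moments(2)[OF ii _ ne] LIMSEQ_unique by simp
qed

text \<open>The off-diagonal covariances vanish by \<open>path_sum_moments\<close> and the
  \<open>N\<close> diagonal ones are at most \<open>C\<close>, to be divided by the square of
  \<open>N\<close>.\<close>

lemma path_sum_mean_square:
 assumes sq: "!!i. 1 <= i ==> (nnE M (%w. (path_sum g n i w)^2)) <= ennreal C" and C: "0 <= C" and N: "1 <= N"
 shows "nnE M (%w. ((\<Sum>i=1..N. path_sum g n i w) / real N - expectation (path_sum g n 1))^2) <= ennreal (C / real N)"
proof -
 define mu where "mu = expectation (path_sum g n 1)"
 define Y where "Y i w = path_sum g n i w - mu" for i w
 have PM [measurable]: "1 <= j ==> path_sum g n j \<in> BM M" for j using path_sum_M by auto
 have int2: "integrable M (%w. (path_sum g n i w)^2)" "expectation (%w. (path_sum g n i w)^2) <= C" if "1 <= i" for i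
  using integrable_from_nn_integral_square[OF PM[OF that] C sq[OF that]] by auto
 have mean: "expectation (path_sum g n i) = mu" if "1 <= i" for i
  unfolding mu_def by (rule path_sum_moments(1)) (use that int2 in auto)
 have uncorr: "expectation (%w. path_sum g n i w * path_sum g n j w) = expectation (path_sum g n i) * expectation (path_sum g n j)"
  if "1 <= i" "1 <= j" "i \<noteq> j" for i j
  by (rule path_sum_moments(2)) (use that int2 in auto)
 have prod_int: "integrable M (%w. path_sum g n i w * path_sum g n j w)" if "1 <= i" "1 <= j" for i j
  by (rule path_sum_moments(3)) (use that int2 in auto)
 have int1: "integrable M (path_sum g n i)" if "1 <= i" for i
  by (rule path_sum_moments(4)[of i i]) (use that int2 in auto)
 have YY: "integrable M (%w. Y i w * Y j w) \<and> expectation (%w. Y i w * Y j w) <= (if i = j then C else 0)"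
  if ij: "1 <= i" "1 <= j" for i j
 proof -
  have eq: "(%w. Y i w * Y j w) = (%w. (path_sum g n i w * path_sum g n j w - mu * path_sum g n i w) - (mu * path_sum g n j w - mu^2))"
   by (simp add: Y_def fun_eq_iff power2_eq_square algebra_simps)
  note i1 = prod_int[OF ij] and i2 = integrable_mult_right[OF int1[OF ij(1)], of mu] and i3 = integrable_mult_right[OF int1[OF ij(2)], of mu]
  have I: "integrable M (%w. Y i w * Y j w)" unfolding eq using i1 i2 i3 by (intro Bochner_Integration.integrable_diff) auto
  have "expectation (%w. Y i w * Y j w) = expectation (%w. path_sum g n i w * path_sum g n j w) - mu * expectation (path_sum g n i) - (mu * expectation (path_sum g n j) - mu^2)"
   unfolding eq using i1 i2 i3 by (simp add: prob_space)
  also have "\<dots> = expectation (%w. path_sum g n i w * path_sum g n j w) - mu^2"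
   using mean ij by (simp add: power2_eq_square)
  also have "\<dots> <= (if i = j then C else 0)"
  proof (cases "i = j")
   case True
   then have "expectation (%w. path_sum g n i w * path_sum g n j w) <= C" using int2(2)[OF ij(1)] by (simp add: power2_eq_square)
   moreover have "0 <= mu^2" by simp
   ultimately have "expectation (%w. path_sum g n i w * path_sum g n j w) - mu^2 <= C" by linarith
   then show ?thesis using True by simp
  next
   case False
   then show ?thesis using uncorr[OF ij False] mean ij by (simp add: power2_eq_square)
  qed
  finally show ?thesis using I by blast
 qed
 have eq: "(\<Sum>i=1..N. path_sum g n i w) / real N - mu = (\<Sum>i=1..N. Y i w) / real N" for w
  using N by (simp add: Y_def sum_subtractf diff_divide_distrib)
 have sqeq: "((\<Sum>i=1..N. path_sum g n i w) / real N - mu)^2 = (\<Sum>i=1..N. \<Sum>j=1..N. Y i w * Y j w) / (real N)^2" for w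
  unfolding eq by (simp add: power_divide power2_eq_square sum_product)
 have I: "integrable M (%w. (\<Sum>i=1..N. \<Sum>j=1..N. Y i w * Y j w) / (real N)^2)"
  using YY by (intro integrable_divide Bochner_Integration.integrable_sum) auto
 have "expectation (%w. (\<Sum>i=1..N. \<Sum>j=1..N. Y i w * Y j w) / (real N)^2) = (\<Sum>i=1..N. \<Sum>j=1..N. expectation (%w. Y i w * Y j w)) / (real N)^2"
 proof -
  have "expectation (%w. \<Sum>i=1..N. \<Sum>j=1..N. Y i w * Y j w) = (\<Sum>i=1..N. expectation (%w. \<Sum>j=1..N. Y i w * Y j w))"
   using YY by (intro Bochner_Integration.integral_sum Bochner_Integration.integrable_sum) auto
  also have "\<dots> = (\<Sum>i=1..N. \<Sum>j=1..N. expectation (%w. Y i w * Y j w))"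
   using YY by (intro sum.cong refl Bochner_Integration.integral_sum) auto
  finally show ?thesis by simp
 qed
 also have "\<dots> <= (\<Sum>i=1..N. \<Sum>j=1..N. if i = j then C else 0) / (real N)^2"
  using YY by (intro divide_right_mono sum_mono) auto
 also have "\<dots> = C / real N" using N by (simp add: power2_eq_square)
 finally have "ennreal (expectation (%w. (\<Sum>i=1..N. \<Sum>j=1..N. Y i w * Y j w) / (real N)^2)) <= ennreal (C / real N)" by (rule ennreal_leI)
 moreover have "nnE M (%w. ((\<Sum>i=1..N. path_sum g n i w) / real N - mu)^2) = ennreal (expectation (%w. (\<Sum>i=1..N. \<Sum>j=1..N. Y i w * Y j w) / (real N)^2))"
 proof -
  have "0 <= (\<Sum>i=1..N. \<Sum>j=1..N. Y i w * Y j w) / (real N)^2" for w unfolding sqeq[symmetric] by simp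
  then show ?thesis unfolding sqeq by (intro nn_integral_eq_integral I) auto
 qed
 ultimately show ?thesis by (simp add: mu_def)
qed

end

end

section \<open>Hermite splines\<close>

text \<open>\<open>r\<close> is the Taylor polynomial of degree \<open>d\<close> of the
  \<open>n\<close>-th power of \<open>1 / (1 - x)\<close>. Each further factor replaces the
  coefficients by their partial sums, which keeps them nonnegative; this sign later makes the basis
  functions nonnegative.\<close>

lemma truncated_inverse_power:
 "\<exists>r :: real poly. degree r <= d \<and> (\<forall>i. 0 <= coeff r i) \<and> (\<forall>j\<le>d. coeff ([:1, -1:] ^ n * r) j = (if j = 0 then 1 else 0))"
proof (induction n)
 case 0
 show ?case by (intro exI[of _ 1]) (auto simp: coeff_1)
next
 case (Suc n)
 then obtain r :: "real poly" where r: "!!i. 0 <= coeff r i" "!!j. j <= d ==> coeff ([:1, -1:] ^ n * r) j = (if j = 0 then 1 else 0)" by blast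
 define r' where "r' = (\<Sum>i\<le>d. monom (\<Sum>l\<le>i. coeff r l) i)"
 have r'_coeff: "coeff r' j = (if j <= d then \<Sum>l\<le>j. coeff r l else 0)" for j
  by (simp add: r'_def coeff_sum)
 have low: "coeff ([:1, -1:] * r') j = coeff r j" if "j <= d" for j
 proof (cases j)
  case 0
  then show ?thesis using r'_coeff[of 0] by (simp add: coeff_pCons)
 next
  case (Suc j')
  have "coeff ([:1, -1:] * r') (Suc j') = coeff r' (Suc j') - coeff r' j'" by simp
  then show ?thesis using that Suc r'_coeff[of "Suc j'"] r'_coeff[of j'] by simp
 qed
 have "coeff ([:1, -1:] ^ Suc n * r') j = (if j = 0 then 1 else 0)" if "j <= d" for j
 proof -
  have "[:1, -1:] ^ Suc n * r' = [:1, -1:] ^ n * ([:1, -1:] * r')" by (simp only: power_Suc2 mult.assoc)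
  then have "coeff ([:1, -1:] ^ Suc n * r') j = (\<Sum>i\<le>j. coeff ([:1, -1:] ^ n) i * coeff ([:1, -1:] * r') (j - i))"
   by (simp only: coeff_mult)
  also have "\<dots> = (\<Sum>i\<le>j. coeff ([:1, -1:] ^ n) i * coeff r (j - i))" 
  proof (intro sum.cong refl)
   fix i
   have "coeff ([:1, -1:] * r') (j - i) = coeff r (j - i)" using that by (intro low) simp
   then show "coeff ([:1, -1:] ^ n) i * coeff ([:1, -1:] * r') (j - i) = coeff ([:1, -1:] ^ n) i * coeff r (j - i)" by (simp only:)
  qed
  also have "\<dots> = coeff ([:1, -1:] ^ n * r) j" by (simp only: coeff_mult)
  finally show ?thesis using r(2)[OF that] by simp
 qed
 moreover have "degree r' <= d" by (rule degree_le) (simp add: r'_coeff)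
 moreover have "0 <= coeff r' i" for i using r(1) by (simp add: r'_coeff sum_nonneg)
 ultimately show ?case by blast
qed

lemma higher_pderiv_diff: "(pderiv ^^ n) (p - q) = (pderiv ^^ n) p - (pderiv ^^ n) q" for p q :: "real poly"
 by (induction n arbitrary: p q) (simp_all del: funpow.simps add: funpow_Suc_right pderiv_diff)

lemma degree_pcompose_linear: "degree (pcompose p [:c, d:]) <= degree p" for p :: "real poly"
proof -
 have "degree (pcompose p [:c, d:]) <= degree p * degree [:c, d:]" by (rule degree_pcompose_le)
 also have "\<dots> <= degree p * 1" by (intro mult_left_mono) auto
 finally show ?thesis by simp
qed

lemma higher_pderiv_at_0: "poly ((pderiv ^^ r) p) 0 = fact r * coeff p r" for p :: "real poly"
 by (simp add: poly_0_coeff_0 coeff_higher_pderiv pochhammer_fact)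

lemma higher_pderiv_root_power:
 fixes p :: "real poly"
 assumes "[:- c, 1:] ^ n dvd p" "r < n"
 shows "poly ((pderiv ^^ r) p) c = 0"
 using assms
proof (induction r arbitrary: n p)
 case 0
 then have "[:- c, 1:] dvd p" by (metis dvd_power dvd_trans neq0_conv not_less0)
 then show ?case by (simp add: poly_eq_0_iff_dvd)
next
 case (Suc r)
 then obtain n' where n: "n = Suc n'" by (cases n) auto
 obtain q where q: "p = [:- c, 1:] ^ Suc n' * q" using Suc.prems n by (auto elim: dvdE)
 have "[:- c, 1:] ^ n' dvd pderiv p"
  unfolding q lemma_order_pderiv1
 proof (intro dvd_add dvd_smult)
  show "[:- c, 1:] ^ n' dvd [:- c, 1:] ^ Suc n' * pderiv q" by (intro dvd_mult2 le_imp_power_dvd) simp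
  show "[:- c, 1:] ^ n' dvd q * [:- c, 1:] ^ n'" by (rule dvd_triv_right)
 qed
 then have "poly ((pderiv ^^ r) (pderiv p)) c = 0" using Suc n by auto
 then show ?case by (simp add: funpow_swap1)
qed

lemma higher_pderiv_order:
 fixes p :: "real poly"
 assumes "p \<noteq> 0" "!!r. r <= a ==> poly ((pderiv ^^ r) p) c = 0"
 shows "Suc a <= order c p"
 using assms
proof (induction a arbitrary: p)
 case 0
 then show ?case using 0(2)[of 0] order_root[of p c] by auto
next
 case (Suc a)
 have root: "poly p c = 0" using Suc.prems(2)[of 0] by simp
 have "pderiv p \<noteq> 0"
 proof
  assume "pderiv p = 0"
  then obtain k where "p = [:k:]" by (metis degree_eq_zeroE pderiv_eq_0_iff)
  then show False using root Suc.prems(1) by simp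
 qed
 moreover have "poly ((pderiv ^^ r) (pderiv p)) c = 0" if "r <= a" for r
  using Suc.prems(2)[of "Suc r"] that by (simp add: funpow_swap1)
 ultimately have "Suc a <= order c (pderiv p)" by (rule Suc.IH)
 then show ?case using order_pderiv[OF Suc.prems(1) root] by simp
qed

text \<open>A nonzero polynomial would have two roots of multiplicity at least \<open>a + 1\<close>,
  hence degree at least \<open>2 * a + 2\<close>.\<close>

lemma two_point_hermite_unique:
 fixes p :: "real poly"
 assumes "degree p <= 2 * a + 1" "u \<noteq> v"
  and "!!r. r <= a ==> poly ((pderiv ^^ r) p) u = 0" "!!r. r <= a ==> poly ((pderiv ^^ r) p) v = 0"
 shows "p = 0"
proof (rule ccontr)
 assume "p \<noteq> 0"
 have "Suc a <= order u p" "Suc a <= order v p" using higher_pderiv_order[OF \<open>p \<noteq> 0\<close>] assms by auto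
 moreover have "poly p u = 0" "poly p v = 0" using assms(3)[of 0] assms(4)[of 0] by auto
 then have "order u p + order v p <= (\<Sum>x | poly p x = 0. order x p)"
  using sum_mono2[OF poly_roots_finite[OF \<open>p \<noteq> 0\<close>], of "{u, v}" "%x. order x p"] \<open>u \<noteq> v\<close> by auto
 moreover have "(\<Sum>x | poly p x = 0. order x p) <= degree p" by (rule sum_order_le_degree[OF \<open>p \<noteq> 0\<close>])
 ultimately show False using assms(1) by simp
qed

text \<open>The polynomial is the monomial of degree \<open>k\<close> divided by
  \<open>fact k\<close>, times \<open>(1 - x) ^ Suc a\<close>, times the truncated expansion of the
  inverse of that power. The power annihilates the derivatives at 1; at 0 the last two factors
  cancel up to order \<open>a - k\<close>, leaving the monomial.\<close>

lemma hermite_basis_exists: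
 assumes "k <= a"
 shows "\<exists>p :: real poly. degree p <= 2 * a + 1 \<and> (\<forall>r\<le>a. poly ((pderiv ^^ r) p) 0 = (if r = k then 1 else 0)) \<and>
  (\<forall>r\<le>a. poly ((pderiv ^^ r) p) 1 = 0) \<and> (\<forall>x\<in>{0..1}. 0 <= poly p x)"
proof -
 obtain r :: "real poly" where r: "degree r <= a - k" "!!i. 0 <= coeff r i"
  "!!j. j <= a - k ==> coeff ([:1, -1:] ^ Suc a * r) j = (if j = 0 then 1 else 0)"
  using truncated_inverse_power[of "a - k" "Suc a"] by blast
 let ?q = "[:1, -1:] ^ Suc a * r"
 let ?p = "smult (1 / fact k) (monom 1 k * ?q)"
 have deg: "degree ?p <= 2 * a + 1"
 proof -
  have "degree ?p <= degree (monom 1 k :: real poly) + (degree ([:1, -1:] ^ Suc a :: real poly) + degree r)"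
   using degree_mult_le[of "monom 1 k" ?q] degree_mult_le[of "[:1, -1:] ^ Suc a" r] degree_smult_le[of "1 / fact k" "monom 1 k * ?q"]
   by (meson add_left_mono order_trans)
  also have "\<dots> <= k + (Suc a + (a - k))"
   using r(1) degree_monom_le[of "1::real" k] degree_power_le[of "[:1, -1:] :: real poly" "Suc a"] by (intro add_mono) auto
  finally show ?thesis using assms by simp
 qed
 have c: "coeff ?p i = (if i = k then 1 / fact k else 0)" if "i <= a" for i
 proof -
  have "coeff ?p i = 1 / fact k * (if i < k then 0 else coeff ?q (i - k))"
   unfolding coeff_smult coeff_monom_mult by simp
  also have "(if i < k then 0 else coeff ?q (i - k)) = (if i = k then 1 else 0)"
   using r(3)[of "i - k"] that assms by auto
  finally show ?thesis by simp
 qed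
 have "poly ((pderiv ^^ i) ?p) 0 = (if i = k then 1 else 0)" if "i <= a" for i
  unfolding higher_pderiv_at_0 c[OF that] by simp
 moreover have "poly ((pderiv ^^ i) ?p) 1 = 0" if "i <= a" for i
 proof (rule higher_pderiv_root_power)
  have "([:1, -1:] :: real poly) = [:- 1, 1:] * [:- 1:]" by simp
  then have "[:- 1, 1:] dvd ([:1, -1:] :: real poly)" by (metis dvd_triv_left)
  then have "[:- 1, 1:] ^ Suc a dvd ([:1, -1:] ^ Suc a :: real poly)" by (rule dvd_power_same)
  then show "[:- 1, 1:] ^ Suc a dvd ?p" by (intro dvd_smult dvd_mult dvd_mult2)
  show "i < Suc a" using that by simp
 qed
 moreover have "0 <= poly ?p x" if "x \<in> {0..1}" for x
 proof -
  have "0 <= poly r x" unfolding poly_altdef using r(2) that by (intro sum_nonneg mult_nonneg_nonneg) auto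
  moreover have "poly ?p x = 1 / fact k * (x ^ k * ((1 - x) ^ Suc a * poly r x))"
   unfolding poly_smult poly_mult poly_monom poly_power by simp
  ultimately show ?thesis using that
   by (simp only:) (intro mult_nonneg_nonneg divide_nonneg_nonneg zero_le_power; simp)
 qed
 ultimately show ?thesis using deg by blast
qed

definition hermite_basis :: "nat => nat => real poly" where
 "hermite_basis a k = (SOME p. degree p <= 2 * a + 1 \<and> (\<forall>r\<le>a. poly ((pderiv ^^ r) p) 0 = (if r = k then 1 else 0)) \<and>
  (\<forall>r\<le>a. poly ((pderiv ^^ r) p) 1 = 0) \<and> (\<forall>x\<in>{0..1}. 0 <= poly p x))"

lemma hermite_basis:
 assumes "k <= a"
 shows "degree (hermite_basis a k) <= 2 * a + 1"
  "r <= a ==> poly ((pderiv ^^ r) (hermite_basis a k)) 0 = (if r = k then 1 else 0)"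
  "r <= a ==> poly ((pderiv ^^ r) (hermite_basis a k)) 1 = 0"
  "x \<in> {0..1} ==> 0 <= poly (hermite_basis a k) x"
 using someI_ex[OF hermite_basis_exists[OF assms], folded hermite_basis_def] by auto

lemma higher_pderiv_pcompose_linear:
 "(pderiv ^^ r) (pcompose p [:c, d:]) = smult (d ^ r) (pcompose ((pderiv ^^ r) p) [:c, d:])" for p :: "real poly"
 by (induction r) (simp_all add: pderiv_smult pderiv_pcompose pderiv_pCons mult.commute)

text \<open>The basis function for the right node, by reflection of the interval; the sign
  compensates the \<open>k\<close> inner derivatives.\<close>

definition hermite_basis' :: "nat => nat => real poly" where
 "hermite_basis' a k = smult ((-1) ^ k) (pcompose (hermite_basis a k) [:1, -1:])"

lemma hermite_basis':
 assumes "k <= a"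
 shows "degree (hermite_basis' a k) <= 2 * a + 1"
  "r <= a ==> poly ((pderiv ^^ r) (hermite_basis' a k)) 0 = 0"
  "r <= a ==> poly ((pderiv ^^ r) (hermite_basis' a k)) 1 = (if r = k then 1 else 0)"
proof -
 show "degree (hermite_basis' a k) <= 2 * a + 1"
  using hermite_basis(1)[OF assms] unfolding hermite_basis'_def
  by (intro order_trans[OF degree_smult_le] order_trans[OF degree_pcompose_linear])
 show "r <= a ==> poly ((pderiv ^^ r) (hermite_basis' a k)) 0 = 0"
  using hermite_basis(3)[OF assms, of r]
  by (simp add: hermite_basis'_def higher_pderiv_smult higher_pderiv_pcompose_linear poly_pcompose)
 show "r <= a ==> poly ((pderiv ^^ r) (hermite_basis' a k)) 1 = (if r = k then 1 else 0)"
  using hermite_basis(2)[OF assms, of r]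
  by (simp add: hermite_basis'_def higher_pderiv_smult higher_pderiv_pcompose_linear poly_pcompose power_mult_distrib[symmetric] power_add[symmetric])
qed

text \<open>Both sides have the Hermite data of the constant 1. Together with nonnegativity this
  makes the order 0 part of an interpolant a convex combination of the two node values, so that a
  common upper bound for the nodes holds in between as well.\<close>

lemma hermite_basis_partition: "hermite_basis a 0 + hermite_basis' a 0 = 1"
proof -
 let ?p = "hermite_basis a 0 + hermite_basis' a 0 - 1"
 have one: "(pderiv ^^ r) 1 = (if r = 0 then 1 else 0 :: real poly)" for r
  by (induction r) (auto simp: pderiv_1)
 have "?p = 0"
 proof (rule two_point_hermite_unique[where u=0 and v=1])
  show "degree ?p <= 2 * a + 1"
   using hermite_basis(1)[of 0 a] hermite_basis'(1)[of 0 a] by (intro degree_diff_le degree_add_le) auto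
 qed (auto simp: higher_pderiv_add higher_pderiv_diff one hermite_basis hermite_basis')
 then show ?thesis by simp
qed

lemma hermite_basis_0_bounds:
 assumes "x \<in> {0..1}"
 shows "0 <= poly (hermite_basis a 0) x" "0 <= poly (hermite_basis' a 0) x"
  "poly (hermite_basis a 0) x + poly (hermite_basis' a 0) x = 1"
proof -
 show "0 <= poly (hermite_basis a 0) x" using hermite_basis(4)[of 0 a x] assms by simp
 show "0 <= poly (hermite_basis' a 0) x" using hermite_basis(4)[of 0 a "1 - x"] assms
  by (simp add: hermite_basis'_def poly_pcompose)
 show "poly (hermite_basis a 0) x + poly (hermite_basis' a 0) x = 1"
  unfolding poly_add[symmetric] hermite_basis_partition by simp
qed

lemma hermite_basis_bounded:
 "\<exists>C\<ge>0. \<forall>k\<le>a. \<forall>x\<in>{0..1}. \<bar>poly (hermite_basis a k) x\<bar> <= C \<and> \<bar>poly (hermite_basis' a k) x\<bar> <= C"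
proof -
 have bnd: "\<exists>C. \<forall>x\<in>{0..1}. \<bar>poly p x\<bar> <= C" for p :: "real poly"
 proof -
  have "compact (poly p ` {0..1})" by (intro compact_continuous_image continuous_intros compact_Icc)
  then have "bounded (poly p ` {0..1})" by (rule compact_imp_bounded)
  then show ?thesis by (auto simp: bounded_iff)
 qed
 have "\<forall>k. \<exists>C. \<forall>x\<in>{0..1}. \<bar>poly (hermite_basis a k) x\<bar> <= C \<and> \<bar>poly (hermite_basis' a k) x\<bar> <= C"
 proof
  fix k
  obtain C1 C2 where "\<forall>x\<in>{0..1}. \<bar>poly (hermite_basis a k) x\<bar> <= C1" "\<forall>x\<in>{0..1}. \<bar>poly (hermite_basis' a k) x\<bar> <= C2"
   using bnd by blast
  then show "\<exists>C. \<forall>x\<in>{0..1}. \<bar>poly (hermite_basis a k) x\<bar> <= C \<and> \<bar>poly (hermite_basis' a k) x\<bar> <= C"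
   by (intro exI[of _ "max C1 C2"]) (auto intro: max.coboundedI1 max.coboundedI2)
 qed
 then obtain C where C: "!!k x. x \<in> {0..1} ==> \<bar>poly (hermite_basis a k) x\<bar> <= C k \<and> \<bar>poly (hermite_basis' a k) x\<bar> <= C k" by metis
 have Ck: "0 <= C k" for k using C[of 0 k] by simp linarith
 show ?thesis
 proof (intro exI[of _ "\<Sum>k\<le>a. C k"] conjI allI impI ballI)
  show "0 <= (\<Sum>k\<le>a. C k)" using Ck by (intro sum_nonneg) auto
  fix k and x :: real assume "k <= a" "x \<in> {0..1}"
  then have "C k <= (\<Sum>k\<le>a. C k)" using Ck by (intro member_le_sum) auto
  with C[OF \<open>x \<in> {0..1}\<close>, of k] show "\<bar>poly (hermite_basis a k) x\<bar> <= (\<Sum>k\<le>a. C k)" "\<bar>poly (hermite_basis' a k) x\<bar> <= (\<Sum>k\<le>a. C k)" by auto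
 qed
qed

text \<open>The factor \<open>1 / real L ^ k\<close> undoes the chain rule for the rescaling of a
  cell to the unit interval. It is also what damps the derivative data when \<open>L\<close> is
  large.\<close>

definition hermite_cell :: "nat => nat => (nat => nat => real) => nat => real poly" where
 "hermite_cell a L g l = (\<Sum>k\<le>a. smult (1 / real L ^ k)
  (smult (g l k) (pcompose (hermite_basis a k) [:- real l, real L:])
   + smult (g (Suc l) k) (pcompose (hermite_basis' a k) [:- real l, real L:])))"

lemma hermite_cell_degree: "degree (hermite_cell a L g l) <= 2 * a + 1"
 unfolding hermite_cell_def
proof (rule degree_sum_le)
 fix k assume "k \<in> {..a}"
 then have k: "k <= a" by simp
 have "degree (pcompose p [:- real l, real L:]) <= 2 * a + 1" if "degree p <= 2 * a + 1" for p :: "real poly"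
  using degree_pcompose_linear that by (rule order_trans)
 then show "degree (smult (1 / real L ^ k)
  (smult (g l k) (pcompose (hermite_basis a k) [:- real l, real L:])
   + smult (g (Suc l) k) (pcompose (hermite_basis' a k) [:- real l, real L:]))) <= 2 * a + 1"
  using hermite_basis(1)[OF k] hermite_basis'(1)[OF k]
  by (intro order_trans[OF degree_smult_le] degree_add_le) auto
qed simp

lemma hermite_cell_nodes:
 assumes "0 < L" "r <= a"
 shows "poly ((pderiv ^^ r) (hermite_cell a L g l)) (grid L l) = g l r"
  "poly ((pderiv ^^ r) (hermite_cell a L g l)) (grid L (Suc l)) = g (Suc l) r"
proof -
 have eq: "poly ((pderiv ^^ r) (hermite_cell a L g l)) x = (\<Sum>k\<le>a. 1 / real L ^ k *
  (g l k * (real L ^ r * poly ((pderiv ^^ r) (hermite_basis a k)) (real L * x - real l))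
   + g (Suc l) k * (real L ^ r * poly ((pderiv ^^ r) (hermite_basis' a k)) (real L * x - real l))))" for x
  by (simp add: hermite_cell_def higher_pderiv_sum higher_pderiv_smult higher_pderiv_add higher_pderiv_pcompose_linear poly_sum poly_pcompose algebra_simps)
 have "poly ((pderiv ^^ r) (hermite_cell a L g l)) (grid L l) = (\<Sum>k\<le>a. if k = r then g l k else 0)"
  unfolding eq using assms by (intro sum.cong refl) (auto simp: grid_def hermite_basis hermite_basis')
 then show "poly ((pderiv ^^ r) (hermite_cell a L g l)) (grid L l) = g l r" using assms by simp
 have u: "real L * grid L (Suc l) - real l = 1" using assms by (simp add: grid_def)
 have "poly ((pderiv ^^ r) (hermite_cell a L g l)) (grid L (Suc l)) = (\<Sum>k\<le>a. if k = r then g (Suc l) k else 0)"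
  unfolding eq u using assms by (intro sum.cong refl) (auto simp: hermite_basis hermite_basis')
 then show "poly ((pderiv ^^ r) (hermite_cell a L g l)) (grid L (Suc l)) = g (Suc l) r" using assms by simp
qed

lemma grid_less: "0 < L ==> l < l' ==> grid L l < grid L l'"
 by (simp add: grid_def divide_strict_right_mono)

lemma grid_cells: "2 <= L ==> {grid L 0..grid L (L - 1)} = (\<Union>l\<in>{l. Suc l < L}. {grid L l..grid L (Suc l)})"
proof (intro equalityI subsetI)
 fix x assume L: "2 <= L" and x: "x \<in> {grid L 0..grid L (L - 1)}"
 have x0: "0 <= real L * x" "real L * x <= real (L - 1)" using x L by (auto simp: grid_def field_simps)
 \<comment> \<open>The minimum with \<open>L - 2\<close> assigns the right end of the grid to the
   last cell.\<close>
 define l where "l = min (nat \<lfloor>real L * x\<rfloor>) (L - 2)"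
 have "real l <= real L * x" unfolding l_def using x0 by (auto simp: min_def) linarith+
 moreover have "real L * x <= real (Suc l)"
 proof (cases "nat \<lfloor>real L * x\<rfloor> <= L - 2")
  case True
  then have "real l = of_int \<lfloor>real L * x\<rfloor>" unfolding l_def using x0 by simp
  then show ?thesis by linarith
 next
  case False
  then have "Suc l = L - 1" unfolding l_def using L by auto
  then show ?thesis using x0 by simp
 qed
 moreover have "Suc l < L" unfolding l_def using L by auto
 ultimately have "x \<in> {grid L l..grid L (Suc l)}" using L by (auto simp: grid_def field_simps)
 then show "x \<in> (\<Union>l\<in>{l. Suc l < L}. {grid L l..grid L (Suc l)})" using \<open>Suc l < L\<close> by blast
next
 fix x assume L: "2 <= L" and "x \<in> (\<Union>l\<in>{l. Suc l < L}. {grid L l..grid L (Suc l)})"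
 then obtain l where l: "Suc l < L" "grid L l <= x" "x <= grid L (Suc l)" by auto
 have "grid L 0 <= grid L l" "grid L (Suc l) <= grid L (L - 1)" using L l(1) by (auto simp: grid_def divide_right_mono)
 then show "x \<in> {grid L 0..grid L (L - 1)}" using l by auto
qed

lemma tendsto_within_finite_Union:
 assumes "finite A" "!!l. l \<in> A ==> (f \<longlongrightarrow> y) (at x within U l)"
 shows "(f \<longlongrightarrow> y) (at x within (\<Union>l\<in>A. U l))"
 using assms
proof (induction A)
 case (insert l A)
 have "(f \<longlongrightarrow> y) (sup (at x within U l) (at x within (\<Union>l\<in>A. U l)))"
  using insert by (intro filterlim_sup) auto
 then show ?case by (simp add: at_within_union)
qed simp

text \<open>Neighbouring cell polynomials share all derivatives up to order \<open>a\<close> at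
  their common node. The arbitrary choice of a cell there is therefore harmless, and difference
  quotients may be examined on each of the finitely many cells separately.\<close>

lemma hermite_spline_exists:
 assumes L: "2 <= L"
 shows "\<exists>h. is_hermite_spline a L g h \<and> (\<forall>x. x \<notin> {grid L 0..grid L (L - 1)} \<longrightarrow> h x = 0)"
proof -
 let ?S = "{grid L 0..grid L (L - 1)}" and ?A = "{l. Suc l < L}" and ?U = "%l. {grid L l..grid L (Suc l)}"
 let ?q = "hermite_cell a L g"
 have L0: "0 < L" using L by simp
 note cells = grid_cells[OF L]
 have finA: "finite ?A" by (rule finite_subset[of _ "{..<L}"]) auto
 define cell where "cell x = (SOME l. l \<in> ?A \<and> x \<in> ?U l)" for x
 have cell: "cell x \<in> ?A \<and> x \<in> ?U (cell x)" if "x \<in> ?S" for x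
 proof -
  have "\<exists>l. l \<in> ?A \<and> x \<in> ?U l" using that unfolding cells by blast
  then show ?thesis unfolding cell_def by (rule someI_ex)
 qed
 define D where "D k x = (if x \<in> ?S then poly ((pderiv ^^ k) (?q (cell x))) x else 0)" for k x
 have glue: "poly ((pderiv ^^ k) (?q l)) x = poly ((pderiv ^^ k) (?q l')) x"
  if "x \<in> ?U l" "x \<in> ?U l'" "k <= a" "l < l'" for l l' x k
 proof -
  have "Suc l = l'"
  proof (rule ccontr)
   assume "Suc l \<noteq> l'"
   then have "grid L (Suc l) < grid L l'" using that L0 by (intro grid_less) auto
   then show False using that by auto
  qed
  moreover have "x = grid L (Suc l)" using that \<open>Suc l = l'\<close> by auto
  ultimately show ?thesis using hermite_cell_nodes[OF L0 that(3)] by metis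
 qed
 have D_eq: "D k x = poly ((pderiv ^^ k) (?q l)) x" if "l \<in> ?A" "x \<in> ?U l" "k <= a" for l x k
 proof -
  have xS: "x \<in> ?S" unfolding cells using that by blast
  have "poly ((pderiv ^^ k) (?q (cell x))) x = poly ((pderiv ^^ k) (?q l)) x"
   using cell[OF xS] that glue[of x l "cell x" k] glue[of x "cell x" l k] by (metis nat_neq_iff)
  then show ?thesis using xS by (simp add: D_def)
 qed
 have "is_hermite_spline a L g (D 0)"
  unfolding is_hermite_spline_def
 proof (intro conjI exI[of _ D] refl allI impI ballI)
  fix k x assume k: "k < a" and x: "x \<in> ?S"
  have "((%y. (D k y - D k x) / (y - x)) \<longlongrightarrow> D (Suc k) x) (at x within (\<Union>l\<in>?A. ?U l))"
  proof (rule tendsto_within_finite_Union[OF finA])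
   fix l assume l: "l \<in> ?A"
   show "((%y. (D k y - D k x) / (y - x)) \<longlongrightarrow> D (Suc k) x) (at x within ?U l)"
   proof (cases "x \<in> ?U l")
    case True
    have deriv: "(poly ((pderiv ^^ k) (?q l)) has_real_derivative poly (pderiv ((pderiv ^^ k) (?q l))) x) (at x within ?U l)"
     by (rule has_field_derivative_at_within[OF poly_DERIV])
    have "D (Suc k) x = poly (pderiv ((pderiv ^^ k) (?q l))) x" using D_eq[OF l True, of "Suc k"] k by simp
    then have "(poly ((pderiv ^^ k) (?q l)) has_real_derivative D (Suc k) x) (at x within ?U l)" using deriv by (simp only:)
    from has_field_derivative_transform_within[OF this zero_less_one True D_eq[OF l _ less_imp_le[OF k], symmetric]]
    have "(D k has_real_derivative D (Suc k) x) (at x within ?U l)" .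
    then show ?thesis by (simp add: has_field_derivative_iff)
   next
    case False
    then have "at x within ?U l = bot" using not_in_closure_trivial_limitI[of x "?U l"] by simp
    then show ?thesis by simp
   qed
  qed
  then show "(D k has_real_derivative D (Suc k) x) (at x within ?S)"
   unfolding has_field_derivative_iff cells .
 next
  fix k assume k: "k <= a"
  show "continuous_on ?S (D k)"
   unfolding cells
  proof (rule continuous_on_closed_Union[OF finA])
   fix l assume l: "l \<in> ?A"
   have "continuous_on (?U l) (poly ((pderiv ^^ k) (?q l)))" by (intro continuous_intros)
   then show "continuous_on (?U l) (D k)" by (rule continuous_on_eq) (rule D_eq[OF l _ k, symmetric])
  qed auto
 next
  fix l k assume l: "l < L" and k: "k <= a"
  show "D k (grid L l) = g l k"
  proof (cases "Suc l < L")
   case True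
   then have "D k (grid L l) = poly ((pderiv ^^ k) (?q l)) (grid L l)"
    using grid_less[OF L0, of l "Suc l"] by (intro D_eq k) auto
   then show ?thesis using hermite_cell_nodes(1)[OF L0 k] by simp
  next
   case False
   obtain l' where l': "l = Suc l'" using False L l by (cases l) auto
   then have "D k (grid L l) = poly ((pderiv ^^ k) (?q l')) (grid L (Suc l'))"
    using l grid_less[OF L0, of l' "Suc l'"] unfolding l' by (intro D_eq k) auto
   then show ?thesis using hermite_cell_nodes(2)[OF L0 k] l' by simp
  qed
 next
  fix l assume l: "Suc l < L"
  show "\<exists>q. degree q <= 2 * a + 1 \<and> (\<forall>x\<in>?U l. D 0 x = poly q x)"
   using hermite_cell_degree[of a L g l] D_eq[of l _ 0] l by (intro exI[of _ "?q l"]) auto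
 qed
 moreover have "\<forall>x. x \<notin> ?S \<longrightarrow> D 0 x = 0" by (simp add: D_def)
 ultimately show ?thesis by blast
qed

text \<open>On a nondegenerate cell the derivatives \<open>D\<close> are those of the polynomial
  piece, derivatives within an interval being unique. The piece thus has the prescribed data at both
  nodes, and \<open>two_point_hermite_unique\<close> identifies it.\<close>

lemma hermite_spline_cell:
 assumes L: "2 <= L" and h: "is_hermite_spline a L g h" and l: "Suc l < L" and x: "x \<in> {grid L l..grid L (Suc l)}"
 shows "h x = poly (hermite_cell a L g l) x"
proof -
 let ?S = "{grid L 0..grid L (L - 1)}" and ?U = "{grid L l..grid L (Suc l)}"
 have L0: "0 < L" using L by simp
 have lt: "grid L l < grid L (Suc l)" by (rule grid_less[OF L0]) simp
 have US: "?U \<subseteq> ?S" unfolding grid_cells[OF L] using l by blast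
 note h' = h[unfolded is_hermite_spline_def]
 obtain D where D': "D 0 = h \<and>
    (\<forall>k<a. \<forall>x\<in>?S. (D k has_real_derivative D (Suc k) x) (at x within ?S)) \<and>
    (\<forall>k\<le>a. continuous_on ?S (D k)) \<and> (\<forall>l<L. \<forall>k\<le>a. D k (grid L l) = g l k)"
  using conjunct1[OF h'] ..
 have D: "D 0 = h" "!!k x. k < a ==> x \<in> ?S ==> (D k has_real_derivative D (Suc k) x) (at x within ?S)"
  "!!l k. l < L ==> k <= a ==> D k (grid L l) = g l k"
  using D' by simp_all
 have "\<exists>q. degree q <= 2 * a + 1 \<and> (\<forall>x\<in>?U. h x = poly q x)"
  by (rule conjunct2[OF h', THEN spec, THEN mp, OF l])
 then obtain q where q': "degree q <= 2 * a + 1 \<and> (\<forall>x\<in>?U. h x = poly q x)" ..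
 then have q: "degree q <= 2 * a + 1" "!!x. x \<in> ?U ==> h x = poly q x" by auto
 have Dq: "\<forall>x\<in>?U. D k x = poly ((pderiv ^^ k) q) x" if "k <= a" for k
  using that
 proof (induction k)
  case 0
  then show ?case using q D(1) by simp
 next
  case (Suc k)
  show ?case
  proof
   fix x assume x: "x \<in> ?U"
   have "(D k has_real_derivative D (Suc k) x) (at x within ?U)"
    using D(2)[of k x] x US Suc.prems by (intro DERIV_subset[OF _ US]) auto
   moreover have "(D k has_real_derivative poly ((pderiv ^^ Suc k) q) x) (at x within ?U)"
   proof (rule has_field_derivative_transform_within[where d=1 and f="poly ((pderiv ^^ k) q)"])
    show "(poly ((pderiv ^^ k) q) has_real_derivative poly ((pderiv ^^ Suc k) q) x) (at x within ?U)"
     using has_field_derivative_at_within[OF poly_DERIV[of "(pderiv ^^ k) q" x]] by simp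
   qed (use x Suc in auto)
   moreover have "at x within ?U \<noteq> bot"
    using x lt islimpt_Icc[of "grid L l" "grid L (Suc l)" x] by (simp add: trivial_limit_within)
   ultimately show "D (Suc k) x = poly ((pderiv ^^ Suc k) q) x" by (rule has_field_derivative_unique)
  qed
 qed
 have "q - hermite_cell a L g l = 0"
 proof (rule two_point_hermite_unique[where u="grid L l" and v="grid L (Suc l)"])
  show "degree (q - hermite_cell a L g l) <= 2 * a + 1" using q(1) hermite_cell_degree by (intro degree_diff_le)
  show "grid L l \<noteq> grid L (Suc l)" using lt by simp
  fix r assume r: "r <= a"
  show "poly ((pderiv ^^ r) (q - hermite_cell a L g l)) (grid L l) = 0"
   using Dq[OF r] D(3)[of l r] hermite_cell_nodes(1)[OF L0 r, of g l] r l lt by (simp add: higher_pderiv_diff)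
  show "poly ((pderiv ^^ r) (q - hermite_cell a L g l)) (grid L (Suc l)) = 0"
   using Dq[OF r] D(3)[of "Suc l" r] hermite_cell_nodes(2)[OF L0 r, of g l] r l lt by (simp add: higher_pderiv_diff)
 qed
 then have "q = hermite_cell a L g l" by simp
 then show ?thesis using q(2)[OF x] by simp
qed

text \<open>Resolves the definite description in \<open>hermite_interp\<close>; from here on only
  this explicit formula on a cell is used.\<close>

theorem hermite_interp_cell:
 assumes L: "2 <= L" and l: "Suc l < L" and x: "x \<in> {grid L l..grid L (Suc l)}"
 shows "hermite_interp a L g x = (\<Sum>k\<le>a. (g l k * poly (hermite_basis a k) (real L * x - real l)
  + g (Suc l) k * poly (hermite_basis' a k) (real L * x - real l)) / real L ^ k)"
proof -
 let ?P = "%h. is_hermite_spline a L g h \<and> (\<forall>x. x \<notin> {grid L 0..grid L (L - 1)} \<longrightarrow> h x = 0)"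
 obtain h where h: "?P h" using hermite_spline_exists[OF L] by blast
 have "h' = h" if "?P h'" for h'
 proof
  fix y
  show "h' y = h y"
  proof (cases "y \<in> {grid L 0..grid L (L - 1)}")
   case True
   then obtain l where "Suc l < L" "y \<in> {grid L l..grid L (Suc l)}" unfolding grid_cells[OF L] by blast
   then show ?thesis using hermite_spline_cell[OF L] h that by metis
  next
   case False
   then show ?thesis using h that by simp
  qed
 qed
 then have "hermite_interp a L g = h" unfolding hermite_interp_def using h by (intro the_equality) blast+
 then have "hermite_interp a L g x = poly (hermite_cell a L g l) x" using hermite_spline_cell[OF L _ l x] h by blast
 also have "\<dots> = (\<Sum>k\<le>a. (g l k * poly (hermite_basis a k) (real L * x - real l)
  + g (Suc l) k * poly (hermite_basis' a k) (real L * x - real l)) / real L ^ k)"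
  by (simp add: hermite_cell_def poly_sum poly_pcompose mult.commute)
 finally show ?thesis .
qed

section \<open>Laplace noise\<close>

lemma laplace_density_nonneg: "0 < s ==> 0 <= laplace_density s x"
 by (simp add: laplace_density_def)

lemma laplace_density_meas [measurable]: "laplace_density s \<in> BM borel"
 unfolding laplace_density_def[abs_def] by measurable

text \<open>On the half line the Laplace density is one half of an exponential density, whose
  moments are known as the Erlang case of order 0.\<close>

lemma laplace_half_moment:
 assumes s: "0 < s"
 shows "has_bochner_integral lborel (%x. indicator {0..} x *\<^sub>R (laplace_density s x * x ^ i)) (fact i * s ^ i / 2)"
proof (rule has_bochner_integral_nn_integral)
 have eq: "ennreal (indicator {0..} x *\<^sub>R (laplace_density s x * x ^ i)) = ennreal (1 / 2) * ennreal (erlang_density 0 (1 / s) x * x ^ i)" for x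
 proof -
  have "indicator {0..} x *\<^sub>R (laplace_density s x * x ^ i) = 1 / 2 * (erlang_density 0 (1 / s) x * x ^ i)"
   using s by (cases "0 <= x") (auto simp: erlang_density_def laplace_density_def field_simps)
  moreover have "0 <= erlang_density 0 (1 / s) x * x ^ i"
   using s by (cases "0 <= x") (auto simp: erlang_density_def)
  ultimately show ?thesis by (simp only: ennreal_mult)
 qed
 have "(nnE lborel (%x. indicator {0..} x *\<^sub>R (laplace_density s x * x ^ i)))
  = ennreal (1 / 2) * (nnE lborel (%x. erlang_density 0 (1 / s) x * x ^ i))"
  unfolding eq by (rule nn_integral_cmult) measurable
 also have "nnE lborel (%x. erlang_density 0 (1 / s) x * x ^ i) = ennreal (fact (0 + i) / (fact 0 * (1 / s) ^ i))"
  by (rule nn_integral_erlang_ith_moment) (use s in simp)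
 also have "ennreal (1 / 2) * ennreal (fact (0 + i) / (fact 0 * (1 / s) ^ i)) = ennreal (fact i * s ^ i / 2)"
  using s by (subst ennreal_mult[symmetric]) (auto simp: power_divide field_simps)
 finally show "nnE lborel (%x. indicator {0..} x *\<^sub>R (laplace_density s x * x ^ i)) = ennreal (fact i * s ^ i / 2)" .
 show "AE x in lborel. 0 <= indicator {0..} x *\<^sub>R (laplace_density s x * x ^ i)"
  using laplace_density_nonneg[OF s] by (intro AE_I2) (auto simp: indicator_def)
qed (use s in auto)

lemma laplace_even_moment:
 assumes s: "0 < s" and "even i"
 shows "has_bochner_integral lborel (%x. laplace_density s x * x ^ i) (fact i * s ^ i)"
proof -
 have "has_bochner_integral lborel (%x. laplace_density s x * x ^ i) (2 *\<^sub>R (fact i * s ^ i / 2))"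
  by (rule has_bochner_integral_even_function[OF laplace_half_moment[OF s]]) (use \<open>even i\<close> in \<open>simp add: laplace_density_def\<close>)
 then show ?thesis by simp
qed

lemma laplace_mean:
 assumes s: "0 < s"
 shows "has_bochner_integral lborel (%x. laplace_density s x * x) 0"
 using has_bochner_integral_odd_function[of "%x. laplace_density s x * x"] laplace_half_moment[OF s, of 1]
 by (simp add: laplace_density_def)

lemma laplace_integrable: "0 < s ==> integrable lborel (laplace_density s)"
 and laplace_integral: "0 < s ==> (\<integral>x. laplace_density s x \<partial>lborel) = 1"
 using laplace_even_moment[of s 0] by (auto simp: has_bochner_integral_iff)

text \<open>Total positivity of order 2 of the kernel \<open>(x, y) \<mapsto> G (x - y)\<close>, i.e. log-concavity of \<open>G\<close>.\<close>

definition pf2 :: "(real => real) => bool" where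
 "pf2 G \<longleftrightarrow> (\<forall>x. 0 <= G x) \<and> (\<forall>x1 x2 y1 y2. x1 <= x2 \<longrightarrow> y1 <= y2 \<longrightarrow> G (x1 - y2) * G (x2 - y1) <= G (x1 - y1) * G (x2 - y2))"

lemma pf2D: "pf2 G ==> x1 <= x2 ==> y1 <= y2 ==> G (x1 - y2) * G (x2 - y1) <= G (x1 - y1) * G (x2 - y2)"
 by (simp add: pf2_def)

text \<open>Log-concavity amounts to the convexity of the absolute value, here in its four-point
  form.\<close>

lemma pf2_laplace:
 assumes s: "0 < s"
 shows "pf2 (laplace_density s)"
 unfolding pf2_def
proof (intro conjI allI impI laplace_density_nonneg s)
 fix x1 x2 y1 y2 :: real assume "x1 <= x2" "y1 <= y2"
 then have "\<bar>x1 - y1\<bar> + \<bar>x2 - y2\<bar> <= \<bar>x1 - y2\<bar> + \<bar>x2 - y1\<bar>" by linarith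
 then have "(- \<bar>x1 - y2\<bar> - \<bar>x2 - y1\<bar>) / s <= (- \<bar>x1 - y1\<bar> - \<bar>x2 - y2\<bar>) / s" using s by (intro divide_right_mono) auto
 then have "exp ((- \<bar>x1 - y2\<bar> - \<bar>x2 - y1\<bar>) / s) <= exp ((- \<bar>x1 - y1\<bar> - \<bar>x2 - y2\<bar>) / s)" by simp
 then have "exp (- \<bar>x1 - y2\<bar> / s) * exp (- \<bar>x2 - y1\<bar> / s) <= exp (- \<bar>x1 - y1\<bar> / s) * exp (- \<bar>x2 - y2\<bar> / s)"
  by (simp add: exp_add[symmetric] diff_divide_distrib add_divide_distrib)
 then have "exp (- \<bar>x1 - y2\<bar> / s) * exp (- \<bar>x2 - y1\<bar> / s) / (2 * s * (2 * s)) <= exp (- \<bar>x1 - y1\<bar> / s) * exp (- \<bar>x2 - y2\<bar> / s) / (2 * s * (2 * s))"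
  using s by (intro divide_right_mono) auto
 then show "laplace_density s (x1 - y2) * laplace_density s (x2 - y1) <= laplace_density s (x1 - y1) * laplace_density s (x2 - y2)"
  unfolding laplace_density_def times_divide_times_eq .
qed

lemma pf2_indicator: "pf2 (indicator {..<0})"
 unfolding pf2_def by (auto simp: indicator_def)

text \<open>The basic composition formula: antisymmetrising the double integral in its two variables
 turns the 2 by 2 minor of the composed kernel into an integral of products of minors.\<close>

lemma pf2_convolution:
 assumes f: "pf2 f" and g: "pf2 g" and [measurable]: "f \<in> BM borel" and gi: "integrable lborel g"
  and f1: "!!x. f x <= 1"
 shows "pf2 (%x. \<integral>y. f (x - y) * g y \<partial>lborel)"
proof -
 have f0: "0 <= f x" and g0: "0 <= g x" for x using f g by (auto simp: pf2_def)
 have [measurable]: "g \<in> BM borel" using borel_measurable_integrable[OF gi] by simp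
 define K where "K x z = (\<integral>u. f (x - u) * g (u - z) \<partial>lborel)" for x z
 have gz: "integrable lborel (%u. g (u - z))" for z
  using lborel_integrable_real_affine[OF gi, of 1 "- z"] by (simp add: algebra_simps)
 have Ki: "integrable lborel (%u. f (x - u) * g (u - z))" for x z
  by (rule Bochner_Integration.integrable_bound[OF gz[of z]]) (use f0 f1 g0 in \<open>auto intro!: AE_I2 mult_left_le_one_le simp: abs_mult\<close>)
 have shift: "(\<integral>y. f (x - z - y) * g y \<partial>lborel) = K x z" for x z
  using lborel_integral_real_affine[of 1 "%y. f (x - z - y) * g y" "- z"] unfolding K_def by (simp add: algebra_simps)
 have main: "K x1 z2 * K x2 z1 <= K x1 z1 * K x2 z2" if "x1 <= x2" "z1 <= z2" for x1 x2 z1 z2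
 proof -
  let ?a = "%i j u. f ((if i then x2 else x1) - u) * g (u - (if j then z2 else z1))"
  \<comment> \<open>Both minors change sign when \<open>u\<close> and \<open>v\<close> are
    exchanged, and both are nonnegative for \<open>u <= v\<close>, so their product never is
    negative.\<close>
  have P: "0 <= (f (x1 - u) * f (x2 - v) - f (x1 - v) * f (x2 - u)) * (g (u - z1) * g (v - z2) - g (u - z2) * g (v - z1))" for u v
  proof (cases "u <= v")
   case True
   then have "f (x1 - v) * f (x2 - u) <= f (x1 - u) * f (x2 - v)" using f that by (auto simp: pf2_def)
   moreover have "g (u - z2) * g (v - z1) <= g (u - z1) * g (v - z2)" using g that True by (auto simp: pf2_def)
   ultimately show ?thesis by (intro mult_nonneg_nonneg) auto
  next
   case False
   then have "f (x1 - u) * f (x2 - v) <= f (x1 - v) * f (x2 - u)" using f that by (auto simp: pf2_def)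
   moreover have "g (v - z2) * g (u - z1) <= g (v - z1) * g (u - z2)" using g that False by (auto simp: pf2_def)
   ultimately show ?thesis by (intro mult_nonpos_nonpos) (auto simp: mult.commute)
  qed
  have inner: "(\<integral>v. (f (x1 - u) * f (x2 - v) - f (x1 - v) * f (x2 - u)) * (g (u - z1) * g (v - z2) - g (u - z2) * g (v - z1)) \<partial>lborel)
   = (f (x1 - u) * g (u - z1)) * K x2 z2 - (f (x1 - u) * g (u - z2)) * K x2 z1 - (f (x2 - u) * g (u - z1)) * K x1 z2 + (f (x2 - u) * g (u - z2)) * K x1 z1" for u
  proof -
   have "(%v. (f (x1 - u) * f (x2 - v) - f (x1 - v) * f (x2 - u)) * (g (u - z1) * g (v - z2) - g (u - z2) * g (v - z1)))
    = (%v. (f (x1 - u) * g (u - z1)) * (f (x2 - v) * g (v - z2)) - (f (x1 - u) * g (u - z2)) * (f (x2 - v) * g (v - z1))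
     - (f (x2 - u) * g (u - z1)) * (f (x1 - v) * g (v - z2)) + (f (x2 - u) * g (u - z2)) * (f (x1 - v) * g (v - z1)))"
    by (simp add: fun_eq_iff algebra_simps)
   then show ?thesis
    using Ki by (simp add: K_def)
  qed
  have "0 <= (\<integral>u. (\<integral>v. (f (x1 - u) * f (x2 - v) - f (x1 - v) * f (x2 - u)) * (g (u - z1) * g (v - z2) - g (u - z2) * g (v - z1)) \<partial>lborel) \<partial>lborel)"
   by (intro integral_nonneg_AE AE_I2 P)
  also have "\<dots> = K x1 z1 * K x2 z2 - K x1 z2 * K x2 z1 - K x2 z1 * K x1 z2 + K x2 z2 * K x1 z1"
   unfolding inner using Ki by (simp add: K_def)
  finally show ?thesis by (simp add: mult.commute)
 qed
 show ?thesis
  unfolding pf2_def shift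
  using main f0 g0 by (auto intro!: integral_nonneg_AE)
qed

text \<open>The survival function of a sum of independent Laplace variables with scales
  \<open>ss\<close>. The empty sum is 0, and 0 exceeds \<open>x\<close> exactly for negative
  \<open>x\<close>.\<close>

primrec laplace_tail :: "real list => real => real" where
 "laplace_tail [] x = indicator {..<0} x"
| "laplace_tail (s # ss) x = (\<integral>y. laplace_tail ss (x - y) * laplace_density s y \<partial>lborel)"

lemma laplace_tail_props:
 assumes "!!s. s \<in> set ss ==> 0 < s"
 shows "laplace_tail ss \<in> BM borel \<and> pf2 (laplace_tail ss) \<and> (\<forall>x. laplace_tail ss x <= 1)"
 using assms
proof (induction ss)
 case Nil
 have "laplace_tail [] = indicator {..<0}" by (simp add: fun_eq_iff)
 then show ?case by (simp only:) (intro conjI allI pf2_indicator; simp add: indicator_def)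
next
 case (Cons s ss)
 have s: "0 < s" using Cons.prems by simp
 have IH: "laplace_tail ss \<in> BM borel" "pf2 (laplace_tail ss)" "!!x. laplace_tail ss x <= 1" using Cons by auto
 note [measurable] = IH(1)
 have eq: "laplace_tail (s # ss) = (%x. \<integral>y. laplace_tail ss (x - y) * laplace_density s y \<partial>lborel)" by (simp add: fun_eq_iff)
 have t0: "0 <= laplace_tail ss x" for x using IH(2) by (simp add: pf2_def)
 have "laplace_tail (s # ss) \<in> BM borel"
  unfolding eq by (rule lborel.borel_measurable_lebesgue_integral) measurable
 moreover have "pf2 (laplace_tail (s # ss))"
  unfolding eq by (rule pf2_convolution[OF IH(2) pf2_laplace[OF s] IH(1) laplace_integrable[OF s] IH(3)])
 moreover have "laplace_tail (s # ss) x <= 1" for x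
 proof -
  have "laplace_tail (s # ss) x <= (\<integral>y. laplace_density s y \<partial>lborel)"
   unfolding eq
  proof (rule integral_mono)
   show "integrable lborel (%y. laplace_tail ss (x - y) * laplace_density s y)"
    by (rule Bochner_Integration.integrable_bound[OF laplace_integrable[OF s]])
     (use t0 IH(3) laplace_density_nonneg[OF s] in \<open>auto intro!: AE_I2 mult_left_le_one_le simp: abs_mult\<close>)
   show "integrable lborel (laplace_density s)" by (rule laplace_integrable[OF s])
   show "laplace_tail ss (x - y) * laplace_density s y <= laplace_density s y" for y
    using t0 IH(3) laplace_density_nonneg[OF s] by (intro mult_left_le_one_le) auto
  qed
  then show ?thesis using laplace_integral[OF s] by simp
 qed
 ultimately show ?case by blast
qed

text \<open>Conditioning on the first variable gives the convolution by which
  \<open>laplace_tail\<close> is defined; the list \<open>zs\<close> fixes the order of this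
  recursion. In the second moment the cross terms vanish by independence and centering.\<close>

lemma (in prob_space) laplace_sum:
 fixes V :: "'i => 'a => real"
 assumes "indep_vars (%_. borel) V (set zs)" "distinct zs"
  and "!!z. z \<in> set zs ==> distributed M lborel (V z) (laplace_density (s z))" "!!z. z \<in> set zs ==> 0 < s z"
 shows "prob {w \<in> space M. x < (\<Sum>z\<in>set zs. V z w)} = laplace_tail (map s zs) x"
  and "integrable M (%w. (\<Sum>z\<in>set zs. V z w)^2)"
  and "expectation (%w. (\<Sum>z\<in>set zs. V z w)^2) = (\<Sum>z\<in>set zs. 2 * (s z)^2)"
  and "integrable M (%w. \<Sum>z\<in>set zs. V z w)"
proof -
 have "(\<forall>x. prob {w \<in> space M. x < (\<Sum>z\<in>set zs. V z w)} = laplace_tail (map s zs) x) \<and>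
  integrable M (%w. (\<Sum>z\<in>set zs. V z w)^2) \<and> integrable M (%w. \<Sum>z\<in>set zs. V z w) \<and>
  expectation (%w. (\<Sum>z\<in>set zs. V z w)^2) = (\<Sum>z\<in>set zs. 2 * (s z)^2) \<and>
  expectation (%w. \<Sum>z\<in>set zs. V z w) = 0"
  using assms
 proof (induction zs)
  case Nil
  have "prob {w \<in> space M. x < 0} = indicator {..<0} x" for x :: real by (cases "x < 0") (auto simp: prob_space)
  then show ?case by simp
 next
  case (Cons z zs)
  let ?S = "%w. \<Sum>z\<in>set zs. V z w"
  have z: "z \<notin> set zs" "distinct zs" and sz: "0 < s z" using Cons.prems by auto
  have D: "distributed M lborel (V z) (laplace_density (s z))" using Cons.prems by auto
  have ind: "indep_var borel (V z) borel ?S" using Cons.prems(1) z by (intro indep_vars_sum) auto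
  have indss: "indep_vars (%_. borel) V (set zs)" using Cons.prems(1) by (rule indep_vars_subset) auto
  have IH: "!!x. prob {w \<in> space M. x < ?S w} = laplace_tail (map s zs) x" "integrable M (%w. (?S w)^2)" "integrable M ?S"
   "expectation (%w. (?S w)^2) = (\<Sum>z\<in>set zs. 2 * (s z)^2)" "expectation ?S = 0"
   using Cons.IH[OF indss z(2)] Cons.prems by auto
  have VM [measurable]: "V z \<in> BM M" and SM [measurable]: "?S \<in> BM M"
   using ind indep_var_rv1 indep_var_rv2 by blast+
  have sum: "(\<Sum>z\<in>set (z # zs). V z w) = V z w + ?S w" for w using z by simp
  have lapM: "laplace_density (s z) \<in> BM lborel" by simp
  have tail_pos: "0 < t" if "t \<in> set (map s (z # zs))" for t using that Cons.prems(4) by auto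
  have tail_props: "laplace_tail (map s zs) \<in> BM borel" "0 <= laplace_tail (map s zs) y" "laplace_tail (map s zs) y <= 1"
   "0 <= laplace_tail (map s (z # zs)) y" for y
   using laplace_tail_props[of "map s zs"] laplace_tail_props[of "map s (z # zs)"] tail_pos unfolding pf2_def by (simp_all del: laplace_tail.simps)
  have EV: "integrable M (V z)" "expectation (V z) = 0" "integrable M (%w. (V z w)^2)" "expectation (%w. (V z w)^2) = 2 * (s z)^2"
  proof -
   show "integrable M (V z)"
    using distributed_integrable[OF D, of "%x. x"] laplace_mean[OF sz] laplace_density_nonneg[OF sz] by (simp add: has_bochner_integral_iff)
   show "expectation (V z) = 0"
    using distributed_integral[OF D, of "%x. x"] laplace_mean[OF sz] laplace_density_nonneg[OF sz] by (simp add: has_bochner_integral_iff)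
   show "integrable M (%w. (V z w)^2)"
    using distributed_integrable[OF D, of "%x. x^2"] laplace_even_moment[OF sz, of 2] laplace_density_nonneg[OF sz] by (simp add: has_bochner_integral_iff)
   show "expectation (%w. (V z w)^2) = 2 * (s z)^2"
    using distributed_integral[OF D, of "%x. x^2"] laplace_even_moment[OF sz, of 2] laplace_density_nonneg[OF sz] by (simp add: has_bochner_integral_iff)
  qed
  have cross: "integrable M (%w. V z w * ?S w)" "expectation (%w. V z w * ?S w) = 0"
   using indep_var_integrable[OF ind EV(1) IH(3)] indep_var_lebesgue_integral[OF ind EV(1) IH(3)] EV by auto
  have sq: "(%w. (\<Sum>z\<in>set (z # zs). V z w)^2) = (%w. (V z w)^2 + 2 * (V z w * ?S w) + (?S w)^2)"
   unfolding sum by (simp add: power2_eq_square algebra_simps)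
  have "prob {w \<in> space M. x < (\<Sum>z\<in>set (z # zs). V z w)} = laplace_tail (map s (z # zs)) x" for x
  proof -
   interpret PV: prob_space "distr M borel (V z)" by (rule prob_space_distr) simp
   interpret PS: prob_space "distr M borel ?S" by (rule prob_space_distr) simp
   interpret PP: pair_prob_space "distr M borel (V z)" "distr M borel ?S" ..
   let ?A = "{p :: real \<times> real. x < fst p + snd p}"
   have A: "?A \<in> sets (borel \<Otimes>\<^sub>M borel)" 
   proof -
    have "{p \<in> space (borel \<Otimes>\<^sub>M borel). x < fst p + snd p} \<in> sets (borel \<Otimes>\<^sub>M (borel :: real measure))" by measurable
    then show ?thesis by (simp add: space_pair_measure)
   qed
   have "emeasure M {w \<in> space M. x < (\<Sum>z\<in>set (z # zs). V z w)} = emeasure (distr M (borel \<Otimes>\<^sub>M borel) (%w. (V z w, ?S w))) ?A"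
    unfolding sum using A by (subst emeasure_distr) (auto intro!: arg_cong[where f="emeasure M"])
   also have "distr M (borel \<Otimes>\<^sub>M borel) (%w. (V z w, ?S w)) = distr M borel (V z) \<Otimes>\<^sub>M distr M borel ?S"
    using ind by (simp add: indep_var_distribution_eq)
   also have "emeasure (distr M borel (V z) \<Otimes>\<^sub>M distr M borel ?S) ?A = (\<integral>\<^sup>+y. emeasure (distr M borel ?S) (Pair y -` ?A) \<partial>distr M borel (V z))"
    using A by (intro PS.emeasure_pair_measure_alt) (simp cong: sets_pair_measure_cong)
   also have "\<dots> = (\<integral>\<^sup>+y. ennreal (laplace_tail (map s zs) (x - y)) \<partial>distr M borel (V z))"
   proof (intro nn_integral_cong)
    fix y
    have eqs: "Pair y -` ?A = {x - y<..}" by auto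
    have "?S -` {x - y<..} \<inter> space M = {w \<in> space M. x - y < ?S w}" by auto
    then have "emeasure (distr M borel ?S) (Pair y -` ?A) = emeasure M {w \<in> space M. x - y < ?S w}"
     unfolding eqs by (subst emeasure_distr) auto
    then show "emeasure (distr M borel ?S) (Pair y -` ?A) = ennreal (laplace_tail (map s zs) (x - y))"
     using IH(1)[of "x - y"] by (simp add: emeasure_eq_measure)
   qed
   also have "\<dots> = nnI lborel (%y. ennreal (laplace_density (s z) y) * ennreal (laplace_tail (map s zs) (x - y)))"
   proof -
    note tm = tail_props(1)
    have "(\<integral>\<^sup>+y. ennreal (laplace_tail (map s zs) (x - y)) \<partial>distr M borel (V z)) = nnE M (%w. laplace_tail (map s zs) (x - V z w))"
     using tm by (subst nn_integral_distr) auto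
    also have "\<dots> = nnI lborel (%y. ennreal (laplace_density (s z) y) * ennreal (laplace_tail (map s zs) (x - y)))"
     using tm by (subst distributed_nn_integral[OF D]) auto
    finally show ?thesis .
   qed
   also have "\<dots> = nnE lborel (%y. laplace_tail (map s zs) (x - y) * laplace_density (s z) y)"
   proof (intro nn_integral_cong)
    fix y
    have "0 <= laplace_tail (map s zs) (x - y)" by (rule tail_props)
    then show "ennreal (laplace_density (s z) y) * ennreal (laplace_tail (map s zs) (x - y)) = ennreal (laplace_tail (map s zs) (x - y) * laplace_density (s z) y)"
     using laplace_density_nonneg[OF sz] by (subst ennreal_mult) (auto simp: mult.commute)
   qed
   also have "\<dots> = ennreal (laplace_tail (map s (z # zs)) x)"
   proof -
    have p: "laplace_tail (map s zs) \<in> BM borel" "!!x. 0 <= laplace_tail (map s zs) x" "!!x. laplace_tail (map s zs) x <= 1"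
     by (rule tail_props)+
    note [measurable] = p(1)
    have "integrable lborel (%y. laplace_tail (map s zs) (x - y) * laplace_density (s z) y)"
     by (rule Bochner_Integration.integrable_bound[OF laplace_integrable[OF sz]])
      (use p laplace_density_nonneg[OF sz] in \<open>auto intro!: AE_I2 mult_left_le_one_le simp: abs_mult\<close>)
    then show ?thesis using p laplace_density_nonneg[OF sz] by (simp add: nn_integral_eq_integral)
   qed
   finally have e: "ennreal (prob {w \<in> space M. x < (\<Sum>z\<in>set (z # zs). V z w)}) = ennreal (laplace_tail (map s (z # zs)) x)"
    by (simp only: emeasure_eq_measure)
   have "0 <= laplace_tail (map s (z # zs)) x" by (rule tail_props)
   then show ?thesis using e by (simp only: ennreal_inj measure_nonneg)
  qed
  moreover have "integrable M (%w. (\<Sum>z\<in>set (z # zs). V z w)^2)"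
   unfolding sq using EV IH cross by (intro Bochner_Integration.integrable_add integrable_mult_right) auto
  moreover have "integrable M (%w. \<Sum>z\<in>set (z # zs). V z w)" "expectation (%w. \<Sum>z\<in>set (z # zs). V z w) = 0"
   unfolding sum using EV IH by simp_all
  moreover have "expectation (%w. (\<Sum>z\<in>set (z # zs). V z w)^2) = (\<Sum>z\<in>set (z # zs). 2 * (s z)^2)"
   unfolding sq using EV IH cross z by simp
  ultimately show ?case by blast
 qed
 then show "prob {w \<in> space M. x < (\<Sum>z\<in>set zs. V z w)} = laplace_tail (map s zs) x"
  "integrable M (%w. (\<Sum>z\<in>set zs. V z w)^2)"
  "expectation (%w. (\<Sum>z\<in>set zs. V z w)^2) = (\<Sum>z\<in>set zs. 2 * (s z)^2)"
  "integrable M (%w. \<Sum>z\<in>set zs. V z w)" by blast+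
qed

text \<open>For a log-concave tail the ratio \<open>G (x + 2 e) / G x\<close> decreases in \<open>x\<close>, so that the maximum
 of many independent variables concentrates around the quantile \<open>q\<close> of level \<open>1 / L\<close>, however
 large \<open>q\<close> is: the maxima over two sets of indices of comparable size are close to each other.\<close>

lemma (in prob_space) max_concentration:
 fixes Y :: "nat => 'a => real"
 assumes ind: "indep_vars (%_. borel) Y {..<L}" and G: "!!l x. l < L ==> prob {w \<in> space M. x < Y l w} = G x"
  and pf: "pf2 G" and V: "!!l t. l < L ==> 0 < t ==> prob {w \<in> space M. t <= \<bar>Y l w\<bar>} <= V / t^2"
  and e: "0 < e" and ro: "0 < ro" "2 * V / e^2 <= ro" "ro <= 1" and L: "3 <= L" and A: "A \<subseteq> {..<L}" "ka * real L <= real (card A)" "0 < ka"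
 shows "\<exists>q. prob {w \<in> space M. \<exists>l<L. q + 4 * e < Y l w} <= ro \<and>
  prob {w \<in> space M. \<forall>l\<in>A. Y l w <= q - 4 * e} <= exp (- ka / ro) + exp (- ka * real L / 2)"
proof -
 have YM [measurable]: "l < L ==> Y l \<in> BM M" for l using ind by (auto simp: indep_vars_def)
 have l0: "0 < L" using L by simp
 have G0: "0 <= G x" for x using pf by (simp add: pf2_def)
 have G1: "G x <= 1" for x using G[OF l0, of x] by (metis prob_le_1)
 have anti: "G y <= G x" if "x <= y" for x y
  unfolding G[OF l0, symmetric] using l0 that by (intro finite_measure_mono) auto
 have up: "G t <= V / t^2" if "0 < t" for t
 proof -
  have "prob {w \<in> space M. t < Y 0 w} <= prob {w \<in> space M. t <= \<bar>Y 0 w\<bar>}" using l0 by (intro finite_measure_mono) auto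
  then show ?thesis using V[OF l0 that] G[OF l0] by simp
 qed
 have low: "1 - V / t\<^sup>2 <= G (- t)" if "0 < t" for t
 proof -
  have "prob {w \<in> space M. - t < Y 0 w} = 1 - prob (space M - {w \<in> space M. - t < Y 0 w})"
   using l0 by (subst prob_compl) auto
  moreover have "prob (space M - {w \<in> space M. - t < Y 0 w}) <= prob {w \<in> space M. t <= \<bar>Y 0 w\<bar>}"
   using l0 by (intro finite_measure_mono) auto
  ultimately show ?thesis using V[OF l0 that] G[OF l0] by simp
 qed
 have Ve: "V / e^2 <= ro / 2" using ro(2) unfolding times_divide_eq_right[symmetric] by linarith
 have half: "1 / 2 <= G (- e)" using low[OF e] Ve ro(3) by linarith
 \<comment> \<open>The minor with shifts 0 and \<open>x + e\<close> compares
   \<open>G (x + 2 * e) / G x\<close> with \<open>G e / G (- e)\<close>, and Chebyshev's inequality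
   bounds the latter by \<open>ro / 2\<close> over \<open>1 / 2\<close>.\<close>
 have ratio: "G (x + 2 * e) <= ro * G x" if "- e <= x" for x
 proof -
  have "G (x - (x + e)) * G (x + 2 * e - 0) <= G (x - 0) * G (x + 2 * e - (x + e))"
   using that e by (intro pf2D[OF pf]) auto
  then have "G (- e) * G (x + 2 * e) <= G x * G e" by simp
  also have "\<dots> <= G x * (ro / 2)" by (rule mult_left_mono[OF order_trans[OF up[OF e] Ve] G0])
  finally have 1: "G (- e) * G (x + 2 * e) <= G x * (ro / 2)" .
  have "1 / 2 * G (x + 2 * e) <= G (- e) * G (x + 2 * e)" using half G0 by (intro mult_right_mono) auto
  with 1 show ?thesis by (simp add: mult.commute)
 qed
 define S where "S = {x. G x <= 1 / real L}"
 define q where "q = Inf S"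
 have S_low: "- e <= x" if "x \<in> S" for x
 proof (rule ccontr)
  assume "\<not> - e <= x"
  then have "1 / 2 <= G x" using half anti[of x "- e"] by simp
  \<comment> \<open>Three nodes suffice to put the level \<open>1 / L\<close> below the value
    \<open>1 / 2\<close> reached at \<open>- e\<close>.\<close>
  moreover have "1 / real L <= 1 / 3" using L by (simp add: field_simps)
  ultimately show False using that by (simp add: S_def)
 qed
 then have bdd: "bdd_below S" by (auto simp: bdd_below_def)
 have "S \<noteq> {}"
 proof -
  \<comment> \<open>By Chebyshev's inequality this point is beyond the level \<open>1 / L\<close>,
    so the quantile exists.\<close>
  define t where "t = sqrt (\<bar>V\<bar> * real L + 1)"
  have t: "0 < t" "t^2 = \<bar>V\<bar> * real L + 1" unfolding t_def by (auto intro: add_nonneg_pos)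
  have "V / t^2 <= 1 / real L"
  proof -
   have "V * real L <= \<bar>V\<bar> * real L" by (intro mult_right_mono) auto
   also have "\<dots> <= t^2" unfolding t(2) by simp
   finally have "V * real L <= 1 * t^2" by simp
   then show ?thesis using t(1) l0 by (simp add: field_simps)
  qed
  then have "t \<in> S" using up[OF t(1)] by (simp add: S_def)
  then show ?thesis by auto
 qed
 have q_low: "- e <= q" unfolding q_def by (rule cInf_greatest[OF \<open>S \<noteq> {}\<close> S_low])
 have above: "G x <= 1 / real L" if qx: "q < x" for x
 proof -
  obtain y where "y \<in> S" "y < x" using cInf_lessD[OF \<open>S \<noteq> {}\<close> qx[unfolded q_def]] by blast
  then show ?thesis using anti[of y x] by (simp add: S_def)
 qed
 have below: "1 / real L < G x" if "x < q" for x
 proof -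
  have "x \<notin> S" using cInf_lower[of x S] bdd that by (auto simp: q_def)
  then show ?thesis by (simp add: S_def not_le)
 qed
 have 1: "prob {w \<in> space M. \<exists>l<L. q + 4 * e < Y l w} <= ro"
 proof -
  have "{w \<in> space M. \<exists>l<L. q + 4 * e < Y l w} = (\<Union>l\<in>{..<L}. {w \<in> space M. q + 4 * e < Y l w})" by auto
  then have "prob {w \<in> space M. \<exists>l<L. q + 4 * e < Y l w} <= (\<Sum>l\<in>{..<L}. prob {w \<in> space M. q + 4 * e < Y l w})"
   by (simp only:) (rule finite_measure_subadditive_finite, auto)
  also have "\<dots> = real L * G (q + 4 * e)" using G by simp
  \<comment> \<open>The first shift by \<open>2 * e\<close> passes the quantile, where
    \<open>G\<close> is at most \<open>1 / L\<close>; the second one gains the factor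
    \<open>ro\<close> that makes the union bound small.\<close>
  also have "G (q + 4 * e) <= ro * G (q + 2 * e)" using ratio[of "q + 2 * e"] q_low e by (simp add: algebra_simps)
  also have "ro * G (q + 2 * e) <= ro * (1 / real L)" using above[of "q + 2 * e"] e ro by (intro mult_left_mono) auto
  finally show ?thesis using l0 by (simp add: mult_left_mono)
 qed
 have 2: "prob {w \<in> space M. \<forall>l\<in>A. Y l w <= q - 4 * e} <= exp (- ka / ro) + exp (- ka * real L / 2)"
 proof -
  have finA: "finite A" using A(1) finite_subset by blast
  have "0 < ka * real L" using A(3) l0 by simp
  then have neA: "A \<noteq> {}" using A(2) by auto
  define p where "p = G (q - 4 * e)"
  have p: "0 <= p" "p <= 1" using G0 G1 by (auto simp: p_def)
  have "{w \<in> space M. \<forall>l\<in>A. Y l w <= q - 4 * e} = (\<Inter>l\<in>A. Y l -` {..q - 4 * e} \<inter> space M)" using neA by auto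
  then have "prob {w \<in> space M. \<forall>l\<in>A. Y l w <= q - 4 * e} = (\<Prod>l\<in>A. prob (Y l -` {..q - 4 * e} \<inter> space M))"
   using indep_varsD[OF ind neA finA A(1), of "%_. {..q - 4 * e}"] by simp
  also have "\<dots> = (\<Prod>l\<in>A. 1 - p)"
  proof (intro prod.cong refl)
   fix l assume "l \<in> A"
   then have l: "l < L" using A by auto
   have "Y l -` {..q - 4 * e} \<inter> space M = space M - {w \<in> space M. q - 4 * e < Y l w}" by auto
   then show "prob (Y l -` {..q - 4 * e} \<inter> space M) = 1 - p"
    using G[OF l, of "q - 4 * e"] l by (simp only: p_def) (subst prob_compl, auto)
  qed
  also have "\<dots> = (1 - p) ^ card A" by simp
  also have "\<dots> <= exp (- p) ^ card A" using p exp_ge_add_one_self[of "- p"] by (intro power_mono) auto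
  also have "\<dots> = exp (- (p * real (card A)))" by (simp add: exp_of_nat_mult[symmetric] mult.commute)
  also have "\<dots> <= exp (- (p * (ka * real L)))" using p A(2) by (simp add: mult_left_mono)
  \<comment> \<open>If \<open>q - 4 * e\<close> lies to the right of \<open>- e\<close>, then
    \<open>ratio\<close> raises the tail there to at least \<open>1 / (ro * L)\<close>, and the
    number of nodes in \<open>A\<close> gives the exponent \<open>- ka / ro\<close>. Otherwise the
    tail is at least \<open>1 / 2\<close> and the exponent is linear in \<open>L\<close>.\<close>
  also have "\<dots> <= exp (- ka / ro) + exp (- ka * real L / 2)"
  proof (cases "- e <= q - 4 * e")
   case True
   have "1 / real L < G (q - 2 * e)" using below[of "q - 2 * e"] e by simp
   also have "G (q - 2 * e) <= ro * p" using ratio[OF True] by (simp add: p_def algebra_simps)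
   finally have "1 / ro <= p * real L" using l0 ro(1) by (simp add: field_simps)
   then have "ka * (1 / ro) <= ka * (p * real L)" using A(3) by (intro mult_left_mono) auto
   then have "exp (- (p * (ka * real L))) <= exp (- ka / ro)" by (simp add: mult_ac)
   moreover have "0 <= exp (- ka * real L / 2)" by simp
   ultimately show ?thesis by linarith
  next
   case False
   then have "1 / 2 <= p" using half anti[of "q - 4 * e" "- e"] by (simp add: p_def)
   then have "1 / 2 * (ka * real L) <= p * (ka * real L)" using A(3) by (intro mult_right_mono) auto
   then have "exp (- (p * (ka * real L))) <= exp (- ka * real L / 2)" by simp
   moreover have "0 <= exp (- ka / ro)" by simp
   ultimately show ?thesis by linarith
  qed
  finally show ?thesis .
 qed
 show ?thesis using 1 2 by blast
qed

section \<open>The contrast\<close>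

text \<open>Pascal's rule after a shift of the index: the induction step of Leibniz's formula,
  stated for sequences so that it fits one-sided derivatives.\<close>

lemma leibniz_sum:
 fixes u v :: "nat => real"
 shows "(\<Sum>r\<le>k. of_nat (k choose r) * (u (Suc r) * v (k - r) + u r * v (Suc (k - r)))) = (\<Sum>r\<le>Suc k. of_nat (Suc k choose r) * (u r * v (Suc k - r)))"
proof -
 have "(\<Sum>r\<le>Suc k. of_nat (Suc k choose r) * (u r * v (Suc k - r)))
  = u 0 * v (Suc k) + (\<Sum>r\<le>k. of_nat (Suc k choose Suc r) * (u (Suc r) * v (k - r)))"
  by (subst sum.atMost_Suc_shift) simp
 also have "(\<Sum>r\<le>k. of_nat (Suc k choose Suc r) * (u (Suc r) * v (k - r)))
  = (\<Sum>r\<le>k. of_nat (k choose r) * (u (Suc r) * v (k - r))) + (\<Sum>r\<le>k. of_nat (k choose Suc r) * (u (Suc r) * v (k - r)))"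
  by (simp add: sum.distrib[symmetric] algebra_simps)
 also have "u 0 * v (Suc k) + (\<dots>) = (\<Sum>r\<le>k. of_nat (k choose r) * (u (Suc r) * v (k - r))) + (u 0 * v (Suc k) + (\<Sum>r\<le>k. of_nat (k choose Suc r) * (u (Suc r) * v (k - r))))"
  by simp
 also have "u 0 * v (Suc k) + (\<Sum>r\<le>k. of_nat (k choose Suc r) * (u (Suc r) * v (k - r))) = (\<Sum>r\<le>Suc k. of_nat (k choose r) * (u r * v (Suc k - r)))"
  by (subst sum.atMost_Suc_shift) simp
 also have "\<dots> = (\<Sum>r\<le>k. of_nat (k choose r) * (u r * v (Suc (k - r))))"
  by (simp add: Suc_diff_le)
 finally show ?thesis by (simp add: sum.distrib[symmetric] algebra_simps)
qed

lemma unit_interval_lipschitz: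
 assumes "!!th. th \<in> {0..1} ==> (g has_real_derivative g' th) (at th within {0..1})" "!!th. th \<in> {0..1} ==> \<bar>g' th\<bar> <= C"
  and "u \<in> {0..1}" "v \<in> {0..1::real}"
 shows "\<bar>g u - g v\<bar> <= C * \<bar>u - v\<bar>"
 using field_differentiable_bound[of "{0..1}" g g' C v u] assms by (simp add: abs_minus_commute)

section \<open>Parameter derivatives of the drift and of the increments\<close>

locale smooth_drift =
 fixes b :: "real => real => real"
 assumes b_smooth: "!!k x th. th \<in> {0..1} ==> dparam k (%et. b et x) differentiable (at th within {0..1})"
  and b_bounded: "\<exists>C. \<forall>x. \<bar>b 0 x\<bar> <= C"
  and b_derivs: "!!k. 1 <= k ==> \<exists>C. \<forall>x. \<forall>th\<in>{0..1}. \<bar>dparam k (%et. b et x) th\<bar> <= C"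
  and b_cont: "!!th. th \<in> {0..1} ==> continuous_on UNIV (b th)"
begin

definition bder :: "nat => real => real => real" where
 "bder k th x = dparam k (%et. b et x) th"

lemma bder_0: "bder 0 th x = b th x" by (simp add: bder_def)

lemma bder_deriv:
 assumes "th \<in> {0..1}"
 shows "((%et. bder k et x) has_real_derivative bder (Suc k) th x) (at th within {0..1})"
 using vector_derivative_works[THEN iffD1, OF b_smooth[OF assms, of k x]]
 by (simp add: bder_def has_real_derivative_iff_has_vector_derivative)

text \<open>For \<open>k = 0\<close> a bound is given at the parameter 0 only; the uniformly bounded
  first derivative spreads it over the whole parameter interval.\<close>

lemma bder_bounded: "\<exists>C\<ge>0. \<forall>x. \<forall>th\<in>{0..1}. \<bar>bder k th x\<bar> <= C"
proof (cases k)
 case 0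
 obtain C0 where C0: "!!x. \<bar>b 0 x\<bar> <= C0" using b_bounded by blast
 obtain C1 where "\<forall>x. \<forall>th\<in>{0..1}. \<bar>dparam 1 (%et. b et x) th\<bar> <= C1" using b_derivs[of 1] by blast
 then have C1: "\<bar>bder 1 th x\<bar> <= C1" if "th \<in> {0..1}" for x th using that unfolding bder_def by blast
 have C1': "0 <= C1" using C1[of 0 undefined] by simp
 have "\<bar>bder 0 th x\<bar> <= C0 + C1" if "th \<in> {0..1}" for th x
 proof -
  have "\<bar>bder 0 th x - bder 0 0 x\<bar> <= C1 * \<bar>th - 0\<bar>"
   using bder_deriv[of _ 0 x] C1 that by (intro unit_interval_lipschitz[where g'="%et. bder 1 et x"]) auto
  also have "\<dots> <= C1 * 1" using that C1' by (intro mult_left_mono) auto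
  finally show ?thesis using C0[of x] by (simp add: bder_0)
 qed
 moreover have "0 <= C0 + C1" using C0[of undefined] C1' by linarith
 ultimately show ?thesis using 0 by blast
next
 case (Suc k')
 then obtain C where C: "\<forall>x. \<forall>th\<in>{0..1}. \<bar>bder k th x\<bar> <= C" using b_derivs[of k] by (auto simp: bder_def)
 then have "0 <= C" using abs_ge_zero[of "bder k 0 undefined"] by (meson atLeastAtMost_iff order_refl order_trans zero_le_one)
 with C show ?thesis by blast
qed

definition bder_bd :: "nat => real" where
 "bder_bd k = (SOME C. 0 <= C \<and> (\<forall>x. \<forall>th\<in>{0..1}. \<bar>bder k th x\<bar> <= C))"

lemma bder_bd: "0 <= bder_bd k" "th \<in> {0..1} ==> \<bar>bder k th x\<bar> <= bder_bd k"
 using someI_ex[OF bder_bounded[of k], folded bder_bd_def] by auto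

text \<open>In the space variable a parameter derivative is a pointwise limit of difference
  quotients. The increments \<open>d r\<close> point to the right for \<open>th <= 1/2\<close> and
  to the left otherwise, so that they never leave the interval and the one-sided derivatives at its
  ends are covered.\<close>

lemma bder_measurable: "th \<in> {0..1} ==> bder k th \<in> BM borel"
proof (induction k arbitrary: th)
 case 0
 then show ?case using b_cont by (simp add: bder_0[abs_def] borel_measurable_continuous_onI)
next
 case (Suc k)
 define d where "d r = (if th <= 1/2 then 1 else - 1) / (2 * real (Suc r))" for r
 have small: "1 / (2 * real (Suc r)) <= 1 / 2" for r by (simp add: field_simps)
 have d: "th + d r \<in> {0..1}" "d r \<noteq> 0" for r
 proof -
  define w where "w = 1 / (2 * real (Suc r))"
  have "0 <= w" "w <= 1 / 2" using small[of r] by (auto simp: w_def)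
  moreover have "d r = (if th <= 1/2 then w else - w)" by (simp add: d_def w_def)
  moreover have "0 <= th" "th <= 1" using Suc.prems by auto
  ultimately show "th + d r \<in> {0..1}" by (cases "th <= 1/2") auto
  show "d r \<noteq> 0" by (simp add: d_def del: of_nat_Suc)
 qed
 have d0: "d \<longlonglongrightarrow> 0"
 proof -
  have "(%r. ((if th <= 1/2 then 1 else - 1) / 2) * (1 / real (Suc r))) \<longlonglongrightarrow> ((if th <= 1/2 then 1 else - 1) / 2) * 0"
   by (intro tendsto_mult_left LIMSEQ_Suc[OF lim_1_over_n])
  then show ?thesis by (simp add: d_def[abs_def])
 qed
 have lim: "(%r. (bder k (th + d r) x - bder k th x) / d r) \<longlonglongrightarrow> bder (Suc k) th x" for x
 proof -
  have "((%et. (bder k et x - bder k th x) / (et - th)) \<longlongrightarrow> bder (Suc k) th x) (at th within {0..1})"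
   using bder_deriv[OF Suc.prems, of k x] by (simp add: has_field_derivative_iff)
  moreover have "filterlim (%r. th + d r) (at th within {0..1}) sequentially"
   unfolding filterlim_at using d tendsto_add[OF tendsto_const d0, of th] by (auto intro!: always_eventually)
  ultimately have "(%r. (bder k (th + d r) x - bder k th x) / (th + d r - th)) \<longlonglongrightarrow> bder (Suc k) th x"
   by (rule filterlim_compose)
  then show ?thesis by simp
 qed
 have [measurable]: "bder k (th + d r) \<in> BM borel" "bder k th \<in> BM borel" for r
  using Suc.IH d(1) Suc.prems by auto
 show ?case by (rule borel_measurable_LIMSEQ_real[OF lim]) measurable
qed

text \<open>The \<open>k\<close>-th parameter derivative of the squared drift, in Leibniz
  form.\<close>

definition bsq :: "nat => real => real => real" where
 "bsq k th x = (\<Sum>r\<le>k. of_nat (k choose r) * (bder r th x * bder (k - r) th x))"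

definition bsq_bd :: "nat => real" where
 "bsq_bd k = (\<Sum>r\<le>k. of_nat (k choose r) * (bder_bd r * bder_bd (k - r)))"

lemma bsq_0: "bsq 0 th x = (b th x)^2" by (simp add: bsq_def bder_0 power2_eq_square)

lemma bsq_bd: "0 <= bsq_bd k" "th \<in> {0..1} ==> \<bar>bsq k th x\<bar> <= bsq_bd k"
proof -
 show "0 <= bsq_bd k" unfolding bsq_bd_def using bder_bd(1) by (intro sum_nonneg mult_nonneg_nonneg) auto
 assume th: "th \<in> {0..1}"
 have "\<bar>bsq k th x\<bar> <= (\<Sum>r\<le>k. \<bar>of_nat (k choose r) * (bder r th x * bder (k - r) th x)\<bar>)" unfolding bsq_def by (rule sum_abs)
 also have "\<dots> <= bsq_bd k" unfolding bsq_bd_def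
  using bder_bd th by (intro sum_mono) (auto simp: abs_mult intro!: mult_left_mono mult_mono)
 finally show "\<bar>bsq k th x\<bar> <= bsq_bd k" .
qed

lemma bsq_deriv:
 assumes "th \<in> {0..1}"
 shows "((%et. bsq k et x) has_real_derivative bsq (Suc k) th x) (at th within {0..1})"
proof -
 have "((%et. \<Sum>r\<le>k. of_nat (k choose r) * (bder r et x * bder (k - r) et x)) has_real_derivative
  (\<Sum>r\<le>k. of_nat (k choose r) * (bder (Suc r) th x * bder (k - r) th x + bder r th x * bder (Suc (k - r)) th x))) (at th within {0..1})"
 proof (rule DERIV_sum)
  fix r
  have "((%et. bder r et x * bder (k - r) et x) has_real_derivative (bder (Suc r) th x * bder (k - r) th x + bder (Suc (k - r)) th x * bder r th x)) (at th within {0..1})"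
   by (rule DERIV_mult[OF bder_deriv[OF assms] bder_deriv[OF assms]])
  from DERIV_cmult[OF this, of "of_nat (k choose r)"]
  show "((%et. of_nat (k choose r) * (bder r et x * bder (k - r) et x)) has_real_derivative
   of_nat (k choose r) * (bder (Suc r) th x * bder (k - r) th x + bder r th x * bder (Suc (k - r)) th x)) (at th within {0..1})"
   by (simp add: mult.commute)
 qed
 then show ?thesis
  using leibniz_sum[of k "%r. bder r th x" "%r. bder r th x"] unfolding bsq_def by simp
qed

lemma bsq_measurable: "th \<in> {0..1} ==> bsq k th \<in> BM borel"
 unfolding bsq_def[abs_def] using bder_measurable by (intro borel_measurable_sum borel_measurable_times borel_measurable_const) auto

text \<open>The \<open>k\<close>-th parameter derivative of \<open>f_increment\<close> in closed
  form, as \<open>dparam_f\<close> confirms.\<close>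

definition fder :: "(real => real) => real => nat => real => real => real => real" where
 "fder sg De k th x y = (2 * bder k th x * (y - x) - De * bsq k th x) / (sg x)^2"

lemma fder_0: "fder sg De 0 th x y = f_increment b sg De th x y"
 by (simp add: fder_def f_increment_def bder_0 bsq_0)

lemma fder_deriv:
 assumes "th \<in> {0..1}"
 shows "((%et. fder sg De k et x y) has_real_derivative fder sg De (Suc k) th x y) (at th within {0..1})"
proof -
 have "((%et. bder k et x * (2 * (y - x)) - bsq k et x * De) has_real_derivative bder (Suc k) th x * (2 * (y - x)) - bsq (Suc k) th x * De) (at th within {0..1})"
  by (intro DERIV_diff DERIV_cmult_right bder_deriv bsq_deriv assms)
 from DERIV_cdivide[OF this, of "(sg x)^2"] show ?thesis unfolding fder_def by (simp only: mult_ac)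
qed

lemma dparam_f:
 assumes "th \<in> {0..1}"
 shows "dparam k (%et. f_increment b sg De et x y) th = fder sg De k th x y"
 using assms
proof (induction k arbitrary: th)
 case 0
 then show ?case by (simp add: fder_0)
next
 case (Suc k)
 have "((%et. fder sg De k et x y) has_vector_derivative fder sg De (Suc k) th x y) (at th within {0..1})"
  using fder_deriv[OF Suc.prems] by (simp add: has_real_derivative_iff_has_vector_derivative)
 then have "(dparam k (%et. f_increment b sg De et x y) has_vector_derivative fder sg De (Suc k) th x y) (at th within {0..1})"
  by (rule has_vector_derivative_transform_within[where d=1]) (use Suc in auto)
 from vector_derivative_within_cbox[of 0 1 th, OF _ _ this[folded cbox_interval]] Suc.prems
 show ?case by simp
qed

end

section \<open>Riemann sums and suprema of random functions\<close>

lemma riemann_sums_converge: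
 fixes f :: "real => real"
 assumes cf: "continuous_on {0..T} f" and T: "0 < T"
 shows "(%q. \<Sum>r<Suc q. T / real (Suc q) * f (real r * (T / real (Suc q)))) \<longlonglongrightarrow> integral {0..T} f"
proof (rule metric_LIMSEQ_I)
 fix e :: real assume e: "0 < e"
 have "uniformly_continuous_on {0..T} f" by (intro compact_uniformly_continuous cf) auto
 then obtain d where d: "0 < d" "!!x y. x \<in> {0..T} ==> y \<in> {0..T} ==> dist y x < d ==> dist (f y) (f x) < e / (2 * T)"
  unfolding uniformly_continuous_on_def using e T by (metis divide_pos_pos mult_pos_pos zero_less_numeral)
 obtain q0 where q0: "T / d < real q0" using reals_Archimedean2 by blast
 have "dist (\<Sum>r<Suc q. T / real (Suc q) * f (real r * (T / real (Suc q)))) (integral {0..T} f) < e" if q: "q0 <= q" for q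
 proof -
  define h where "h = T / real (Suc q)"
  define t where "t r = real r * h" for r
  have h: "0 < h" "real (Suc q) * h = T" using T by (auto simp: h_def)
  have hd: "h < d"
  proof -
   have "T / d < real (Suc q)" using q0 q by simp
   then show ?thesis using d(1) by (simp add: h_def field_simps del: of_nat_Suc)
  qed
  have tS: "t (Suc r) - t r = h" for r by (simp add: t_def algebra_simps)
  have t: "0 <= t r" "r <= Suc q ==> t r <= T" for r
  proof -
   show "0 <= t r" using h by (simp add: t_def)
   assume "r <= Suc q"
   then have "real r * h <= real (Suc q) * h" using h by (intro mult_right_mono) auto
   then show "t r <= T" by (simp only: t_def h(2))
  qed
  have split: "integral {0..t r} f = (\<Sum>i<r. integral {t i..t (Suc i)} f)" if "r <= Suc q" for r
   using that
  proof (induction r)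
   case 0
   then show ?case by (simp add: t_def)
  next
   case (Suc r)
   have "f integrable_on {0..t (Suc r)}"
    using t(2)[OF Suc.prems] by (intro integrable_continuous_interval continuous_on_subset[OF cf]) auto
   then have "integral {0..t r} f + integral {t r..t (Suc r)} f = integral {0..t (Suc r)} f"
    using t(1)[of r] tS[of r] h by (intro Henstock_Kurzweil_Integration.integral_combine) auto
   then show ?case using Suc by simp
  qed
  have cell: "\<bar>integral {t r..t (Suc r)} f - h * f (t r)\<bar> <= h * (e / (2 * T))" if "r < Suc q" for r
  proof -
   have sub: "{t r..t (Suc r)} \<subseteq> {0..T}" using t(1)[of r] t(2)[of "Suc r"] that by auto
   have le: "t r <= t (Suc r)" using tS[of r] h by linarith
   have tr: "t r \<in> {0..T}" using sub le by auto
   have int: "f integrable_on {t r..t (Suc r)}" by (intro integrable_continuous_interval continuous_on_subset[OF cf sub])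
   have "integral {t r..t (Suc r)} f - h * f (t r) = integral {t r..t (Suc r)} (%x. f x - f (t r))"
    using int le tS[of r] by (subst Henstock_Kurzweil_Integration.integral_diff) auto
   also have "norm \<dots> <= (e / (2 * T)) * (t (Suc r) - t r)"
   proof (rule integral_bound[OF le])
    show "continuous_on {t r..t (Suc r)} (%x. f x - f (t r))" by (intro continuous_intros continuous_on_subset[OF cf sub])
    fix x assume x: "x \<in> {t r..t (Suc r)}"
    then have "dist x (t r) < d" using tS[of r] hd by (auto simp: dist_real_def)
    then show "norm (f x - f (t r)) <= e / (2 * T)" using d(2)[OF tr subsetD[OF sub x]] by (simp add: dist_real_def)
   qed
   finally show ?thesis unfolding tS by (simp add: mult.commute)
  qed
  have "integral {0..T} f = (\<Sum>i<Suc q. integral {t i..t (Suc i)} f)"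
   using split[of "Suc q"] h by (simp add: t_def del: of_nat_Suc sum.lessThan_Suc)
  then have "\<bar>integral {0..T} f - (\<Sum>i<Suc q. h * f (t i))\<bar> <= (\<Sum>i<Suc q. \<bar>integral {t i..t (Suc i)} f - h * f (t i)\<bar>)"
   by (simp only: sum_subtractf[symmetric]) (rule sum_abs)
  also have "\<dots> <= (\<Sum>i<Suc q. h * (e / (2 * T)))" by (intro sum_mono cell) auto
  also have "\<dots> = real (Suc q) * h * (e / (2 * T))" by (simp del: sum.lessThan_Suc of_nat_Suc)
  also have "\<dots> = e / 2" unfolding h(2) using T by simp
  finally have "\<bar>integral {0..T} f - (\<Sum>i<Suc q. h * f (t i))\<bar> < e" using e by simp
  then show ?thesis unfolding t_def h_def dist_real_def by (simp only: abs_minus_commute)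
 qed
 then show "\<exists>no. \<forall>n\<ge>no. dist (\<Sum>r<Suc n. T / real (Suc n) * f (real r * (T / real (Suc n)))) (integral {0..T} f) < e" by blast
qed

text \<open>Integrating the derivative controls the supremum; the Riemann sums keep everything measurable.\<close>

lemma sup_moment_bound:
 fixes g :: "real => 'a => real"
 assumes der: "!!w th. w \<in> space M ==> th \<in> {0..1} ==> ((%et. g et w) has_real_derivative g' th w) (at th within {0..1})"
  and cont: "!!w. w \<in> space M ==> continuous_on {0..1} (%th. g' th w)"
  and meas: "!!th. th \<in> {0..1} ==> g th \<in> BM M" "!!th. th \<in> {0..1} ==> g' th \<in> BM M"
  and bnd: "nnE M (%w. \<bar>g 0 w\<bar>) <= ennreal C" "!!th. th \<in> {0..1} ==> (nnE M (%w. \<bar>g' th w\<bar>)) <= ennreal C'"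
  and C: "0 <= C" "0 <= C'"
 shows "\<exists>Z. Z \<in> BM M \<and> (\<forall>w\<in>space M. 0 <= Z w \<and> (\<forall>th\<in>{0..1}. \<bar>g th w\<bar> <= Z w)) \<and> (nnE M (%w. Z w)) <= ennreal (C + C')"
proof -
 define R where "R q w = (\<Sum>r<Suc q. \<bar>g' (real r / real (Suc q)) w\<bar>) / real (Suc q)" for q w
 define Iq where "Iq w = integral {0..1} (%th. \<bar>g' th w\<bar>)" for w
 have pt: "real r / real (Suc q) \<in> {0..1}" if "r <= Suc q" for r q using that by (auto simp: field_simps)
 have RM [measurable]: "R q \<in> BM M" for q
  unfolding R_def[abs_def] using pt meas(2) by (intro borel_measurable_divide borel_measurable_sum borel_measurable_abs borel_measurable_const) auto
 have lim: "(%q. R q w) \<longlonglongrightarrow> Iq w" if w: "w \<in> space M" for w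
 proof -
  have "continuous_on {0..1} (%th. \<bar>g' th w\<bar>)" by (intro continuous_intros cont w)
  from riemann_sums_converge[OF this] have "(%q. \<Sum>r<Suc q. 1 / real (Suc q) * \<bar>g' (real r * (1 / real (Suc q))) w\<bar>) \<longlonglongrightarrow> Iq w"
   by (simp only: Iq_def zero_less_one simp_thms)
  moreover have "R q w = (\<Sum>r<Suc q. 1 / real (Suc q) * \<bar>g' (real r * (1 / real (Suc q))) w\<bar>)" for q
   unfolding R_def sum_divide_distrib by simp
  ultimately show ?thesis by (simp only:)
 qed
 have IM: "Iq \<in> BM M" by (rule borel_measurable_LIMSEQ_real[OF lim RM])
 have R0: "0 <= R q w" for q w unfolding R_def by (intro divide_nonneg_nonneg sum_nonneg) auto
 have I0: "0 <= Iq w" if "w \<in> space M" for w using lim[OF that] R0 by (intro LIMSEQ_le_const) auto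
 have ER: "nnE M (%w. R q w) <= ennreal C'" for q
 proof -
  have "nnE M (%w. R q w) = nnI M (%w. ennreal (1 / real (Suc q)) * (\<Sum>r<Suc q. ennreal \<bar>g' (real r / real (Suc q)) w\<bar>))"
   unfolding R_def by (intro nn_integral_cong, subst sum_ennreal, simp, subst ennreal_mult[symmetric]) (auto intro: sum_nonneg simp del: of_nat_Suc sum.lessThan_Suc)
  also have "\<dots> = ennreal (1 / real (Suc q)) * (\<Sum>r<Suc q. (nnE M (%w. \<bar>g' (real r / real (Suc q)) w\<bar>)))"
  proof -
   have m: "(%w. ennreal \<bar>g' (real r / real (Suc q)) w\<bar>) \<in> BM M" if "r < Suc q" for r
    using meas(2)[OF pt[of r q]] that by simp
   have "nnI M (%w. (\<Sum>r<Suc q. ennreal \<bar>g' (real r / real (Suc q)) w\<bar>)) = (\<Sum>r<Suc q. (nnE M (%w. \<bar>g' (real r / real (Suc q)) w\<bar>)))"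
    using m by (intro nn_integral_sum) auto
   moreover have "(%w. \<Sum>r<Suc q. ennreal \<bar>g' (real r / real (Suc q)) w\<bar>) \<in> BM M"
    using m by (intro borel_measurable_sum) auto
   ultimately show ?thesis by (simp only: nn_integral_cmult)
  qed
  also have "\<dots> <= ennreal (1 / real (Suc q)) * (\<Sum>r<Suc q. ennreal C')"
   using pt by (intro mult_left_mono sum_mono bnd(2)) (auto simp del: of_nat_Suc)
  also have "\<dots> = ennreal C'"
   using C(2) by (subst sum_ennreal, simp, subst ennreal_mult[symmetric]) (auto simp del: of_nat_Suc sum.lessThan_Suc)
  finally show ?thesis .
 qed
 have EI: "nnE M (%w. Iq w) <= ennreal C'"
 proof -
  have "nnE M (%w. Iq w) = nnI M (%w. liminf (%q. ennreal (R q w)))"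
   using lim by (intro nn_integral_cong) (auto intro!: lim_imp_Liminf[symmetric] tendsto_ennrealI)
  also have "\<dots> <= liminf (%q. (nnE M (%w. R q w)))" by (rule nn_integral_liminf) measurable
  also have "\<dots> <= liminf (%q::nat. ennreal C')" by (intro Liminf_mono always_eventually allI ER)
  finally show ?thesis by (simp add: Liminf_const)
 qed
 let ?Z = "%w. \<bar>g 0 w\<bar> + Iq w"
 have g0M [measurable]: "g 0 \<in> BM M" using meas(1)[of 0] by simp
 note [measurable] = IM
 have "\<bar>g th w\<bar> <= ?Z w" if w: "w \<in> space M" and th: "th \<in> {0..1}" for th w
 proof -
  have sub: "{0..th} \<subseteq> {0..1}" using th by auto
  have ftc: "((%et. g' et w) has_integral (g th w - g 0 w)) {0..th}"
   using th der[OF w] sub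
   by (intro fundamental_theorem_of_calculus) (auto simp: has_real_derivative_iff_has_vector_derivative[symmetric] intro: DERIV_subset[OF _ sub])
  have c: "continuous_on {0..th} (%et. g' et w)" by (rule continuous_on_subset[OF cont[OF w] sub])
  have "\<bar>g th w - g 0 w\<bar> = \<bar>integral {0..th} (%et. g' et w)\<bar>" using ftc by (simp add: integral_unique)
  also have "\<dots> <= integral {0..th} (%et. \<bar>g' et w\<bar>)"
  proof -
   have "norm (integral {0..th} (%et. g' et w)) <= integral {0..th} (%et. \<bar>g' et w\<bar>)"
    using c by (intro integral_norm_bound_integral integrable_continuous_interval continuous_intros) auto
   then show ?thesis by simp
  qed
  also have "\<dots> <= Iq w" unfolding Iq_def
   using sub c by (intro integral_subset_le integrable_continuous_interval continuous_intros cont w) auto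
  finally show ?thesis by linarith
 qed
 moreover have "nnE M (%w. ?Z w) <= ennreal (C + C')"
 proof -
  have "nnE M (%w. ?Z w) = nnI M (%w. ennreal \<bar>g 0 w\<bar> + ennreal (Iq w))"
   using I0 by (intro nn_integral_cong) (auto simp: ennreal_plus)
  also have "\<dots> = (nnE M (%w. \<bar>g 0 w\<bar>)) + (nnE M (%w. Iq w))" by (intro nn_integral_add) auto
  also have "\<dots> <= ennreal C + ennreal C'" by (intro add_mono bnd(1) EI)
  finally show ?thesis using C by (simp add: ennreal_plus)
 qed
 moreover have "0 <= ?Z w" if "w \<in> space M" for w using I0[OF that] by simp
 moreover have "?Z \<in> BM M" by measurable
 ultimately show ?thesis by (intro exI[of _ ?Z]) blast
qed

text \<open>The bounded Lipschitz functions. They are closed under products and differences, and the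
  integrand \<open>psi\<close> of the limit contrast is built from them; the Lipschitz property
  turns mean square continuity of \<open>X\<close> into continuity in time of its mean.\<close>

definition blip :: "(real => real) => bool" where
 "blip f \<longleftrightarrow> (\<exists>C L. 0 <= C \<and> 0 <= L \<and> (\<forall>x. \<bar>f x\<bar> <= C) \<and> (\<forall>x y. \<bar>f x - f y\<bar> <= L * \<bar>x - y\<bar>))"

lemma blip_mult:
 assumes "blip f" "blip g" shows "blip (%x. f x * g x)"
proof -
 obtain C L where f: "0 <= C" "0 <= L" "!!x. \<bar>f x\<bar> <= C" "!!x y. \<bar>f x - f y\<bar> <= L * \<bar>x - y\<bar>" using assms(1) by (auto simp: blip_def)
 obtain D K where g: "0 <= D" "0 <= K" "!!x. \<bar>g x\<bar> <= D" "!!x y. \<bar>g x - g y\<bar> <= K * \<bar>x - y\<bar>" using assms(2) by (auto simp: blip_def)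
 have "\<bar>f x * g x - f y * g y\<bar> <= (C * K + L * D) * \<bar>x - y\<bar>" for x y
 proof -
  have "f x * g x - f y * g y = f x * (g x - g y) + (f x - f y) * g y" by (simp add: algebra_simps)
  then have "\<bar>f x * g x - f y * g y\<bar> <= \<bar>f x\<bar> * \<bar>g x - g y\<bar> + \<bar>f x - f y\<bar> * \<bar>g y\<bar>" by (metis abs_mult abs_triangle_ineq)
  also have "\<dots> <= C * (K * \<bar>x - y\<bar>) + (L * \<bar>x - y\<bar>) * D" using f g by (intro add_mono mult_mono) auto
  finally show ?thesis by (simp add: algebra_simps)
 qed
 moreover have "\<bar>f x * g x\<bar> <= C * D" for x unfolding abs_mult using f g by (intro mult_mono) auto
 ultimately show ?thesis unfolding blip_def using f g by (intro exI[of _ "C * D"] exI[of _ "C * K + L * D"]) auto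
qed

lemma blip_diff:
 assumes "blip f" "blip g" shows "blip (%x. f x - g x)"
proof -
 obtain C L where f: "0 <= C" "0 <= L" "!!x. \<bar>f x\<bar> <= C" "!!x y. \<bar>f x - f y\<bar> <= L * \<bar>x - y\<bar>" using assms(1) by (auto simp: blip_def)
 obtain D K where g: "0 <= D" "0 <= K" "!!x. \<bar>g x\<bar> <= D" "!!x y. \<bar>g x - g y\<bar> <= K * \<bar>x - y\<bar>" using assms(2) by (auto simp: blip_def)
 have "\<bar>(f x - g x) - (f y - g y)\<bar> <= (L + K) * \<bar>x - y\<bar>" for x y
  using f(4)[of x y] g(4)[of x y] by (simp add: algebra_simps)
 moreover have "\<bar>f x - g x\<bar> <= C + D" for x using f(3)[of x] g(3)[of x] by linarith
 ultimately show ?thesis unfolding blip_def using f g by (intro exI[of _ "C + D"] exI[of _ "L + K"]) auto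
qed

lemma blip_const: "blip (%_. a)"
 unfolding blip_def by (intro exI[of _ "\<bar>a\<bar>"] exI[of _ 0]) auto

text \<open>\<open>s\<close> may be unbounded, but its reciprocal is bounded and Lipschitz by
  ellipticity; the square is then a product.\<close>

lemma blip_inverse_square:
 assumes lip: "!!x y. \<bar>s x - s y\<bar> <= c * \<bar>x - y\<bar>" "0 <= c" and ell: "!!x. m <= (s x)^2" "0 < m"
 shows "blip (%x. 1 / (s x)^2)"
proof -
 have s0: "sqrt m <= \<bar>s x\<bar>" "s x \<noteq> 0" for x
 proof -
  have "sqrt m <= sqrt ((s x)^2)" using ell by (intro real_sqrt_le_mono)
  then show "sqrt m <= \<bar>s x\<bar>" by simp
  show "s x \<noteq> 0" using ell(1)[of x] ell(2) by auto
 qed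
 have inv: "blip (%x. 1 / s x)"
 proof -
  have b: "\<bar>1 / s x\<bar> <= 1 / sqrt m" for x using s0[of x] ell(2) by (simp add: frac_le)
  have "\<bar>1 / s x - 1 / s y\<bar> <= (1 / sqrt m * (1 / sqrt m) * c) * \<bar>x - y\<bar>" for x y
  proof -
   have "1 / s x - 1 / s y = 1 / s x * (1 / s y) * (s y - s x)" using s0 by (simp add: field_simps)
   then have "\<bar>1 / s x - 1 / s y\<bar> = \<bar>1 / s x\<bar> * \<bar>1 / s y\<bar> * \<bar>s y - s x\<bar>" by (simp only: abs_mult)
   also have "\<dots> <= 1 / sqrt m * (1 / sqrt m) * (c * \<bar>x - y\<bar>)"
    using b lip(1)[of y x] lip(2) ell(2) by (intro mult_mono) (auto simp: abs_minus_commute)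
   finally show ?thesis by (simp add: mult_ac)
  qed
  then show ?thesis unfolding blip_def using b lip(2) ell(2)
   by (intro exI[of _ "1 / sqrt m"] exI[of _ "1 / sqrt m * (1 / sqrt m) * c"]) auto
 qed
 have "(%x. 1 / s x * (1 / s x)) = (%x. 1 / (s x)^2)" by (simp add: power2_eq_square fun_eq_iff)
 with blip_mult[OF inv inv] show ?thesis by simp
qed

lemma blip_measurable: "blip f ==> f \<in> BM borel"
proof -
 assume "blip f"
 then obtain L where L: "0 <= L" "!!x y. \<bar>f x - f y\<bar> <= L * \<bar>x - y\<bar>" by (auto simp: blip_def)
 then have "continuous_on UNIV f" by (intro lipschitz_on_continuous_on[of L]) (auto simp: lipschitz_on_def dist_real_def)
 then show ?thesis by (rule borel_measurable_continuous_onI)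
qed

section \<open>The contrast of one observed particle\<close>

locale observed_particle = sde_particle M F T W "b ths" sg X I B c ka + smooth_drift b
 for M :: "'a measure" and F :: "real => 'a measure" and T :: real and W :: "real => 'a => real"
  and b :: "real => real => real" and ths :: real and sg :: "real => real" and X I :: "real => 'a => real" and B c ka :: real +
 fixes mn :: real
 assumes ths: "ths \<in> {0..1}" and elliptic: "!!x. mn <= (sg x)^2" and mn: "0 < mn"
  and b_lip: "!!th. th \<in> {0..1} ==> \<exists>L\<ge>0. \<forall>x y. \<bar>b th x - b th y\<bar> <= L * \<bar>x - y\<bar>"
begin

lemma sigma_inv: "1 / (sg x)^2 <= 1 / mn" "0 <= 1 / (sg x)^2" "sg x \<noteq> 0" "\<bar>sg x\<bar> / (sg x)^2 <= 1 / sqrt mn"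
proof -
 show "1 / (sg x)^2 <= 1 / mn" using elliptic[of x] mn by (intro frac_le) auto
 show "0 <= 1 / (sg x)^2" by simp
 show s0: "sg x \<noteq> 0" using elliptic[of x] mn by auto
 have "sqrt mn <= sqrt ((sg x)^2)" using elliptic[of x] by (rule real_sqrt_le_mono)
 then have "sqrt mn <= \<bar>sg x\<bar>" by simp
 then have "1 / \<bar>sg x\<bar> <= 1 / sqrt mn" using mn by (intro frac_le) auto
 moreover have "\<bar>sg x\<bar> / (sg x)^2 = 1 / \<bar>sg x\<bar>" using s0 by (simp add: power2_eq_square field_simps abs_mult_self_eq)
 ultimately show "\<bar>sg x\<bar> / (sg x)^2 <= 1 / sqrt mn" by simp
qed

lemma grid_time:
 assumes "1 <= n" "j <= n" shows "0 <= real j * (T / real n)" "real j * (T / real n) <= T"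
proof -
 show "0 <= real j * (T / real n)" using T_pos by simp
 have "real j * (T / real n) <= real n * (T / real n)" using assms T_pos by (intro mult_right_mono) auto
 then show "real j * (T / real n) <= T" using assms by simp
qed

definition wt :: "nat => real => real => real" where "wt k th x = 2 * bder k th x / (sg x)^2"

definition wt_bd :: "nat => real" where "wt_bd k = 2 * bder_bd k / mn"

lemma wt_bd: "th \<in> {0..1} ==> \<bar>wt k th x\<bar> <= wt_bd k" "0 <= wt_bd k"
proof -
 show "0 <= wt_bd k" using bder_bd(1)[of k] mn by (simp add: wt_bd_def)
 assume th: "th \<in> {0..1}"
 have "\<bar>wt k th x\<bar> = 2 * \<bar>bder k th x\<bar> * (1 / (sg x)^2)" by (simp add: wt_def abs_mult)
 also have "\<dots> <= 2 * bder_bd k * (1 / mn)" using bder_bd(2)[OF th, of k x] bder_bd(1)[of k] sigma_inv[of x] by (intro mult_mono) auto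
 finally show "\<bar>wt k th x\<bar> <= wt_bd k" by (simp add: wt_bd_def)
qed

lemma wt_F:
 assumes "th \<in> {0..1}" "0 <= t" "t <= T" shows "(%w. wt k th (X t w)) \<in> BM (F t)"
proof -
 note [measurable] = bder_measurable[OF assms(1), of k] X_F[OF assms(2,3)]
 show ?thesis unfolding wt_def by measurable
qed

lemma fder_split: "fder sg De k th x y = wt k th x * (y - x) - De * (bsq k th x / (sg x)^2)"
 by (simp add: fder_def wt_def diff_divide_distrib)

lemma bsq_sigma: "th \<in> {0..1} ==> \<bar>bsq k th x / (sg x)^2\<bar> <= bsq_bd k / mn"
proof -
 assume th: "th \<in> {0..1}"
 have "\<bar>bsq k th x / (sg x)^2\<bar> = \<bar>bsq k th x\<bar> * (1 / (sg x)^2)" by (simp add: abs_divide)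
 also have "\<dots> <= bsq_bd k * (1 / mn)" using bsq_bd(2)[OF th, of k x] bsq_bd(1)[of k] sigma_inv[of x] by (intro mult_mono) auto
 finally show ?thesis by simp
qed

lemma X_incr: "AE w in M. \<forall>j<n. X (real (Suc j) * (T / real n)) w - X (real j * (T / real n)) w
 = (drift (real (Suc j) * (T / real n)) w - drift (real j * (T / real n)) w) + (I (real (Suc j) * (T / real n)) w - I (real j * (T / real n)) w)"
 if n: "1 <= n"
 using X_eq_drift
proof eventually_elim
 case (elim w)
 show ?case
 proof (intro allI impI)
  fix j assume "j < n"
  then have "real (Suc j) * (T / real n) \<in> {0..T}" "real j * (T / real n) \<in> {0..T}"
   using grid_time[OF n, of "Suc j"] grid_time[OF n, of j] by auto
  from bspec[OF elim this(1)] bspec[OF elim this(2)]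
  show "X (real (Suc j) * (T / real n)) w - X (real j * (T / real n)) w
 = (drift (real (Suc j) * (T / real n)) w - drift (real j * (T / real n)) w) + (I (real (Suc j) * (T / real n)) w - I (real j * (T / real n)) w)" by linarith
 qed
qed

definition psum :: "nat => nat => real => 'a => real" where
 "psum n k th w = (\<Sum>j<n. fder sg (T / real n) k th (X (real j * (T / real n)) w) (X (real (Suc j) * (T / real n)) w))"

lemma fder_M:
 assumes "th \<in> {0..1}" "u \<in> BM N" "v \<in> BM N"
 shows "(%w. fder sg De k th (u w) (v w)) \<in> BM N"
proof -
 note [measurable] = bder_measurable[OF assms(1), of k] bsq_measurable[OF assms(1), of k] assms(2,3)
 show ?thesis unfolding fder_def by measurable
qed

lemma psum_M:
 assumes n: "1 <= n" and th: "th \<in> {0..1}" shows "psum n k th \<in> BM M"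
 unfolding psum_def[abs_def]
 by (intro borel_measurable_sum fder_M th X_M grid_time[OF n]) auto

definition psum_bd :: "nat => real" where
 "psum_bd k = 2 * (wt_bd k * B * T + T * (bsq_bd k / mn))^2 + 2 * ((wt_bd k)^2 * sigma_bound * T)"

lemma psum_bd_nonneg: "0 <= psum_bd k"
 unfolding psum_bd_def using sigma_bound_nonneg T_pos by (intro add_nonneg_nonneg mult_nonneg_nonneg) auto

text \<open>The drift and the quadratic term add up to a deterministic bound of order
  \<open>T\<close>; the stochastic part has bounded weights and is covered by
  \<open>weighted_ito_sum\<close>. The result depends neither on the number of observations nor on
  the parameter.\<close>

lemma psum_square:
 assumes n: "1 <= n" and th: "th \<in> {0..1}"
 shows "nnE M (%w. (psum n k th w)^2) <= ennreal (psum_bd k)"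
proof -
 define De where "De = T / real n"
 define t where "t j = real j * De" for j
 have De: "0 < De" "real n * De = T" using T_pos n by (auto simp: De_def)
 have tt: "0 <= t j" "t j <= T" if "j <= n" for j using grid_time[OF n that] by (auto simp: t_def De_def)
 have tS: "t (Suc j) - t j = De" for j by (simp add: t_def algebra_simps)
 define J where "J w = (\<Sum>j<n. wt k th (X (t j) w) * (I (t (Suc j)) w - I (t j) w))" for w
 have EJ: "nnE M (%w. (J w)^2) <= ennreal ((wt_bd k)^2 * sigma_bound * T)"
 proof -
  have "nnE M (%w. (\<Sum>j<n. wt k th (X (t j) w) * (I (t (Suc j)) w - I (t j) w))^2) <= ennreal ((wt_bd k)^2 * sigma_bound * (t n - t 0))"
  proof (rule weighted_ito_sum)
   show "0 <= t j \<and> t j <= T" if "j <= n" for j using tt that by blast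
   show "t j <= t (Suc j)" if "j < n" for j using tS[of j] De by linarith
   show "(%w. wt k th (X (t j) w)) \<in> BM (F (t j))" if "j < n" for j using wt_F[OF th tt] that by simp
  qed (rule wt_bd(1)[OF th])
  then show ?thesis using De by (simp add: J_def t_def)
 qed
 have Jm [measurable]: "J \<in> BM M"
 proof -
  have "(%w. wt k th (X (t j) w) * (I (t (Suc j)) w - I (t j) w)) \<in> BM M" if "j < n" for j
   using F_imp_M[OF wt_F[OF th tt(1,2)]] I_M[OF tt(1,2)] that by (intro borel_measurable_times borel_measurable_diff) auto
  then show ?thesis unfolding J_def[abs_def] by (intro borel_measurable_sum) auto
 qed
 define K where "K = wt_bd k * B * T + T * (bsq_bd k / mn)"
 have le: "AE w in M. (psum n k th w)^2 <= 2 * K^2 + 2 * (J w)^2"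
  using X_incr[OF n] AE_space
 proof eventually_elim
  case (elim w)
  have "psum n k th w = (\<Sum>j<n. (wt k th (X (t j) w) * (drift (t (Suc j)) w - drift (t j) w) - De * (bsq k th (X (t j) w) / (sg (X (t j) w))^2))
    + wt k th (X (t j) w) * (I (t (Suc j)) w - I (t j) w))"
   unfolding psum_def
  proof (intro sum.cong refl)
   fix j assume "j \<in> {..<n}"
   then have e: "X (t (Suc j)) w - X (t j) w = (drift (t (Suc j)) w - drift (t j) w) + (I (t (Suc j)) w - I (t j) w)"
    using elim(1) unfolding t_def De_def by blast
   show "fder sg (T / real n) k th (X (real j * (T / real n)) w) (X (real (Suc j) * (T / real n)) w) =
    (wt k th (X (t j) w) * (drift (t (Suc j)) w - drift (t j) w) - De * (bsq k th (X (t j) w) / (sg (X (t j) w))^2))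
    + wt k th (X (t j) w) * (I (t (Suc j)) w - I (t j) w)"
    unfolding fder_split t_def[symmetric] De_def[symmetric] e distrib_left by linarith
  qed
  then have split: "psum n k th w = (\<Sum>j<n. wt k th (X (t j) w) * (drift (t (Suc j)) w - drift (t j) w) - De * (bsq k th (X (t j) w) / (sg (X (t j) w))^2)) + J w"
   unfolding J_def sum.distrib .
  have "\<bar>\<Sum>j<n. wt k th (X (t j) w) * (drift (t (Suc j)) w - drift (t j) w) - De * (bsq k th (X (t j) w) / (sg (X (t j) w))^2)\<bar>
   <= (\<Sum>j<n. wt_bd k * (B * De) + De * (bsq_bd k / mn))"
  proof (rule order_trans[OF sum_abs sum_mono])
   fix j assume "j \<in> {..<n}"
   then have "\<bar>drift (t (Suc j)) w - drift (t j) w\<bar> <= B * De"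
    using drift_diff_bound[OF elim(2) tt(1)[of j], of "t (Suc j)"] tt[of "Suc j"] tS[of j] De by auto
   then have "\<bar>wt k th (X (t j) w) * (drift (t (Suc j)) w - drift (t j) w)\<bar> <= wt_bd k * (B * De)"
    unfolding abs_mult using wt_bd(1)[OF th] wt_bd(2) by (intro mult_mono) auto
   moreover have "\<bar>De * (bsq k th (X (t j) w) / (sg (X (t j) w))^2)\<bar> <= De * (bsq_bd k / mn)"
    using bsq_sigma[OF th] De unfolding abs_mult by (intro mult_mono) auto
   ultimately show "\<bar>wt k th (X (t j) w) * (drift (t (Suc j)) w - drift (t j) w) - De * (bsq k th (X (t j) w) / (sg (X (t j) w))^2)\<bar> <= wt_bd k * (B * De) + De * (bsq_bd k / mn)"
    by linarith
  qed
  also have "\<dots> = K" unfolding K_def De(2)[symmetric] by (simp add: algebra_simps)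
  finally have "(\<Sum>j<n. wt k th (X (t j) w) * (drift (t (Suc j)) w - drift (t j) w) - De * (bsq k th (X (t j) w) / (sg (X (t j) w))^2))^2 <= K^2"
   by (rule square_le_of_abs_le)
  then have "(psum n k th w)^2 <= 2 * K^2 + 2 * (J w)^2"
   unfolding split by (intro order_trans[OF two_squares]) simp
  then show ?case .
 qed
 have "nnE M (%w. (psum n k th w)^2) <= ennreal (2 * K^2 + 2 * ((wt_bd k)^2 * sigma_bound * T))"
  by (rule nn_bound1[OF le _ _ _ _ EJ]) (use sigma_bound_nonneg T_pos in auto)
 then show ?thesis by (simp add: psum_bd_def K_def)
qed

text \<open>One variable that dominates, up to constants, the increments of all orders at all
  parameters. The Brownian increment enters without the unbounded factor \<open>sg (X t w)\<close>,
  because that is divided by its square in the contrast.\<close>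

definition major :: "nat => nat => 'a => real" where
 "major n j w = (let De = T / real n; t = real j * De; t' = real (Suc j) * De in
  De + \<bar>I t' w - I t w - sg (X t w) * (W t' w - W t w)\<bar> + \<bar>W t' w - W t w\<bar>)"

definition major_const :: "nat => real" where
 "major_const k = 2 * bder_bd k * (B / mn + 1 / mn + 1 / sqrt mn) + bsq_bd k / mn"

lemma major_const_nonneg: "0 <= major_const k"
 unfolding major_const_def using bder_bd(1)[of k] bsq_bd(1)[of k] mn pos by (intro add_nonneg_nonneg mult_nonneg_nonneg) auto

lemma fder_major:
 assumes n: "1 <= n"
 shows "AE w in M. \<forall>j<n. \<forall>k. \<forall>th\<in>{0..1}. \<bar>fder sg (T / real n) k th (X (real j * (T / real n)) w) (X (real (Suc j) * (T / real n)) w)\<bar> <= major_const k * major n j w"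
 using X_incr[OF n] AE_space
proof eventually_elim
 case (elim w)
 show ?case
 proof (intro allI impI ballI)
  fix j k th assume j: "j < n" and th: "th \<in> {0..1::real}"
  define De where "De = T / real n"
  define t where "t = real j * De"
  define t' where "t' = real (Suc j) * De"
  have De: "0 < De" using T_pos n by (auto simp: De_def)
  have tt: "0 <= t" "t <= t'" "t' <= T" "t' - t = De"
   using grid_time[OF n, of j] grid_time[OF n, of "Suc j"] j De by (auto simp: t_def t'_def De_def[symmetric] algebra_simps)
  define R where "R = \<bar>I t' w - I t w - sg (X t w) * (W t' w - W t w)\<bar>"
  define D where "D = \<bar>W t' w - W t w\<bar>"
  have RD: "0 <= R" "0 <= D" by (auto simp: R_def D_def)
  have e: "X t' w - X t w = (drift t' w - drift t w) + (I t' w - I t w)"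
   using elim(1) j unfolding t_def t'_def De_def by blast
  have dr: "\<bar>drift t' w - drift t w\<bar> <= B * De" using drift_diff_bound[OF elim(2) tt(1-3)] tt(4) by simp
  have "\<bar>I t' w - I t w\<bar> <= R + \<bar>sg (X t w)\<bar> * D" unfolding R_def D_def abs_mult[symmetric] by linarith
  then have Xd: "\<bar>X t' w - X t w\<bar> <= B * De + R + \<bar>sg (X t w)\<bar> * D" unfolding e using dr by linarith
  let ?s = "1 / (sg (X t w))^2"
  have s: "0 <= ?s" "?s <= 1 / mn" using sigma_inv by auto
  have "\<bar>X t' w - X t w\<bar> * ?s <= (B * De + R + \<bar>sg (X t w)\<bar> * D) * ?s" using Xd s by (intro mult_right_mono) auto
  also have "\<dots> = (B * De + R) * ?s + (\<bar>sg (X t w)\<bar> / (sg (X t w))^2) * D" by (simp add: distrib_right add_divide_distrib)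
  also have "\<dots> <= (B * De + R) * (1 / mn) + (1 / sqrt mn) * D"
   using s sigma_inv(4)[of "X t w"] RD pos De by (intro add_mono mult_left_mono mult_right_mono) auto
  also have "\<dots> <= (B / mn + 1 / mn + 1 / sqrt mn) * (De + R + D)"
  proof -
   define p where "p = B / mn"
   define q where "q = 1 / mn"
   define r where "r = 1 / sqrt mn"
   have "0 <= p" "0 <= q" "0 <= r" using pos mn by (auto simp: p_def q_def r_def)
   then have nn: "0 <= p * R" "0 <= p * D" "0 <= q * De" "0 <= q * D" "0 <= r * De" "0 <= r * R" using RD De by auto
   have "(B * De + R) * (1 / mn) + (1 / sqrt mn) * D = p * De + q * R + r * D"
    by (simp add: p_def q_def r_def add_divide_distrib)
   also have "\<dots> <= (p + q + r) * (De + R + D)" using nn by (simp add: algebra_simps)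
   finally show ?thesis by (simp only: p_def q_def r_def)
  qed
  finally have A: "\<bar>X t' w - X t w\<bar> * ?s <= (B / mn + 1 / mn + 1 / sqrt mn) * (De + R + D)" .
  have "fder sg De k th (X t w) (X t' w) = 2 * bder k th (X t w) * ((X t' w - X t w) * ?s) - De * (bsq k th (X t w) / (sg (X t w))^2)"
   unfolding fder_def diff_divide_distrib by (simp only: times_divide_eq_right mult_1_right mult.assoc)
  then have "\<bar>fder sg De k th (X t w) (X t' w)\<bar> <= \<bar>2 * bder k th (X t w) * ((X t' w - X t w) * ?s)\<bar> + \<bar>De * (bsq k th (X t w) / (sg (X t w))^2)\<bar>"
   by (simp only: abs_triangle_ineq4)
  also have "\<dots> = 2 * \<bar>bder k th (X t w)\<bar> * (\<bar>X t' w - X t w\<bar> * ?s) + De * \<bar>bsq k th (X t w) / (sg (X t w))^2\<bar>"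
   using De s by (simp add: abs_mult)
  also have "\<dots> <= 2 * bder_bd k * ((B / mn + 1 / mn + 1 / sqrt mn) * (De + R + D)) + (De + R + D) * (bsq_bd k / mn)"
  proof (rule add_mono; rule mult_mono)
   show "2 * \<bar>bder k th (X t w)\<bar> <= 2 * bder_bd k" using bder_bd(2)[OF th] by simp
  qed (use A bsq_sigma[OF th] RD De bder_bd(1)[of k] in auto)
  also have "\<dots> = major_const k * (De + R + D)" unfolding major_const_def by (simp only: ring_distribs mult_ac add_ac)
  also have "De + R + D = major n j w" by (simp only: major_def Let_def De_def t_def t'_def R_def D_def)
  finally show "\<bar>fder sg (T / real n) k th (X (real j * (T / real n)) w) (X (real (Suc j) * (T / real n)) w)\<bar> <= major_const k * major n j w"
   by (simp only: t_def t'_def De_def)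
 qed
qed

lemma major_M: assumes "1 <= n" "j < n" shows "major n j \<in> BM M"
proof -
 have t: "0 <= real j * (T / real n)" "real j * (T / real n) <= T" "0 <= real (Suc j) * (T / real n)" "real (Suc j) * (T / real n) <= T"
  using grid_time[OF assms(1), of j] grid_time[OF assms(1), of "Suc j"] assms(2) by auto
 note [measurable] = X_M[OF t(1,2)] I_M[OF t(1,2)] I_M[OF t(3,4)] W_M[OF t(1,2)] W_M[OF t(3,4)]
 show ?thesis unfolding major_def[abs_def] Let_def by measurable
qed

lemma major_nonneg: "1 <= n ==> 0 <= major n j w"
 unfolding major_def Let_def using T_pos by (intro add_nonneg_nonneg) auto

end

text \<open>Completing the square: an exponential factor merely shifts the mean of a Gaussian
  density.\<close>

lemma normal_density_exp:
 assumes "0 < s"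
 shows "normal_density 0 s x * exp (mu * x / s) = exp (mu^2 / 2) * normal_density (mu * s) s x"
proof -
 have "- (x - 0)\<^sup>2 / (2 * s\<^sup>2) + mu * x / s = mu\<^sup>2 / 2 + - (x - mu * s)\<^sup>2 / (2 * s\<^sup>2)"
  using assms by (simp add: field_simps power2_eq_square)
 then have "exp (- (x - 0)\<^sup>2 / (2 * s\<^sup>2)) * exp (mu * x / s) = exp (mu\<^sup>2 / 2) * exp (- (x - mu * s)\<^sup>2 / (2 * s\<^sup>2))"
  by (simp only: exp_add[symmetric])
 then show ?thesis unfolding normal_density_def by (simp add: mult.assoc mult.left_commute)
qed

context filtered_bm begin

lemma W_incr_exp_moment:
 assumes st: "0 <= s" "s < t" "t <= T"
 shows "nnE M (%w. exp (mu * (\<bar>W t w - W s w\<bar> / sqrt (t - s)))) <= ennreal (2 * exp (mu^2 / 2))"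
proof -
 let ?s = "sqrt (t - s)"
 have s: "0 < ?s" using st by simp
 note D = W_incr_dist[OF st]
 have one: "nnE lborel (%x. normal_density m ?s x) = 1" for m
  using prob_space.emeasure_space_1[OF prob_space_normal_density[OF s, of m]] by (simp add: emeasure_density)
 have "nnE M (%w. exp (mu * (\<bar>W t w - W s w\<bar> / ?s))) = nnI lborel (%x. ennreal (normal_density 0 ?s x) * ennreal (exp (mu * (\<bar>x\<bar> / ?s))))"
  using distributed_nn_integral[OF D, of "%x. ennreal (exp (mu * (\<bar>x\<bar> / ?s)))"] by simp
 also have "\<dots> <= nnI lborel (%x. ennreal (exp (mu\<^sup>2 / 2)) * ennreal (normal_density (mu * ?s) ?s x) + ennreal (exp (mu\<^sup>2 / 2)) * ennreal (normal_density (- mu * ?s) ?s x))"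
 proof (intro nn_integral_mono)
  fix x
  have n0: "0 <= normal_density m ?s x" for m by (rule normal_density_nonneg)
  have "exp (mu * (\<bar>x\<bar> / ?s)) <= exp (mu * x / ?s) + exp (- mu * x / ?s)" by (cases "0 <= x") (auto simp: add_increasing add_increasing2)
  then have "normal_density 0 ?s x * exp (mu * (\<bar>x\<bar> / ?s)) <= normal_density 0 ?s x * (exp (mu * x / ?s) + exp (- mu * x / ?s))"
   using n0 by (rule mult_left_mono)
  also have "\<dots> = exp (mu\<^sup>2 / 2) * normal_density (mu * ?s) ?s x + exp (mu\<^sup>2 / 2) * normal_density (- mu * ?s) ?s x"
   unfolding distrib_left normal_density_exp[OF s] by simp
  finally have "ennreal (normal_density 0 ?s x * exp (mu * (\<bar>x\<bar> / ?s))) <= ennreal (exp (mu\<^sup>2 / 2) * normal_density (mu * ?s) ?s x + exp (mu\<^sup>2 / 2) * normal_density (- mu * ?s) ?s x)"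
   by (rule ennreal_leI)
  then show "ennreal (normal_density 0 ?s x) * ennreal (exp (mu * (\<bar>x\<bar> / ?s))) <= ennreal (exp (mu\<^sup>2 / 2)) * ennreal (normal_density (mu * ?s) ?s x) + ennreal (exp (mu\<^sup>2 / 2)) * ennreal (normal_density (- mu * ?s) ?s x)"
   using n0 by (simp only: ennreal_mult ennreal_plus mult_nonneg_nonneg exp_ge_zero)
 qed
 also have "\<dots> = ennreal (exp (mu^2 / 2)) + ennreal (exp (mu^2 / 2))"
  by (subst nn_integral_add, simp, simp, subst (1 2) nn_integral_cmult) (simp_all add: one)
 also have "\<dots> = ennreal (2 * exp (mu^2 / 2))" by (simp add: ennreal_plus[symmetric] del: ennreal_plus)
 finally show ?thesis .
qed

end

section \<open>The effect of truncation and the limit contrast\<close>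

context observed_particle begin

text \<open>The first term comes from the time step and the remainder of the stochastic integral,
  the second from the Gaussian tail. Both tend to 0 even when multiplied by the number
  \<open>n\<close> of steps.\<close>

definition trunc_err :: "nat => real => real" where
 "trunc_err n K = 8 * K^2 * (1 + c^2 * incr_bound) * ((T / real n)^2 / trunc_level T n)
  + 4 * K * exp ((1 + 4 * K)^2 / 2) * (sqrt (T / real n) / (real n)^2)"

lemma trunc_err_lim: "(%n. real n * trunc_err n K) \<longlonglongrightarrow> 0"
proof -
 have T: "0 < T" by (rule T_pos)
 have 1: "(%n. real n * ((T / real n)^2 / (sqrt (T / real n) * ln (real n)))) \<longlonglongrightarrow> 0" using T by real_asymp
 have 2: "(%n. real n * (sqrt (T / real n) / (real n)^2)) \<longlonglongrightarrow> 0" using T by real_asymp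
 have "(%n. 8 * K^2 * (1 + c^2 * incr_bound) * (real n * ((T / real n)^2 / (sqrt (T / real n) * ln (real n))))
  + 4 * K * exp ((1 + 4 * K)^2 / 2) * (real n * (sqrt (T / real n) / (real n)^2))) \<longlonglongrightarrow> 8 * K^2 * (1 + c^2 * incr_bound) * 0 + 4 * K * exp ((1 + 4 * K)^2 / 2) * 0"
  by (intro tendsto_add tendsto_mult_left 1 2)
 then show ?thesis unfolding trunc_err_def trunc_level_def by (simp only: distrib_left mult_zero_right add_0_right mult.left_commute)
qed

lemma remainder_square:
 assumes st: "0 <= s" "s <= t" "t <= T"
 shows "nnE M (%w. (I t w - I s w - sg (X s w) * (W t w - W s w))^2) <= ennreal (c^2 * incr_bound * (t - s)^2)"
proof -
 define p where "p k = (if k = 0 then s else t)" for k :: nat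
 have "(nnE M (%w. (\<Sum>k<1. 1 * (I (p (Suc k)) w - I (p k) w - sg (X (p k) w) * (W (p (Suc k)) w - W (p k) w)))^2))
   <= ennreal (\<Sum>k<1. 1^2 * c^2 * incr_bound * (p (Suc k) - p k) * (p (Suc k) - p k))"
  by (rule weighted_remainder_sum(2)) (use st in \<open>auto simp: p_def\<close>)
 then show ?thesis by (simp add: p_def power2_eq_square mult.assoc)
qed

text \<open>The majorant is \<open>u + v\<close>, with \<open>v\<close> the Brownian part. If
  \<open>u\<close> dominates, it is at least half the truncation level, so
  \<open>u + v <= 4 * u^2 / ta\<close> and second moments suffice. If \<open>v\<close> dominates,
  the standardised increment \<open>Z\<close> exceeds a multiple of \<open>ln n\<close>, and an
  exponential moment yields the power of \<open>n\<close> that is needed; the logarithm in the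
  truncation level serves this case.\<close>

lemma truncation_error:
 assumes n: "2 <= n" and j: "j < n" and K: "0 <= K"
 shows "nnE M (%w. if trunc_level T n < K * major n j w then K * major n j w else 0) <= ennreal (trunc_err n K)"
proof -
 define De where "De = T / real n"
 define t where "t = real j * De"
 define t' where "t' = real (Suc j) * De"
 define R where "R w = I t' w - I t w - sg (X t w) * (W t' w - W t w)" for w
 define Z where "Z w = \<bar>W t' w - W t w\<bar> / sqrt (t' - t)" for w
 define ta where "ta = trunc_level T n"
 have n1: "1 <= n" using n by simp
 have De: "0 < De" using T_pos n by (auto simp: De_def)
 have tt: "0 <= t" "t < t'" "t' <= T" "t' - t = De" "t <= T"
  using grid_time[OF n1, of j] grid_time[OF n1, of "Suc j"] j De by (auto simp: t_def t'_def De_def[symmetric] algebra_simps)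
 have ta: "ta = sqrt De * ln n" by (simp add: ta_def trunc_level_def De_def)
 have ta0: "0 < ta" using De n by (auto simp: ta)
 have WZ: "\<bar>W t' w - W t w\<bar> = sqrt De * Z w" "0 <= Z w" for w using De by (auto simp: Z_def tt(4))
 have maj: "major n j w = De + \<bar>R w\<bar> + sqrt De * Z w" for w
  unfolding WZ(1)[symmetric] by (simp only: major_def Let_def De_def t_def t'_def R_def)
 have [measurable]: "R \<in> BM M" "Z \<in> BM M"
  unfolding R_def[abs_def] Z_def[abs_def] using X_M[OF tt(1,5)] I_M[OF tt(1,5)] I_M[OF _ tt(3)] W_M[OF tt(1,5)] W_M[OF _ tt(3)] tt
  by (auto intro!: borel_measurable_diff borel_measurable_times borel_measurable_divide borel_measurable_abs)
 define A where "A = 8 * K^2 / ta"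
 define G where "G = 2 * K * sqrt De / (real n)^2"
 have A0: "0 <= A" and G0: "0 <= G" using ta0 K De by (auto simp: A_def G_def)
 have pt: "(if ta < K * major n j w then K * major n j w else 0) <= (A * De^2 + A * (R w)^2) + G * exp ((1 + 4 * K) * Z w)" for w
 proof (cases "ta < K * major n j w")
  case True
  define u where "u = K * (De + \<bar>R w\<bar>)"
  define v where "v = K * (sqrt De * Z w)"
  have uv: "K * major n j w = u + v" by (simp add: maj u_def v_def algebra_simps)
  have nn: "0 <= u" "0 <= v" using K De WZ(2)[of w] by (auto simp: u_def v_def)
  have nnA: "0 <= A * De^2 + A * (R w)^2" using A0 by simp
  have nnG: "0 <= G * exp ((1 + 4 * K) * Z w)" using G0 by simp
  show ?thesis
  proof (cases "v <= u")
   case uv': True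
   have "ta <= 2 * u" using True uv uv' by linarith
   then have "(u + v) * ta <= (2 * u) * (2 * u)" using uv' nn ta0 by (intro mult_mono) auto
   then have uv4: "u + v <= 4 * u^2 / ta" using ta0 by (simp add: pos_le_divide_eq power2_eq_square)
   have u4: "4 * u^2 <= 8 * K^2 * (De^2 + (R w)^2)"
   proof -
    have "(De + \<bar>R w\<bar>)^2 <= 2 * De^2 + 2 * \<bar>R w\<bar>^2" by (rule two_squares)
    then have "4 * K^2 * (De + \<bar>R w\<bar>)^2 <= 4 * K^2 * (2 * De^2 + 2 * (R w)^2)" by (intro mult_left_mono) auto
    then show ?thesis unfolding u_def power_mult_distrib by (simp add: distrib_left)
   qed
   have "4 * u^2 / ta <= A * De^2 + A * (R w)^2"
   proof -
    have "A * De^2 + A * (R w)^2 = 8 * K^2 * (De^2 + (R w)^2) / ta" by (simp add: A_def distrib_left add_divide_distrib)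
    moreover note u4
    ultimately show ?thesis using ta0 by (simp add: divide_right_mono)
   qed
   with uv4 show ?thesis using True uv nnG by simp
  next
   case False
   have "ln n < 2 * 2 * (K * Z w)"
   proof -
    have "sqrt De * ln n < sqrt De * (2 * (K * Z w))" using False True uv by (simp add: ta v_def mult_ac)
    then have "ln n < 2 * (K * Z w)" using De by simp
    moreover have "0 <= K * Z w" using K WZ(2)[of w] by simp
    ultimately show ?thesis by linarith
   qed
   have lnn: "ln n < 2 * (K * Z w)"
   proof -
    have "sqrt De * ln n < sqrt De * (2 * (K * Z w))" using False True uv by (simp add: ta v_def mult_ac)
    then show ?thesis using De by simp
   qed
   \<comment> \<open>In this case \<open>exp (4 * K * Z w)\<close> is at least the square of
     \<open>n\<close>; the remaining 1 in the exponent \<open>1 + 4 * K\<close> absorbs the factor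
     \<open>Z w\<close> itself.\<close>
   have "Z w <= exp (Z w)" using exp_ge_add_one_self[of "Z w"] by linarith
   also have "\<dots> <= exp ((1 + 4 * K) * Z w + - (2 * ln n))" using lnn by (simp add: algebra_simps)
   also have "\<dots> = exp ((1 + 4 * K) * Z w) / (real n)^2"
   proof -
    have "exp (2 * ln n) = (real n)^2" using n by (simp add: exp_double)
    then show ?thesis by (simp only: exp_add exp_minus divide_inverse)
   qed
   finally have "2 * (K * sqrt De) * Z w <= 2 * (K * sqrt De) * (exp ((1 + 4 * K) * Z w) / (real n)^2)" using K De by (intro mult_left_mono) auto
   then have "2 * v <= G * exp ((1 + 4 * K) * Z w)" by (simp add: v_def G_def mult_ac)
   then show ?thesis using True uv False nnA by simp
  qed
 qed (use A0 G0 in auto)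
 have ER: "nnE M (%w. (R w)^2) <= ennreal (c^2 * incr_bound * De^2)"
  using remainder_square[of t t'] tt by (simp add: R_def)
 have EZ: "nnE M (%w. exp ((1 + 4 * K) * Z w)) <= ennreal (2 * exp ((1 + 4 * K)^2 / 2))"
  using W_incr_exp_moment[OF tt(1-3), of "1 + 4 * K"] by (simp add: Z_def)
 have "(nnE M (%w. if ta < K * major n j w then K * major n j w else 0))
  <= ennreal (A * De^2 + A * (c^2 * incr_bound * De^2) + G * (2 * exp ((1 + 4 * K)^2 / 2)))"
  by (rule nn_bound2[OF AE_I2[OF pt] _ _ _ _ _ ER _ _ _ EZ]) (use A0 G0 incr_bound_nonneg in auto)
 also have "A * De^2 + A * (c^2 * incr_bound * De^2) + G * (2 * exp ((1 + 4 * K)^2 / 2)) = trunc_err n K"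
 proof -
  have "A * De^2 + A * (c^2 * incr_bound * De^2) = 8 * K^2 * (1 + c^2 * incr_bound) * (De^2 / ta)"
   by (simp add: A_def algebra_simps add_divide_distrib)
  moreover have "G * (2 * exp ((1 + 4 * K)^2 / 2)) = 4 * K * exp ((1 + 4 * K)^2 / 2) * (sqrt De / (real n)^2)"
   by (simp add: G_def)
  ultimately show ?thesis by (simp only: trunc_err_def De_def ta_def)
 qed
 finally show ?thesis by (simp only: ta_def)
qed

text \<open>The mean of a contrast increment per unit of time, to leading order: the increment of
  \<open>X\<close> is replaced by its drift at the true parameter.\<close>

definition psi :: "real => real => real" where
 "psi th x = (2 * b th x * b ths x - (b th x)^2) / (sg x)^2"

lemma blip_b: assumes "th \<in> {0..1}" shows "blip (b th)"
proof -
 obtain L where "0 <= L" "\<forall>x y. \<bar>b th x - b th y\<bar> <= L * \<bar>x - y\<bar>" using b_lip[OF assms] by blast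
 moreover have "\<forall>x. \<bar>b th x\<bar> <= bder_bd 0" using bder_bd(2)[OF assms, of 0] by (simp add: bder_0)
 ultimately show ?thesis unfolding blip_def using bder_bd(1)[of 0] by blast
qed

lemma blip_psi: assumes "th \<in> {0..1}" shows "blip (psi th)"
proof -
 have "blip (%x. (2 * b th x * b ths x - b th x * b th x) * (1 / (sg x)^2))"
  by (intro blip_mult blip_diff blip_const blip_b assms ths blip_inverse_square[OF sg_lip pos(2) elliptic mn])
 then show ?thesis by (simp add: psi_def[abs_def] power2_eq_square)
qed

definition mean_psi :: "real => real => real" where "mean_psi th s = expectation (%w. psi th (X s w))"

lemma psi_integrable:
 assumes "th \<in> {0..1}" "0 <= s" "s <= T" shows "integrable M (%w. psi th (X s w))"
proof -
 obtain C where "!!x. \<bar>psi th x\<bar> <= C" using blip_psi[OF assms(1)] by (auto simp: blip_def)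
 moreover have "(%w. psi th (X s w)) \<in> BM M"
  using measurable_compose[OF X_M[OF assms(2,3)] blip_measurable[OF blip_psi[OF assms(1)]]] .
 ultimately show ?thesis by (intro integrable_const_bound[of _ C]) auto
qed

text \<open>\<open>psi\<close> is Lipschitz and the increments of \<open>X\<close> are of order
  square root of the time step in mean. The continuity makes Riemann sums over the observation times
  converge.\<close>

lemma mean_psi_cont: assumes th: "th \<in> {0..1}" shows "continuous_on {0..T} (mean_psi th)"
proof -
 obtain L where L: "0 <= L" "!!x y. \<bar>psi th x - psi th y\<bar> <= L * \<bar>x - y\<bar>" using blip_psi[OF th] by (auto simp: blip_def)
 have ord: "\<bar>mean_psi th t - mean_psi th s\<bar> <= L * sqrt (incr_bound * \<bar>t - s\<bar>)" if st: "0 <= s" "s <= t" "t <= T" for s t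
 proof -
  have m: "(%w. X t w - X s w) \<in> BM M" using X_M st by (intro borel_measurable_diff) auto
  have b0: "0 <= incr_bound * (t - s)" using incr_bound_nonneg st by simp
  note E = integrable_from_nn_integral_square[OF m b0 X_increment[OF st]]
  have "\<bar>mean_psi th t - mean_psi th s\<bar> = \<bar>expectation (%w. psi th (X t w) - psi th (X s w))\<bar>"
   unfolding mean_psi_def using psi_integrable[OF th] st by simp
  also have "\<dots> <= expectation (%w. \<bar>psi th (X t w) - psi th (X s w)\<bar>)" by (rule integral_abs_bound)
  also have "\<dots> <= expectation (%w. L * \<bar>X t w - X s w\<bar>)"
   using L psi_integrable[OF th] st E by (intro integral_mono) auto
  also have "\<dots> <= L * sqrt (incr_bound * (t - s))" using E(4) L(1) by (simp add: mult_left_mono)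
  finally show ?thesis using st by simp
 qed
 have bnd: "\<bar>mean_psi th t - mean_psi th s\<bar> <= L * sqrt (incr_bound * \<bar>t - s\<bar>)" if "t \<in> {0..T}" "s \<in> {0..T}" for s t
 proof (cases "s <= t")
  case True
  show ?thesis by (rule ord) (use that True in auto)
 next
  case False
  then have "\<bar>mean_psi th s - mean_psi th t\<bar> <= L * sqrt (incr_bound * \<bar>s - t\<bar>)" using that by (intro ord) auto
  then show ?thesis by (simp only: abs_minus_commute)
 qed
 show ?thesis unfolding continuous_on_def
 proof
  fix s assume s: "s \<in> {0..T}"
  have "((%t. L * sqrt (incr_bound * \<bar>t - s\<bar>)) \<longlongrightarrow> L * sqrt (incr_bound * \<bar>s - s\<bar>)) (at s within {0..T})"
   by (intro tendsto_intros)
  then have lim: "((%t. L * sqrt (incr_bound * \<bar>t - s\<bar>)) \<longlongrightarrow> 0) (at s within {0..T})" by simp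
  have "\<forall>\<^sub>F t in at s within {0..T}. norm (mean_psi th t - mean_psi th s) <= L * sqrt (incr_bound * \<bar>t - s\<bar>)"
   unfolding eventually_at_filter real_norm_def by (intro always_eventually allI impI bnd s)
  from Lim_null_comparison[OF this lim] have "((%t. mean_psi th t - mean_psi th s) \<longlongrightarrow> 0) (at s within {0..T})" .
  then show "(mean_psi th \<longlongrightarrow> mean_psi th s) (at s within {0..T})" by (simp add: LIM_zero_iff)
 qed
qed

definition limit_contrast :: "real => real" where "limit_contrast th = (LBINT s:{0..T}. mean_psi th s)"

lemma mean_psi_set_integrable: "th \<in> {0..1} ==> set_integrable lborel {0..T} (mean_psi th)"
 using borel_integrable_atLeastAtMost'[OF mean_psi_cont] .

lemma limit_contrast_riemann:
 assumes th: "th \<in> {0..1}"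
 shows "(%n. \<Sum>j<n. T / real n * mean_psi th (real j * (T / real n))) \<longlonglongrightarrow> limit_contrast th"
proof -
 have eq: "limit_contrast th = integral {0..T} (mean_psi th)"
  unfolding limit_contrast_def by (rule set_borel_integral_eq_integral(2)[OF mean_psi_set_integrable[OF th]])
 have "(%q. \<Sum>j<Suc q. T / real (Suc q) * mean_psi th (real j * (T / real (Suc q)))) \<longlonglongrightarrow> limit_contrast th"
  unfolding eq by (rule riemann_sums_converge[OF mean_psi_cont[OF th] T_pos])
 then show ?thesis by (rule LIMSEQ_imp_Suc)
qed

text \<open>Completing the square: at the true parameter \<open>psi\<close> is the squared drift
  over the squared diffusion coefficient, so the difference of the integrands is exactly the squared
  distance of the drifts, weighted.\<close>

lemma limit_contrast_diff:
 assumes th: "th \<in> {0..1}"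
 shows "limit_contrast ths - limit_contrast th = (LBINT s:{0..T}. (\<integral>w. (b th (X s w) - b ths (X s w))^2 / (sg (X s w))^2 \<partial>M))"
proof -
 have "limit_contrast ths - limit_contrast th = (LBINT s:{0..T}. mean_psi ths s - mean_psi th s)"
  unfolding limit_contrast_def using mean_psi_set_integrable th ths by (simp add: set_integral_diff)
 also have "\<dots> = (LBINT s:{0..T}. (\<integral>w. (b th (X s w) - b ths (X s w))^2 / (sg (X s w))^2 \<partial>M))"
 proof (rule set_lebesgue_integral_cong; (intro allI impI)?)
  fix s assume s: "s \<in> {0..T}"
  have "mean_psi ths s - mean_psi th s = expectation (%w. psi ths (X s w) - psi th (X s w))"
   unfolding mean_psi_def using psi_integrable th ths s by simp
  also have "\<dots> = (\<integral>w. (b th (X s w) - b ths (X s w))^2 / (sg (X s w))^2 \<partial>M)"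
   by (intro Bochner_Integration.integral_cong refl) (simp add: psi_def diff_divide_distrib[symmetric] power2_eq_square algebra_simps)
  finally show "mean_psi ths s - mean_psi th s = \<dots>" .
 qed simp
 finally show ?thesis .
qed

definition psi_lip :: real where "psi_lip = (2 * bder_bd 1 * bder_bd 0 + bsq_bd 1) / mn"

lemma psi_lip_nonneg: "0 <= psi_lip"
 unfolding psi_lip_def using bder_bd(1) bsq_bd(1) mn by simp

lemma psi_param_lip:
 assumes "u \<in> {0..1}" "v \<in> {0..1}" shows "\<bar>psi u x - psi v x\<bar> <= psi_lip * \<bar>u - v\<bar>"
proof (rule unit_interval_lipschitz[where g="%th. psi th x" and g'="%th. (bder 1 th x * (2 * b ths x) - bsq 1 th x) / (sg x)^2"])
 fix th :: real assume th: "th \<in> {0..1}"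
 have "((%et. bder 0 et x * (2 * b ths x) - bsq 0 et x) has_real_derivative bder (Suc 0) th x * (2 * b ths x) - bsq (Suc 0) th x) (at th within {0..1})"
  by (intro DERIV_diff DERIV_cmult_right bder_deriv bsq_deriv th)
 from DERIV_cdivide[OF this, of "(sg x)^2"]
 show "((%th. psi th x) has_real_derivative (bder 1 th x * (2 * b ths x) - bsq 1 th x) / (sg x)^2) (at th within {0..1})"
  by (simp add: psi_def bder_0 bsq_0 mult_ac)
 have "\<bar>bder 1 th x * (2 * b ths x) - bsq 1 th x\<bar> <= \<bar>bder 1 th x * (2 * b ths x)\<bar> + \<bar>bsq 1 th x\<bar>" by (rule abs_triangle_ineq4)
 also have "\<dots> <= bder_bd 1 * (2 * bder_bd 0) + bsq_bd 1"
  unfolding abs_mult using bder_bd(2)[of th 1 x] bder_bd(2)[of ths 0 x] bsq_bd(2)[of th 1 x] bder_bd(1) th ths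
  by (intro add_mono mult_mono) (auto simp: bder_0)
 finally have "\<bar>bder 1 th x * (2 * b ths x) - bsq 1 th x\<bar> * (1 / (sg x)^2) <= (bder_bd 1 * (2 * bder_bd 0) + bsq_bd 1) * (1 / mn)"
  using sigma_inv[of x] bder_bd(1) bsq_bd(1) by (intro mult_mono) auto
 then show "\<bar>(bder 1 th x * (2 * b ths x) - bsq 1 th x) / (sg x)^2\<bar> <= psi_lip" by (simp add: psi_lip_def mult_ac)
qed (use assms in auto)

text \<open>The estimate is uniform in time, and hence holds for the Riemann sums at every stage and
  passes to their limit.\<close>

lemma limit_contrast_lip:
 assumes u: "u \<in> {0..1}" and v: "v \<in> {0..1}" shows "\<bar>limit_contrast u - limit_contrast v\<bar> <= T * psi_lip * \<bar>u - v\<bar>"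
proof -
 have pt: "\<bar>mean_psi u s - mean_psi v s\<bar> <= psi_lip * \<bar>u - v\<bar>" if s: "0 <= s" "s <= T" for s
 proof -
  have "\<bar>mean_psi u s - mean_psi v s\<bar> = \<bar>expectation (%w. psi u (X s w) - psi v (X s w))\<bar>"
   unfolding mean_psi_def using psi_integrable u v s by simp
  also have "\<dots> <= expectation (%w. \<bar>psi u (X s w) - psi v (X s w)\<bar>)" by (rule integral_abs_bound)
  also have "\<dots> <= expectation (%w. psi_lip * \<bar>u - v\<bar>)"
   using psi_integrable u v s psi_param_lip[OF u v] by (intro integral_mono integrable_abs Bochner_Integration.integrable_diff) auto
  finally show ?thesis by (simp add: prob_space)
 qed
 have "\<bar>(\<Sum>j<n. T / real n * mean_psi u (real j * (T / real n))) - (\<Sum>j<n. T / real n * mean_psi v (real j * (T / real n)))\<bar> <= T * psi_lip * \<bar>u - v\<bar>" if n: "1 <= n" for n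
 proof -
  have "\<bar>(\<Sum>j<n. T / real n * mean_psi u (real j * (T / real n))) - (\<Sum>j<n. T / real n * mean_psi v (real j * (T / real n)))\<bar>
   <= (\<Sum>j<n. \<bar>T / real n * mean_psi u (real j * (T / real n)) - T / real n * mean_psi v (real j * (T / real n))\<bar>)"
   unfolding sum_subtractf[symmetric] by (rule sum_abs)
  also have "\<dots> <= (\<Sum>j<n. T / real n * (psi_lip * \<bar>u - v\<bar>))"
  proof (rule sum_mono)
   fix j assume "j \<in> {..<n}"
   then have "\<bar>mean_psi u (real j * (T / real n)) - mean_psi v (real j * (T / real n))\<bar> <= psi_lip * \<bar>u - v\<bar>"
    using grid_time[OF n, of j] by (intro pt) auto
   then show "\<bar>T / real n * mean_psi u (real j * (T / real n)) - T / real n * mean_psi v (real j * (T / real n))\<bar> <= T / real n * (psi_lip * \<bar>u - v\<bar>)"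
    using T_pos unfolding right_diff_distrib[symmetric] abs_mult by (intro mult_mono) auto
  qed
  also have "\<dots> = T * psi_lip * \<bar>u - v\<bar>" using n by simp
  finally show ?thesis .
 qed
 moreover have "(%n. \<bar>(\<Sum>j<n. T / real n * mean_psi u (real j * (T / real n))) - (\<Sum>j<n. T / real n * mean_psi v (real j * (T / real n)))\<bar>) \<longlonglongrightarrow> \<bar>limit_contrast u - limit_contrast v\<bar>"
  by (intro tendsto_intros limit_contrast_riemann u v)
 ultimately show ?thesis by (intro LIMSEQ_le_const2) auto
qed

text \<open>Only the drift part survives in the mean: the stochastic integrals are replaced by
 \<open>sg(X)\<close> times a Brownian increment, which has mean zero.\<close>

lemma psum_mean_error:
 assumes n: "1 <= n" and th: "th \<in> {0..1}"
 shows "\<bar>expectation (psum n 0 th) - (\<Sum>j<n. T / real n * mean_psi th (real j * (T / real n)))\<bar>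
  <= wt_bd 0 * c * sqrt incr_bound * (T + sqrt T) * sqrt (T / real n)"
proof -
 define De where "De = T / real n"
 define t where "t j = real j * De" for j
 have De: "0 < De" "real n * De = T" using T_pos n by (auto simp: De_def)
 have tt: "0 <= t j" "t j <= T" if "j <= n" for j using grid_time[OF n that] by (auto simp: t_def De_def)
 have tS: "t (Suc j) - t j = De" for j by (simp add: t_def algebra_simps)
 define w where "w j y = wt 0 th (X (t j) y)" for j y
 define D where "D j y = drift (t (Suc j)) y - drift (t j) y - b ths (X (t j) y) * De" for j y
 define R where "R y = (\<Sum>j<n. w j y * (I (t (Suc j)) y - I (t j) y - sg (X (t j) y) * (W (t (Suc j)) y - W (t j) y)))" for y
 define G where "G j y = w j y * sg (X (t j) y) * (W (t (Suc j)) y - W (t j) y)" for j y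
 have wF: "w j \<in> BM (F (t j))" if "j < n" for j using wt_F[OF th tt, of j] that by (simp add: w_def[abs_def])
 have wb: "\<bar>w j y\<bar> <= wt_bd 0" for j y unfolding w_def by (rule wt_bd(1)[OF th])
 have XM: "X (t j) \<in> BM M" if "j <= n" for j using X_M tt that by blast
 \<comment> \<open>In this order: the leading term, the error of freezing the drift, the error of
   freezing the diffusion coefficient, and a sum of mean 0.\<close>
 have dec: "AE y in M. psum n 0 th y = (\<Sum>j<n. De * psi th (X (t j) y)) + (\<Sum>j<n. w j y * D j y) + R y + (\<Sum>j<n. G j y)"
  using X_incr[OF n]
 proof eventually_elim
  case (elim y)
  show ?case unfolding psum_def R_def sum.distrib[symmetric]
  proof (intro sum.cong refl)
   fix j assume "j \<in> {..<n}"
   then have e: "X (t (Suc j)) y - X (t j) y = (drift (t (Suc j)) y - drift (t j) y) + (I (t (Suc j)) y - I (t j) y)"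
    using elim unfolding t_def De_def by blast
   have p: "psi th (X (t j) y) = w j y * b ths (X (t j) y) - bsq 0 th (X (t j) y) / (sg (X (t j) y))^2"
    by (simp add: psi_def w_def wt_def bder_0 bsq_0 diff_divide_distrib)
   show "fder sg (T / real n) 0 th (X (real j * (T / real n)) y) (X (real (Suc j) * (T / real n)) y)
    = De * psi th (X (t j) y) + w j y * D j y + w j y * (I (t (Suc j)) y - I (t j) y - sg (X (t j) y) * (W (t (Suc j)) y - W (t j) y)) + G j y"
    unfolding fder_split t_def[symmetric] De_def[symmetric] e p D_def G_def w_def[symmetric] by (simp add: algebra_simps)
  qed
 qed
 have R: "R \<in> BM M" "nnE M (%y. (R y)^2) <= ennreal ((wt_bd 0 * c * sqrt incr_bound * sqrt T * sqrt De)^2)"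
 proof -
  have p: "0 <= t j \<and> t j <= T" if "j <= n" for j using tt that by blast
  have p': "t j <= t (Suc j)" if "j < n" for j using tS[of j] De by linarith
  note WR = weighted_remainder_sum[where p=t and m=n and w=w and C="wt_bd 0", OF p p' wF wb]
  show "R \<in> BM M" unfolding R_def[abs_def] by (rule WR(1)) auto
  have "(\<Sum>k<n. (wt_bd 0)^2 * c^2 * incr_bound * (t (Suc k) - t k) * (t (Suc k) - t k)) = (wt_bd 0)^2 * c^2 * incr_bound * (real n * De) * De"
   unfolding tS by simp
  also have "\<dots> = (wt_bd 0 * c * sqrt incr_bound * sqrt T * sqrt De)^2"
   unfolding De(2) using incr_bound_nonneg T_pos De(1) by (simp add: power_mult_distrib)
  finally have eq: "(\<Sum>k<n. (wt_bd 0)^2 * c^2 * incr_bound * (t (Suc k) - t k) * (t (Suc k) - t k)) = (wt_bd 0 * c * sqrt incr_bound * sqrt T * sqrt De)^2" .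
  show "nnE M (%y. (R y)^2) <= ennreal ((wt_bd 0 * c * sqrt incr_bound * sqrt T * sqrt De)^2)"
   unfolding R_def eq[symmetric] by (rule WR(2)) auto
 qed
 have Rnn: "0 <= wt_bd 0 * c * sqrt incr_bound * sqrt T * sqrt De" using wt_bd(2) pos incr_bound_nonneg T_pos De by simp
 note ER = integrable_from_nn_integral_square[OF R(1) zero_le_power2 R(2)]
 have D: "D j \<in> BM M" "nnE M (%y. (D j y)^2) <= ennreal ((c * sqrt incr_bound * sqrt De * De)^2)" if j: "j < n" for j
 proof -
  have j': "j <= n" "Suc j <= n" using j by auto
  note [measurable] = XM[OF j'(1)] drift_M[OF tt(2)[OF j'(1)]] drift_M[OF tt(2)[OF j'(2)]]
  show "D j \<in> BM M" unfolding D_def[abs_def] by measurable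
  have st: "t j < t (Suc j)" using tS[of j] De by linarith
  have "(nnE M (%y. (drift (t (Suc j)) y - drift (t j) y - b ths (X (t j) y) * (t (Suc j) - t j))^2))
   <= ennreal (c^2 * incr_bound * De * (t (Suc j) - t j)^2)"
  proof (rule drift_local_error[OF tt(1)[OF j'(1)] st tt(2)[OF j'(2)] XM[OF j'(1)]])
   fix u assume u: "t j <= u" "u <= t (Suc j)"
   have uT: "u <= T" "0 <= u" using u tt[OF j'(2)] tt[OF j'(1)] by auto
   note [measurable] = X_M[OF uT(2,1)]
   have le: "AE y in M. (b ths (X u y) - b ths (X (t j) y))^2 <= 0 + c^2 * (X u y - X (t j) y)^2"
   proof (rule AE_I2)
    fix y
    have "(b ths (X u y) - b ths (X (t j) y))^2 <= (c * \<bar>X u y - X (t j) y\<bar>)^2" by (intro square_le_of_abs_le bt_lip)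
    then show "(b ths (X u y) - b ths (X (t j) y))^2 <= 0 + c^2 * (X u y - X (t j) y)^2" by (simp add: power_mult_distrib)
   qed
   have "incr_bound * (u - t j) <= incr_bound * De" using u(2) tS[of j] incr_bound_nonneg by (intro mult_left_mono) auto
   then have EX: "nnE M (%y. (X u y - X (t j) y)^2) <= ennreal (incr_bound * De)"
    by (intro order_trans[OF X_increment[OF tt(1)[OF j'(1)] u(1) uT(1)]] ennreal_leI)
   have "nnE M (%y. (b ths (X u y) - b ths (X (t j) y))^2) <= ennreal (0 + c^2 * (incr_bound * De))"
    by (rule nn_bound1[OF le _ _ _ _ EX]) (use incr_bound_nonneg De XM[OF j'(1)] in auto)
   then show "nnE M (%y. (b ths (X u y) - b ths (X (t j) y))^2) <= ennreal (c^2 * incr_bound * De)" by (simp add: mult.assoc)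
  qed (use incr_bound_nonneg De in auto)
  moreover have "c^2 * incr_bound * De * (t (Suc j) - t j)^2 = (c * sqrt incr_bound * sqrt De * De)^2"
   unfolding tS using incr_bound_nonneg De by (simp add: power_mult_distrib)
  ultimately show "nnE M (%y. (D j y)^2) <= ennreal ((c * sqrt incr_bound * sqrt De * De)^2)"
   unfolding D_def tS by simp
 qed
 have Dnn: "0 <= c * sqrt incr_bound * sqrt De * De" using pos incr_bound_nonneg De by simp
 have wM: "w j \<in> BM M" if "j < n" for j by (rule F_imp_M[OF wF[OF that]])
 have wD: "integrable M (%y. w j y * D j y)" "\<bar>expectation (%y. w j y * D j y)\<bar> <= wt_bd 0 * (c * sqrt incr_bound * sqrt De * De)" if j: "j < n" for j
 proof -
  note ED = integrable_from_nn_integral_square[OF D(1)[OF j] zero_le_power2 D(2)[OF j]]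
  have pt: "\<bar>w j y * D j y\<bar> <= wt_bd 0 * \<bar>D j y\<bar>" for y unfolding abs_mult using wb by (intro mult_right_mono) auto
  have i: "integrable M (%y. wt_bd 0 * \<bar>D j y\<bar>)" using ED(3) by simp
  show iw: "integrable M (%y. w j y * D j y)"
   by (rule Bochner_Integration.integrable_bound[OF i]) (use pt wM[OF j] D(1)[OF j] wt_bd(2) in \<open>auto simp: abs_mult\<close>)
  have "\<bar>expectation (%y. w j y * D j y)\<bar> <= expectation (%y. \<bar>w j y * D j y\<bar>)" by (rule integral_abs_bound)
  also have "\<dots> <= expectation (%y. wt_bd 0 * \<bar>D j y\<bar>)" using iw i pt by (intro integral_mono integrable_abs) auto
  also have "\<dots> <= wt_bd 0 * (c * sqrt incr_bound * sqrt De * De)"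
   using ED(4) Dnn wt_bd(2) by (simp only: integral_mult_right_zero real_sqrt_abs abs_of_nonneg) (rule mult_left_mono)
  finally show "\<bar>expectation (%y. w j y * D j y)\<bar> <= wt_bd 0 * (c * sqrt incr_bound * sqrt De * De)" .
 qed
 have G: "integrable M (G j)" "expectation (G j) = 0" if j: "j < n" for j
 proof -
  have j': "j <= n" "Suc j <= n" using j by auto
  have st: "t j < t (Suc j)" using tS[of j] De by linarith
  have sF: "(%y. w j y * sg (X (t j) y)) \<in> BM (F (t j))"
   using wF[OF j] X_F[OF tt[OF j'(1)]] by measurable
  have sM: "(%y. sg (X (t j) y)) \<in> BM M" using XM[OF j'(1)] by measurable
  note ES = integrable_from_nn_integral_square[OF sM sigma_bound_nonneg sigma_second_moment[OF tt[OF j'(1)]]]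
  have i: "integrable M (%y. wt_bd 0 * \<bar>sg (X (t j) y)\<bar>)" using ES(3) by simp
  have iws: "integrable M (%y. w j y * sg (X (t j) y))"
   by (rule Bochner_Integration.integrable_bound[OF i]) (use wb F_imp_M[OF sF] wt_bd(2) in \<open>auto simp: abs_mult intro!: mult_right_mono\<close>)
  note ind = W_incr_indep[OF tt(1)[OF j'(1)] st tt(2)[OF j'(2)] sF]
  note m = W_incr_moments[OF tt(1)[OF j'(1)] st tt(2)[OF j'(2)]]
  show "integrable M (G j)" "expectation (G j) = 0"
   using indep_var_integrable[OF ind iws m(1)] indep_var_lebesgue_integral[OF ind iws m(1)] m(2) by (simp_all add: G_def[abs_def])
 qed
 have P: "integrable M (%y. psi th (X (t j) y))" if "j < n" for j using psi_integrable[OF th tt] that by simp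
 have "expectation (psum n 0 th) = expectation (%y. (\<Sum>j<n. De * psi th (X (t j) y)) + (\<Sum>j<n. w j y * D j y) + R y + (\<Sum>j<n. G j y))"
  using dec P wD(1) ER(3) G(1)
  by (intro integral_cong_AE psum_M[OF n th] borel_measurable_integrable[of M "%y. _ y + _ y"] Bochner_Integration.integrable_add Bochner_Integration.integrable_sum integrable_mult_right) auto
 also have "\<dots> = (\<Sum>j<n. De * mean_psi th (t j)) + (\<Sum>j<n. expectation (%y. w j y * D j y)) + expectation R"
 proof -
  have i: "integrable M (%y. \<Sum>j<n. De * psi th (X (t j) y))" "integrable M (%y. \<Sum>j<n. w j y * D j y)" "integrable M (%y. \<Sum>j<n. G j y)"
   using P wD(1) G(1) by (auto intro!: Bochner_Integration.integrable_sum)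
  have "expectation (%y. \<Sum>j<n. De * psi th (X (t j) y)) = (\<Sum>j<n. expectation (%y. De * psi th (X (t j) y)))"
   "expectation (%y. \<Sum>j<n. w j y * D j y) = (\<Sum>j<n. expectation (%y. w j y * D j y))"
   "expectation (%y. \<Sum>j<n. G j y) = (\<Sum>j<n. expectation (G j))"
   using P wD(1) G(1) by (auto intro!: Bochner_Integration.integral_sum)
  moreover have "(\<Sum>j<n. expectation (G j)) = 0" using G(2) by simp
  ultimately show ?thesis using i ER(3) by (simp add: mean_psi_def)
 qed
 finally have "\<bar>expectation (psum n 0 th) - (\<Sum>j<n. De * mean_psi th (t j))\<bar> <= \<bar>\<Sum>j<n. expectation (%y. w j y * D j y)\<bar> + \<bar>expectation R\<bar>"
  by linarith
 also have "\<dots> <= real n * (wt_bd 0 * (c * sqrt incr_bound * sqrt De * De)) + wt_bd 0 * c * sqrt incr_bound * sqrt T * sqrt De"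
 proof (rule add_mono)
  have "\<bar>\<Sum>j<n. expectation (%y. w j y * D j y)\<bar> <= (\<Sum>j<n. wt_bd 0 * (c * sqrt incr_bound * sqrt De * De))"
   by (rule order_trans[OF sum_abs sum_mono]) (use wD(2) in auto)
  then show "\<bar>\<Sum>j<n. expectation (%y. w j y * D j y)\<bar> <= real n * (wt_bd 0 * (c * sqrt incr_bound * sqrt De * De))" by simp
  have "\<bar>expectation R\<bar> <= expectation (%y. \<bar>R y\<bar>)" by (rule integral_abs_bound)
  also note ER(4)
  finally show "\<bar>expectation R\<bar> <= wt_bd 0 * c * sqrt incr_bound * sqrt T * sqrt De" using Rnn by simp
 qed
 also have "\<dots> = wt_bd 0 * c * sqrt incr_bound * (real n * De + sqrt T) * sqrt De" by (simp add: algebra_simps)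
 also have "\<dots> = wt_bd 0 * c * sqrt incr_bound * (T + sqrt T) * sqrt De" unfolding De(2) ..
 finally show ?thesis by (simp only: t_def De_def)
qed

lemma psum_mean_lim:
 assumes th: "th \<in> {0..1}" shows "(%n. expectation (psum n 0 th)) \<longlonglongrightarrow> limit_contrast th"
proof -
 let ?K = "wt_bd 0 * c * sqrt incr_bound * (T + sqrt T)"
 have "(%n. sqrt (T / real n)) \<longlonglongrightarrow> sqrt 0" by (intro tendsto_intros lim_const_over_n)
 then have "(%n. ?K * sqrt (T / real n)) \<longlonglongrightarrow> 0" using tendsto_mult_left[of _ "sqrt 0" sequentially ?K] by simp
 then have "(%n. expectation (psum n 0 th) - (\<Sum>j<n. T / real n * mean_psi th (real j * (T / real n)))) \<longlonglongrightarrow> 0"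
  by (rule Lim_null_comparison[rotated]) (use psum_mean_error[OF _ th] in \<open>auto simp: eventually_sequentially intro!: exI[of _ 1]\<close>)
 from tendsto_add[OF this limit_contrast_riemann[OF th]] show ?thesis by simp
qed

lemma fder_continuous:
 assumes "th \<in> {0..1}" shows "continuous_on UNIV (%z. fder sg De 0 th (fst z) (snd z))"
proof -
 have "continuous_on UNIV (%z::real \<times> real. b th (fst z))" "continuous_on UNIV (%z::real \<times> real. sg (fst z))"
  using continuous_on_compose2[OF b_cont[OF assms], of UNIV fst] continuous_on_compose2[OF sg_cont, of UNIV fst] continuous_on_fst[OF continuous_on_id] by auto
 then show ?thesis unfolding fder_def bder_0 bsq_0 using sigma_inv(3) by (intro continuous_intros) auto
qed

end

section \<open>Consistency\<close>

context prob_space begin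

text \<open>The failures are enclosed in an event \<open>B\<close>, because the set where
  \<open>P\<close> fails need not be measurable, for instance when \<open>P\<close> quantifies over
  all parameters. The level \<open>de\<close> is explicit since a bound obtained from tightness
  depends on it; \<open>whp\<close> asks for every level.\<close>

definition ev_prob :: "real => (nat => 'a => bool) => bool" where
 "ev_prob de P \<longleftrightarrow> (\<forall>\<^sub>F m in sequentially. \<exists>B\<in>events. prob B <= de \<and> (\<forall>w\<in>space M - B. P m w))"

definition whp :: "(nat => 'a => bool) => bool" where "whp P \<longleftrightarrow> (\<forall>de>0. ev_prob de P)"

lemma ev_prob_conj:
 assumes "ev_prob d P" "ev_prob e Q" shows "ev_prob (d + e) (%m w. P m w \<and> Q m w)"
 using assms unfolding ev_prob_def
proof eventually_elim
 case (elim m)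
 obtain B where B: "B \<in> events" "prob B <= d" "!!w. w \<in> space M - B ==> P m w" using elim(1) by blast
 obtain C where C: "C \<in> events" "prob C <= e" "!!w. w \<in> space M - C ==> Q m w" using elim(2) by blast
 have "prob (B \<union> C) <= d + e" using measure_Un_le[OF B(1) C(1)] B(2) C(2) by linarith
 then show ?case using B C by (intro bexI[of _ "B \<union> C"]) auto
qed

lemma ev_prob_mono:
 assumes "ev_prob d P" "\<forall>\<^sub>F m in sequentially. \<forall>w\<in>space M. P m w \<longrightarrow> Q m w" "d <= e"
 shows "ev_prob e Q"
 using assms(1,2) unfolding ev_prob_def
proof eventually_elim
 case (elim m)
 obtain B where "B \<in> events" "prob B <= d" "!!w. w \<in> space M - B ==> P m w" using elim(1) by blast
 then show ?case using elim(2) assms(3) by (intro bexI[of _ B]) auto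
qed

lemma whp_conj:
 assumes "whp P" "whp Q" shows "whp (%m w. P m w \<and> Q m w)"
 unfolding whp_def
proof (intro allI impI)
 fix de :: real assume "0 < de"
 then have "ev_prob (de / 2) P" "ev_prob (de / 2) Q" using assms by (auto simp: whp_def)
 from ev_prob_conj[OF this] show "ev_prob de (%m w. P m w \<and> Q m w)" by simp
qed

lemma whp_mono:
 assumes P: "whp P" and PQ: "\<forall>\<^sub>F m in sequentially. \<forall>w\<in>space M. P m w \<longrightarrow> Q m w" shows "whp Q"
 unfolding whp_def
proof (intro allI impI)
 fix de :: real assume "0 < de"
 from mp[OF spec[OF P[unfolded whp_def], of de] this] have "ev_prob de P" .
 from this PQ order_refl show "ev_prob de Q" by (rule ev_prob_mono)
qed

lemma whp_AE:
 assumes AE: "!!m. AE w in M. P m w" shows "whp P"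
 unfolding whp_def ev_prob_def
proof (intro allI impI always_eventually)
 fix de :: real and m assume de: "0 < de"
 from AE[of m] obtain B where B: "{w \<in> space M. \<not> P m w} \<subseteq> B" "B \<in> events" "emeasure M B = 0" by (rule AE_E)
 have "prob B <= de" using B(3) de by (simp add: measure_def)
 moreover have "\<forall>w\<in>space M - B. P m w"
 proof
  fix w assume "w \<in> space M - B"
  then show "P m w" using subsetD[OF B(1), of w] by (cases "P m w") simp_all
 qed
 ultimately show "\<exists>B\<in>events. prob B <= de \<and> (\<forall>w\<in>space M - B. P m w)" using B(2) by (intro bexI conjI)
qed

lemma whp_ball:
 assumes "finite A" "!!x. x \<in> A ==> whp (P x)" shows "whp (%m w. \<forall>x\<in>A. P x m w)"
 using assms
proof (induction A)
 case empty
 show ?case by (rule whp_AE) simp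
next
 case (insert x A)
 have "whp (%m w. P x m w \<and> (\<forall>x\<in>A. P x m w))" by (intro whp_conj insert) (use insert in auto)
 then show ?case by simp
qed

lemma whp_bad_event:
 assumes "!!m. B m \<in> events" "(%m. prob (B m)) \<longlonglongrightarrow> 0" "!!m w. w \<in> space M ==> w \<notin> B m ==> P m w"
 shows "whp P"
 unfolding whp_def ev_prob_def
proof (intro allI impI)
 fix de :: real assume "0 < de"
 then have "\<forall>\<^sub>F m in sequentially. prob (B m) < de" using order_tendstoD(2)[OF assms(2)] by blast
 then show "\<forall>\<^sub>F m in sequentially. \<exists>B\<in>events. prob B <= de \<and> (\<forall>w\<in>space M - B. P m w)"
  by eventually_elim (use assms(1,3) in \<open>auto intro!: bexI[of _ "B _"]\<close>)
qed

lemma markov_abs: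
 assumes [measurable]: "Z \<in> BM M" and "0 < ep" "0 <= c" "nnE M (%w. \<bar>Z w\<bar>) <= ennreal c"
 shows "prob {w \<in> space M. ep < \<bar>Z w\<bar>} <= c / ep"
proof -
 have "prob {w \<in> space M. sqrt ep < \<bar>sqrt \<bar>Z w\<bar>\<bar>} <= c / (sqrt ep)^2"
  using assms by (intro prob_gt_le_nn_integral_square) auto
 then show ?thesis using assms(2) by simp
qed

lemma whp_markov:
 assumes "!!m. Z m \<in> BM M" "!!m. (nnE M (%w. \<bar>Z m w\<bar>)) <= ennreal (c m)" "!!m. 0 <= c m" "c \<longlonglongrightarrow> 0" "0 < ep"
 shows "whp (%m w. \<bar>Z m w\<bar> <= ep)"
proof (rule whp_bad_event[where B="%m. {w \<in> space M. ep < \<bar>Z m w\<bar>}"])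
 note [measurable] = assms(1)
 show "{w \<in> space M. ep < \<bar>Z m w\<bar>} \<in> events" for m by measurable
 have lim: "(%m. c m / ep) \<longlonglongrightarrow> 0" using tendsto_divide[OF assms(4) tendsto_const[of ep]] assms(5) by simp
 show "(%m. prob {w \<in> space M. ep < \<bar>Z m w\<bar>}) \<longlonglongrightarrow> 0"
  by (rule tendsto_sandwich[OF _ _ tendsto_const lim]) (use markov_abs[OF assms(1,5,3,2)] in auto)
qed auto

lemma whp_chebyshev:
 assumes "!!m. Z m \<in> BM M" "!!m. (nnE M (%w. (Z m w)^2)) <= ennreal (c m)" "!!m. 0 <= c m" "c \<longlonglongrightarrow> 0" "0 < ep"
 shows "whp (%m w. \<bar>Z m w\<bar> <= ep)"
proof -
 have "whp (%m w. \<bar>(Z m w)^2\<bar> <= ep^2)"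
  using assms by (intro whp_markov[where c=c]) auto
 then show ?thesis
  by (rule whp_mono) (use assms(5) abs_le_square_iff[of _ ep] in auto)
qed

text \<open>Tightness: a mean that stays bounded without tending to 0 gives only a bound that grows
  as the level \<open>de\<close> shrinks. The 1 added to \<open>c\<close> keeps this bound
  positive.\<close>

lemma ev_prob_markov:
 assumes "!!m. Z m \<in> BM M" "!!m. (nnE M (%w. \<bar>Z m w\<bar>)) <= ennreal c" "0 <= c" "0 < de"
 shows "ev_prob de (%m w. \<bar>Z m w\<bar> <= (c + 1) / de)"
 unfolding ev_prob_def
proof (intro always_eventually allI)
 fix m
 note [measurable] = assms(1)
 have ev: "{w \<in> space M. (c + 1) / de < \<bar>Z m w\<bar>} \<in> events" by measurable
 have "prob {w \<in> space M. (c + 1) / de < \<bar>Z m w\<bar>} <= c / ((c + 1) / de)" using assms by (intro markov_abs) auto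
 also have "\<dots> <= de" using assms(3,4) by (simp add: field_simps)
 finally have P: "prob {w \<in> space M. (c + 1) / de < \<bar>Z m w\<bar>} <= de" .
 show "\<exists>B\<in>events. prob B <= de \<and> (\<forall>w\<in>space M - B. \<bar>Z m w\<bar> <= (c + 1) / de)"
  by (intro bexI[of _ "{w \<in> space M. (c + 1) / de < \<bar>Z m w\<bar>}"] conjI P ev) auto
qed

end

section \<open>Sums of the privacy noise\<close>

definition noise_sum :: "nat => nat => (nat => nat => nat => nat => 'a => real) => nat => nat => 'a => real" where
 "noise_sum n N E l k w = (\<Sum>i=1..N. \<Sum>j=1..n. E i j l k w)"

definition noise_scale :: "nat => real => nat => nat => (nat => real) => nat => real" where
 "noise_scale a T n L \<alpha> j = 2 * trunc_level T n * real L * (real a + 1) / \<alpha> j"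

definition noise_var :: "nat => real => nat => nat => nat => (nat => real) => real" where
 "noise_var a T n N L \<alpha> = real N * (\<Sum>j=1..n. 2 * (noise_scale a T n L \<alpha> j)^2)"

lemma noise_var_nonneg: "0 <= noise_var a T n N L \<alpha>"
 unfolding noise_var_def by (intro mult_nonneg_nonneg sum_nonneg) auto

text \<open>Up to a constant this is the square of the sequence in the rate condition with its
  factor \<open>ln L\<close> removed; the factors \<open>L\<close> and \<open>ln n\<close> enter
  through the scale of the noise.\<close>

lemma noise_var_eq:
 assumes "0 < T" "1 <= n" "1 <= N"
 shows "noise_var a T n N L \<alpha> / (real N)^2 = 8 * (real a + 1)^2 * T * ((real L * ln n / sqrt N)^2 / alpha_bar2 n \<alpha>)"
proof -
 define S where "S = (\<Sum>j=1..n. 1 / (\<alpha> j)^2)"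
 have 1: "(\<Sum>j=1..n. 2 * (noise_scale a T n L \<alpha> j)^2) = 8 * (trunc_level T n)^2 * (real L)^2 * (real a + 1)^2 * S"
  unfolding noise_scale_def S_def sum_distrib_left by (intro sum.cong refl) (simp add: power_divide power_mult_distrib)
 have 2: "(trunc_level T n)^2 = T / real n * (ln n)^2"
  using assms by (simp add: trunc_level_def power_mult_distrib)
 have 3: "x / alpha_bar2 n \<alpha> = x * (S / real n)" for x by (simp add: alpha_bar2_def S_def)
 have 4: "(real L * ln n / sqrt N)^2 = (real L)^2 * (ln n)^2 / real N" by (simp add: power_divide power_mult_distrib)
 show ?thesis unfolding noise_var_def 1 2 3 4 using assms(3) by (simp add: power2_eq_square mult_ac)
qed

context prob_space begin

context
 fixes a n N L :: nat and T :: real and \<alpha> :: "nat => real" and X :: "nat => real => 'a => real" and E :: "nat => nat => nat => nat => 'a => real"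
 assumes noise: "privacy_noise M a T n N L \<alpha> X E"
  and T: "0 < T" and n: "2 <= n" and L: "0 < L" and \<alpha>: "!!j. 1 <= j ==> j <= n ==> 0 < \<alpha> j"
begin

lemma noise_indep: "indep_vars (%_. borel) (%(i, j, l, k). E i j l k) (noise_index a n N L)"
 using noise unfolding privacy_noise_def by blast

lemma noise_distributed:
 assumes "i \<in> {1..N}" "j \<in> {1..n}" "l < L" "k <= a"
 shows "distributed M lborel (E i j l k) (laplace_density (noise_scale a T n L \<alpha> j))"
proof -
 have "(i, j, l, k) \<in> noise_index a n N L" using assms by (simp add: noise_index_def)
 then show ?thesis using noise unfolding privacy_noise_def noise_scale_def by blast
qed

lemma noise_scale_pos: "j \<in> {1..n} ==> 0 < noise_scale a T n L \<alpha> j"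
 using T n L \<alpha>[of j] by (simp add: noise_scale_def trunc_level_def)

text \<open>The order of the quantifiers is the point: one list \<open>ss\<close> serves all nodes,
  so the sums at different nodes have a common tail, as \<open>max_concentration\<close>
  demands.\<close>

lemma noise_sum_props:
 assumes l: "l < L" and k: "k <= a"
 shows "\<exists>ss. \<forall>l<L. (\<forall>s\<in>set ss. 0 < s) \<and> (\<forall>x. prob {w \<in> space M. x < noise_sum n N E l k w} = laplace_tail ss x) \<and>
  noise_sum n N E l k \<in> BM M \<and> (nnE M (%w. (noise_sum n N E l k w)^2)) = ennreal (noise_var a T n N L \<alpha>)"
proof -
 obtain zs where zs: "set zs = {1..N} \<times> {1..n}" "distinct zs"
  using finite_distinct_list[of "{1..N} \<times> {1..n}"] by auto
 define s where "s z = noise_scale a T n L \<alpha> (snd z)" for z :: "nat \<times> nat"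
 show ?thesis
 proof (intro exI[of _ "map s zs"] allI impI)
  fix l assume l: "l < L"
  define V where "V z = E (fst z) (snd z) l k" for z
  have "indep_vars (%z. \<Pi>\<^sub>M _\<in>{(fst z, snd z, l, k)}. borel) (%z w. restrict (%i. (case i of (i, j, l, k) => E i j l k) w) {(fst z, snd z, l, k)}) ({1..N} \<times> {1..n})"
   by (rule indep_vars_restrict[OF noise_indep]) (use l k in \<open>auto simp: noise_index_def disjoint_family_on_def\<close>)
  then have "indep_vars (%_. borel) (%z w. (%f. f (fst z, snd z, l, k)) (restrict (%i. (case i of (i, j, l, k) => E i j l k) w) {(fst z, snd z, l, k)})) ({1..N} \<times> {1..n})"
   by (rule indep_vars_compose2) (rule measurable_component_singleton, simp)
  then have ind: "indep_vars (%_. borel) V (set zs)" by (simp add: V_def[abs_def] zs(1))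
  have D: "distributed M lborel (V z) (laplace_density (s z))" "0 < s z" if "z \<in> set zs" for z
   using that noise_distributed[of "fst z" "snd z" l k] noise_scale_pos[of "snd z"] l k unfolding V_def s_def zs(1) by auto
  have eq: "(\<Sum>z\<in>set zs. V z w) = noise_sum n N E l k w" for w
   unfolding zs(1) noise_sum_def V_def by (simp add: sum.cartesian_product case_prod_beta)
  note LS = laplace_sum[OF ind zs(2) D, unfolded eq]
  show "(\<forall>s\<in>set (map s zs). 0 < s) \<and> (\<forall>x. prob {w \<in> space M. x < noise_sum n N E l k w} = laplace_tail (map s zs) x) \<and>
   noise_sum n N E l k \<in> BM M \<and> (nnE M (%w. (noise_sum n N E l k w)^2)) = ennreal (noise_var a T n N L \<alpha>)"
  proof (intro conjI allI)
   show "\<forall>s\<in>set (map s zs). 0 < s" using D(2) by auto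
   show "prob {w \<in> space M. x < noise_sum n N E l k w} = laplace_tail (map s zs) x" for x by (rule LS(1))
   show "noise_sum n N E l k \<in> BM M" using borel_measurable_integrable[OF LS(4)] by simp
   have "nnE M (%w. (noise_sum n N E l k w)^2) = ennreal (expectation (%w. (noise_sum n N E l k w)^2))"
    by (rule nn_integral_eq_integral[OF LS(2)]) auto
   also have "expectation (%w. (noise_sum n N E l k w)^2) = (\<Sum>z\<in>set zs. 2 * (s z)^2)" by (rule LS(3)) auto
   also have "(\<Sum>z\<in>set zs. 2 * (s z)^2) = (\<Sum>i=1..N. \<Sum>j=1..n. 2 * (noise_scale a T n L \<alpha> j)^2)"
    unfolding zs(1) s_def sum.cartesian_product by (intro sum.cong refl) auto
   also have "\<dots> = noise_var a T n N L \<alpha>" by (simp add: noise_var_def)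
   finally show "nnE M (%w. (noise_sum n N E l k w)^2) = ennreal (noise_var a T n N L \<alpha>)" .
  qed
 qed
qed

lemma noise_sum_square:
 assumes "l < L" "k <= a"
 shows "noise_sum n N E l k \<in> BM M" "nnE M (%w. (noise_sum n N E l k w)^2) = ennreal (noise_var a T n N L \<alpha>)"
 using noise_sum_props[OF assms] assms(1) by blast+

lemma noise_sum_indep:
 assumes k: "k <= a" shows "indep_vars (%_. borel) (%l. noise_sum n N E l k) {..<L}"
proof -
 define K where "K l = (%z. (fst z, snd z, l, k)) ` ({1..N} \<times> {1..n})" for l :: nat
 have "indep_vars (%l. \<Pi>\<^sub>M _\<in>K l. borel) (%l w. restrict (%i. (case i of (i, j, l, k) => E i j l k) w) (K l)) {..<L}"
  by (rule indep_vars_restrict[OF noise_indep]) (use k in \<open>auto simp: K_def noise_index_def disjoint_family_on_def\<close>)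
 then have "indep_vars (%_. borel) (%l w. (%f. \<Sum>i=1..N. \<Sum>j=1..n. f (i, j, l, k)) (restrict (%i. (case i of (i, j, l, k) => E i j l k) w) (K l))) {..<L}"
 proof (rule indep_vars_compose2)
  fix l assume "l \<in> {..<L}"
  show "(%f. \<Sum>i=1..N. \<Sum>j=1..n. f (i, j, l, k) :: real) \<in> BM (\<Pi>\<^sub>M _\<in>K l. borel)"
   by (intro borel_measurable_sum measurable_component_singleton[where M="%_. borel"]) (force simp: K_def)
 qed
 moreover have "(%f. \<Sum>i=1..N. \<Sum>j=1..n. f (i, j, l, k)) (restrict (%i. (case i of (i, j, l, k) => E i j l k) w) (K l)) = noise_sum n N E l k w" for l w
  unfolding noise_sum_def by (intro sum.cong refl) (force simp: K_def)
 ultimately show ?thesis by simp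
qed

text \<open>A union bound with Chebyshev's inequality. The factor \<open>L\<close> is affordable for
  the derivative data, whose threshold may grow like \<open>L\<close>, but not for the
  values.\<close>

lemma noise_sum_large:
 assumes k: "k <= a" and h: "0 < h"
 shows "prob {w \<in> space M. \<exists>l<L. h < \<bar>noise_sum n N E l k w\<bar>} <= real L * (noise_var a T n N L \<alpha> / h^2)"
proof -
 have [measurable]: "{w \<in> space M. h < \<bar>noise_sum n N E l k w\<bar>} \<in> events" if "l < L" for l
  using noise_sum_square(1)[OF that k] by measurable
 have "{w \<in> space M. \<exists>l<L. h < \<bar>noise_sum n N E l k w\<bar>} = (\<Union>l\<in>{..<L}. {w \<in> space M. h < \<bar>noise_sum n N E l k w\<bar>})" by auto
 then have "prob {w \<in> space M. \<exists>l<L. h < \<bar>noise_sum n N E l k w\<bar>} <= (\<Sum>l<L. prob {w \<in> space M. h < \<bar>noise_sum n N E l k w\<bar>})"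
  using finite_measure_subadditive_finite[of "{..<L}" "%l. {w \<in> space M. h < \<bar>noise_sum n N E l k w\<bar>}"] by (auto simp: image_subset_iff)
 also have "\<dots> <= (\<Sum>l<L. noise_var a T n N L \<alpha> / h^2)"
  by (intro sum_mono prob_gt_le_nn_integral_square h noise_var_nonneg noise_sum_square(1) k) (use noise_sum_square(2) k in auto)
 finally show ?thesis by simp
qed

lemma noise_sum_concentration:
 assumes e: "0 < e" and ro: "0 < ro" "2 * noise_var a T n N L \<alpha> / e^2 <= ro" "ro <= 1" and L3: "3 <= L"
  and A: "A \<subseteq> {..<L}" "ka * real L <= real (card A)" "0 < ka"
 shows "\<exists>q. prob {w \<in> space M. \<exists>l<L. q + 4 * e < noise_sum n N E l 0 w} <= ro \<and>
  prob {w \<in> space M. \<forall>l\<in>A. noise_sum n N E l 0 w <= q - 4 * e} <= exp (- ka / ro) + exp (- ka * real L / 2)"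
proof -
 obtain ss where ss: "!!l. l < L ==> \<forall>s\<in>set ss. 0 < s" "!!l x. l < L ==> prob {w \<in> space M. x < noise_sum n N E l 0 w} = laplace_tail ss x"
  using noise_sum_props[OF L, of 0] by blast
 have pf: "pf2 (laplace_tail ss)" using laplace_tail_props[of ss] ss(1)[OF L] by blast
 show ?thesis
 proof (rule max_concentration[OF noise_sum_indep ss(2) pf _ e ro L3 A])
  fix l t assume l: "l < L" and t: "(0::real) < t"
  have M: "noise_sum n N E l 0 \<in> BM M" by (rule noise_sum_square(1)[OF l]) simp
  note sq = eq_refl[OF noise_sum_square(2)[OF l, of 0]]
  \<comment> \<open>Chebyshev's inequality is available for the strict event; it is applied at
    levels \<open>u\<close> below \<open>t\<close>, and then \<open>u\<close> tends to
    \<open>t\<close>.\<close>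
  have b: "prob {w \<in> space M. t <= \<bar>noise_sum n N E l 0 w\<bar>} <= noise_var a T n N L \<alpha> / u^2" if u: "0 < u" "u < t" for u
  proof -
   have "prob {w \<in> space M. t <= \<bar>noise_sum n N E l 0 w\<bar>} <= prob {w \<in> space M. u < \<bar>noise_sum n N E l 0 w\<bar>}"
    using M u by (intro finite_measure_mono) auto
   also have "\<dots> <= noise_var a T n N L \<alpha> / u^2" by (rule prob_gt_le_nn_integral_square[OF M u(1) noise_var_nonneg sq]) simp
   finally show ?thesis .
  qed
  have "((%u. noise_var a T n N L \<alpha> / u^2) \<longlongrightarrow> noise_var a T n N L \<alpha> / t^2) (at_left t)" using t by (intro tendsto_intros) auto
  moreover have "\<forall>\<^sub>F u in at_left t. prob {w \<in> space M. t <= \<bar>noise_sum n N E l 0 w\<bar>} <= noise_var a T n N L \<alpha> / u^2"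
   using t b by (auto simp: eventually_at_left[OF t] intro!: exI[of _ 0])
  ultimately show "prob {w \<in> space M. t <= \<bar>noise_sum n N E l 0 w\<bar>} <= noise_var a T n N L \<alpha> / t^2"
   by (intro tendsto_lowerbound[OF _ _ trivial_limit_at_left_real])
 qed simp
qed

end

end

lemma grid_unit: "l < L ==> grid L l \<in> {0..1}"
 by (simp add: grid_def)

text \<open>On a cell the interpolant is, up to the terms of order \<open>k \<ge> 1\<close>, a convex combination of the
 two values at the nodes.\<close>

lemma hermite_sandwich:
 fixes A :: "nat => nat => real" and h S :: "real => real"
 assumes L: "2 <= L"
  and cell: "!!l x. Suc l < L ==> x \<in> {grid L l..grid L (Suc l)} ==>
   h x = (\<Sum>k\<le>a. (A l k * poly (hermite_basis a k) (real L * x - real l) + A (Suc l) k * poly (hermite_basis' a k) (real L * x - real l)) / real L ^ k)"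
  and C: "0 <= C" "!!k x. k <= a ==> x \<in> {0..1} ==> \<bar>poly (hermite_basis a k) x\<bar> <= C \<and> \<bar>poly (hermite_basis' a k) x\<bar> <= C"
  and A0: "!!l. l < L ==> \<bar>A l 0 - S (grid L l) - Y l\<bar> <= e0"
  and Ak: "!!l k. l < L ==> 1 <= k ==> k <= a ==> \<bar>A l k\<bar> <= e1 * real L"
  and S: "!!u v. u \<in> {0..1} ==> v \<in> {0..1} ==> \<bar>S u - S v\<bar> <= La * \<bar>u - v\<bar>" and La: "0 <= La"
 shows "l < L ==> S (grid L l) + Y l - e0 <= h (grid L l)"
  and "x \<in> {grid L 0..grid L (L - 1)} ==> (!!l. l < L ==> Y l <= q) ==> h x <= S x + La / real L + q + e0 + real a * (2 * C * e1)"
proof -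
 have L0: "0 < L" using L by simp
 have sel: "(\<Sum>k\<le>a. (if k = 0 then w else 0) / real L ^ k) = w" for w
  by (subst sum.remove[of _ 0]) (auto intro!: sum.neutral)
 \<comment> \<open>At a node only the basis function of order 0 is nonzero. The last node has no
   cell to its right and is read as the right end of the cell before it.\<close>
 have node: "h (grid L l) = A l 0" if l: "l < L" for l
 proof (cases "Suc l < L")
  case True
  have u: "real L * grid L l - real l = 0" using L0 by (simp add: grid_def)
  have "h (grid L l) = (\<Sum>k\<le>a. (A l k * poly (hermite_basis a k) 0 + A (Suc l) k * poly (hermite_basis' a k) 0) / real L ^ k)"
   using cell[OF True, of "grid L l"] grid_less[OF L0, of l "Suc l"] by (simp add: u)
  also have "\<dots> = (\<Sum>k\<le>a. (if k = 0 then A l 0 else 0) / real L ^ k)"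
   using hermite_basis(2)[of _ a 0] hermite_basis'(2)[of _ a 0] by (intro sum.cong refl) auto
  finally show ?thesis using sel by simp
 next
  case False
  then obtain l' where l': "l = Suc l'" "Suc l' < L" using l L by (cases l) auto
  have u: "real L * grid L l - real l' = 1" using L0 l' by (simp add: grid_def)
  have "h (grid L l) = (\<Sum>k\<le>a. (A l' k * poly (hermite_basis a k) 1 + A l k * poly (hermite_basis' a k) 1) / real L ^ k)"
   using cell[OF l'(2), of "grid L l"] grid_less[OF L0, of l' l] by (simp add: u[unfolded l'(1)] l'(1))
  also have "\<dots> = (\<Sum>k\<le>a. (if k = 0 then A l 0 else 0) / real L ^ k)"
   using hermite_basis(3)[of _ a 0] hermite_basis'(3)[of _ a 0] by (intro sum.cong refl) auto
  finally show ?thesis using sel by simp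
 qed
 show "S (grid L l) + Y l - e0 <= h (grid L l)" if "l < L" using A0[OF that] node[OF that] by linarith
 show "h x <= S x + La / real L + q + e0 + real a * (2 * C * e1)" if x: "x \<in> {grid L 0..grid L (L - 1)}" and q: "!!l. l < L ==> Y l <= q"
 proof -
  obtain l where l: "Suc l < L" "x \<in> {grid L l..grid L (Suc l)}" using x unfolding grid_cells[OF L] by blast
  have l': "l < L" using l by simp
  let ?u = "real L * x - real l"
  have u: "?u \<in> {0..1}" using l(2) L0 by (auto simp: grid_def field_simps)
  have xu: "x \<in> {0..1}" using l grid_unit[OF l'] grid_unit[OF l(1)] by auto
  have gx: "\<bar>grid L l - x\<bar> <= 1 / real L" "\<bar>grid L (Suc l) - x\<bar> <= 1 / real L"
   using l(2) L0 by (auto simp: grid_def add_divide_distrib)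
  have near: "A i 0 <= S x + La / real L + q + e0" if i: "i < L" "\<bar>grid L i - x\<bar> <= 1 / real L" for i
  proof -
   have "\<bar>S (grid L i) - S x\<bar> <= La * \<bar>grid L i - x\<bar>" by (rule S[OF grid_unit[OF i(1)] xu])
   also have "\<dots> <= La * (1 / real L)" by (rule mult_left_mono[OF i(2) La])
   finally show ?thesis using A0[OF i(1)] q[OF i(1)] by simp
  qed
  note B = hermite_basis_0_bounds[OF u, of a]
  have "h x = (\<Sum>k\<le>a. (A l k * poly (hermite_basis a k) ?u + A (Suc l) k * poly (hermite_basis' a k) ?u) / real L ^ k)"
   by (rule cell[OF l])
  also have "\<dots> = (A l 0 * poly (hermite_basis a 0) ?u + A (Suc l) 0 * poly (hermite_basis' a 0) ?u)
   + (\<Sum>k=1..a. (A l k * poly (hermite_basis a k) ?u + A (Suc l) k * poly (hermite_basis' a k) ?u) / real L ^ k)"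
   by (simp add: atMost_atLeast0 sum.atLeast_Suc_atMost)
  also have "\<dots> <= (S x + La / real L + q + e0) + (\<Sum>k=1..a. 2 * C * e1)"
  proof (rule add_mono)
   let ?m = "S x + La / real L + q + e0"
   have "A l 0 * poly (hermite_basis a 0) ?u + A (Suc l) 0 * poly (hermite_basis' a 0) ?u <= ?m * poly (hermite_basis a 0) ?u + ?m * poly (hermite_basis' a 0) ?u"
    using near[OF l' gx(1)] near[OF l(1) gx(2)] B by (intro add_mono mult_right_mono) auto
   also have "\<dots> = ?m" using B(3) by (simp only: distrib_left[symmetric] mult_1_right)
   finally show "A l 0 * poly (hermite_basis a 0) ?u + A (Suc l) 0 * poly (hermite_basis' a 0) ?u <= ?m" .
   show "(\<Sum>k=1..a. (A l k * poly (hermite_basis a k) ?u + A (Suc l) k * poly (hermite_basis' a k) ?u) / real L ^ k) <= (\<Sum>k=1..a. 2 * C * e1)"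
   proof (rule sum_mono)
    fix k assume "k \<in> {1..a}"
    then have k: "1 <= k" "k <= a" by auto
    have "A l k * poly (hermite_basis a k) ?u <= \<bar>A l k\<bar> * \<bar>poly (hermite_basis a k) ?u\<bar>" using abs_ge_self[of "A l k * poly (hermite_basis a k) ?u"] by (simp only: abs_mult)
    also have "\<dots> <= (e1 * real L) * C" using Ak[OF l' k] C(2)[OF k(2) u] C(1) order_trans[OF abs_ge_zero Ak[OF l' k]] by (intro mult_mono) auto
    finally have 1: "A l k * poly (hermite_basis a k) ?u <= (e1 * real L) * C" .
    have "A (Suc l) k * poly (hermite_basis' a k) ?u <= \<bar>A (Suc l) k\<bar> * \<bar>poly (hermite_basis' a k) ?u\<bar>" using abs_ge_self[of "A (Suc l) k * poly (hermite_basis' a k) ?u"] by (simp only: abs_mult)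
    also have "\<dots> <= (e1 * real L) * C" using Ak[OF l(1) k] C(2)[OF k(2) u] C(1) order_trans[OF abs_ge_zero Ak[OF l' k]] by (intro mult_mono) auto
    finally have 2: "A (Suc l) k * poly (hermite_basis' a k) ?u <= (e1 * real L) * C" .
    have e1: "0 <= e1" using order_trans[OF abs_ge_zero Ak[OF l' k]] L0 by (simp add: zero_le_mult_iff)
    have "(A l k * poly (hermite_basis a k) ?u + A (Suc l) k * poly (hermite_basis' a k) ?u) / real L ^ k <= (2 * C * e1 * real L) / real L ^ k"
     using 1 2 by (intro divide_right_mono) (auto simp: mult_ac)
    \<comment> \<open>Since \<open>k >= 1\<close>, at least one factor \<open>L\<close> in the
      denominator is left to cancel the growth of the derivative data.\<close>
    also have "\<dots> <= (2 * C * e1 * real L) / real L ^ 1"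
     using k(1) L0 e1 C(1) by (intro divide_left_mono power_increasing) auto
    finally show "(A l k * poly (hermite_basis a k) ?u + A (Suc l) k * poly (hermite_basis' a k) ?u) / real L ^ k <= 2 * C * e1" using L0 by simp
   qed
  qed
  also have "\<dots> = S x + La / real L + q + e0 + real a * (2 * C * e1)" by simp
  finally show ?thesis .
 qed
qed

context observed_particle begin

definition major_max :: "nat => real" where "major_max a = (\<Sum>k\<le>a. major_const k)"

lemma major_max: "0 <= major_max a" "k <= a ==> major_const k <= major_max a"
 unfolding major_max_def using major_const_nonneg by (auto intro!: sum_nonneg member_le_sum)

text \<open>While the majorant stays below the truncation level, so do all increments up to order
  \<open>a\<close> at every parameter, and the truncation does nothing. One variable per time step
  thus controls all nodes and orders simultaneously.\<close>

definition excess :: "nat => nat => nat => 'a => real" where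
 "excess a n j w = (if trunc_level T n < major_max a * major n j w then major_max a * major n j w else 0)"

lemma excess_M: "1 <= n ==> j < n ==> excess a n j \<in> BM M"
 unfolding excess_def[abs_def] using major_M[of n j] by measurable

lemma excess_nonneg: "1 <= n ==> 0 <= excess a n j w"
 unfolding excess_def using major_nonneg major_max(1) by simp

lemma excess_sum_bound:
 assumes n: "2 <= n"
 shows "nnE M (%w. \<Sum>j<n. excess a n j w) <= ennreal (real n * trunc_err n (major_max a))" and "0 <= trunc_err n (major_max a)"
proof -
 have n1: "1 <= n" using n by simp
 show t0: "0 <= trunc_err n (major_max a)"
  unfolding trunc_err_def trunc_level_def using n T_pos major_max(1) incr_bound_nonneg pos by (intro add_nonneg_nonneg mult_nonneg_nonneg) auto
 have "nnE M (%w. \<Sum>j<n. excess a n j w) = nnI M (%w. (\<Sum>j<n. ennreal (excess a n j w)))"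
  using excess_nonneg[OF n1] by (intro nn_integral_cong) (simp add: sum_ennreal)
 also have "\<dots> = (\<Sum>j<n. (nnE M (%w. excess a n j w)))" using excess_M[OF n1] by (intro nn_integral_sum) auto
 also have "\<dots> <= (\<Sum>j<n. ennreal (trunc_err n (major_max a)))"
  unfolding excess_def by (intro sum_mono truncation_error n major_max(1)) auto
 also have "\<dots> = ennreal (real n * trunc_err n (major_max a))" using t0 by (simp add: ennreal_mult ennreal_of_nat_eq_real_of_nat)
 finally show "nnE M (%w. \<Sum>j<n. excess a n j w) <= ennreal (real n * trunc_err n (major_max a))" .
qed

lemma excess_dominates:
 assumes n: "1 <= n"
 shows "AE w in M. \<forall>j<n. \<forall>k\<le>a. \<forall>th\<in>{0..1}. \<forall>v. v = fder sg (T / real n) k th (X (real j * (T / real n)) w) (X (real (Suc j) * (T / real n)) w) \<longrightarrow>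
  (if trunc_level T n < \<bar>v\<bar> then \<bar>v\<bar> else 0) <= excess a n j w"
 using fder_major[OF n]
proof eventually_elim
 case (elim w)
 show ?case
 proof (intro allI impI ballI)
  fix j k th v assume j: "j < n" and k: "k <= a" and th: "th \<in> {0..1::real}"
   and v: "v = fder sg (T / real n) k th (X (real j * (T / real n)) w) (X (real (Suc j) * (T / real n)) w)"
  have "\<bar>v\<bar> <= major_const k * major n j w" unfolding v using elim j th by blast
  also have "\<dots> <= major_max a * major n j w" by (rule mult_right_mono[OF major_max(2)[OF k] major_nonneg[OF n]])
  finally show "(if trunc_level T n < \<bar>v\<bar> then \<bar>v\<bar> else 0) <= excess a n j w"
   using excess_nonneg[OF n, of a j w] by (auto simp: excess_def split: if_splits)
 qed
qed

end

section \<open>Averages over the particles\<close>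

locale estimation = particle_system M F T W X I "b ths" sg B c ka + smooth_drift b
 for M :: "'a measure" and F :: "real => 'a measure" and T :: real and W X I :: "nat => real => 'a => real"
  and b :: "real => real => real" and ths :: real and sg :: "real => real" and B c ka :: real +
 fixes mn :: real
 assumes ths: "ths \<in> {0..1}" and elliptic: "!!x. mn <= (sg x)^2" and mn: "0 < mn"
  and b_lip: "!!th. th \<in> {0..1} ==> \<exists>L\<ge>0. \<forall>x y. \<bar>b th x - b th y\<bar> <= L * \<bar>x - y\<bar>"
begin

lemma observed: "1 <= i ==> observed_particle M F T (W i) b ths sg (X i) (I i) B c ka mn"
 unfolding observed_particle_def observed_particle_axioms_def
 using particle smooth_drift_axioms ths elliptic mn b_lip by blast

text \<open>The first particle represents the common law: means and the limit contrast are taken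
  from it. Bounds such as \<open>psum_bd\<close> are built from the constants of the model alone and
  hence are the same for every particle.\<close>

sublocale P1: observed_particle M F T "W 1" b ths sg "X 1" "I 1" B c ka mn
 by (rule observed) simp

definition emp :: "nat => nat => nat => real => 'a => real" where
 "emp n N k th w = (\<Sum>i=1..N. path_sum (fder sg (T / real n) k th) n i w) / real N"

lemma path_sum_psum: "1 <= i ==> path_sum (fder sg (T / real n) k th) n i = observed_particle.psum T b sg (X i) n k th"
 by (rule ext) (simp add: path_sum_def observed_particle.psum_def[OF observed])

context
 fixes n N :: nat assumes n: "1 <= n" and N: "1 <= N"
begin

lemma path_square: "1 <= i ==> th \<in> {0..1} ==> (nnE M (%w. (path_sum (fder sg (T / real n) k th) n i w)^2)) <= ennreal (P1.psum_bd k)"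
 unfolding path_sum_psum by (rule observed_particle.psum_square[OF observed n])

lemma path_meas: "1 <= i ==> th \<in> {0..1} ==> path_sum (fder sg (T / real n) k th) n i \<in> BM M"
 unfolding path_sum_psum by (rule observed_particle.psum_M[OF observed n])

lemma emp_M: "th \<in> {0..1} ==> emp n N k th \<in> BM M"
 unfolding emp_def[abs_def] by (intro borel_measurable_divide borel_measurable_sum path_meas) auto

lemma emp_mean_square:
 assumes th: "th \<in> {0..1}"
 shows "nnE M (%w. (emp n N 0 th w - expectation (P1.psum n 0 th))^2) <= ennreal (P1.psum_bd 0 / real N)"
 using path_sum_mean_square[OF P1.fder_continuous[OF th] n path_square[OF _ th] P1.psum_bd_nonneg N]
 unfolding emp_def path_sum_psum[OF order_refl] .

lemma emp_abs:
 assumes th: "th \<in> {0..1}"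
 shows "nnE M (%w. \<bar>emp n N k th w\<bar>) <= ennreal (sqrt (P1.psum_bd k))"
proof -
 let ?p = "%i. path_sum (fder sg (T / real n) k th) n i"
 have one: "nnE M (%w. \<bar>?p i w\<bar>) <= ennreal (sqrt (P1.psum_bd k))" if i: "1 <= i" for i
 proof -
  note E = integrable_from_nn_integral_square[OF path_meas[OF i th] P1.psum_bd_nonneg path_square[OF i th]]
  have "nnE M (%w. \<bar>?p i w\<bar>) = ennreal (expectation (%w. \<bar>?p i w\<bar>))"
   using E(3) by (intro nn_integral_eq_integral integrable_abs) auto
  then show ?thesis using E(4) by (simp add: ennreal_leI)
 qed
 then show ?thesis unfolding emp_def using path_meas th P1.psum_bd_nonneg N by (intro nn_average_bound) auto
qed

lemma emp_deriv:
 assumes "th \<in> {0..1}" shows "((%et. emp n N k et w) has_real_derivative emp n N (Suc k) th w) (at th within {0..1})"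
 unfolding emp_def path_sum_def by (intro DERIV_cdivide DERIV_sum fder_deriv assms)

lemma emp_sup:
 "\<exists>Z. Z \<in> BM M \<and> (\<forall>w\<in>space M. 0 <= Z w \<and> (\<forall>th\<in>{0..1}. \<bar>emp n N k th w\<bar> <= Z w)) \<and>
  (nnE M (%w. Z w)) <= ennreal (sqrt (P1.psum_bd k) + sqrt (P1.psum_bd (Suc k)))"
proof (rule sup_moment_bound)
 show "((%et. emp n N k et w) has_real_derivative emp n N (Suc k) th w) (at th within {0..1})" if "th \<in> {0..1}" for w th by (rule emp_deriv[OF that])
 show "continuous_on {0..1} (%th. emp n N (Suc k) th w)" for w
  by (rule DERIV_continuous_on[OF emp_deriv])
 show "emp n N k th \<in> BM M" "emp n N (Suc k) th \<in> BM M" if "th \<in> {0..1}" for th using emp_M[OF that] by auto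
 show "nnE M (%w. \<bar>emp n N k 0 w\<bar>) <= ennreal (sqrt (P1.psum_bd k))" by (rule emp_abs) simp
 show "nnE M (%w. \<bar>emp n N (Suc k) th w\<bar>) <= ennreal (sqrt (P1.psum_bd (Suc k)))" if "th \<in> {0..1}" for th by (rule emp_abs[OF that])
qed (use P1.psum_bd_nonneg in auto)

end

definition cut :: "nat => nat => nat => 'a => real" where
 "cut a n N w = (\<Sum>i=1..N. \<Sum>j<n. observed_particle.excess T (W i) b sg (X i) (I i) B mn a n j w) / real N"

lemma cut_bound:
 assumes n: "2 <= n" and N: "1 <= N"
 shows "cut a n N \<in> BM M" "nnE M (%w. \<bar>cut a n N w\<bar>) <= ennreal (real n * P1.trunc_err n (P1.major_max a))"
proof -
 define e where "e i w = (\<Sum>j<n. observed_particle.excess T (W i) b sg (X i) (I i) B mn a n j w)" for i w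
 have n1: "1 <= n" using n by simp
 have m: "e i \<in> BM M" if "i \<in> {1..N}" for i
  unfolding e_def[abs_def] using that by (intro borel_measurable_sum observed_particle.excess_M[OF observed n1]) auto
 have e0: "0 <= e i w" if "i \<in> {1..N}" for i w
  unfolding e_def using that by (intro sum_nonneg observed_particle.excess_nonneg[OF observed n1]) auto
 show "cut a n N \<in> BM M" unfolding cut_def[abs_def] e_def[symmetric] by (intro borel_measurable_divide borel_measurable_sum[OF m]) auto
 have "nnE M (%w. \<bar>e i w\<bar>) <= ennreal (real n * P1.trunc_err n (P1.major_max a))" if i: "i \<in> {1..N}" for i
  unfolding abs_of_nonneg[OF e0[OF i]] unfolding e_def by (rule observed_particle.excess_sum_bound(1)[OF observed n]) (use i in simp)
 then show "nnE M (%w. \<bar>cut a n N w\<bar>) <= ennreal (real n * P1.trunc_err n (P1.major_max a))"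
  unfolding cut_def e_def[symmetric] using m N P1.excess_sum_bound(2)[OF n, of a] by (intro nn_average_bound) auto
qed

definition node_avg :: "(real => real) => nat => nat => nat => (nat => nat => nat => nat => 'a => real) => 'a => nat => nat => real" where
 "node_avg \<phi> n N L E w l k = (\<Sum>i=1..N. \<Sum>j=1..n. priv_data T b sg \<phi> n L (X i) (E i j) j w l k) / real N"

text \<open>The interpolant is linear in its data, so the average over particles can be taken at the
  nodes before interpolating.\<close>

lemma pub_contrast_cell:
 assumes L: "2 <= L" "Suc l < L" "x \<in> {grid L l..grid L (Suc l)}"
 shows "pub_contrast a T b sg \<phi> n N L X E x w / real N = (\<Sum>k\<le>a. (node_avg \<phi> n N L E w l k * poly (hermite_basis a k) (real L * x - real l)
  + node_avg \<phi> n N L E w (Suc l) k * poly (hermite_basis' a k) (real L * x - real l)) / real L ^ k)"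
proof -
 define u where "u = real L * x - real l"
 define p where "p i j l k = priv_data T b sg \<phi> n L (X i) (E i j) j w l k" for i j l k
 have swap: "(\<Sum>i=1..N. \<Sum>j=1..n. \<Sum>k\<le>a. z i j k) = (\<Sum>k\<le>a. \<Sum>i=1..N. \<Sum>j=1..n. z i j k)" for z :: "nat => nat => nat => real"
  by (simp only: sum.swap[of _ "{..a}" "{1..n}"] sum.swap[of _ "{..a}" "{1..N}"])
 have "pub_contrast a T b sg \<phi> n N L X E x w = (\<Sum>i=1..N. \<Sum>j=1..n. \<Sum>k\<le>a. (p i j l k * poly (hermite_basis a k) u + p i j (Suc l) k * poly (hermite_basis' a k) u) / real L ^ k)"
  unfolding pub_contrast_def u_def p_def by (intro sum.cong refl hermite_interp_cell[OF L])
 also have "\<dots> = (\<Sum>k\<le>a. ((\<Sum>i=1..N. \<Sum>j=1..n. p i j l k) * poly (hermite_basis a k) u + (\<Sum>i=1..N. \<Sum>j=1..n. p i j (Suc l) k) * poly (hermite_basis' a k) u) / real L ^ k)"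
  unfolding swap by (simp only: sum_divide_distrib[symmetric] sum.distrib sum_distrib_right[symmetric])
 finally have e: "pub_contrast a T b sg \<phi> n N L X E x w = \<dots>" .
 show ?thesis unfolding node_avg_def u_def[symmetric] p_def[symmetric] e sum_divide_distrib[of _ "{..a}"]
  by (intro sum.cong refl) (simp only: add_divide_distrib divide_divide_eq_left times_divide_eq_left mult.commute[of "real N"])
qed

text \<open>The cut-off factor differs from 1 only beyond the truncation level, where the increment
  is dominated by \<open>excess\<close>. The exceptional null set is the same for all grids, nodes
  and orders.\<close>

lemma node_avg_approx:
 assumes n: "1 <= n" and N: "1 <= N" and \<phi>: "!!xi. \<bar>xi\<bar> <= 1 ==> \<phi> xi = 1" "!!xi. \<bar>\<phi> xi - 1\<bar> <= C" and n2: "2 <= n"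
 shows "AE w in M. \<forall>L. \<forall>l<L. \<forall>k\<le>a. \<bar>node_avg \<phi> n N L E w l k - emp n N k (grid L l) w - noise_sum n N E l k w / real N\<bar> <= C * cut a n N w"
proof -
 have "AE w in M. \<forall>i\<in>{1..N}. \<forall>j<n. \<forall>k\<le>a. \<forall>th\<in>{0..1}. \<forall>v. v = fder sg (T / real n) k th (X i (real j * (T / real n)) w) (X i (real (Suc j) * (T / real n)) w) \<longrightarrow>
  (if trunc_level T n < \<bar>v\<bar> then \<bar>v\<bar> else 0) <= observed_particle.excess T (W i) b sg (X i) (I i) B mn a n j w"
  using observed_particle.excess_dominates[OF observed n] by (intro AE_finite_allI) auto
 then show ?thesis
 proof eventually_elim
  case (elim w)
  show ?case
  proof (intro allI impI)
   fix L l k :: nat assume l: "l < L" and k: "k <= a"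
   define v where "v i j = fder sg (T / real n) k (grid L l) (X i (real j * (T / real n)) w) (X i (real (Suc j) * (T / real n)) w)" for i j
   define ta where "ta = trunc_level T n"
   define ex where "ex i j = observed_particle.excess T (W i) b sg (X i) (I i) B mn a n j w" for i j
   have ta: "0 < ta" using P1.T_pos n2 by (simp add: ta_def trunc_level_def)
   have pd: "priv_data T b sg \<phi> n L (X i) (E i (Suc j)) (Suc j) w l k = v i j * \<phi> (v i j / ta) + E i (Suc j) l k w" for i j
    unfolding priv_data_def Let_def dparam_f[OF grid_unit[OF l]] by (simp add: v_def ta_def)
   have re: "(\<Sum>j=1..n. f j) = (\<Sum>j<n. f (Suc j))" for f :: "nat => real" by (simp add: sum.atLeast1_atMost_eq)
   have A: "node_avg \<phi> n N L E w l k = (\<Sum>i=1..N. \<Sum>j<n. v i j * \<phi> (v i j / ta) + E i (Suc j) l k w) / real N"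
    unfolding node_avg_def re pd ..
   have Ns: "noise_sum n N E l k w = (\<Sum>i=1..N. \<Sum>j<n. E i (Suc j) l k w)"
    unfolding noise_sum_def re ..
   have G: "emp n N k (grid L l) w = (\<Sum>i=1..N. \<Sum>j<n. v i j) / real N" by (simp add: emp_def path_sum_def v_def)
   have "node_avg \<phi> n N L E w l k - emp n N k (grid L l) w - noise_sum n N E l k w / real N = (\<Sum>i=1..N. \<Sum>j<n. v i j * (\<phi> (v i j / ta) - 1)) / real N"
    unfolding A Ns G by (simp only: diff_divide_distrib[symmetric] sum_subtractf[symmetric] right_diff_distrib mult_1_right) (simp add: algebra_simps)
   also have "\<bar>\<dots>\<bar> <= (\<Sum>i=1..N. \<Sum>j<n. C * ex i j) / real N"
   proof -
    have "\<bar>v i j * (\<phi> (v i j / ta) - 1)\<bar> <= C * ex i j" if ij: "i \<in> {1..N}" "j \<in> {..<n}" for i j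
    proof -
     have C: "0 <= C" using order_trans[OF abs_ge_zero \<phi>(2)[of 0]] .
     have d: "(if ta < \<bar>v i j\<bar> then \<bar>v i j\<bar> else 0) <= ex i j"
      using elim ij k grid_unit[OF l] unfolding v_def ta_def ex_def by blast
     show ?thesis
     proof (cases "ta < \<bar>v i j\<bar>")
      case True
      have "\<bar>v i j\<bar> * \<bar>\<phi> (v i j / ta) - 1\<bar> <= ex i j * C" using True d \<phi>(2) by (intro mult_mono) auto
      then show ?thesis by (simp add: abs_mult mult.commute)
     next
      case False
      then have "\<phi> (v i j / ta) = 1" using ta by (intro \<phi>(1)) simp
      then show ?thesis using d False C by simp
     qed
    qed
    then have "\<bar>\<Sum>i=1..N. \<Sum>j<n. v i j * (\<phi> (v i j / ta) - 1)\<bar> <= (\<Sum>i=1..N. \<Sum>j<n. C * ex i j)"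
     by (intro order_trans[OF sum_abs] sum_mono order_trans[OF sum_abs]) auto
    then show ?thesis by (simp add: divide_right_mono)
   qed
   also have "\<dots> = C * cut a n N w" by (simp add: cut_def ex_def sum_distrib_left)
   finally show "\<bar>node_avg \<phi> n N L E w l k - emp n N k (grid L l) w - noise_sum n N E l k w / real N\<bar> <= C * cut a n N w" .
  qed
 qed
qed

end

text \<open>Only the nodes to the right of \<open>th\<close> are counted; \<open>th + et < 1\<close>
  guarantees that these belong to the grid. Rounding loses at most one of \<open>et * L\<close>
  nodes, which is at most half of them by the assumption on \<open>L\<close>.\<close>

lemma card_near_nodes:
 assumes th: "0 <= th" "th + et < 1" and et: "0 < et" and L: "2 <= et * real L"
 shows "et / 2 * real L <= real (card {l. l < L \<and> \<bar>grid L l - th\<bar> <= et})"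
proof -
 let ?A = "{l. l < L \<and> \<bar>grid L l - th\<bar> <= et}"
 define p where "p = nat \<lceil>real L * th\<rceil>"
 define q where "q = nat \<lfloor>et * real L\<rfloor>"
 have L0: "0 < real L" using L et by (metis mult_eq_0_iff not_numeral_le_zero of_nat_0_le_iff order_le_less)
 have pp: "real L * th <= real p" "real p < real L * th + 1"
 proof -
  have "0 <= real L * th" using th(1) by simp
  then have "real p = of_int \<lceil>real L * th\<rceil>" unfolding p_def by (intro of_nat_nat) linarith
  then show "real L * th <= real p" "real p < real L * th + 1" by linarith+
 qed
 have qq: "real q <= et * real L" "et * real L - 1 < real q" 
 proof -
  have "real q = of_int \<lfloor>et * real L\<rfloor>" unfolding q_def using L by (intro of_nat_nat) linarith
  then show "real q <= et * real L" "et * real L - 1 < real q" by linarith+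
 qed
 have "(%i. p + i) ` {..<q} \<subseteq> ?A"
 proof
  fix l assume "l \<in> (%i. p + i) ` {..<q}"
  then obtain i where i: "l = p + i" "Suc i <= q" by auto
  have l1: "real L * th <= real l" using i(1) pp by simp
  have "real l <= real p + real q - 1" using i by linarith
  then have l2: "real l <= real L * th + et * real L" using pp qq by linarith
  have "th <= grid L l" using l1 L0 by (simp add: grid_def field_simps)
  moreover have g: "grid L l <= th + et" using l2 L0 by (simp add: grid_def field_simps)
  moreover have "grid L l < 1" using g th(2) by linarith
  then have "l < L" using L0 by (simp add: grid_def)
  ultimately show "l \<in> ?A" using et by auto
 qed
 then have "card ((%i. p + i) ` {..<q}) <= card ?A" by (intro card_mono) auto
 then have "real q <= real (card ?A)" by (simp add: card_image)
 then show ?thesis using qq L by linarith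
qed

section \<open>Uniform convergence and the maximizer\<close>

context estimation begin

abbreviation (input) "S \<equiv> P1.limit_contrast"

text \<open>The limit contrast is continuous and the parameters at distance at least
  \<open>e\<close> form a compact set, so strict inequality at each of them becomes a positive
  gap.\<close>

lemma limit_contrast_gap:
 assumes id: "!!th. th \<in> {0..1} ==> th \<noteq> ths ==> S th < S ths" and e: "0 < e"
 obtains ga where "0 < ga" "!!th. th \<in> {0..1} ==> e < \<bar>th - ths\<bar> ==> S th <= S ths - ga"
proof -
 let ?K = "{0..1} \<inter> {th. e <= \<bar>th - ths\<bar>}"
 have "closed {th. e <= \<bar>th - ths\<bar>}" by (intro closed_Collect_le continuous_intros)
 then have K: "compact ?K" by (intro compact_Int_closed compact_Icc)
 have cont: "continuous_on ?K P1.limit_contrast"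
  using P1.T_pos P1.psi_lip_nonneg P1.limit_contrast_lip
  by (intro lipschitz_on_continuous_on[of "T * P1.psi_lip"]) (auto simp: lipschitz_on_def dist_real_def)
 show ?thesis
 proof (cases "?K = {}")
  case True
  show ?thesis by (rule that[of 1]) (use True in auto)
 next
  case False
  obtain t where t: "t \<in> ?K" "!!th. th \<in> ?K ==> S th <= S t" using continuous_attains_sup[OF K False cont] by blast
  have "S t < S ths" using t(1) e by (intro id) auto
  then show ?thesis by (intro that[of "S ths - S t"]) (use t(2) in auto)
 qed
qed

lemma (in prob_space) whp_tendsto:
 fixes Y :: "nat => 'a => real"
 assumes "whp (%m w. \<bar>Y m w - Y' w\<bar> <= e)"
 shows "(%m. prob {w \<in> space M. e < \<bar>Y m w - Y' w\<bar>}) \<longlonglongrightarrow> 0"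
proof (rule tendstoI)
 fix d :: real assume d: "0 < d"
 have "ev_prob (d / 2) (%m w. \<bar>Y m w - Y' w\<bar> <= e)" using assms d by (simp add: whp_def)
 then show "\<forall>\<^sub>F m in sequentially. dist (prob {w \<in> space M. e < \<bar>Y m w - Y' w\<bar>}) 0 < d"
  unfolding ev_prob_def
 proof eventually_elim
  case (elim m)
  then obtain B where B: "B \<in> events" "prob B <= d / 2" "\<forall>w\<in>space M - B. \<bar>Y m w - Y' w\<bar> <= e" by blast
  have "{w \<in> space M. e < \<bar>Y m w - Y' w\<bar>} \<subseteq> B"
  proof
   fix w assume w: "w \<in> {w \<in> space M. e < \<bar>Y m w - Y' w\<bar>}"
   show "w \<in> B"
   proof (rule ccontr)
    assume "w \<notin> B"
    with w have "\<bar>Y m w - Y' w\<bar> <= e" using B(3) by blast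
    with w show False by simp
   qed
  qed
  then have "prob {w \<in> space M. e < \<bar>Y m w - Y' w\<bar>} <= prob B" using B(1) by (rule finite_measure_mono)
  then show ?case using B(2) d by (simp add: dist_real_def)
 qed
qed

context
 fixes n N L :: "nat => nat"
 assumes n2: "!!m. 2 <= n m" and N1: "!!m. 1 <= N m" and L2: "!!m. 2 <= L m"
  and n_lim: "filterlim n at_top sequentially" and N_lim: "filterlim N at_top sequentially" and L_lim: "filterlim L at_top sequentially"
begin

lemma n1: "1 <= n m" using n2[of m] by simp

lemma inverse_lim: "filterlim u at_top sequentially ==> (%m. C / real (u m)) \<longlonglongrightarrow> 0" for u :: "nat => nat"
 using filterlim_compose[OF lim_const_over_n[of C]] .

lemma emp_pointwise:
 assumes th: "th \<in> {0..1}" and ep: "0 < ep"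
 shows "whp (%m w. \<bar>emp (n m) (N m) 0 th w - S th\<bar> <= ep)"
proof -
 have "whp (%m w. \<bar>emp (n m) (N m) 0 th w - expectation (P1.psum (n m) 0 th)\<bar> <= ep / 2)"
 proof (rule whp_chebyshev)
  show "(%w. emp (n m) (N m) 0 th w - expectation (P1.psum (n m) 0 th)) \<in> BM M" for m
   using emp_M[OF n1 N1 th] by (intro borel_measurable_diff) auto
  show "nnE M (%w. (emp (n m) (N m) 0 th w - expectation (P1.psum (n m) 0 th))^2) <= ennreal (P1.psum_bd 0 / real (N m))" for m
   by (rule emp_mean_square[OF n1 N1 th])
  show "0 <= P1.psum_bd 0 / real (N m)" for m using P1.psum_bd_nonneg by simp
  show "(%m. P1.psum_bd 0 / real (N m)) \<longlonglongrightarrow> 0" by (rule inverse_lim[OF N_lim])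
 qed (use ep in simp)
 moreover have "\<forall>\<^sub>F m in sequentially. \<bar>expectation (P1.psum (n m) 0 th) - S th\<bar> < ep / 2"
  using tendstoD[OF filterlim_compose[OF P1.psum_mean_lim[OF th] n_lim], of "ep / 2"] ep by (simp add: dist_real_def)
 ultimately show ?thesis
 proof (rule whp_mono[OF _ eventually_mono])
  fix m assume "\<bar>expectation (P1.psum (n m) 0 th) - S th\<bar> < ep / 2"
  then show "\<forall>w\<in>space M. \<bar>emp (n m) (N m) 0 th w - expectation (P1.psum (n m) 0 th)\<bar> <= ep / 2 \<longrightarrow> \<bar>emp (n m) (N m) 0 th w - S th\<bar> <= ep"
   by (intro ballI impI) linarith
 qed
qed

definition dominates :: "(nat => 'a => real) => nat => real => bool" where
 "dominates Z k C \<longleftrightarrow> 0 <= C \<and> (\<forall>m. Z m \<in> BM M \<and> (\<forall>w\<in>space M. 0 <= Z m w \<and> (\<forall>th\<in>{0..1}. \<bar>emp (n m) (N m) k th w\<bar> <= Z m w)) \<and>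
  (nnE M (%w. \<bar>Z m w\<bar>)) <= ennreal C)"

lemma dominates_ex: "\<exists>Z C. dominates Z k C"
proof -
 let ?C = "sqrt (P1.psum_bd k) + sqrt (P1.psum_bd (Suc k))"
 have "\<exists>Z. Z \<in> BM M \<and> (\<forall>w\<in>space M. 0 <= Z w \<and> (\<forall>th\<in>{0..1}. \<bar>emp (n m) (N m) k th w\<bar> <= Z w)) \<and>
  (nnE M (%w. Z w)) <= ennreal ?C" for m
  by (rule emp_sup[OF n1 N1])
 from choice[OF allI[OF this]] obtain Z where Z: "\<forall>m. Z m \<in> BM M \<and> (\<forall>w\<in>space M. 0 <= Z m w \<and> (\<forall>th\<in>{0..1}. \<bar>emp (n m) (N m) k th w\<bar> <= Z m w)) \<and>
  (nnE M (%w. Z m w)) <= ennreal ?C" by (rule exE)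
 have eq: "nnE M (%w. \<bar>Z m w\<bar>) = nnE M (%w. Z m w)" for m
  using spec[OF Z, of m] by (intro nn_integral_cong) simp
 have "0 <= ?C" using P1.psum_bd_nonneg by simp
 then have "dominates Z k ?C" unfolding dominates_def eq using Z by (rule conjI)
 then show ?thesis by blast
qed

lemma dominatesD:
 assumes "dominates Z k C"
 shows "Z m \<in> BM M" "w \<in> space M ==> 0 <= Z m w"
  "w \<in> space M ==> th \<in> {0..1} ==> \<bar>emp (n m) (N m) k th w\<bar> <= Z m w"
  "nnE M (%w. \<bar>Z m w\<bar>) <= ennreal C" "0 <= C"
 using assms unfolding dominates_def by blast+

text \<open>The supremum of a derivative is only bounded in mean. The threshold grows with
  \<open>L\<close>, however, which is what the damping of the derivative data in the interpolant
  permits.\<close>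

lemma emp_deriv_small:
 assumes ep: "0 < ep"
 shows "whp (%m w. \<forall>th\<in>{0..1}. \<bar>emp (n m) (N m) k th w\<bar> <= ep * real (L m))"
proof -
 obtain Z C where D: "dominates Z k C" using dominates_ex by blast
 note Z = dominatesD[OF D] and C = dominatesD(5)[OF D]
 have Lp: "0 < real (L m)" for m using L2[of m] by simp
 have "whp (%m w. \<bar>1 / real (L m) * Z m w\<bar> <= ep)"
 proof (rule whp_markov)
  show "(%w. 1 / real (L m) * Z m w) \<in> BM M" for m using Z(1) by (intro borel_measurable_times) auto
  show "nnE M (%w. \<bar>1 / real (L m) * Z m w\<bar>) <= ennreal (C / real (L m))" for m
  proof -
   have "nnE M (%w. \<bar>1 / real (L m) * Z m w\<bar>) = nnI M (%w. ennreal (1 / real (L m)) * ennreal \<bar>Z m w\<bar>)"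
    using Lp[of m] by (intro nn_integral_cong) (simp add: ennreal_mult[symmetric] abs_mult del: times_divide_eq_left)
   also have "\<dots> = ennreal (1 / real (L m)) * (nnE M (%w. \<bar>Z m w\<bar>))"
    using Z(1)[of m] by (intro nn_integral_cmult) measurable
   also have "\<dots> <= ennreal (1 / real (L m)) * ennreal C" by (intro mult_left_mono Z(4)) auto
   also have "\<dots> = ennreal (C / real (L m))" using C by (subst ennreal_mult[symmetric]) auto
   finally show ?thesis .
  qed
  show "0 <= C / real (L m)" for m using C by simp
  show "(%m. C / real (L m)) \<longlonglongrightarrow> 0" by (rule inverse_lim[OF L_lim])
 qed (rule ep)
 then show ?thesis
 proof (rule whp_mono, intro always_eventually allI ballI impI)
  fix m w th assume w: "w \<in> space M" and b: "\<bar>1 / real (L m) * Z m w\<bar> <= ep" and th: "th \<in> {0..1::real}"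
  have "Z m w <= ep * real (L m)" using b Lp[of m] Z(2)[OF w, of m] by (simp add: pos_divide_le_eq)
  then show "\<bar>emp (n m) (N m) k th w\<bar> <= ep * real (L m)" using Z(3)[OF w th, of m] by linarith
 qed
qed

text \<open>At a given level \<open>de\<close> the supremum of the first derivative is at most
  \<open>H\<close>, which depends on \<open>de\<close>. With this random function Lipschitz,
  convergence on a net of mesh \<open>1 / q\<close> suffices, where \<open>q\<close> is chosen after
  \<open>H\<close>.\<close>

lemma emp_uniform:
 assumes ep: "0 < ep"
 shows "whp (%m w. \<forall>th\<in>{0..1}. \<bar>emp (n m) (N m) 0 th w - S th\<bar> <= ep)"
 unfolding whp_def
proof (intro allI impI)
 fix de :: real assume de: "0 < de"
 obtain Z C where D: "dominates Z 1 C" using dominates_ex by blast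
 note Z = dominatesD[OF D] and C = dominatesD(5)[OF D]
 define H where "H = (C + 1) / (de / 2)"
 define La where "La = T * P1.psi_lip"
 have H0: "0 < H" using C de by (simp add: H_def)
 have La0: "0 <= La" using P1.T_pos P1.psi_lip_nonneg by (simp add: La_def)
 obtain q :: nat where q: "(H + La) / (ep / 2) < real q" using reals_Archimedean2 by blast
 have "0 <= (H + La) / (ep / 2)" using H0 La0 ep by simp
 then have q0: "0 < real q" using q by (rule le_less_trans)
 have q': "(H + La) * (1 / real q) <= ep / 2" using q q0 ep by (simp add: field_simps)
 have 1: "ev_prob (de / 2) (%m w. \<bar>Z m w\<bar> <= H)"
  unfolding H_def using de by (intro ev_prob_markov Z(1,4) C) auto
 have "whp (%m w. \<forall>r\<in>{..q}. \<bar>emp (n m) (N m) 0 (real r / real q) w - S (real r / real q)\<bar> <= ep / 2)"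
 proof (rule whp_ball)
  fix r assume "r \<in> {..q}"
  then have "real r / real q \<in> {0..1}" using q0 by (simp add: field_simps)
  then show "whp (%m w. \<bar>emp (n m) (N m) 0 (real r / real q) w - S (real r / real q)\<bar> <= ep / 2)" using ep by (intro emp_pointwise) auto
 qed simp
 then have 2: "ev_prob (de / 2) (%m w. \<forall>r\<in>{..q}. \<bar>emp (n m) (N m) 0 (real r / real q) w - S (real r / real q)\<bar> <= ep / 2)"
  using de by (simp add: whp_def)
 show "ev_prob de (%m w. \<forall>th\<in>{0..1}. \<bar>emp (n m) (N m) 0 th w - S th\<bar> <= ep)"
 proof (rule ev_prob_mono[OF ev_prob_conj[OF 1 2]], intro always_eventually allI ballI impI)
  fix m w th assume w: "w \<in> space M" and th: "th \<in> {0..1::real}"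
   and b: "\<bar>Z m w\<bar> <= H \<and> (\<forall>r\<in>{..q}. \<bar>emp (n m) (N m) 0 (real r / real q) w - S (real r / real q)\<bar> <= ep / 2)"
  define r where "r = nat \<lfloor>th * real q\<rfloor>"
  have "0 <= th * real q" using th by simp
  then have r: "real r <= th * real q" "th * real q < real r + 1"
  proof -
   assume "0 <= th * real q"
   then have "real r = of_int \<lfloor>th * real q\<rfloor>" unfolding r_def by (intro of_nat_nat) linarith
   then show "real r <= th * real q" "th * real q < real r + 1" by linarith+
  qed
  have "th * real q <= 1 * real q" using th by (intro mult_right_mono) auto
  then have rq: "r <= q" using r by linarith
  define et where "et = real r / real q"
  have et: "et \<in> {0..1}" using rq q0 by (simp add: et_def field_simps)
  have "et <= th" "th <= et + 1 / real q" using r q0 by (auto simp: et_def field_simps)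
  then have d: "\<bar>th - et\<bar> <= 1 / real q" by simp
  have "\<bar>emp (n m) (N m) 0 th w - emp (n m) (N m) 0 et w\<bar> <= H * \<bar>th - et\<bar>"
  proof (rule unit_interval_lipschitz[OF _ _ th et])
   fix u :: real assume u: "u \<in> {0..1}"
   show "((%u. emp (n m) (N m) 0 u w) has_real_derivative emp (n m) (N m) 1 u w) (at u within {0..1})"
    using emp_deriv[OF n1 N1 u, of m m 0 w] by simp
   show "\<bar>emp (n m) (N m) 1 u w\<bar> <= H" using Z(3)[OF w u, of m] b Z(2)[OF w, of m] by linarith
  qed
  also have "\<dots> <= H * (1 / real q)" using d H0 by (intro mult_left_mono) auto
  finally have e1: "\<bar>emp (n m) (N m) 0 th w - emp (n m) (N m) 0 et w\<bar> <= H * (1 / real q)" .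
  have "\<bar>S th - S et\<bar> <= La * \<bar>th - et\<bar>" unfolding La_def by (rule P1.limit_contrast_lip[OF th et])
  also have "\<dots> <= La * (1 / real q)" using d La0 by (intro mult_left_mono) auto
  finally have e2: "\<bar>S th - S et\<bar> <= La * (1 / real q)" .
  have e3: "\<bar>emp (n m) (N m) 0 et w - S et\<bar> <= ep / 2" unfolding et_def using b rq by blast
  have "H * (1 / real q) + La * (1 / real q) <= ep / 2" using q' by (simp only: distrib_right)
  then show "\<bar>emp (n m) (N m) 0 th w - S th\<bar> <= ep" using e1 e2 e3 by linarith
 qed simp
qed

lemma cut_small:
 assumes ep: "0 < ep" shows "whp (%m w. \<bar>cut a (n m) (N m) w\<bar> <= ep)"
proof (rule whp_markov)
 show "cut a (n m) (N m) \<in> BM M" for m by (rule cut_bound(1)[OF n2 N1])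
 show "nnE M (%w. \<bar>cut a (n m) (N m) w\<bar>) <= ennreal (real (n m) * P1.trunc_err (n m) (P1.major_max a))" for m by (rule cut_bound(2)[OF n2 N1])
 show "0 <= real (n m) * P1.trunc_err (n m) (P1.major_max a)" for m using P1.excess_sum_bound(2)[OF n2] by simp
 show "(%m. real (n m) * P1.trunc_err (n m) (P1.major_max a)) \<longlonglongrightarrow> 0" by (rule filterlim_compose[OF P1.trunc_err_lim n_lim])
qed (rule ep)

context
 fixes a :: nat and \<alpha> :: "nat => nat => real" and E :: "nat => nat => nat => nat => nat => 'a => real"
 assumes noise: "!!m. privacy_noise M a T (n m) (N m) (L m) (\<alpha> m) X (E m)"
  and \<alpha>: "!!m j. 1 <= j ==> j <= n m ==> 0 < \<alpha> m j"
  and rate: "(%m. real (L m) * ln (n m) / sqrt (N m) * sqrt (ln (L m) / alpha_bar2 (n m) (\<alpha> m))) \<longlonglongrightarrow> 0"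
begin

definition avg_var :: "nat => real" where "avg_var m = noise_var a T (n m) (N m) (L m) (\<alpha> m) / (real (N m))^2"

lemma avg_var_nonneg: "0 <= avg_var m" unfolding avg_var_def using noise_var_nonneg by simp

text \<open>The square of the rate sequence is, up to a constant,
  \<open>avg_var m * ln (L m)\<close>, and \<open>L m >= 2\<close> keeps the logarithm away from
  0.\<close>

lemma avg_var_lim: "avg_var \<longlonglongrightarrow> 0"
proof -
 define r where "r m = real (L m) * ln (n m) / sqrt (N m) * sqrt (ln (L m) / alpha_bar2 (n m) (\<alpha> m))" for m
 define K where "K = 8 * (real a + 1)^2 * T"
 have K: "0 <= K" using P1.T_pos by (simp add: K_def)
 have "avg_var m <= K * ((r m)^2 / ln 2)" for m
 proof -
  define w where "w = (real (L m) * ln (n m) / sqrt (N m))^2 / alpha_bar2 (n m) (\<alpha> m)"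
  have ab: "0 <= alpha_bar2 (n m) (\<alpha> m)" unfolding alpha_bar2_def by (intro divide_nonneg_nonneg sum_nonneg) auto
  have w0: "0 <= w" using ab by (simp add: w_def)
  have lnL: "ln 2 <= ln (real (L m))" using L2[of m] by (subst ln_le_cancel_iff) auto
  have "0 <= ln (real (L m)) / alpha_bar2 (n m) (\<alpha> m)" using ab L2[of m] by simp
  moreover have "(x * sqrt y)^2 = x^2 * y" if "0 <= y" for x y :: real using that by (simp add: power_mult_distrib)
  ultimately have "(r m)^2 = (real (L m) * ln (n m) / sqrt (N m))^2 * (ln (L m) / alpha_bar2 (n m) (\<alpha> m))" unfolding r_def by blast
  then have "(r m)^2 = w * ln (real (L m))" by (simp add: w_def)
  then have "w * ln 2 <= (r m)^2" using lnL w0 by (simp add: mult_left_mono)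
  then have "w <= (r m)^2 / ln 2" by (simp add: pos_le_divide_eq)
  then have "K * w <= K * ((r m)^2 / ln 2)" using K by (rule mult_left_mono)
  moreover have "avg_var m = K * w" unfolding avg_var_def K_def w_def by (rule noise_var_eq[OF P1.T_pos n1 N1])
  ultimately show ?thesis by simp
 qed
 moreover have "(%m. K * ((r m)^2 / ln 2)) \<longlonglongrightarrow> K * (0^2 / ln 2)"
  using rate by (intro tendsto_intros) (auto simp: r_def[abs_def])
 then have lim: "(%m. K * ((r m)^2 / ln 2)) \<longlonglongrightarrow> 0" by (simp only: zero_power2 div_0 mult_zero_right)
 ultimately show ?thesis by (intro tendsto_sandwich[OF _ _ tendsto_const lim] always_eventually allI avg_var_nonneg)
qed

text \<open>At the threshold \<open>ep * L * N\<close> the union bound over \<open>L\<close> nodes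
  still gains a factor \<open>1 / L\<close> from the square.\<close>

lemma noise_deriv_small:
 assumes k: "k <= a" and ep: "0 < ep"
 shows "whp (%m w. \<forall>l<L m. \<bar>noise_sum (n m) (N m) (E m) l k w / real (N m)\<bar> <= ep * real (L m))"
proof (rule whp_bad_event[where B="%m. {w \<in> space M. \<exists>l<L m. ep * real (L m) * real (N m) < \<bar>noise_sum (n m) (N m) (E m) l k w\<bar>}"])
 have Lp: "0 < L m" "0 < real (L m)" "0 < real (N m)" for m using L2[of m] N1[of m] by auto
 note ctx = noise P1.T_pos n2 Lp(1) \<alpha>
 show "{w \<in> space M. \<exists>l<L m. ep * real (L m) * real (N m) < \<bar>noise_sum (n m) (N m) (E m) l k w\<bar>} \<in> events" for m
 proof -
  have "{w \<in> space M. ep * real (L m) * real (N m) < \<bar>noise_sum (n m) (N m) (E m) l k w\<bar>} \<in> events" if "l < L m" for l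
   using noise_sum_square(1)[OF ctx that k] by measurable
  then have "(\<Union>l\<in>{..<L m}. {w \<in> space M. ep * real (L m) * real (N m) < \<bar>noise_sum (n m) (N m) (E m) l k w\<bar>}) \<in> events" by blast
  moreover have "(\<Union>l\<in>{..<L m}. {w \<in> space M. ep * real (L m) * real (N m) < \<bar>noise_sum (n m) (N m) (E m) l k w\<bar>})
   = {w \<in> space M. \<exists>l<L m. ep * real (L m) * real (N m) < \<bar>noise_sum (n m) (N m) (E m) l k w\<bar>}" by blast
  ultimately show ?thesis by (simp only:)
 qed
 have "prob {w \<in> space M. \<exists>l<L m. ep * real (L m) * real (N m) < \<bar>noise_sum (n m) (N m) (E m) l k w\<bar>} <= avg_var m * (1 / ep^2 / real (L m))" for m
 proof -
  have "prob {w \<in> space M. \<exists>l<L m. ep * real (L m) * real (N m) < \<bar>noise_sum (n m) (N m) (E m) l k w\<bar>}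
   <= real (L m) * (noise_var a T (n m) (N m) (L m) (\<alpha> m) / (ep * real (L m) * real (N m))^2)"
   using ep Lp[of m] by (intro noise_sum_large[OF ctx k]) auto
  also have "\<dots> = avg_var m * (1 / ep^2 / real (L m))"
   using Lp[of m] by (simp add: avg_var_def power_mult_distrib power2_eq_square)
  finally show ?thesis .
 qed
 moreover have "(%m. avg_var m * (1 / ep^2 / real (L m))) \<longlonglongrightarrow> 0 * 0"
  by (intro tendsto_mult avg_var_lim inverse_lim L_lim)
 then have lim: "(%m. avg_var m * (1 / ep^2 / real (L m))) \<longlonglongrightarrow> 0" by (simp only: mult_zero_right)
 ultimately show "(%m. prob {w \<in> space M. \<exists>l<L m. ep * real (L m) * real (N m) < \<bar>noise_sum (n m) (N m) (E m) l k w\<bar>}) \<longlonglongrightarrow> 0"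
  by (intro tendsto_sandwich[OF _ _ tendsto_const lim] always_eventually allI measure_nonneg)
 fix m w assume w: "w \<in> space M" and nb: "w \<notin> {w \<in> space M. \<exists>l<L m. ep * real (L m) * real (N m) < \<bar>noise_sum (n m) (N m) (E m) l k w\<bar>}"
 show "\<forall>l<L m. \<bar>noise_sum (n m) (N m) (E m) l k w / real (N m)\<bar> <= ep * real (L m)"
 proof (intro allI impI)
  fix l assume "l < L m"
  then have "\<not> ep * real (L m) * real (N m) < \<bar>noise_sum (n m) (N m) (E m) l k w\<bar>" using w nb by blast
  then show "\<bar>noise_sum (n m) (N m) (E m) l k w / real (N m)\<bar> <= ep * real (L m)"
   using Lp(3)[of m] by (simp add: abs_divide pos_divide_le_eq)
 qed
qed

lemma noise_max:
 assumes e: "0 < e" and mu: "0 < mu" and A: "!!m. A m \<subseteq> {..<L m}" "\<forall>\<^sub>F m in sequentially. mu * real (L m) <= real (card (A m))"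
 shows "whp (%m w. \<exists>q. (\<forall>l<L m. noise_sum (n m) (N m) (E m) l 0 w / real (N m) <= q + 4 * e) \<and>
  (\<exists>l\<in>A m. q - 4 * e < noise_sum (n m) (N m) (E m) l 0 w / real (N m)))"
 unfolding whp_def ev_prob_def
proof (intro allI impI)
 fix de :: real assume de: "0 < de"
 \<comment> \<open>Chosen so that the upper maximum fails with probability at most
   \<open>de / 3\<close>, and likewise \<open>exp (- mu / ro) <= ro / mu <= de / 3\<close> for the
   lower one; the last third is left for the term exponential in \<open>L\<close>.\<close>
 define ro where "ro = min 1 (min (de / 3) (mu * de / 3))"
 have ro: "0 < ro" "ro <= 1" "ro <= de / 3" "ro <= mu * de / 3" using de mu by (auto simp: ro_def)
 have exro: "exp (- mu / ro) <= de / 3"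
 proof -
  have x: "0 < mu / ro" using mu ro by simp
  have "mu / ro <= exp (mu / ro)" using exp_ge_add_one_self[of "mu / ro"] by linarith
  then have "1 / exp (mu / ro) <= 1 / (mu / ro)" using x by (intro frac_le) auto
  also have "\<dots> <= de / 3" using ro mu by (simp add: field_simps)
  finally show ?thesis by (simp add: exp_minus inverse_eq_divide)
 qed
 have "(%m. 2 * avg_var m / e^2) \<longlonglongrightarrow> 2 * 0 / e^2" using e by (intro tendsto_intros avg_var_lim) auto
 then have ev1: "\<forall>\<^sub>F m in sequentially. 2 * avg_var m / e^2 < ro" using ro(1) by (intro order_tendstoD) auto
 have "filterlim (%m. real (L m)) at_top sequentially" by (rule filterlim_compose[OF filterlim_real_sequentially L_lim])
 then have ev2: "\<forall>\<^sub>F m in sequentially. max 3 (6 / (mu * de)) <= real (L m)" unfolding filterlim_at_top by blast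
 show "\<forall>\<^sub>F m in sequentially. \<exists>B\<in>events. prob B <= de \<and> (\<forall>w\<in>space M - B. \<exists>q. (\<forall>l<L m. noise_sum (n m) (N m) (E m) l 0 w / real (N m) <= q + 4 * e) \<and>
  (\<exists>l\<in>A m. q - 4 * e < noise_sum (n m) (N m) (E m) l 0 w / real (N m)))"
  using ev1 ev2 A(2)
 proof eventually_elim
  case (elim m)
  have Lp: "0 < L m" "3 <= L m" "0 < real (N m)" using elim(2) N1[of m] by auto
  note ctx = noise P1.T_pos n2 Lp(1) \<alpha>
  have exL: "exp (- mu * real (L m) / 2) <= de / 3"
  proof -
   have L6: "6 / (mu * de) <= real (L m)" using elim(2) by simp
   have x: "0 < mu * real (L m) / 2" using mu Lp by simp
   have "mu * real (L m) / 2 <= exp (mu * real (L m) / 2)" using exp_ge_add_one_self[of "mu * real (L m) / 2"] by linarith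
   then have "1 / exp (mu * real (L m) / 2) <= 1 / (mu * real (L m) / 2)" using x by (intro frac_le) auto
   also have "\<dots> <= de / 3" using L6 mu de Lp by (simp add: field_simps)
   finally show ?thesis by (simp add: exp_minus inverse_eq_divide)
  qed
  have "2 * noise_var a T (n m) (N m) (L m) (\<alpha> m) / (real (N m) * e)^2 <= ro"
   using elim(1) by (simp add: avg_var_def power_mult_distrib)
  from noise_sum_concentration[OF ctx _ ro(1) this ro(2) Lp(2) A(1) elim(3) mu] e Lp(3)
  obtain q where q: "prob {w \<in> space M. \<exists>l<L m. q + 4 * (real (N m) * e) < noise_sum (n m) (N m) (E m) l 0 w} <= ro"
   "prob {w \<in> space M. \<forall>l\<in>A m. noise_sum (n m) (N m) (E m) l 0 w <= q - 4 * (real (N m) * e)} <= exp (- mu / ro) + exp (- mu * real (L m) / 2)"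
   by auto
  define B1 where "B1 = {w \<in> space M. \<exists>l\<in>{..<L m}. q + 4 * (real (N m) * e) < noise_sum (n m) (N m) (E m) l 0 w}"
  define B2 where "B2 = {w \<in> space M. \<forall>l\<in>A m. noise_sum (n m) (N m) (E m) l 0 w <= q - 4 * (real (N m) * e)}"
  have meas [measurable]: "noise_sum (n m) (N m) (E m) l 0 \<in> BM M" if "l < L m" for l
   using noise_sum_square(1)[OF ctx that] by simp
  have B1: "B1 \<in> events" unfolding B1_def by (intro sets.sets_Collect_finite_Ex) (auto intro!: borel_measurable_less meas)
  have B2: "B2 \<in> events" unfolding B2_def using A(1)[of m] finite_subset[OF A(1)[of m]]
   by (intro sets.sets_Collect_finite_All) (auto intro!: borel_measurable_le meas)
  have "prob B1 <= ro" "prob B2 <= exp (- mu / ro) + exp (- mu * real (L m) / 2)" using q by (simp_all add: B1_def B2_def Bex_def)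
  then have "prob (B1 \<union> B2) <= de" using measure_Un_le[OF B1 B2] ro(3) exro exL by linarith
  moreover have "\<exists>q. (\<forall>l<L m. noise_sum (n m) (N m) (E m) l 0 w / real (N m) <= q + 4 * e) \<and>
   (\<exists>l\<in>A m. q - 4 * e < noise_sum (n m) (N m) (E m) l 0 w / real (N m))" if w: "w \<in> space M - (B1 \<union> B2)" for w
  proof (intro exI[of _ "q / real (N m)"] conjI allI impI)
   fix l assume l: "l < L m"
   have "noise_sum (n m) (N m) (E m) l 0 w <= q + 4 * (real (N m) * e)" using w l unfolding B1_def by (auto simp: not_less)
   then have "noise_sum (n m) (N m) (E m) l 0 w / real (N m) <= (q + 4 * (real (N m) * e)) / real (N m)" by (rule divide_right_mono) simp
   then show "noise_sum (n m) (N m) (E m) l 0 w / real (N m) <= q / real (N m) + 4 * e" using Lp(3) by (simp add: add_divide_distrib)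
  next
   obtain l where l: "l \<in> A m" "q - 4 * (real (N m) * e) < noise_sum (n m) (N m) (E m) l 0 w" using w unfolding B2_def by (auto simp: not_le)
   have "(q - 4 * (real (N m) * e)) / real (N m) < noise_sum (n m) (N m) (E m) l 0 w / real (N m)" using l(2) Lp(3) by (intro divide_strict_right_mono) auto
   then show "\<exists>l\<in>A m. q / real (N m) - 4 * e < noise_sum (n m) (N m) (E m) l 0 w / real (N m)"
    using l(1) Lp(3) by (intro bexI[of _ l]) (auto simp: diff_divide_distrib)
  qed
  ultimately show ?case using B1 B2 by (intro bexI[of _ "B1 \<union> B2"]) auto
 qed
qed

text \<open>Some node near the true parameter has noise above \<open>q - 4 * e\<close>, while no
  node has noise above \<open>q + 4 * e\<close>. Comparing the contrast at that node with its value
  at the maximizer, the uncontrolled quantile \<open>q\<close> cancels; what is left contradicts the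
  gap \<open>ga\<close> unless the maximizer is close to \<open>ths\<close>.\<close>

lemma argmax_consistent:
 fixes \<phi> :: "real => real" and th_hat :: "nat => 'a => real"
 assumes ths: "0 < ths" "ths < 1" and id: "!!th. th \<in> {0..1} ==> th \<noteq> ths ==> S th < S ths"
  and \<phi>: "!!xi. \<bar>xi\<bar> <= 1 ==> \<phi> xi = 1" "!!xi. \<bar>\<phi> xi - 1\<bar> <= C\<phi>"
  and hat: "!!m. th_hat m \<in> BM M"
  and arg: "!!m w. w \<in> space M ==> is_arg_max (%th. pub_contrast a T b sg \<phi> (n m) (N m) (L m) X (E m) th w)
    (%th. th \<in> {grid (L m) 0..grid (L m) (L m - 1)}) (th_hat m w)"
 shows "tendsto_in_prob M th_hat (%_. ths)"
 unfolding tendsto_in_prob_def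
proof (intro conjI allI impI hat borel_measurable_const whp_tendsto)
 fix ep0 :: real assume ep0: "0 < ep0"
 obtain ga where ga: "0 < ga" "!!th. th \<in> {0..1} ==> ep0 < \<bar>th - ths\<bar> ==> S th <= S ths - ga"
  using limit_contrast_gap[OF id ep0] by metis
 obtain C where C: "0 <= C" "\<forall>k\<le>a. \<forall>x\<in>{0..1}. \<bar>poly (hermite_basis a k) x\<bar> <= C \<and> \<bar>poly (hermite_basis' a k) x\<bar> <= C"
  using hermite_basis_bounded[of a] by blast
 define La where "La = T * P1.psi_lip"
 have La: "0 <= La" using P1.T_pos P1.psi_lip_nonneg by (simp add: La_def)
 have C\<phi>: "0 <= C\<phi>" using order_trans[OF abs_ge_zero \<phi>(2)[of 0]] .
 \<comment> \<open>The error budget: \<open>ga / 8\<close> each for the distance of the node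
   (\<open>La * et\<close>), the mesh (\<open>La / L\<close>) and the spread of the noise
   (\<open>8 * e\<close>), and \<open>3 * ga / 8\<close> for all terms with \<open>ep\<close>.
   Together this is \<open>3 * ga / 4\<close>, less than the gap. The second bound in
   \<open>et\<close> keeps \<open>ths + et\<close> below 1.\<close>
 define ep where "ep = ga / (16 * (1 + real a * C))"
 define e where "e = ga / 64"
 define et where "et = min (ga / (8 * (La + 1))) ((1 - ths) / 2)"
 have aC: "0 <= real a * C" using C(1) by simp
 have ep: "0 < ep" "6 * ep * (1 + real a * C) = 6 * ga / 16"
 proof -
  have "6 * (ga / (16 * r)) * r = 6 * ga / 16" if "0 < r" for r using that by simp
  then show "6 * ep * (1 + real a * C) = 6 * ga / 16" unfolding ep_def using aC by (simp only: add_pos_nonneg zero_less_one)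
  show "0 < ep" using ga(1) aC by (simp add: ep_def add_pos_nonneg)
 qed
 have e: "0 < e" using ga(1) by (simp add: e_def)
 have "et <= (1 - ths) / 2" unfolding et_def by (rule min.cobounded2)
 then have et: "0 < et" "ths + et < 1" 
 proof -
  assume le: "et <= (1 - ths) / 2"
  show "0 < et" using ga(1) La ths by (simp add: et_def)
  show "ths + et < 1" using le ths(2) by (simp add: pos_le_divide_eq)
 qed
 have Laet: "La * et <= ga / 8"
 proof -
  have "La * et <= (La + 1) * (ga / (8 * (La + 1)))" using La et(1) by (intro mult_mono) (auto simp: et_def)
  moreover have "r * (ga / (8 * r)) = ga / 8" if "0 < r" for r using that by simp
  ultimately show ?thesis using La by (simp only: add_nonneg_pos zero_less_one)
 qed
 define A where "A m = {l. l < L m \<and> \<bar>grid (L m) l - ths\<bar> <= et}" for m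
 define Y where "Y m l k w = noise_sum (n m) (N m) (E m) l k w / real (N m)" for m l k w
 have Llim: "filterlim (%m. real (L m)) at_top sequentially" by (rule filterlim_compose[OF filterlim_real_sequentially L_lim])
 have evA: "\<forall>\<^sub>F m in sequentially. et / 2 * real (L m) <= real (card (A m))"
 proof -
  have "\<forall>\<^sub>F m in sequentially. 2 / et <= real (L m)" using Llim unfolding filterlim_at_top by blast
  then show ?thesis
  proof eventually_elim
   case (elim m)
   then have "2 <= et * real (L m)" using et(1) by (simp add: pos_divide_le_eq mult.commute)
   then show ?case unfolding A_def using ths et by (intro card_near_nodes) auto
  qed
 qed
 have p1: "whp (%m w. \<forall>th\<in>{0..1}. \<bar>emp (n m) (N m) 0 th w - S th\<bar> <= ep)" by (rule emp_uniform[OF ep(1)])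
 have p2: "whp (%m w. \<forall>k\<in>{..a}. \<forall>th\<in>{0..1}. \<bar>emp (n m) (N m) k th w\<bar> <= ep * real (L m))"
  by (intro whp_ball emp_deriv_small ep(1)) simp
 have p3: "whp (%m w. \<bar>cut a (n m) (N m) w\<bar> <= ep / (C\<phi> + 1))" using ep(1) C\<phi> by (intro cut_small) auto
 have p4: "whp (%m w. \<forall>k\<in>{..a}. \<forall>l<L m. \<bar>Y m l k w\<bar> <= ep * real (L m))"
  unfolding Y_def by (intro whp_ball noise_deriv_small ep(1)) auto
 have p5: "whp (%m w. \<exists>q. (\<forall>l<L m. Y m l 0 w <= q + 4 * e) \<and> (\<exists>l\<in>A m. q - 4 * e < Y m l 0 w))"
  unfolding Y_def by (rule noise_max[OF e _ _ evA]) (use et(1) in \<open>auto simp: A_def\<close>)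
 have p6: "whp (%m w. \<forall>L. \<forall>l<L. \<forall>k\<le>a. \<bar>node_avg \<phi> (n m) (N m) L (E m) w l k - emp (n m) (N m) k (grid L l) w - noise_sum (n m) (N m) (E m) l k w / real (N m)\<bar> <= C\<phi> * cut a (n m) (N m) w)"
  by (rule whp_AE, rule node_avg_approx[OF n1 N1 \<phi> n2])
 have evL: "\<forall>\<^sub>F m in sequentially. La / real (L m) < ga / 8"
  using order_tendstoD(2)[OF inverse_lim[OF L_lim, of La], of "ga / 8"] ga(1) by simp
 show "whp (%m w. \<bar>th_hat m w - ths\<bar> <= ep0)"
 proof (rule whp_mono[OF whp_conj[OF p1 whp_conj[OF p2 whp_conj[OF p3 whp_conj[OF p4 whp_conj[OF p5 p6]]]]] eventually_mono[OF evL]], intro ballI impI, elim conjE)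
  fix m w assume evL: "La / real (L m) < ga / 8" and w: "w \<in> space M"
   and q1: "\<forall>th\<in>{0..1}. \<bar>emp (n m) (N m) 0 th w - S th\<bar> <= ep"
   and q2: "\<forall>k\<in>{..a}. \<forall>th\<in>{0..1}. \<bar>emp (n m) (N m) k th w\<bar> <= ep * real (L m)"
   and q3: "\<bar>cut a (n m) (N m) w\<bar> <= ep / (C\<phi> + 1)"
   and q4: "\<forall>k\<in>{..a}. \<forall>l<L m. \<bar>Y m l k w\<bar> <= ep * real (L m)"
   and q5: "\<exists>q. (\<forall>l<L m. Y m l 0 w <= q + 4 * e) \<and> (\<exists>l\<in>A m. q - 4 * e < Y m l 0 w)"
   and q6: "\<forall>L. \<forall>l<L. \<forall>k\<le>a. \<bar>node_avg \<phi> (n m) (N m) L (E m) w l k - emp (n m) (N m) k (grid L l) w - noise_sum (n m) (N m) (E m) l k w / real (N m)\<bar> <= C\<phi> * cut a (n m) (N m) w"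
  obtain q l where q: "!!l. l < L m ==> Y m l 0 w <= q + 4 * e" and l: "l < L m" "\<bar>grid (L m) l - ths\<bar> <= et" "q - 4 * e < Y m l 0 w"
   using q5 unfolding A_def by blast
  have cut: "C\<phi> * cut a (n m) (N m) w <= ep"
  proof -
   have "C\<phi> * cut a (n m) (N m) w <= (C\<phi> + 1) * (ep / (C\<phi> + 1))"
    using q3 C\<phi> ep(1) by (intro order_trans[OF mult_left_mono[OF order_trans[OF abs_ge_self q3] C\<phi>]] mult_right_mono) auto
   then show ?thesis using C\<phi> by simp
  qed
  define D where "D l k = node_avg \<phi> (n m) (N m) (L m) (E m) w l k" for l k
  define h where "h x = pub_contrast a T b sg \<phi> (n m) (N m) (L m) X (E m) x w / real (N m)" for x
  have ap: "\<bar>D l k - emp (n m) (N m) k (grid (L m) l) w - Y m l k w\<bar> <= ep" if "l < L m" "k <= a" for l k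
   using q6 that cut unfolding D_def Y_def by (meson order_trans)
  have cell: "h x = (\<Sum>k\<le>a. (D l k * poly (hermite_basis a k) (real (L m) * x - real l) + D (Suc l) k * poly (hermite_basis' a k) (real (L m) * x - real l)) / real (L m) ^ k)"
   if "Suc l < L m" "x \<in> {grid (L m) l..grid (L m) (Suc l)}" for l x
   unfolding h_def D_def by (rule pub_contrast_cell[OF L2 that])
  have D0: "\<bar>D l 0 - S (grid (L m) l) - Y m l 0 w\<bar> <= 2 * ep" if "l < L m" for l
   using ap[OF that, of 0] bspec[OF q1 grid_unit[OF that]] by linarith
  have Lm: "1 <= real (L m)" using L2[of m] by simp
  have Dk: "\<bar>D l k\<bar> <= 3 * ep * real (L m)" if "l < L m" "1 <= k" "k <= a" for l k
  proof -
   have "\<bar>emp (n m) (N m) k (grid (L m) l) w\<bar> <= ep * real (L m)" "\<bar>Y m l k w\<bar> <= ep * real (L m)"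
    using q2 q4 that grid_unit[OF that(1)] by blast+
   moreover have "ep * 1 <= ep * real (L m)" using Lm ep(1) by (intro mult_left_mono) auto
   ultimately show ?thesis using ap[OF that(1,3)] by linarith
  qed
  have Slip: "\<bar>S u - S v\<bar> <= La * \<bar>u - v\<bar>" if "u \<in> {0..1}" "v \<in> {0..1}" for u v
   unfolding La_def by (rule P1.limit_contrast_lip[OF that])
  have Cb: "\<bar>poly (hermite_basis a k) x\<bar> <= C \<and> \<bar>poly (hermite_basis' a k) x\<bar> <= C" if "k <= a" "x \<in> {0..1}" for k x
   using C(2) that by blast
  note sandwich = hermite_sandwich[where A=D and h=h and S=P1.limit_contrast and Y="%l. Y m l 0 w" and C=C, OF L2 cell C(1) Cb D0 Dk Slip La]
  have am: "th_hat m w \<in> {grid (L m) 0..grid (L m) (L m - 1)}"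
   "!!y. y \<in> {grid (L m) 0..grid (L m) (L m - 1)} ==> h y <= h (th_hat m w)"
   using arg[OF w, of m] unfolding is_arg_max_def h_def by (auto simp: not_less intro!: divide_right_mono)
  have mono: "grid (L m) i <= grid (L m) j" if "i <= j" for i j using that by (simp add: grid_def divide_right_mono)
  have hl: "h (grid (L m) l) <= h (th_hat m w)" using l(1) by (intro am(2)) (auto intro!: mono)
  have u: "th_hat m w \<in> {0..1}"
   using am(1) grid_unit[of 0 "L m"] grid_unit[of "L m - 1" "L m"] L2[of m] by auto
  have low: "S (grid (L m) l) + Y m l 0 w - 2 * ep <= h (grid (L m) l)" by (rule sandwich(1)) (use l(1) in auto)
  have up: "h (th_hat m w) <= S (th_hat m w) + La / real (L m) + (q + 4 * e) + 2 * ep + real a * (2 * C * (3 * ep))"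
   by (rule sandwich(2)) (use am(1) q in auto)
  have "\<bar>S (grid (L m) l) - S ths\<bar> <= La * \<bar>grid (L m) l - ths\<bar>" using grid_unit[OF l(1)] ths by (intro Slip) auto
  also have "\<dots> <= La * et" by (rule mult_left_mono[OF l(2) La])
  finally have near: "S ths - ga / 8 <= S (grid (L m) l)" using Laet by linarith
  have "4 * ep + real a * (2 * C * (3 * ep)) <= 6 * ep * (1 + real a * C)" using ep(1) by (simp add: algebra_simps)
  then have "4 * ep + real a * (2 * C * (3 * ep)) <= 6 * ga / 16" using ep(2) by simp
  then have "S ths - ga < S (th_hat m w)"
   using low up hl near l(3) evL ga(1) unfolding e_def by linarith
  then show "\<bar>th_hat m w - ths\<bar> <= ep0" using ga(2)[OF u] by linarith
 qed
qed

end

end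

end

theorem theorem1:
  fixes M :: "'a measure" and F :: "real \<Rightarrow> 'a measure"
    and T \<theta>s :: real and b :: "real \<Rightarrow> real \<Rightarrow> real" and \<sigma> \<phi> :: "real \<Rightarrow> real"
    and W :: "nat \<Rightarrow> real \<Rightarrow> 'a \<Rightarrow> real" and X :: "real \<Rightarrow> nat \<Rightarrow> real \<Rightarrow> 'a \<Rightarrow> real"
    and a :: nat and n N L :: "nat \<Rightarrow> nat" and \<alpha> :: "nat \<Rightarrow> nat \<Rightarrow> real"
    and E :: "nat \<Rightarrow> nat \<Rightarrow> nat \<Rightarrow> nat \<Rightarrow> nat \<Rightarrow> 'a \<Rightarrow> real"
    and \<theta>_hat :: "nat \<Rightarrow> 'a \<Rightarrow> real"
  assumes T: "0 < T" and \<theta>s: "0 < \<theta>s" "\<theta>s < 1" and a: "1 \<le> a"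
    and model: "diffusion_model M F T b \<sigma> W X"
    \<comment> \<open>limits are along an arbitrary joint sequence of stages \<open>m\<close> with sizes \<open>n m\<close>, \<open>N m\<close>, \<open>L m\<close>\<close>
    and valid: "\<And>m. 2 \<le> n m" "\<And>m. 1 \<le> N m" "\<And>m. 2 \<le> L m"
    and n_lim: "filterlim n at_top sequentially"
    and N_lim: "filterlim N at_top sequentially"
    and L_lim: "filterlim L at_top sequentially"
    and N_poly: "\<exists>\<rho>>0. (\<lambda>m. real (N m)) \<in> O(\<lambda>m. real (n m) powr \<rho>)"
    and L_poly: "\<exists>\<rho>>0. (\<lambda>m. real (L m)) \<in> O(\<lambda>m. real (n m) powr \<rho>)"
    and \<alpha>: "\<And>m j. 1 \<le> j \<Longrightarrow> j \<le> n m \<Longrightarrow> 0 < \<alpha> m j"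
    and \<phi>_smooth: "\<And>k. (deriv ^^ k) \<phi> differentiable_on UNIV"
    and \<phi>_one: "\<And>\<xi>. \<bar>\<xi>\<bar> \<le> 1 \<Longrightarrow> \<phi> \<xi> = 1" and \<phi>_zero: "\<And>\<xi>. 2 \<le> \<bar>\<xi>\<bar> \<Longrightarrow> \<phi> \<xi> = 0"
    and noise: "\<And>m. privacy_noise M a T (n m) (N m) (L m) (\<alpha> m) (X \<theta>s) (E m)"
    and \<theta>_hat_rv: "\<And>m. \<theta>_hat m \<in> borel_measurable M"
    and \<theta>_hat_argmax: "\<And>m \<omega>. \<omega> \<in> space M \<Longrightarrow>
      is_arg_max (\<lambda>\<theta>. pub_contrast a T b \<sigma> \<phi> (n m) (N m) (L m) (X \<theta>s) (E m) \<theta> \<omega>)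
        (\<lambda>\<theta>. \<theta> \<in> {grid (L m) 0..grid (L m) (L m - 1)}) (\<theta>_hat m \<omega>)"
    and b_bounded: "\<And>\<theta>. \<theta> \<in> {0..1} \<Longrightarrow> \<exists>C. \<forall>x. \<bar>b \<theta> x\<bar> \<le> C"
    and lipschitz: "\<And>\<theta>. \<theta> \<in> {0..1} \<Longrightarrow>
      \<exists>c>0. \<forall>x y. \<bar>b \<theta> x - b \<theta> y\<bar> + \<bar>\<sigma> x - \<sigma> y\<bar> \<le> c * \<bar>x - y\<bar>"
    and elliptic: "\<exists>\<sigma>_min>0. \<forall>x. \<sigma>_min\<^sup>2 \<le> (\<sigma> x)\<^sup>2"
    and b_smooth: "\<And>k x \<theta>. \<theta> \<in> {0..1} \<Longrightarrow>
      dparam k (\<lambda>\<eta>. b \<eta> x) differentiable (at \<theta> within {0..1})"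
    and b_derivs: "\<And>k. 1 \<le> k \<Longrightarrow> \<exists>C. \<forall>x. \<forall>\<theta>\<in>{0..1}. \<bar>dparam k (\<lambda>\<eta>. b \<eta> x) \<theta>\<bar> \<le> C"
    and identifiable: "\<And>\<theta>. \<theta> \<in> {0..1} \<Longrightarrow> \<theta> \<noteq> \<theta>s \<Longrightarrow>
      0 < (LBINT s:{0..T}. (\<integral>\<omega>. (b \<theta> (X \<theta>s 1 s \<omega>) - b \<theta>s (X \<theta>s 1 s \<omega>))\<^sup>2
                                / (\<sigma> (X \<theta>s 1 s \<omega>))\<^sup>2 \<partial>M))"
    and rate: "(\<lambda>m. real (L m) * ln (n m) / sqrt (N m)
                      * sqrt (ln (L m) / alpha_bar2 (n m) (\<alpha> m))) \<longlonglongrightarrow> 0"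
  shows "tendsto_in_prob M \<theta>_hat (\<lambda>_. \<theta>s)"
proof -
 let ?X = "X \<theta>s"
 note inner = \<theta>s
 then have \<theta>s01: "\<theta>s \<in> {0..1}" by simp
 have ps: "prob_space M" and filt: "filtration (space M) F" and sub: "!!t. subalgebra M (F t)"
  and bm: "!!i. 1 <= i ==> brownian_motion M F T (W i)"
  and iW: "prob_space.indep_vars M (%_. path_space T) (%i. sample_path T (W i)) {1..}"
  using model unfolding diffusion_model_def by blast+
 have sde: "!!i. 1 <= i ==> sde_solution M F T (b \<theta>s) \<sigma> (W i) (?X i)"
  and iX: "prob_space.indep_vars M (%_. borel) (%i. ?X i 0) {1..}"
  and law: "!!i. 1 <= i ==> distr M borel (?X i 0) = distr M borel (?X 1 0)"
  and mom: "!!i q. 1 <= i ==> 1 <= q ==> integrable M (%w. \<bar>?X i 0 w\<bar> powr q)"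
  and iWX: "indep_rv M (\<Pi>\<^sub>M i\<in>{1..}. path_space T) (%w. \<lambda>i\<in>{1..}. sample_path T (W i) w)
     (\<Pi>\<^sub>M i\<in>{1..}. borel) (%w. \<lambda>i\<in>{1..}. ?X i 0 w)"
  using model \<theta>s01 unfolding diffusion_model_def by blast+
 interpret prob_space M by (rule ps)
 have "\<forall>i\<in>{1..}. \<exists>I. ito_integral M F T (W i) (%s w. \<sigma> (?X i s w)) I \<and>
    (AE w in M. \<forall>t\<in>{0..T}. ?X i t w = ?X i 0 w + (LBINT s:{0..t}. b \<theta>s (?X i s w)) + I t w)"
  using sde unfolding sde_solution_def by auto
 from bchoice[OF this] obtain I where I: "\<forall>i\<in>{1..}. ito_integral M F T (W i) (%s w. \<sigma> (?X i s w)) (I i) \<and>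
    (AE w in M. \<forall>t\<in>{0..T}. ?X i t w = ?X i 0 w + (LBINT s:{0..t}. b \<theta>s (?X i s w)) + I i t w)" by blast
 obtain c where c: "0 < c" "!!x y. \<bar>b \<theta>s x - b \<theta>s y\<bar> + \<bar>\<sigma> x - \<sigma> y\<bar> <= c * \<bar>x - y\<bar>" using lipschitz[OF \<theta>s01] by blast
 obtain B where B: "!!x. \<bar>b \<theta>s x\<bar> <= B" using b_bounded[OF \<theta>s01] by blast
 obtain sm where sm: "0 < sm" "!!x. sm^2 <= (\<sigma> x)^2" using elliptic by blast
 have b_lip: "\<exists>L\<ge>0. \<forall>x y. \<bar>b \<theta> x - b \<theta> y\<bar> <= L * \<bar>x - y\<bar>" if t: "\<theta> \<in> {0..1}" for \<theta>
 proof -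
  obtain L where L: "0 < L" "\<forall>x y. \<bar>b \<theta> x - b \<theta> y\<bar> + \<bar>\<sigma> x - \<sigma> y\<bar> <= L * \<bar>x - y\<bar>" using lipschitz[OF t] by blast
  have "\<bar>b \<theta> x - b \<theta> y\<bar> <= L * \<bar>x - y\<bar>" for x y using L(2)[rule_format, of x y] abs_ge_zero[of "\<sigma> x - \<sigma> y"] by linarith
  then show ?thesis using L(1) by (intro exI[of _ L]) auto
 qed
 \<comment> \<open>By the common initial law this second moment serves all particles.\<close>
 define \<kappa> where "\<kappa> = expectation (%w. (?X 1 0 w)^2)"
 have T0: "0 \<in> {0..T}" using T by simp
 have bm1: "filtered_bm M F T (W i)" if "1 <= i" for i
  using ps filt sub bm[OF that] T by (simp add: filtered_bm_def filtered_bm_axioms_def)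
 have XM: "?X i 0 \<in> BM M" if "1 <= i" for i
  using iX that unfolding indep_vars_def by auto
 have X0: "nnE M (%w. (?X i 0 w)^2) <= ennreal \<kappa>" if i: "1 <= i" for i
 proof -
  have "nnE M (%w. (?X i 0 w)^2) = (\<integral>\<^sup>+x. ennreal (x^2) \<partial>distr M borel (?X i 0))" using XM[OF i] by (subst nn_integral_distr) auto
  also have "\<dots> = (\<integral>\<^sup>+x. ennreal (x^2) \<partial>distr M borel (?X 1 0))" by (simp only: law[OF i])
  also have "\<dots> = nnE M (%w. (?X 1 0 w)^2)" using XM[of 1] by (subst nn_integral_distr) auto
  also have "\<dots> = ennreal \<kappa>" unfolding \<kappa>_def
  proof (rule nn_integral_eq_integral)
   have "\<bar>x\<bar> powr 2 = x^2" for x :: real by (cases "x = 0") (auto simp: powr_numeral)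
   then show "integrable M (%w. (?X 1 0 w)^2)" using mom[of 1 2] by simp
  qed simp
  finally show ?thesis by simp
 qed
 have particle: "sde_particle M F T (W i) (b \<theta>s) \<sigma> (?X i) (I i) B c \<kappa>" if i: "1 <= i" for i
  unfolding sde_particle_def sde_particle_axioms_def
 proof (intro conjI allI bm1[OF i] X0[OF i])
  show "\<bar>b \<theta>s x\<bar> <= B" for x by (rule B)
  show "\<bar>b \<theta>s x - b \<theta>s y\<bar> <= c * \<bar>x - y\<bar>" "\<bar>\<sigma> x - \<sigma> y\<bar> <= c * \<bar>x - y\<bar>" for x y
   using c(2)[of x y] abs_ge_zero[of "\<sigma> x - \<sigma> y"] abs_ge_zero[of "b \<theta>s x - b \<theta>s y"] by linarith+
  show "progressive F T (?X i)" using sde[OF i] unfolding sde_solution_def by blast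
  show "ito_integral M F T (W i) (%s w. \<sigma> (?X i s w)) (I i)" using I i by simp
  show "AE w in M. \<forall>t\<in>{0..T}. ?X i t w = ?X i 0 w + (LBINT s:{0..t}. b \<theta>s (?X i s w)) + I i t w" using I i by simp
  show "0 <= B" using order_trans[OF abs_ge_zero B] .
  show "0 <= c" using c by simp
  show "0 <= \<kappa>" unfolding \<kappa>_def by simp
 qed
 interpret estimation M F T W ?X I b \<theta>s \<sigma> B c \<kappa> "sm^2"
 proof (unfold estimation_def particle_system_def particle_system_axioms_def smooth_drift_def estimation_axioms_def, intro conjI allI impI)
  show "sde_particle M F T (W i) (b \<theta>s) \<sigma> (?X i) (I i) B c \<kappa>" if "1 <= i" for i by (rule particle[OF that])
  show "indep_vars (%_. path_space T) (%i. sample_path T (W i)) {1..}" by (rule iW)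
  show "indep_vars (%_. borel) (%i. ?X i 0) {1..}" by (rule iX)
  show "distr M borel (?X i 0) = distr M borel (?X 1 0)" if "1 <= i" for i by (rule law[OF that])
  show "indep_rv M (\<Pi>\<^sub>M i\<in>{1..}. path_space T) (%w. \<lambda>i\<in>{1..}. sample_path T (W i) w)
     (\<Pi>\<^sub>M i\<in>{1..}. borel) (%w. \<lambda>i\<in>{1..}. ?X i 0 w)" by (rule iWX)
  show "dparam k (%\<eta>. b \<eta> x) differentiable (at \<theta> within {0..1})" if "\<theta> \<in> {0..1}" for k x \<theta> by (rule b_smooth[OF that])
  show "\<exists>C. \<forall>x. \<bar>b 0 x\<bar> <= C" by (rule b_bounded) simp
  show "\<exists>C. \<forall>x. \<forall>\<theta>\<in>{0..1}. \<bar>dparam k (%\<eta>. b \<eta> x) \<theta>\<bar> <= C" if "1 <= k" for k by (rule b_derivs[OF that])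
  show "continuous_on UNIV (b \<theta>)" if t: "\<theta> \<in> {0..1}" for \<theta>
  proof -
   obtain L where L: "0 <= L" "\<forall>x y. \<bar>b \<theta> x - b \<theta> y\<bar> <= L * \<bar>x - y\<bar>" using b_lip[OF t] by blast
   then show ?thesis by (intro lipschitz_on_continuous_on[of L]) (auto simp: lipschitz_on_def dist_real_def)
  qed
  show "\<theta>s \<in> {0..1}" by (rule \<theta>s01)
  show "sm^2 <= (\<sigma> x)^2" for x by (rule sm(2))
  show "0 < sm^2" using sm(1) by simp
  show "\<exists>L\<ge>0. \<forall>x y. \<bar>b \<theta> x - b \<theta> y\<bar> <= L * \<bar>x - y\<bar>" if "\<theta> \<in> {0..1}" for \<theta> by (rule b_lip[OF that])
 qed (rule ps)
 \<comment> \<open>The integral in the identifiability assumption is the loss of the limit contrast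
   away from the true parameter.\<close>
 have id: "P1.limit_contrast \<theta> < P1.limit_contrast \<theta>s" if "\<theta> \<in> {0..1}" "\<theta> \<noteq> \<theta>s" for \<theta>
  using identifiable[OF that] P1.limit_contrast_diff[OF that(1)] by simp
 \<comment> \<open>A continuous function that vanishes outside a compact interval is bounded, so the
   distance of the cut-off factor from 1 has a uniform bound.\<close>
 obtain C\<phi> where C\<phi>: "!!\<xi>. \<bar>\<phi> \<xi> - 1\<bar> <= C\<phi>"
 proof -
  have "continuous_on UNIV \<phi>" using \<phi>_smooth[of 0] differentiable_imp_continuous_on by simp
  then have "continuous_on {-2..2} \<phi>" by (rule continuous_on_subset) simp
  then have "compact (\<phi> ` {-2..2})" by (intro compact_continuous_image) auto
  then have "bounded (\<phi> ` {-2..2})" by (rule compact_imp_bounded)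
  then obtain K where K': "\<forall>y\<in>\<phi> ` {-2..2}. norm y <= K" unfolding bounded_iff by blast
  have K: "\<bar>\<phi> \<xi>\<bar> <= K" if "\<xi> \<in> {-2..2}" for \<xi> using bspec[OF K' imageI[OF that]] by simp
  have "\<bar>\<phi> \<xi> - 1\<bar> <= \<bar>K\<bar> + 1" for \<xi>
  proof (cases "\<bar>\<xi>\<bar> <= 2")
   case True
   then have "\<bar>\<phi> \<xi>\<bar> <= K" by (intro K) auto
   then show ?thesis by linarith
  next
   case False
   then show ?thesis using \<phi>_zero[of \<xi>] by simp
  qed
  then show ?thesis by (rule that)
 qed
 show ?thesis
  by (rule argmax_consistent[where n=n and N=N and L=L and a=a and \<alpha>=\<alpha> and E=E and \<phi>=\<phi> and C\<phi>=C\<phi>])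
   (fact valid n_lim N_lim L_lim noise \<alpha> rate inner id \<phi>_one C\<phi> \<theta>_hat_rv \<theta>_hat_argmax)+
qed

end
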